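(* Let $N/K$ be a fully (totally) ramified Galois extension with $G=\mathrm{Gal}(N/K)=\langle\gamma,\sigma\rangle\cong C_p^2$, one ramification break at $b$, and second refined break $b_*$; let $\Theta=\gamma\sigma^{[\omega]}$ be as in the context. Let $r\in\mathbb Z$ and write the $\mathbb F_q[\Theta]$-module $\mathfrak P_N^r/p\mathfrak P_N^r$ as $\bigoplus_{i=1}^pL(i)^{a_i}$ with integers $a_i\ge0$. Then $$a_p=\dim_{\mathbb F_q}\left((\Theta-1)^{p-1}\,\mathfrak P_N^r/p\mathfrak P_N^r\right)=pe_K+\left\lceil\frac rp\right\rceil-\left\lceil\frac{r-b}p\right\rceil-b-\varepsilon,$$ where $$\varepsilon=\begin{cases}\dfrac{b_*-b}{p}&\text{if }b_*<(p-1+1/p)b,\\[2mm] b+\left\lceil\dfrac{r-pb}{p^2}\right\rceil-\left\lceil\dfrac{r+(p-1)b}{p^2}\right\rceil&\text{otherwise.}\end{cases}$$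
   Context: $p$ is a prime; $K$ is a finite extension of $\mathbb Q_p$ with absolute ramification index $e_K$, inertia degree $f$, $q=p^f$. $T$ is the maximal unramified extension of $\mathbb Q_p$ inside $K$, so $\mathfrak O_T/p\mathfrak O_T=\mathbb F_q$. $v_F$, $\mathfrak O_F$, $\mathfrak P_F$ denote the normalized valuation, valuation ring and maximal ideal of a local field $F$. With $G_i=\{g\in G:(g-1)\mathfrak P_N\subset\mathfrak P_N^{i+1}\}$, "one ramification break at $b$" means $G_b=G$ and $G_{b+1}=\{1\}$. Truncated exponentiation: $x^{[\kappa]}:=\sum_{i=0}^{p-1}\binom{\kappa}{i}(x-1)^i$. Choose $\rho_0\in N$ with $v_N(\rho_0)=b$; let $\omega\in T$ be the unique $(p^f-1)$-th root of unity with $v_N((\gamma-1)\rho_0+\omega(\sigma-1)\rho_0)>2b$; set $\Theta=\gamma\sigma^{[\omega]}\in\mathfrak O_T[G]$. The second refined break is $b_*:=v_N((\Theta-1)\rho_0)-v_N(\rho_0)$; it does not depend on the choices. $\Theta$ is identified with its image in $\mathbb F_q[G]$, where $\Theta^p=1$. The indecomposable modules over $\mathbb F_q[\Theta]$ are $L(i)=\mathbb F_q[x]/(x-1)^i$, $1\le i\le p$, with $\Theta$ acting as multiplication by $x$; so $\mathfrak P_N^r/p\mathfrak P_N^r$ is uniquely expressible as $\bigoplus_{i=1}^pL(i)^{a_i}$. *)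

theory Defs
  imports
    "HOL-Algebra.Algebraic_Closure_Type"
    "HOL-Algebra.Elementary_Groups"
    "Jordan_Normal_Form.Missing_VectorSpace"
begin

text \<open>
  The top field \<open>N\<close> is a whole type of class \<^class>\<open>field_char_0\<close>; the fields below it are subsets
  of that type. \<open>amb\<close> is \<open>N\<close> as a HOL-Algebra ring, so that the subfields, dimensions, quotients
  and ring isomorphisms of HOL-Algebra apply.
\<close>

abbreviation amb :: "'a::field_char_0 ring" where
  "amb \<equiv> ring_of_type_algebra"


section \<open>Valuations and p-adic fields\<close>

text \<open>
  A valuation is integer valued and only meaningful away from \<open>0\<close>; \<open>v x \<ge> n\<close> is always written
  \<open>x = 0 \<or> n \<le> v x\<close>, encoding \<open>v 0 = \<infinity>\<close>.
\<close>

definition normalized_valuation :: "('a::field \<Rightarrow> int) \<Rightarrow> bool" where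
  "normalized_valuation v \<longleftrightarrow>
     (\<forall>x y. x \<noteq> 0 \<longrightarrow> y \<noteq> 0 \<longrightarrow> v (x * y) = v x + v y) \<and>
     (\<forall>x y. x \<noteq> 0 \<longrightarrow> y \<noteq> 0 \<longrightarrow> x + y \<noteq> 0 \<longrightarrow> min (v x) (v y) \<le> v (x + y)) \<and>
     v ` (UNIV - {0}) = UNIV"

text \<open>
  \<open>F\<close> is a copy of \<open>\<rat>\<^sub>p\<close> inside \<open>N\<close> and \<open>v\<close> extends, up to scaling, its valuation: on \<open>\<rat>\<close> the
  valuation \<open>v\<close> is a positive multiple of the \<open>p\<close>-adic one (the multiple being \<open>v p\<close>), and \<open>F\<close>
  is the completion of \<open>\<rat>\<close>, that is, complete with \<open>\<rat>\<close> dense in it.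
\<close>

definition padic_subfield :: "nat \<Rightarrow> ('a::field_char_0 \<Rightarrow> int) \<Rightarrow> 'a set \<Rightarrow> bool" where
  "padic_subfield p v F \<longleftrightarrow>
     subfield F amb \<and>
     v (of_nat p) > 0 \<and>
     (\<forall>n>0. v (of_nat n) = v (of_nat p) * int (Factorial_Ring.multiplicity p n)) \<and>
     (\<forall>x\<in>F. \<forall>n. \<exists>c::rat. x - of_rat c = 0 \<or> n \<le> v (x - of_rat c)) \<and>
     (\<forall>s::nat \<Rightarrow> 'a. range s \<subseteq> F \<longrightarrow>
        (\<forall>n. \<exists>M. \<forall>i\<ge>M. \<forall>j\<ge>M. s i - s j = 0 \<or> n \<le> v (s i - s j)) \<longrightarrow>
        (\<exists>x\<in>F. \<forall>n. \<exists>M. \<forall>i\<ge>M. s i - x = 0 \<or> n \<le> v (s i - x)))"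

text \<open>
  For a subfield \<open>F\<close>, \<open>v(F\<^sup>\<times>) = e \<int>\<close> with \<open>e = e(N/F)\<close> the ramification index of \<open>N/F\<close>,
  where \<open>v\<close> is the normalized valuation of \<open>N\<close>; the normalized valuation of \<open>F\<close> is
  \<open>v\<^sub>F = v / e\<close> (the division is exact on \<open>F\<^sup>\<times>\<close>).
\<close>

definition ram_index :: "('a::field_char_0 \<Rightarrow> int) \<Rightarrow> 'a set \<Rightarrow> nat" where
  "ram_index v F = (LEAST e. 0 < e \<and> (\<exists>x\<in>F - {0}. v x = int e))"

definition val_of :: "('a::field_char_0 \<Rightarrow> int) \<Rightarrow> 'a set \<Rightarrow> 'a \<Rightarrow> int" where
  "val_of v F x = v x div int (ram_index v F)"

definition prime_ideal_pow :: "('a::field_char_0 \<Rightarrow> int) \<Rightarrow> 'a set \<Rightarrow> int \<Rightarrow> 'a set" where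
  \<comment> \<open>the fractional ideal \<open>\<PP>\<^sub>F\<^sup>n\<close>, any \<open>n \<in> \<int>\<close>\<close>
  "prime_ideal_pow v F n = {x \<in> F. x = 0 \<or> n \<le> val_of v F x}"

abbreviation val_ring :: "('a::field_char_0 \<Rightarrow> int) \<Rightarrow> 'a set \<Rightarrow> 'a set" where
  "val_ring v F \<equiv> prime_ideal_pow v F 0"

definition abs_ram_index :: "nat \<Rightarrow> ('a::field_char_0 \<Rightarrow> int) \<Rightarrow> 'a set \<Rightarrow> int" where
  "abs_ram_index p v F = val_of v F (of_nat p)"

definition residue_field :: "('a::field_char_0 \<Rightarrow> int) \<Rightarrow> 'a set \<Rightarrow> 'a set ring" where
  "residue_field v F = (amb\<lparr>carrier := val_ring v F\<rparr>) Quot (prime_ideal_pow v F 1)"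

text \<open>
  The degree of the residue field of \<open>F\<close> over that of \<open>Q\<close>; the latter embeds as the image of the
  valuation ring of \<open>Q\<close>.
\<close>

definition inertia_degree :: "('a::field_char_0 \<Rightarrow> int) \<Rightarrow> 'a set \<Rightarrow> 'a set \<Rightarrow> nat" where
  "inertia_degree v Q F =
     ring.dim (residue_field v F)
       ((\<lambda>x. prime_ideal_pow v F 1 +>\<^bsub>amb\<^esub> x) ` val_ring v Q) (carrier (residue_field v F))"

text \<open>
  An intermediate field is unramified over \<open>\<rat>\<^sub>p\<close> when its absolute ramification index is \<open>1\<close>
  (residue fields are finite, so residue extensions are separable).
\<close>

definition max_unramified ::
  "nat \<Rightarrow> ('a::field_char_0 \<Rightarrow> int) \<Rightarrow> 'a set \<Rightarrow> 'a set \<Rightarrow> 'a set \<Rightarrow> bool" where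
  "max_unramified p v Q K T \<longleftrightarrow>
     (let unr = (\<lambda>L. subfield L amb \<and> Q \<subseteq> L \<and> L \<subseteq> K \<and> abs_ram_index p v L = 1)
      in unr T \<and> (\<forall>L. unr L \<longrightarrow> L \<subseteq> T))"


section \<open>Galois theory and ramification groups\<close>

definition gal_group :: "'a::field_char_0 set \<Rightarrow> ('a \<Rightarrow> 'a) monoid" where
  "gal_group K = \<lparr>carrier = {g \<in> ring_iso amb amb. \<forall>x\<in>K. g x = x},
                  monoid.mult = (\<circ>), one = id\<rparr>"

definition galois_over :: "'a::field_char_0 set \<Rightarrow> bool" where
  "galois_over K \<longleftrightarrow>
     subfield K amb \<and> ring.finite_dimension amb K UNIV \<and>
     {x. \<forall>g\<in>carrier (gal_group K). g x = x} = K"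

definition totally_ramified_over :: "('a::field_char_0 \<Rightarrow> int) \<Rightarrow> 'a set \<Rightarrow> bool" where
  "totally_ramified_over v K \<longleftrightarrow> ram_index v K = ring.dim amb K UNIV"

definition ram_group :: "('a::field_char_0 \<Rightarrow> int) \<Rightarrow> 'a set \<Rightarrow> int \<Rightarrow> ('a \<Rightarrow> 'a) set" where
  "ram_group v K i = {g \<in> carrier (gal_group K).
     \<forall>x \<in> prime_ideal_pow v UNIV 1. g x - x \<in> prime_ideal_pow v UNIV (i + 1)}"

definition one_break :: "('a::field_char_0 \<Rightarrow> int) \<Rightarrow> 'a set \<Rightarrow> int \<Rightarrow> bool" where
  "one_break v K b \<longleftrightarrow>
     ram_group v K b = carrier (gal_group K) \<and> ram_group v K (b + 1) = {id}"

text \<open>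
  Elements of \<open>T[G]\<close> are represented by the operators on \<open>N\<close> through which they act, \<open>s - 1\<close> being
  \<open>\<lambda>y. s y - y\<close>; for \<open>T \<subseteq> K\<close> products of \<open>T[G]\<close> become compositions.
\<close>

definition trunc_exp ::
  "nat \<Rightarrow> ('a::field_char_0 \<Rightarrow> 'a) \<Rightarrow> 'a \<Rightarrow> 'a \<Rightarrow> 'a" where
  "trunc_exp p s \<kappa> x = (\<Sum>i<p. (\<kappa> gchoose i) * ((\<lambda>y. s y - y) ^^ i) x)"


section \<open>Modules over \<open>\<bbbF>\<^sub>q\<close> with an operator\<close>

text \<open>
  A module over \<open>\<bbbF>\<^sub>q[\<Theta>]\<close> is given as an \<open>\<bbbF>\<^sub>q\<close>-module together with the operator by which \<open>\<Theta>\<close> acts.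
  The fields \<open>mult\<close> and \<open>one\<close> of a module record play no role.
\<close>

definition Fq :: "nat \<Rightarrow> ('a::field_char_0 \<Rightarrow> int) \<Rightarrow> 'a set \<Rightarrow> 'a set ring" where
  "Fq p v T = (amb\<lparr>carrier := val_ring v T\<rparr>) Quot ((\<lambda>x. of_nat p * x) ` val_ring v T)"

text \<open>Scalars are cosets as well, since they are taken from \<open>Fq\<close>.\<close>

definition quot_module :: "'a::field_char_0 set \<Rightarrow> 'a set \<Rightarrow> ('a set, 'a set) module" where
  "quot_module M M' =
     \<lparr>carrier = a_rcosets\<^bsub>amb\<lparr>carrier := M\<rparr>\<^esub> M',
      monoid.mult = (\<lambda>_ _. M'), one = M', zero = M', add = set_add amb,
      module.smult = (\<lambda>A C. \<Union>a\<in>A. \<Union>x\<in>C. M' +>\<^bsub>amb\<^esub> (a * x))\<rparr>"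

definition quot_map :: "'a::field_char_0 set \<Rightarrow> ('a \<Rightarrow> 'a) \<Rightarrow> 'a set \<Rightarrow> 'a set" where
  "quot_map M' h C = (\<Union>x\<in>C. M' +>\<^bsub>amb\<^esub> h x)"

definition ideal_module ::
  "nat \<Rightarrow> ('a::field_char_0 \<Rightarrow> int) \<Rightarrow> int \<Rightarrow> ('a set, 'a set) module" where
  "ideal_module p v r =
     quot_module (prime_ideal_pow v UNIV r) ((\<lambda>x. of_nat p * x) ` prime_ideal_pow v UNIV r)"

definition ideal_map ::
  "nat \<Rightarrow> ('a::field_char_0 \<Rightarrow> int) \<Rightarrow> int \<Rightarrow> ('a \<Rightarrow> 'a) \<Rightarrow> 'a set \<Rightarrow> 'a set" where
  "ideal_map p v r = quot_map ((\<lambda>x. of_nat p * x) ` prime_ideal_pow v UNIV r)"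

definition diff_power_image ::
  "('k, 'm) module \<Rightarrow> ('m \<Rightarrow> 'm) \<Rightarrow> nat \<Rightarrow> ('k, 'm) module" where
  "diff_power_image V \<theta> k = V\<lparr>carrier := ((\<lambda>u. \<theta> u \<ominus>\<^bsub>V\<^esub> u) ^^ k) ` carrier V\<rparr>"

text \<open>\<open>L(i) = F[x]/(x-1)\<^sup>i\<close> as an \<open>F\<close>-module, and multiplication by \<open>x\<close> on it.\<close>

definition L_poly :: "'k ring \<Rightarrow> nat \<Rightarrow> 'k list" where
  "L_poly F i = (var F \<ominus>\<^bsub>poly_ring F\<^esub> \<one>\<^bsub>poly_ring F\<^esub>) [^]\<^bsub>poly_ring F\<^esub> i"

definition L_ring :: "'k ring \<Rightarrow> nat \<Rightarrow> 'k list set ring" where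
  "L_ring F i = rupture F (carrier F) (L_poly F i)"

definition L_proj :: "'k ring \<Rightarrow> nat \<Rightarrow> 'k list \<Rightarrow> 'k list set" where
  "L_proj F i = ring.rupture_surj F (carrier F) (L_poly F i)"

definition L_module :: "'k ring \<Rightarrow> nat \<Rightarrow> ('k, 'k list set) module" where
  "L_module F i =
     \<lparr>carrier = carrier (L_ring F i), monoid.mult = monoid.mult (L_ring F i),
      one = \<one>\<^bsub>L_ring F i\<^esub>, zero = \<zero>\<^bsub>L_ring F i\<^esub>, add = add (L_ring F i),
      module.smult = (\<lambda>c u. L_proj F i (ring.poly_of_const F c) \<otimes>\<^bsub>L_ring F i\<^esub> u)\<rparr>"

definition L_map :: "'k ring \<Rightarrow> nat \<Rightarrow> 'k list set \<Rightarrow> 'k list set" where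
  "L_map F i u = L_proj F i (var F) \<otimes>\<^bsub>L_ring F i\<^esub> u"

text \<open>The carrier is the full product, so this is the direct sum only for finite \<open>I\<close>.\<close>

definition fin_direct_sum ::
  "'i set \<Rightarrow> ('i \<Rightarrow> ('k, 'm) module) \<Rightarrow> ('k, 'i \<Rightarrow> 'm) module" where
  "fin_direct_sum I W =
     \<lparr>carrier = (\<Pi>\<^sub>E i\<in>I. carrier (W i)),
      monoid.mult = (\<lambda>_ _. \<lambda>i\<in>I. \<zero>\<^bsub>W i\<^esub>), one = (\<lambda>i\<in>I. \<zero>\<^bsub>W i\<^esub>),
      zero = (\<lambda>i\<in>I. \<zero>\<^bsub>W i\<^esub>),
      add = (\<lambda>x y. \<lambda>i\<in>I. x i \<oplus>\<^bsub>W i\<^esub> y i),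
      module.smult = (\<lambda>c x. \<lambda>i\<in>I. c \<odot>\<^bsub>W i\<^esub> x i)\<rparr>"

definition module_op_iso ::
  "'k ring \<Rightarrow> ('k, 'm) module \<Rightarrow> ('m \<Rightarrow> 'm) \<Rightarrow> ('k, 'n) module \<Rightarrow> ('n \<Rightarrow> 'n) \<Rightarrow> bool" where
  "module_op_iso F V \<theta> W \<eta> \<longleftrightarrow>
     (\<exists>\<phi> \<in> LinearCombinations.module_hom F V W.
        bij_betw \<phi> (carrier V) (carrier W) \<and> (\<forall>u\<in>carrier V. \<phi> (\<theta> u) = \<eta> (\<phi> u)))"

text \<open>\<open>(V, \<theta>) \<cong> \<Oplus>\<^sub>i L(i)\<^sup>a\<^sup>i\<close>, the sum being over \<open>1 \<le> i \<le> p\<close>; the summand with index \<open>(i, j)\<close>,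
  \<open>j < a\<^sub>i\<close>, is the \<open>j\<close>-th copy of \<open>L(i)\<close>.\<close>

definition decomposes_as ::
  "'k ring \<Rightarrow> nat \<Rightarrow> ('k, 'm) module \<Rightarrow> ('m \<Rightarrow> 'm) \<Rightarrow> (nat \<Rightarrow> nat) \<Rightarrow> bool" where
  "decomposes_as F p V \<theta> a \<longleftrightarrow>
     (let I = (SIGMA i:{1..p}. {..<a i})
      in module_op_iso F V \<theta>
           (fin_direct_sum I (\<lambda>ij. L_module F (fst ij)))
           (\<lambda>x. \<lambda>ij\<in>I. L_map F (fst ij) (x ij)))"

end

theory Submission
  imports Defs
begin

text \<open>
  Write \<open>x = \<sigma> - 1\<close>, \<open>y = \<gamma> - 1\<close>, \<open>\<delta> = \<Theta> - 1\<close>. As \<open>\<Theta> - 1\<close> acts nilpotently of exponent at most \<open>i\<close> on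
  \<open>L(i)\<close>, its \<open>(p-1)\<close>-st power kills \<open>L(i)\<close> for \<open>i < p\<close> and maps \<open>L(p)\<close> onto a line, so \<open>a\<^sub>p\<close> is the rank of
  \<open>\<delta>\<^sup>p\<^sup>-\<^sup>1\<close> on \<open>\<PP>\<^sup>r / p \<PP>\<^sup>r\<close>. Since \<open>T\<close> and \<open>N\<close> have the same residue field (Teichmueller representatives
  generate unramified extensions), this rank is the number of \<open>n < r + v(p)\<close> that occur as valuations of
  \<open>\<delta>\<^sup>p\<^sup>-\<^sup>1 u\<close> with \<open>u \<in> \<PP>\<^sup>r\<close>.

  These valuations are determined from two sources. First, \<open>\<delta>\<^sup>p = p (W x - V \<delta>)\<close> with valuation preserving
  operators \<open>V\<close> and \<open>W\<close>. Second, there is \<open>\<xi>\<close> of valuation \<open>-b\<close> with \<open>x \<xi>\<close> close to \<open>1\<close>; then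
  \<open>\<delta> (\<xi> choose j)\<close> is close to \<open>\<delta> \<xi> \<sqdot> (\<xi> choose (j - 1))\<close>, and the products of these binomials with
  elements fixed by \<open>\<sigma>\<close> realise all valuations. Either \<open>v (\<delta> \<xi>) = p t < (p - 1) b\<close>; then \<open>b\<^sub>* = b + p t\<close>, and \<open>\<delta>\<close>
  raises valuations prime to \<open>p\<close> by exactly \<open>b\<^sub>*\<close>. Or \<open>v (\<delta> \<xi>) > (p - 1) b\<close>; then \<open>b\<^sub>* = p b\<close>, and \<open>\<delta>\<close> is controlled
  by the action of \<open>\<gamma>\<close> on the field fixed by \<open>\<sigma>\<close>, whose ramification break is \<open>p b\<close>. In both cases the
  valuations attained form a union of truncated residue classes modulo \<open>p\<close> or \<open>p\<^sup>2\<close>, which are counted.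
\<close>

section \<open>Valuations\<close>

text \<open>The obstacle is that \<open>\<Theta>\<close> is not multiplicative, so its effect cannot
  be read off a uniformizer as for an automorphism. Two facts replace multiplicativity:
  \<open>\<Theta>\<close> is semilinear over the fixed field of \<open>\<sigma>\<close>, and on
  binomials truncated exponentiation becomes Vandermonde's identity, so that (\<xi> choose j) goes
  approximately to (\<gamma> \<xi> + \<omega> choose j). On products of fixed elements with
  binomials the gain b + v(\<delta> \<xi>) competes with the gain p b of \<open>\<gamma>\<close> on
  the fixed field, whence the two cases. The cutoff in the theorem is a different one and lies
  inside the first case. There a third class of valuations, modulo p^2, is reached only by
  cancelling the leading term of \<delta>^(p-1) y against a value taken on the fixed field. Its
  lower end is at most r + v(p) exactly when p^2 t >= (p - 1)^2 b, which is the cutoff; its size is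
  then t minus the second value of \<epsilon>, so that beyond the cutoff both cases end in the same
  formula.\<close>

locale nval =
  fixes v :: "'a::field_char_0 \<Rightarrow> int"
  assumes nv: "normalized_valuation v"
begin

text \<open>\<open>P n\<close> contains 0 and \<open>U n\<close> does not, so bounds and exact
  valuations never touch the meaningless value \<open>v 0\<close>.\<close>

definition P :: "int \<Rightarrow> 'a set" where "P n = {x. x = 0 \<or> n \<le> v x}"
definition U :: "int \<Rightarrow> 'a set" where "U n = {x. x \<noteq> 0 \<and> v x = n}"

lemma v_mult: "x \<noteq> 0 \<Longrightarrow> y \<noteq> 0 \<Longrightarrow> v (x * y) = v x + v y"
  and v_add: "x \<noteq> 0 \<Longrightarrow> y \<noteq> 0 \<Longrightarrow> x + y \<noteq> 0 \<Longrightarrow> min (v x) (v y) \<le> v (x + y)"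
  and v_surj: "v ` (UNIV - {0}) = UNIV"
  using nv unfolding normalized_valuation_def by blast+

lemma v_one [simp]: "v 1 = 0"
  using v_mult[of 1 1] by simp

lemma v_minus [simp]: "v (- x) = v x"
proof (cases "x = 0")
  case False
  have "v (-1) + v (-1) = 0" using v_mult[of "-1" "-1"] by simp
  then have "v (-1) = 0" by simp
  then show ?thesis using v_mult[of "-1" x] False by simp
qed simp

lemma U_iff: "x \<in> U n \<longleftrightarrow> x \<noteq> 0 \<and> v x = n" by (simp add: U_def)
lemma P_iff: "x \<in> P n \<longleftrightarrow> x = 0 \<or> n \<le> v x" by (simp add: P_def)

lemma U_v [intro]: "x \<noteq> 0 \<Longrightarrow> x \<in> U (v x)" by (simp add: U_iff)
lemma P_v [intro]: "x \<in> P (v x)" by (simp add: P_iff)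
lemma U_nz: "x \<in> U n \<Longrightarrow> x \<noteq> 0" by (simp add: U_iff)
lemma U_P [intro]: "x \<in> U n \<Longrightarrow> x \<in> P n" by (simp add: U_iff P_iff)
lemma U_P_le: "x \<in> U n \<Longrightarrow> m \<le> n \<Longrightarrow> x \<in> P m" by (auto simp: U_iff P_iff)
lemma U_P_iff: "x \<in> U n \<Longrightarrow> x \<in> P m \<longleftrightarrow> m \<le> n" by (auto simp: U_iff P_iff)
lemma U_unique: "x \<in> U n \<Longrightarrow> x \<in> U m \<Longrightarrow> m = n" by (simp add: U_iff)
lemma P_mono: "x \<in> P n \<Longrightarrow> m \<le> n \<Longrightarrow> x \<in> P m" by (auto simp: P_iff)
lemma P_cases: "x \<in> P n \<Longrightarrow> x \<in> U n \<or> x \<in> P (n + 1)" by (auto simp: U_iff P_iff)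
lemma U_not_P: "x \<in> U n \<Longrightarrow> x \<notin> P (n + 1)" by (auto simp: U_iff P_iff)
lemma P_zero [simp, intro]: "0 \<in> P n" by (simp add: P_iff)
lemma P_all_zero: "(\<And>n. x \<in> P n) \<Longrightarrow> x = 0" using U_P_iff[of x "v x" "v x + 1"] by (auto simp: U_iff)
lemma one_U [simp, intro]: "1 \<in> U 0" by (simp add: U_iff)
lemma one_P [simp, intro]: "1 \<in> P 0" by (simp add: P_iff)
lemma ex_U: "\<exists>x. x \<in> U n"
proof -
  have "n \<in> v ` (UNIV - {0})" using v_surj by simp
  then show ?thesis by (auto simp: U_iff)
qed

lemma P_uminus: "x \<in> P n \<Longrightarrow> - x \<in> P n" by (auto simp: P_iff)
lemma P_uminus_iff [simp]: "- x \<in> P n \<longleftrightarrow> x \<in> P n" by (auto simp: P_iff)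
lemma U_uminus_iff [simp]: "- x \<in> U n \<longleftrightarrow> x \<in> U n" by (auto simp: U_iff)
lemma P_add: "x \<in> P n \<Longrightarrow> y \<in> P n \<Longrightarrow> x + y \<in> P n"
  using v_add[of x y] by (fastforce simp: P_iff)
lemma P_diff: "x \<in> P n \<Longrightarrow> y \<in> P n \<Longrightarrow> x - y \<in> P n"
  using P_add[of x n "- y"] by simp
lemma P_diff_swap: "x - y \<in> P n \<Longrightarrow> y - x \<in> P n"
  using P_uminus[of "x - y" n] by simp
lemma P_trans: "x - y \<in> P n \<Longrightarrow> y - z \<in> P n \<Longrightarrow> x - z \<in> P n"
  using P_add[of "x - y" n "y - z"] by simp
lemma P_sum: "(\<And>i. i \<in> I \<Longrightarrow> f i \<in> P n) \<Longrightarrow> sum f I \<in> P n"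
  by (induction I rule: infinite_finite_induct) (auto intro: P_add)
lemma P_mult: "x \<in> P m \<Longrightarrow> y \<in> P n \<Longrightarrow> x * y \<in> P (m + n)"
  using v_mult[of x y] by (cases "x = 0"; cases "y = 0") (auto simp: P_iff)
lemma U_mult: "x \<in> U m \<Longrightarrow> y \<in> U n \<Longrightarrow> x * y \<in> U (m + n)"
  using v_mult[of x y] by (auto simp: U_iff)
lemma P_mult0: "x \<in> P 0 \<Longrightarrow> y \<in> P n \<Longrightarrow> x * y \<in> P n"
  using P_mult[of x 0 y n] by simp
lemma U_mult0: "x \<in> U 0 \<Longrightarrow> y \<in> U n \<Longrightarrow> x * y \<in> U n"
  using U_mult[of x 0 y n] by simp
lemma U_add: "x \<in> U n \<Longrightarrow> y \<in> P (n + 1) \<Longrightarrow> x + y \<in> U n"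
proof -
  assume x: "x \<in> U n" and y: "y \<in> P (n + 1)"
  have "x + y \<in> P n" using x y by (auto intro!: P_add intro: P_mono)
  moreover have "x + y \<notin> P (n + 1)"
    using P_diff[of "x + y" "n + 1" y] y U_not_P[OF x] by auto
  ultimately show ?thesis using P_cases by blast
qed
lemma U_cong: "y - x \<in> P (n + 1) \<Longrightarrow> x \<in> U n \<Longrightarrow> y \<in> U n"
  using U_add[of x n "y - x"] by simp
lemma P_cong: "y - x \<in> P n \<Longrightarrow> x \<in> P n \<Longrightarrow> y \<in> P n"
  using P_add[of x n "y - x"] by simp
lemma U_inverse: "x \<in> U n \<Longrightarrow> inverse x \<in> U (- n)"
proof -
  assume x: "x \<in> U n"
  then have "v x + v (inverse x) = 0" using v_mult[of x "inverse x"] by (simp add: U_iff)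
  with x show ?thesis by (auto simp: U_iff)
qed
lemma U_divide: "x \<in> U m \<Longrightarrow> y \<in> U n \<Longrightarrow> x / y \<in> U (m - n)"
  using U_mult[of x m "inverse y" "- n"] U_inverse[of y n] by (simp add: field_simps)
lemma P_divide: "x \<in> P m \<Longrightarrow> y \<in> U n \<Longrightarrow> x / y \<in> P (m - n)"
  using P_mult[of x m "inverse y" "- n"] U_P[OF U_inverse[of y n]] by (simp add: field_simps)
lemma U_power: "x \<in> U n \<Longrightarrow> x ^ k \<in> U (int k * n)"
  by (induction k) (auto dest: U_mult simp: algebra_simps)
lemma P_power: "x \<in> P n \<Longrightarrow> x ^ k \<in> P (int k * n)"
  by (induction k) (auto dest: P_mult simp: algebra_simps)
lemma P_power0: "x \<in> P 0 \<Longrightarrow> x ^ k \<in> P 0"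
  using P_power[of x 0 k] by simp
lemma U_power_int: "x \<in> U n \<Longrightarrow> x powi k \<in> U (k * n)"
proof (cases "k \<ge> 0")
  case True
  then show "x \<in> U n \<Longrightarrow> ?thesis" using U_power[of x n "nat k"] by (simp add: power_int_def)
next
  case False
  then show "x \<in> U n \<Longrightarrow> ?thesis" using U_power[OF U_inverse[of x n], of "nat (- k)"]
    by (simp add: power_int_def algebra_simps)
qed
lemma of_nat_P [simp, intro]: "of_nat k \<in> P 0"
  by (induction k) (auto intro: P_add)
lemma of_int_P [simp, intro]: "of_int k \<in> P 0"
  by (cases k) (auto simp del: of_nat_Suc)
lemma P_mult_of_nat: "x \<in> P n \<Longrightarrow> of_nat k * x \<in> P n" by (rule P_mult0) auto
lemma P_prod0: "(\<And>i. i \<in> I \<Longrightarrow> f i \<in> P 0) \<Longrightarrow> prod f I \<in> P 0"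
  by (induction I rule: infinite_finite_induct) (auto intro: P_mult0)
lemma U_prod: "finite I \<Longrightarrow> (\<And>i. i \<in> I \<Longrightarrow> f i \<in> U n) \<Longrightarrow> prod f I \<in> U (int (card I) * n)"
proof (induction I rule: finite_induct)
  case (insert i I)
  then have "f i * prod f I \<in> U (n + int (card I) * n)" by (intro U_mult) auto
  then show ?case using insert by (simp add: algebra_simps)
qed simp

lemma U0_div_P: "x \<in> U n \<Longrightarrow> y \<in> U n \<Longrightarrow> x / y \<in> U 0"
  using U_divide[of x n y n] by simp

lemma sum_distinct_val:
  assumes "finite I" "inj_on (v \<circ> f) I" "\<And>i. i \<in> I \<Longrightarrow> f i \<noteq> 0" "I \<noteq> {}"
  shows "\<exists>i\<in>I. sum f I \<in> U (v (f i)) \<and> (\<forall>j\<in>I. v (f i) \<le> v (f j))"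
proof -
  define m where "m = Min ((v \<circ> f) ` I)"
  have "m \<in> (v \<circ> f) ` I" unfolding m_def using assms by (intro Min_in) auto
  then obtain i where i: "i \<in> I" "m = v (f i)" by auto
  have le: "m \<le> v (f j)" if "j \<in> I" for j unfolding m_def using assms(1) that by (simp add: image_comp)
  have lt: "m < v (f j)" if "j \<in> I - {i}" for j
    using le[of j] that assms(2) i unfolding inj_on_def by fastforce
  have "sum f (I - {i}) \<in> P (m + 1)"
    using lt by (intro P_sum) (force simp: P_iff)
  then have "f i + sum f (I - {i}) \<in> U m"
    using i assms(3) by (intro U_add) (auto simp: U_iff)
  then show ?thesis using i le assms(1) by (auto simp: sum.remove)
qed

text \<open>The term of least valuation cannot be cancelled, so it already satisfies the bound. Zero
  terms are discarded first, since \<open>v\<close> says nothing about them.\<close>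

lemma sum_distinct_val_P:
  assumes "finite I" "\<And>i j. i \<in> I \<Longrightarrow> j \<in> I \<Longrightarrow> i \<noteq> j \<Longrightarrow> f i \<noteq> 0 \<Longrightarrow> f j \<noteq> 0 \<Longrightarrow> v (f i) \<noteq> v (f j)"
    and "sum f I \<in> P n" "i \<in> I"
  shows "f i \<in> P n"
proof (cases "f i = 0")
  case False
  define J where "J = {i \<in> I. f i \<noteq> 0}"
  have J: "finite J" "J \<noteq> {}" "i \<in> J" using assms False unfolding J_def by auto
  have eq: "sum f J = sum f I" unfolding J_def using assms(1) by (intro sum.mono_neutral_left) auto
  have inj: "inj_on (v \<circ> f) J"
  proof (rule inj_onI)
    fix i j assume "i \<in> J" "j \<in> J" "(v \<circ> f) i = (v \<circ> f) j"
    then show "i = j" using assms(2)[of i j] unfolding J_def by auto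
  qed
  have nz: "f i \<noteq> 0" if "i \<in> J" for i using that unfolding J_def by simp
  obtain k where k: "k \<in> J" "sum f J \<in> U (v (f k))" "\<forall>j\<in>J. v (f k) \<le> v (f j)"
    using sum_distinct_val[OF J(1) inj nz J(2)] by blast
  then have "n \<le> v (f k)" using U_P_iff[OF k(2)] eq assms(3) by auto
  with k(3) J have "n \<le> v (f i)" by force
  then show ?thesis by (simp add: P_iff)
qed simp

text \<open>First-order Taylor expansion at 1; it makes g - 1 behave like a derivation on powers of
  a uniformizer.\<close>

lemma power_int_approx:
  assumes "\<eta> - 1 \<in> P R" "R \<ge> 1"
  shows "\<eta> powi s - 1 - of_int s * (\<eta> - 1) \<in> P (2 * R)"
proof -
  have nat: "\<eta> ^ k - 1 - of_nat k * (\<eta> - 1) \<in> P (2 * R)" if "\<eta> - 1 \<in> P R" for \<eta> and k :: nat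
  proof (induction k)
    case (Suc k)
    have "\<eta> ^ Suc k - 1 - of_nat (Suc k) * (\<eta> - 1)
        = \<eta> * (\<eta> ^ k - 1 - of_nat k * (\<eta> - 1)) + of_nat k * ((\<eta> - 1) * (\<eta> - 1))"
      by (simp add: algebra_simps)
    moreover have "\<eta> \<in> P 0" using P_cong[of \<eta> 1 0] P_mono[OF that, of 0] \<open>R \<ge> 1\<close> by auto
    ultimately show ?case
      using P_mult0[OF _ Suc, of \<eta>] P_mult_of_nat[of _ "R + R" k, OF P_mult[OF that that]]
      by (auto intro!: P_add)
  qed simp
  show ?thesis
  proof (cases "s \<ge> 0")
    case True
    then show ?thesis using nat[OF assms(1), of "nat s"] by (simp add: power_int_def)
  next
    case False
    have \<eta>: "\<eta> \<in> U 0" using U_cong[of \<eta> 1 0] P_mono[OF assms(1), of 1] assms(2) by simp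
    then have nz: "\<eta> \<noteq> 0" by (auto simp: U_iff)
    have i: "inverse \<eta> - 1 = - (inverse \<eta> * (\<eta> - 1))" using nz by (simp add: field_simps)
    have iR: "inverse \<eta> - 1 \<in> P R"
      unfolding i P_uminus_iff using U_inverse[OF \<eta>] assms(1) by (intro P_mult0) auto
    have "inverse \<eta> - 1 + (\<eta> - 1) = (\<eta> - 1) * (\<eta> - 1) * inverse \<eta>" using nz by (simp add: field_simps)
    also have "\<dots> \<in> P ((R + R) + 0)"
      using U_inverse[OF \<eta>] by (intro P_mult assms(1)) auto
    finally have 2: "inverse \<eta> - 1 + (\<eta> - 1) \<in> P (2 * R)" by simp
    \<comment> \<open>A negative power is a positive power of the inverse, and
      \<open>inverse \<eta> - 1\<close> equals \<open>- (\<eta> - 1)\<close> up to second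
      order.\<close>
    have "\<eta> powi s - 1 - of_int s * (\<eta> - 1)
       = (inverse \<eta> ^ nat (-s) - 1 - of_nat (nat (-s)) * (inverse \<eta> - 1))
         + of_nat (nat (-s)) * (inverse \<eta> - 1 + (\<eta> - 1))"
      using False by (simp add: power_int_def algebra_simps)
    then show ?thesis using nat[OF iR, of "nat (-s)"] P_mult_of_nat[OF 2] by (simp only: P_add)
  qed
qed

end

section \<open>Subrings and the freshman's dream\<close>

definition subrng :: "'a::ring_1 set \<Rightarrow> bool" where
  "subrng M \<longleftrightarrow> 1 \<in> M \<and> (\<forall>x\<in>M. \<forall>y\<in>M. x - y \<in> M \<and> x * y \<in> M)"

lemma subrngD:
  assumes "subrng M"
  shows "1 \<in> M" "0 \<in> M" "x \<in> M \<Longrightarrow> y \<in> M \<Longrightarrow> x - y \<in> M" "x \<in> M \<Longrightarrow> y \<in> M \<Longrightarrow> x * y \<in> M"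
    "x \<in> M \<Longrightarrow> - x \<in> M" "x \<in> M \<Longrightarrow> y \<in> M \<Longrightarrow> x + y \<in> M"
proof -
  have M: "1 \<in> M" "\<And>x y. x \<in> M \<Longrightarrow> y \<in> M \<Longrightarrow> x - y \<in> M \<and> x * y \<in> M"
    using assms unfolding subrng_def by blast+
  show 0: "0 \<in> M" using M(2)[OF M(1) M(1)] by simp
  show m: "- x \<in> M" if "x \<in> M" for x using M(2)[OF 0 that] by simp
  show "x + y \<in> M" if "x \<in> M" "y \<in> M" using M(2)[OF that(1) m[OF that(2)]] by simp
  show "1 \<in> M" "x \<in> M \<Longrightarrow> y \<in> M \<Longrightarrow> x - y \<in> M" "x \<in> M \<Longrightarrow> y \<in> M \<Longrightarrow> x * y \<in> M" using M by auto
qed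

lemma subrng_sum: "subrng M \<Longrightarrow> (\<And>i. i \<in> I \<Longrightarrow> f i \<in> M) \<Longrightarrow> sum f I \<in> M"
  by (induction I rule: infinite_finite_induct) (auto intro: subrngD)
lemma subrng_power: "subrng M \<Longrightarrow> x \<in> M \<Longrightarrow> x ^ n \<in> M"
  by (induction n) (auto intro: subrngD)
lemma subrng_of_nat: "subrng M \<Longrightarrow> of_nat n \<in> M"
  by (induction n) (auto intro: subrngD)

text \<open>The middle binomial coefficients are divided by p as natural numbers, so the cofactor
  stays in \<open>M\<close>. This matters later for lattices such as Z_p[\<zeta>], not only for the
  valuation ring.\<close>

lemma freshman_dream:
  fixes a b :: "'a::comm_ring_1"
  assumes "subrng M" "a \<in> M" "b \<in> M" "Factorial_Ring.prime p"
  shows "\<exists>c\<in>M. (a + b) ^ p - (a ^ p + b ^ p) = of_nat p * c"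
proof -
  have p: "p > 1" using prime_gt_1_nat assms(4) by auto
  define c where "c = (\<Sum>i\<in>{0<..<p}. of_nat ((p choose i) div p) * a ^ i * b ^ (p - i))"
  have "(a + b) ^ p = (\<Sum>i\<le>p. of_nat (p choose i) * a ^ i * b ^ (p - i))" by (rule binomial_ring)
  also have "{..p} = insert 0 (insert p {0<..<p})" using p by auto
  also have "(\<Sum>i\<in>\<dots>. of_nat (p choose i) * a ^ i * b ^ (p - i))
     = b ^ p + a ^ p + (\<Sum>i\<in>{0<..<p}. of_nat (p choose i) * a ^ i * b ^ (p - i))" using p by simp
  also have "(\<Sum>i\<in>{0<..<p}. of_nat (p choose i) * a ^ i * b ^ (p - i)) = of_nat p * c"
    unfolding c_def sum_distrib_left
  proof (rule sum.cong)
    fix i assume "i \<in> {0<..<p}"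
    then have "p dvd p choose i" using dvd_choose_prime[of i p] assms(4) by auto
    then have "p choose i = p * ((p choose i) div p)" by (rule dvd_mult_div_cancel[symmetric])
    then have "of_nat (p choose i) = (of_nat (p * ((p choose i) div p)) :: 'a)" by (rule arg_cong)
    then have "of_nat (p choose i) = of_nat p * (of_nat ((p choose i) div p) :: 'a)" by simp
    then show "of_nat (p choose i) * a ^ i * b ^ (p - i)
        = of_nat p * (of_nat ((p choose i) div p) * a ^ i * b ^ (p - i))" by (simp add: mult.assoc)
  qed simp
  finally have "(a + b) ^ p - (a ^ p + b ^ p) = of_nat p * c" by simp
  moreover have "c \<in> M" unfolding c_def using assms
    by (intro subrng_sum subrngD(4) subrng_power subrng_of_nat) auto
  ultimately show ?thesis by blast
qed

section \<open>Residue characteristic p\<close>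

locale pval = nval v for v :: "'a::field_char_0 \<Rightarrow> int" +
  fixes p :: nat
  assumes p_prime: "Factorial_Ring.prime p" and vp_pos: "v (of_nat p) > 0"
begin

abbreviation "vp \<equiv> v (of_nat p)"

lemma p_gt1: "p > 1" using p_prime prime_gt_1_nat by auto
lemma p_pos [simp]: "p > 0" using p_gt1 by linarith
lemma p_nz [simp]: "(of_nat p :: 'a) \<noteq> 0" by simp
lemma p_U: "of_nat p \<in> U vp" by (simp add: U_iff)
lemma p_P1: "of_nat p \<in> P 1" using vp_pos by (simp add: P_iff)

lemma subrng_P0: "subrng (P 0)"
  unfolding subrng_def by (auto intro: P_diff P_mult0)

text \<open>Bezout supplies an integer inverse of k modulo p; both factors being integral with a
  unit as product, neither has positive valuation.\<close>

lemma of_int_U: "\<not> int p dvd k \<Longrightarrow> of_int k \<in> U 0"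
proof -
  assume "\<not> int p dvd k"
  then have "coprime (int p) k" using p_prime by (simp add: prime_imp_coprime)
  then have "coprime k (int p)" by (simp add: coprime_commute)
  then have "gcd k (int p) = 1" by simp
  then obtain a c where "a * k + c * int p = 1" using bezout_int[of k "int p"] by auto
  then have "k * a + int p * c = 1" by (simp add: mult.commute)
  then have "of_int (k * a + int p * c) = (1 :: 'a)" by simp
  then have "(of_int k :: 'a) * of_int a = 1 - of_nat p * of_int c" by (simp add: algebra_simps)
  moreover have "1 - of_nat p * of_int c \<in> U 0"
    using U_add[of 1 0 "- (of_nat p * of_int c)"] P_mult[OF p_P1 of_int_P] by simp
  ultimately have u: "(of_int k :: 'a) * of_int a \<in> U 0" by simp
  then have "(of_int k :: 'a) \<noteq> 0" "(of_int a :: 'a) \<noteq> 0" by (auto simp: U_iff)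
  with u have "v (of_int k) + v (of_int a) = 0" "v (of_int k) \<ge> 0" "v (of_int a) \<ge> 0"
    using v_mult[of "of_int k" "of_int a"] of_int_P[of k] of_int_P[of a] by (auto simp: U_iff P_iff)
  then show ?thesis using \<open>(of_int k :: 'a) \<noteq> 0\<close> by (simp add: U_iff)
qed
lemma of_nat_U: "\<not> p dvd k \<Longrightarrow> of_nat k \<in> U 0"
  using of_int_U[of "int k"] by simp
lemma of_int_P1: "int p dvd k \<Longrightarrow> of_int k \<in> P 1"
proof -
  assume "int p dvd k"
  then obtain m where "k = int p * m" ..
  then show ?thesis using P_mult[OF p_P1 of_int_P[of m]] by simp
qed

text \<open>Keeps binomials with lower index below p integral, which is what truncation at p
  buys.\<close>

lemma fact_U: "k < p \<Longrightarrow> fact k \<in> U 0"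
proof -
  assume "k < p"
  then have "\<not> p dvd fact k" using p_prime by (simp add: prime_dvd_fact_iff)
  from of_nat_U[OF this] show ?thesis by simp
qed

lemma gbinomial_P0:
  assumes "z \<in> P 0" "k < p" shows "z gchoose k \<in> P 0"
proof -
  have "(\<Prod>i = 0..<k. z - of_nat i) \<in> P 0" using assms by (intro P_prod0 P_diff) auto
  then show ?thesis using P_divide[OF _ fact_U[OF assms(2)]] by (auto simp: gbinomial_prod_rev)
qed

lemma frob_diff:
  assumes "x \<in> P 0" "y \<in> P 0"
  shows "(x - y) ^ p - (x ^ p - y ^ p) \<in> P 1"
proof -
  obtain c where c: "c \<in> P 0" "((x - y) + y) ^ p - ((x - y) ^ p + y ^ p) = of_nat p * c"
    using freshman_dream[OF subrng_P0 _ _ p_prime, of "x - y" y] assms by (auto intro: P_diff)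
  have "(x - y) ^ p - (x ^ p - y ^ p) = - (of_nat p * c)" using c(2) by (simp add: algebra_simps)
  then show ?thesis using P_mult[OF p_P1 c(1)] by simp
qed

lemma root_P: "x ^ k \<in> P 1 \<Longrightarrow> k > 0 \<Longrightarrow> x \<in> P 1"
proof (cases "x = 0")
  case False
  assume a: "x ^ k \<in> P 1" "k > 0"
  have "x ^ k \<in> U (int k * v x)" using U_power[OF U_v[OF False]] .
  with a have "1 \<le> int k * v x" using U_P_iff by blast
  then have "int k * v x > 0" by simp
  then have "v x > 0" using a(2) by (simp add: zero_less_mult_iff)
  then show ?thesis by (simp add: P_iff)
qed simp

text \<open>Mixed binomial terms gain a factor p, and (x - y)^p has depth p m >= m + 1. This
  contraction drives the Teichmueller limit.\<close>

lemma frob_pow_cong: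
  assumes "x \<in> P 0" "y \<in> P 0" "x - y \<in> P m" "m \<ge> 1"
  shows "x ^ p - y ^ p \<in> P (m + 1)"
proof -
  have "x ^ p = (y + (x - y)) ^ p" by simp
  also have "\<dots> = (\<Sum>i\<le>p. of_nat (p choose i) * y ^ i * (x - y) ^ (p - i))" by (rule binomial_ring)
  also have "\<dots> = y ^ p + (\<Sum>i<p. of_nat (p choose i) * y ^ i * (x - y) ^ (p - i))"
    by (simp add: lessThan_Suc_atMost[symmetric] add.commute)
  finally have "x ^ p - y ^ p = (\<Sum>i<p. of_nat (p choose i) * y ^ i * (x - y) ^ (p - i))" by simp
  moreover have "of_nat (p choose i) * y ^ i * (x - y) ^ (p - i) \<in> P (m + 1)" if "i < p" for i
  proof (cases "i = 0")
    case True
    have "(x - y) ^ p \<in> P (int p * m)" using P_power[OF assms(3)] .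
    moreover have "2 * m \<le> int p * m" using p_gt1 assms(4) by (intro mult_right_mono) auto
    then have "m + 1 \<le> int p * m" using assms(4) by linarith
    ultimately show ?thesis using True P_mono by auto
  next
    case False
    have "p dvd p choose i" using dvd_choose_prime[of i p] p_prime False that by auto
    then obtain q where q: "p choose i = p * q" ..
    have 1: "(x - y) ^ (p - i) \<in> P m"
    proof -
      have "(x - y) ^ (p - i) \<in> P (int (p - i) * m)" using P_power[OF assms(3)] .
      moreover have "m \<le> int (p - i) * m" using that assms(4) by (simp add: mult_le_cancel_right1)
      ultimately show ?thesis using P_mono by blast
    qed
    have "(of_nat q * y ^ i) * (of_nat p * (x - y) ^ (p - i)) \<in> P (0 + (1 + m))"
      by (intro P_mult p_P1 1 P_mult0 P_power0 assms) auto
    then show ?thesis by (simp add: q algebra_simps)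
  qed
  ultimately show ?thesis by (auto intro!: P_sum)
qed

end

section \<open>Operators raising valuations\<close>

lemma additive_funpow: "additive (F :: 'b::ab_group_add \<Rightarrow> 'b) \<Longrightarrow> additive (F ^^ n)"
  unfolding additive_def by (induction n) simp_all
lemma funpow_commute: "(\<And>x. F (G x) = G (F x)) \<Longrightarrow> (F ^^ n) (G x) = G ((F ^^ n) x)"
  by (induction n) simp_all
lemma funpow_comp_commute: "(\<And>x. F (G x) = G (F x)) \<Longrightarrow> ((\<lambda>x. F (G x)) ^^ n) x = (F ^^ n) ((G ^^ n) x)"
  by (induction n arbitrary: x) (simp_all add: funpow_commute[of F G] funpow_commute[of G F])

text \<open>The binomial theorem for commuting operators; additivity is enough because the
  coefficients are natural numbers.\<close>

lemma binomial_operators: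
  fixes F G :: "'b::comm_ring_1 \<Rightarrow> 'b"
  assumes F: "additive F" and G: "additive G" and c: "\<And>x. F (G x) = G (F x)"
  shows "((\<lambda>x. F x + G x) ^^ n) x = (\<Sum>i\<le>n. of_nat (n choose i) * (F ^^ i) ((G ^^ (n - i)) x))"
proof (induction n)
  case (Suc n)
  have nat: "additive H \<Longrightarrow> H (of_nat k * x) = of_nat k * H x" for H :: "'b \<Rightarrow> 'b" and k x
    by (induction k) (simp_all add: additive.zero additive.add algebra_simps)
  define t where "t i m = (F ^^ i) ((G ^^ m) x)" for i m
  have Ft: "F (t i m) = t (Suc i) m" and Gt: "G (t i m) = t i (Suc m)" for i m
    unfolding t_def by (simp_all add: funpow_commute[of F G] c)
  have "((\<lambda>x. F x + G x) ^^ Suc n) x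
      = F (\<Sum>i\<le>n. of_nat (n choose i) * t i (n - i)) + G (\<Sum>i\<le>n. of_nat (n choose i) * t i (n - i))"
    using Suc unfolding t_def by simp
  also have "\<dots> = (\<Sum>i\<le>n. of_nat (n choose i) * t (Suc i) (n - i))
      + (\<Sum>i\<le>n. of_nat (n choose i) * t i (Suc n - i))"
    using F G by (simp add: additive.sum nat Ft Gt Suc_diff_le)
  also have "(\<Sum>i\<le>n. of_nat (n choose i) * t i (Suc n - i)) = (\<Sum>i\<le>Suc n. of_nat (n choose i) * t i (Suc n - i))"
    by (simp add: binomial_eq_0)
  also have "\<dots> = t 0 (Suc n) + (\<Sum>i\<le>n. of_nat (n choose Suc i) * t (Suc i) (n - i))"
    by (subst sum.atMost_Suc_shift) simp
  finally have "((\<lambda>x. F x + G x) ^^ Suc n) x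
     = t 0 (Suc n) + (\<Sum>i\<le>n. of_nat (Suc n choose Suc i) * t (Suc i) (n - i))"
    by (simp add: sum.distrib[symmetric] algebra_simps)
  also have "\<dots> = (\<Sum>i\<le>Suc n. of_nat (Suc n choose i) * t i (Suc n - i))"
    by (simp add: sum.atMost_Suc_shift del: sum.atMost_Suc binomial_Suc_Suc)
  finally show ?case unfolding t_def .
qed simp

lemma binomial_one_plus:
  fixes F :: "'b::comm_ring_1 \<Rightarrow> 'b"
  assumes F: "additive F"
  shows "((\<lambda>x. x + F x) ^^ n) x = (\<Sum>i\<le>n. of_nat (n choose i) * (F ^^ i) x)"
proof -
  have id: "((\<lambda>x. x) ^^ m) y = y" for m and y :: 'b by (induction m) auto
  have "((\<lambda>x. F x + x) ^^ n) x = (\<Sum>i\<le>n. of_nat (n choose i) * (F ^^ i) x)"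
    using binomial_operators[OF F, of "\<lambda>x. x"] by (simp add: additive_def id)
  then show ?thesis by (simp add: add.commute)
qed

context pval begin

definition raises :: "int \<Rightarrow> ('a \<Rightarrow> 'a) \<Rightarrow> bool" where
  "raises m F \<longleftrightarrow> additive F \<and> (\<forall>n. \<forall>x\<in>P n. F x \<in> P (n + m))"

lemma raisesD: "raises m F \<Longrightarrow> x \<in> P n \<Longrightarrow> F x \<in> P (n + m)"
  and raises_add: "raises m F \<Longrightarrow> additive F"
  by (auto simp: raises_def)
lemma raises_mono: "raises m F \<Longrightarrow> k \<le> m \<Longrightarrow> raises k F"
  unfolding raises_def by (meson P_mono add_left_mono)
lemma raises_funpow: "raises m F \<Longrightarrow> raises (int k * m) (F ^^ k)"
proof (induction k)
  case (Suc k)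
  then have IH: "raises (int k * m) (F ^^ k)" by simp
  show ?case unfolding raises_def
  proof (intro conjI allI ballI)
    show "additive (F ^^ Suc k)" using Suc.prems by (intro additive_funpow raises_add)
    fix n x assume "x \<in> P n"
    then have "F ((F ^^ k) x) \<in> P ((n + int k * m) + m)" by (intro raisesD[OF Suc.prems] raisesD[OF IH])
    then show "(F ^^ Suc k) x \<in> P (n + int (Suc k) * m)" by (simp add: algebra_simps)
  qed
qed (simp add: raises_def additive_def)
lemma raises_funpow1: "raises m F \<Longrightarrow> m \<ge> 0 \<Longrightarrow> k \<ge> 1 \<Longrightarrow> raises m (F ^^ k)"
  using raises_mono[OF raises_funpow, of m F m k] mult_right_mono[of 1 "int k" m] by simp
lemma raises_U: "raises m F \<Longrightarrow> m \<ge> 1 \<Longrightarrow> x \<in> U n \<Longrightarrow> x + F x \<in> U n"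
  by (rule U_add) (auto intro: P_mono[OF raisesD[of m F x n]])

text \<open>The coefficients of F^2, ..., F^(p-1) are divisible by p; dividing it out and splitting
  off one F leaves \<open>E\<close>, which still raises by m. If the p-th power of 1 + F is the
  identity, F^p is therefore -p F to leading order.\<close>

lemma frobenius_operator:
  assumes F: "raises m F" and m: "m \<ge> 1"
  obtains E where "raises m E" "\<And>x. ((\<lambda>x. x + F x) ^^ p) x = x + (F ^^ p) x + of_nat p * (F x + E (F x))"
proof -
  define E where "E y = (\<Sum>i\<in>{2..<p}. of_nat ((p choose i) div p) * (F ^^ (i - 1)) y)" for y
  note Fa = raises_add[OF F]
  have add: "additive E" unfolding E_def additive_def
    using additive_funpow[OF Fa] by (simp add: additive.add distrib_left sum.distrib)
  have E: "raises m E" unfolding raises_def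
  proof (intro conjI add allI ballI)
    fix n x assume x: "x \<in> P n"
    show "E x \<in> P (n + m)" unfolding E_def
      using raisesD[OF raises_funpow1[OF F] x] m by (intro P_sum P_mult_of_nat) auto
  qed
  have "((\<lambda>x. x + F x) ^^ p) x = x + (F ^^ p) x + of_nat p * (F x + E (F x))" for x
  proof -
    have set: "{..p} = insert 0 (insert p (insert 1 {2..<p}))" using p_gt1 by auto
    have "((\<lambda>x. x + F x) ^^ p) x = (\<Sum>i\<le>p. of_nat (p choose i) * (F ^^ i) x)"
      by (rule binomial_one_plus[OF Fa])
    also have "\<dots> = x + (F ^^ p) x + (of_nat p * F x + (\<Sum>i\<in>{2..<p}. of_nat (p choose i) * (F ^^ i) x))"
      unfolding set using p_gt1 by simp
    also have "(\<Sum>i\<in>{2..<p}. of_nat (p choose i) * (F ^^ i) x) = of_nat p * E (F x)"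
      unfolding E_def sum_distrib_left
    proof (rule sum.cong)
      fix i assume i: "i \<in> {2..<p}"
      then have "p dvd p choose i" using dvd_choose_prime[of i p] p_prime by auto
      then have "p choose i = p * ((p choose i) div p)" by (rule dvd_mult_div_cancel[symmetric])
      then have "of_nat (p choose i) = (of_nat (p * ((p choose i) div p)) :: 'a)" by (rule arg_cong)
      moreover have "(F ^^ i) x = (F ^^ (i - 1)) (F x)"
        using i by (cases i) (simp_all add: funpow_swap1)
      ultimately show "of_nat (p choose i) * (F ^^ i) x
          = of_nat p * (of_nat ((p choose i) div p) * (F ^^ (i - 1)) (F x))" by simp
    qed simp
    finally show ?thesis by (simp add: algebra_simps)
  qed
  with E show ?thesis by (rule that)
qed

text \<open>The bound on the number of roots over the residue field, argued with representatives:
  division by X - a keeps the coefficients integral and the leading one a unit, and differences in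
  \<open>A\<close> are units, so any further root modulo \<open>P 1\<close> is a root of the
  quotient.\<close>

lemma poly_roots_residue:
  assumes "finite A" "degree f < card A" "coeff f (degree f) \<in> U 0" "\<And>i. coeff f i \<in> P 0"
    and "\<And>a. a \<in> A \<Longrightarrow> a \<in> P 0" "\<And>a b. a \<in> A \<Longrightarrow> b \<in> A \<Longrightarrow> a \<noteq> b \<Longrightarrow> a - b \<in> U 0"
  shows "\<exists>a\<in>A. poly f a \<notin> P 1"
  using assms
proof (induction "degree f" arbitrary: f A)
  case 0
  from 0 obtain a where "a \<in> A" by fastforce
  moreover obtain c where c: "f = [:c:]" using 0(1) degree_eq_zeroE[of f] by metis
  ultimately show ?case using 0(4) U_not_P[of c 0] by auto
next
  case (Suc n)
  obtain a where a: "a \<in> A" using Suc.prems(2) by fastforce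
  define g where "g = synthetic_div f a"
  have fg: "f = [:- a, 1:] * g + [:poly f a:]"
    using synthetic_div_correct'[of a f] unfolding g_def by simp
  have dg: "degree g = n" unfolding g_def using Suc.hyps(2) by (simp add: degree_synthetic_div)
  have cf: "coeff f (Suc i) = coeff g i - a * coeff g (Suc i)" for i
    by (subst fg) simp
  have lead: "coeff g n = coeff f (Suc n)" using cf[of n] dg by (simp add: coeff_eq_0)
  have cg: "coeff g i \<in> P 0" for i
  proof (cases "i \<le> n")
    case True
    then show ?thesis
    proof (induction i rule: inc_induct)
      case base show ?case using lead Suc.prems(4) by simp
    next
      case (step i)
      have "coeff g i = coeff f (Suc i) + a * coeff g (Suc i)" using cf[of i] by simp
      then show ?case using Suc.prems(4,5) a step by (auto intro: P_add P_mult0)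
    qed
  qed (use dg in \<open>simp add: coeff_eq_0\<close>)
  show ?case
  proof (cases "poly f a \<in> P 1")
    case True
    have "\<exists>b\<in>A - {a}. poly g b \<notin> P 1"
    proof (rule Suc.hyps(1))
      show "degree g < card (A - {a})" using Suc.prems(1,2) Suc.hyps(2) a dg by simp
      show "coeff g (degree g) \<in> U 0" using lead dg Suc.hyps(2) Suc.prems(3) by simp
    qed (use dg cg Suc.prems in auto)
    then obtain b where b: "b \<in> A" "b \<noteq> a" "poly g b \<notin> P 1" by auto
    have "poly f b \<notin> P 1"
    proof
      assume "poly f b \<in> P 1"
      moreover have "poly f b = (b - a) * poly g b + poly f a" by (subst fg) (simp add: algebra_simps)
      ultimately have "(b - a) * poly g b \<in> P 1" using True P_diff[of "poly f b" 1 "poly f a"] by simp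
      then have "(b - a) * poly g b / (b - a) \<in> P (1 - 0)"
        by (rule P_divide) (use Suc.prems(6) a b in auto)
      then show False using b by simp
    qed
    then show ?thesis using b by blast
  qed (use a in blast)
qed

text \<open>Otherwise X^p - X would have p + 1 roots in the residue field: c and the classes of 0,
  ..., p - 1.\<close>

lemma frobenius_fixed_residue:
  assumes c: "c \<in> P 0" and cp: "c ^ p - c \<in> P 1"
  shows "\<exists>a<p. c - of_nat a \<in> P 1"
proof (rule ccontr)
  assume "\<not> ?thesis"
  then have no: "c - of_nat a \<in> U 0" if "a < p" for a
    using that P_cases[of "c - of_nat a" 0] c by (auto intro: P_diff)
  define f :: "'a poly" where "f = monom 1 p - [:0, 1:]"
  have deg: "degree f = p" unfolding f_def diff_conv_add_uminus
    using p_gt1 by (subst degree_add_eq_left) (simp_all add: degree_monom_eq)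
  have co: "coeff f i \<in> P 0" for i
    unfolding f_def by (auto simp: coeff_pCons split: nat.splits intro!: P_diff)
  have lead: "coeff f p \<in> U 0"
    unfolding f_def using p_gt1 by (auto simp: coeff_pCons split: nat.splits)
  have pf: "poly f x = x ^ p - x" for x unfolding f_def by (simp add: poly_monom)
  have nat: "poly f (of_nat a) \<in> P 1" for a
  proof (induction a)
    case (Suc a)
    obtain d where d: "d \<in> P 0" "(of_nat a + 1) ^ p - (of_nat a ^ p + 1 ^ p) = of_nat p * d"
      using freshman_dream[OF subrng_P0 of_nat_P[of a] one_P p_prime] by blast
    have "poly f (of_nat (Suc a)) = poly f (of_nat a) + of_nat p * d"
      using d(2) unfolding pf by (simp add: algebra_simps)
    then show ?case using Suc P_mult[OF p_P1 d(1)] by (auto intro: P_add)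
  qed (use p_pos in \<open>simp add: pf power_0_left del: p_pos\<close>)
  define A where "A = insert c (of_nat ` {..<p})"
  have cn: "c \<notin> of_nat ` {..<p}" using no by (auto simp: U_iff)
  have diff: "(of_nat i :: 'a) - of_nat j \<in> U 0" if "i < p" "j < p" "i \<noteq> j" for i j
  proof -
    have "\<not> int p dvd int i - int j"
    proof
      assume "int p dvd int i - int j"
      then have "int i mod int p = int j mod int p" by (simp only: mod_eq_dvd_iff)
      then show False using that by simp
    qed
    from of_int_U[OF this] show ?thesis by simp
  qed
  have "\<exists>a\<in>A. poly f a \<notin> P 1"
  proof (rule poly_roots_residue)
    show "finite A" by (simp add: A_def)
    show "degree f < card A" using cn unfolding deg A_def by (simp add: card_image)
    show "coeff f (degree f) \<in> U 0" using lead deg by simp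
    show "coeff f i \<in> P 0" for i by (rule co)
    show "a \<in> A \<Longrightarrow> a \<in> P 0" for a using c by (auto simp: A_def)
    fix a d assume ad: "a \<in> A" "d \<in> A" "a \<noteq> d"
    show "a - d \<in> U 0"
    proof (cases "a = c")
      case True with ad no show ?thesis by (auto simp: A_def)
    next
      case False
      then obtain i where i: "a = of_nat i" "i < p" using ad by (auto simp: A_def)
      show ?thesis
      proof (cases "d = c")
        case True with i no[OF i(2)] U_uminus_iff[of "c - of_nat i" 0] show ?thesis by simp
      next
        case False with i ad diff show ?thesis by (auto simp: A_def)
      qed
    qed
  qed
  then show False using nat cp by (auto simp: A_def pf)
qed

end

section \<open>Residue coefficients and ramified automorphisms\<close>

lemma map_poly_mult_hom:
  fixes g :: "'b::comm_ring_1 \<Rightarrow> 'b"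
  assumes "additive g" "\<And>x y. g (x * y) = g x * g y"
  shows "map_poly g (f * h) = map_poly g f * map_poly g h"
proof (rule poly_eqI)
  have z: "g 0 = 0" using assms(1) by (rule additive.zero)
  show "coeff (map_poly g (f * h)) n = coeff (map_poly g f * map_poly g h) n" for n
    using assms by (simp add: coeff_map_poly z coeff_mult additive.sum)
qed

lemma map_poly_prod_hom:
  fixes g :: "'b::comm_ring_1 \<Rightarrow> 'b"
  assumes "additive g" "\<And>x y. g (x * y) = g x * g y" "g 1 = 1"
  shows "map_poly g (prod h I) = (\<Prod>i\<in>I. map_poly g (h i))"
  by (induction I rule: infinite_finite_induct) (simp_all add: map_poly_mult_hom[OF assms(1,2)] assms(3) map_poly_1)

lemma map_poly_linear_hom:
  fixes g :: "'b::comm_ring_1 \<Rightarrow> 'b"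
  assumes "additive g" "g 1 = 1"
  shows "map_poly g [:- u, 1:] = [:- g u, 1:]"
proof -
  have "g 0 = 0" "g (- u) = - g u" using assms(1) by (simp_all add: additive.zero additive.minus)
  with assms(2) show ?thesis by (simp add: map_poly_pCons)
qed

text \<open>Monicity removes the top coefficient, which \<open>g\<close> fixes.\<close>

lemma poly_map_poly_diff:
  fixes g :: "'b::comm_ring_1 \<Rightarrow> 'b"
  assumes "additive g" "g 1 = 1" "lead_coeff f = 1"
  shows "poly (map_poly g f) x - poly f x = (\<Sum>j<degree f. (g (coeff f j) - coeff f j) * x ^ j)"
proof -
  have z: "g 0 = 0" using assms(1) by (rule additive.zero)
  have d: "degree (map_poly g f) \<le> degree f" by (rule degree_le) (simp add: coeff_map_poly z coeff_eq_0)
  have "poly (map_poly g f) x = poly (\<Sum>j\<le>degree f. monom (coeff (map_poly g f) j) j) x"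
    by (simp only: poly_as_sum_of_monoms'[OF d])
  then have "poly (map_poly g f) x = (\<Sum>j\<le>degree f. g (coeff f j) * x ^ j)"
    by (simp add: poly_sum poly_monom coeff_map_poly z)
  then have "poly (map_poly g f) x - poly f x = (\<Sum>j\<le>degree f. (g (coeff f j) - coeff f j) * x ^ j)"
    by (simp add: poly_altdef sum_subtractf left_diff_distrib)
  also have "\<dots> = (\<Sum>j<degree f. (g (coeff f j) - coeff f j) * x ^ j)"
    using assms(2,3) by (simp add: lessThan_Suc_atMost[symmetric])
  finally show ?thesis .
qed

lemma monic_prod_linear:
  fixes u :: "'i \<Rightarrow> 'b::idom"
  shows "degree (\<Prod>i\<in>I. [:- u i, 1:]) = card I" "lead_coeff (\<Prod>i\<in>I. [:- u i, 1:]) = 1"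
proof -
  show "degree (\<Prod>i\<in>I. [:- u i, 1:]) = card I" by (simp add: degree_prod_sum_eq)
  show "lead_coeff (\<Prod>i\<in>I. [:- u i, 1:]) = 1" unfolding lead_coeff_prod by simp
qed

text \<open>Leading coefficients can be chosen in \<open>T\<close>, over which the operators
  considered are linear; this is how the equality of the residue fields of \<open>T\<close> and
  \<open>N\<close> is used.\<close>

locale resval = pval v p for v :: "'a::field_char_0 \<Rightarrow> int" and p +
  fixes T :: "'a set"
  assumes T_sub: "subrng T"
    and T_inverse: "c \<in> T \<Longrightarrow> inverse c \<in> T"
    and residue: "u \<in> U 0 \<Longrightarrow> \<exists>c\<in>T. c \<in> U 0 \<and> u - c \<in> P 1"
begin

definition tlinear :: "('a \<Rightarrow> 'a) \<Rightarrow> bool" where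
  "tlinear F \<longleftrightarrow> additive F \<and> (\<forall>c\<in>T. \<forall>x. F (c * x) = c * F x)"

lemma tlinearD: "tlinear F \<Longrightarrow> additive F" "tlinear F \<Longrightarrow> c \<in> T \<Longrightarrow> F (c * x) = c * F x"
  by (auto simp: tlinear_def)
lemma iterate_U:
  assumes "x \<in> U n" "\<And>k x. k < m \<Longrightarrow> x \<in> U (n + int k * R) \<Longrightarrow> F x \<in> U (n + int k * R + R)"
  shows "(F ^^ m) x \<in> U (n + int m * R)"
  using assms
proof (induction m)
  case (Suc m)
  then have "F ((F ^^ m) x) \<in> U (n + int m * R + R)" by simp
  moreover have "n + int m * R + R = n + int (Suc m) * R" by (simp add: algebra_simps)
  ultimately show ?case by simp
qed simp
lemma tlinear_step: "tlinear F \<Longrightarrow> c \<in> T \<Longrightarrow> F x = c * F y + F (x - c * y)"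
  using additive.diff[OF tlinearD(1), of F x "c * y"] by (simp add: tlinearD)
lemma tlinear_funpow: "tlinear F \<Longrightarrow> tlinear (F ^^ k)"
  unfolding tlinear_def by (intro conjI additive_funpow) (auto intro: funpow_commute)

lemma residue_step: "x \<in> U n \<Longrightarrow> y \<in> U n \<Longrightarrow> \<exists>c\<in>T. c \<in> U 0 \<and> x - c * y \<in> P (n + 1)"
proof -
  assume xy: "x \<in> U n" "y \<in> U n"
  from residue[OF U0_div_P[OF this]] obtain c where c: "c \<in> T" "c \<in> U 0" "x / y - c \<in> P 1" by blast
  have "(x / y - c) * y \<in> P (1 + n)" using c(3) xy(2) by (intro P_mult) auto
  moreover have "(x / y - c) * y = x - c * y" using xy(2) by (simp add: field_simps U_iff)
  ultimately show ?thesis using c by (auto simp: add.commute)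
qed

lemma scaled_funpow:
  assumes "tlinear F" "c \<in> T"
  shows "((\<lambda>x. c * F x) ^^ k) x = c ^ k * (F ^^ k) x"
proof (induction k)
  case (Suc k)
  have "F (c ^ k * (F ^^ k) x) = c ^ k * F ((F ^^ k) x)"
    using assms subrng_power[OF T_sub] by (intro tlinearD(2))
  then show ?case using Suc by simp
qed simp

text \<open>To bound an operator from below it suffices to test it on one element of each valuation:
  the remaining elements are approximated by \<open>T\<close>-combinations of these.\<close>

lemma approximation:
  assumes F: "tlinear F" and weak: "\<And>n x. x \<in> L \<Longrightarrow> x \<in> P n \<Longrightarrow> F x \<in> P n"
    and L: "\<And>x y c. x \<in> L \<Longrightarrow> y \<in> L \<Longrightarrow> c \<in> T \<Longrightarrow> x - c * y \<in> L"
    and test: "\<And>x. x \<in> L \<Longrightarrow> x \<noteq> 0 \<Longrightarrow> \<exists>y\<in>L. y \<in> U (v x) \<and> F y \<in> P (v x + R)"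
    and x: "x \<in> L" "x \<in> P n"
  shows "F x \<in> P (n + R)"
proof -
  \<comment> \<open>No infinite expansion is summed: the estimate is truncated at depth m, where
    \<open>weak\<close> suffices, and each induction step strips one leading term.\<close>
  have "F x \<in> P (min (n + R) (n + int m))" if "x \<in> L" "x \<in> P n" for m n x
    using that
  proof (induction m arbitrary: n x)
    case 0
    then show ?case using weak P_mono[of "F x" n] by auto
  next
    case (Suc m)
    consider "x \<in> P (n + 1)" | "x \<in> U n" using P_cases[OF Suc.prems(2)] by blast
    then show ?case
    proof cases
      case 1
      from Suc.IH[OF Suc.prems(1) this] show ?thesis by (rule P_mono) auto
    next
      case 2
      then obtain y where y: "y \<in> L" "y \<in> U n" "F y \<in> P (n + R)"
        using test[OF Suc.prems(1)] by (auto simp: U_iff)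
      obtain c where c: "c \<in> T" "c \<in> U 0" "x - c * y \<in> P (n + 1)" using residue_step[OF 2 y(2)] by blast
      have "F (x - c * y) \<in> P (min (n + 1 + R) (n + 1 + int m))"
        by (rule Suc.IH[OF L[OF Suc.prems(1) y(1) c(1)] c(3)])
      then have "F (x - c * y) \<in> P (min (n + R) (n + int (Suc m)))" by (rule P_mono) auto
      moreover have "c * F y \<in> P (min (n + R) (n + int (Suc m)))"
        using P_mult0[OF U_P[OF c(2)] y(3)] by (rule P_mono) auto
      ultimately show ?thesis by (subst tlinear_step[OF F c(1), of x y]) (rule P_add)
    qed
  qed
  from this[OF x, of "nat R"] show ?thesis by (cases "R \<ge> 0") (auto intro: P_mono)
qed

text \<open>An element of valuation n is a unit of \<open>T\<close> times \<open>y\<close> up to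
  higher valuation, and \<open>raise\<close> pushes the error beyond n + R; so a single test element
  decides exactness.\<close>

lemma approximation_exact:
  assumes F: "tlinear F" and raise: "\<And>n x. x \<in> L \<Longrightarrow> x \<in> P n \<Longrightarrow> F x \<in> P (n + R)"
    and L: "\<And>x y c. x \<in> L \<Longrightarrow> y \<in> L \<Longrightarrow> c \<in> T \<Longrightarrow> x - c * y \<in> L"
    and y: "y \<in> L" "y \<in> U n" "F y \<in> U (n + R)" and x: "x \<in> L" "x \<in> U n"
  shows "F x \<in> U (n + R)"
proof -
  obtain c where c: "c \<in> T" "c \<in> U 0" "x - c * y \<in> P (n + 1)" using residue_step[OF x(2) y(2)] by blast
  have "F (x - c * y) \<in> P ((n + R) + 1)"
    using raise[OF L[OF x(1) y(1) c(1)] c(3)] by (simp add: algebra_simps)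
  with U_mult0[OF c(2) y(3)] show ?thesis
    by (subst tlinear_step[OF F c(1), of x y]) (rule U_add)
qed

section \<open>Valuation-preserving automorphisms and their differences\<close>

definition aut :: "('a \<Rightarrow> 'a) \<Rightarrow> bool" where
  "aut g \<longleftrightarrow> additive g \<and> (\<forall>x y. g (x * y) = g x * g y) \<and> g 1 = 1
     \<and> (\<forall>n. \<forall>x\<in>U n. g x \<in> U n) \<and> (\<forall>c\<in>T. g c = c)"

lemma autD:
  assumes "aut g"
  shows "additive g" "g (x * y) = g x * g y" "g 1 = 1" "x \<in> U n \<Longrightarrow> g x \<in> U n" "c \<in> T \<Longrightarrow> g c = c"
    "g 0 = 0" "g (x + y) = g x + g y" "g (x - y) = g x - g y" "g (- x) = - g x"
  using assms additive.zero[of g] additive.add[of g] additive.diff[of g] additive.minus[of g]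
  by (auto simp: aut_def)
lemma aut_P: "aut g \<Longrightarrow> x \<in> P n \<Longrightarrow> g x \<in> P n"
  using autD(4)[of g x "v x"] autD(6)[of g] by (cases "x = 0") (auto simp: P_iff U_iff)
lemma aut_comp: "aut g \<Longrightarrow> aut h \<Longrightarrow> aut (\<lambda>x. g (h x))"
  unfolding aut_def[of "\<lambda>x. g (h x)"] additive_def by (simp add: autD)
lemma aut_funpow: "aut g \<Longrightarrow> aut (g ^^ k)"
proof (induction k)
  case (Suc k)
  then have "aut (\<lambda>x. g ((g ^^ k) x))" using aut_comp[of g "g ^^ k"] by blast
  then show ?case by (simp add: comp_def)
qed (simp add: aut_def additive_def)
lemma aut_power: "aut g \<Longrightarrow> g (x ^ k) = g x ^ k"
  by (induction k) (simp_all add: autD)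
lemma aut_inverse: "aut g \<Longrightarrow> g (inverse x) = inverse (g x)"
proof (cases "x = 0")
  case False
  assume g: "aut g"
  have "g x * g (inverse x) = g (x * inverse x)" by (rule autD(2)[OF g, symmetric])
  then have "g x * g (inverse x) = 1" using False autD(3)[OF g] by simp
  then show ?thesis by (simp add: inverse_unique)
qed (simp add: autD)
lemma aut_divide: "aut g \<Longrightarrow> g (x / y) = g x / g y"
  by (simp add: divide_inverse autD aut_inverse)
lemma aut_powi: "aut g \<Longrightarrow> g (x powi k) = g x powi k"
  by (simp add: power_int_def aut_power aut_inverse)
lemma aut_of_nat: "aut g \<Longrightarrow> g (of_nat k) = of_nat k"
  by (erule autD(5)) (rule subrng_of_nat[OF T_sub])

lemma tlinear_aut: "aut g \<Longrightarrow> tlinear g"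
  unfolding tlinear_def by (simp add: autD)

definition df :: "('a \<Rightarrow> 'a) \<Rightarrow> 'a \<Rightarrow> 'a" where "df g x = g x - x"

lemma tlinear_df: "tlinear g \<Longrightarrow> tlinear (df g)"
  unfolding tlinear_def additive_def df_def by (simp add: algebra_simps)
lemma df_P: "aut g \<Longrightarrow> x \<in> P n \<Longrightarrow> df g x \<in> P n"
  unfolding df_def by (rule P_diff[OF aut_P])
text \<open>By multiplicativity g(\<tau>^s) / \<tau>^s is the s-th power of g(\<tau>) / \<tau>, to
  which the first-order expansion applies.\<close>

lemma df_power_int:
  assumes g: "aut g" and t: "\<tau> \<in> U m" "df g \<tau> \<in> P (m + R)" "R \<ge> 1"
  shows "df g (\<tau> powi s) - of_int s * (\<tau> powi s / \<tau>) * df g \<tau> \<in> P (s * m + 2 * R)"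
proof -
  define \<eta> where "\<eta> = g \<tau> / \<tau>"
  have nz: "\<tau> \<noteq> 0" using t by (auto simp: U_iff)
  have eta: "\<eta> - 1 = df g \<tau> / \<tau>" unfolding \<eta>_def df_def using nz by (simp add: field_simps)
  have "\<eta> - 1 \<in> P R" unfolding eta using P_divide[OF t(2,1)] by simp
  from power_int_approx[OF this t(3)]
  have "\<eta> powi s - 1 - of_int s * (\<eta> - 1) \<in> P (2 * R)" .
  from P_mult[OF U_P[OF U_power_int[OF t(1)]] this]
  have "\<tau> powi s * (\<eta> powi s - 1 - of_int s * (\<eta> - 1)) \<in> P (s * m + 2 * R)" .
  moreover have "g (\<tau> powi s) = \<tau> powi s * \<eta> powi s"
    unfolding aut_powi[OF g] \<eta>_def using nz by (simp add: power_int_divide_distrib)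
  ultimately show ?thesis unfolding eta by (simp add: df_def[of g "\<tau> powi s"] algebra_simps)
qed

lemma df_power_int_P:
  assumes g: "aut g" and t: "\<tau> \<in> U m" "df g \<tau> \<in> P (m + R)" "R \<ge> 1"
  shows "df g (\<tau> powi s) \<in> P (s * m + R)"
proof -
  have "df g (\<tau> powi s) - of_int s * (\<tau> powi s / \<tau>) * df g \<tau> \<in> P (s * m + R)"
    using P_mono[OF df_power_int[OF assms, of s]] t(3) by simp
  moreover have "of_int s * (\<tau> powi s / \<tau>) * df g \<tau> \<in> P ((0 + (s * m - m)) + (m + R))"
    using U_divide[OF U_power_int[OF t(1), of s] t(1)] by (intro P_mult of_int_P t) auto
  ultimately have "df g (\<tau> powi s) \<in> P ((0 + (s * m - m)) + (m + R))"
    using P_cong[of "df g (\<tau> powi s)"] by simp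
  then show ?thesis by simp
qed

lemma df_power_int_U:
  assumes g: "aut g" and t: "\<tau> \<in> U m" "df g \<tau> \<in> U (m + R)" "R \<ge> 1" and s: "\<not> int p dvd s"
  shows "df g (\<tau> powi s) \<in> U (s * m + R)"
proof -
  have "df g (\<tau> powi s) - of_int s * (\<tau> powi s / \<tau>) * df g \<tau> \<in> P (s * m + R + 1)"
    using P_mono[OF df_power_int[OF g t(1) U_P[OF t(2)] t(3), of s], of "s * m + R + 1"] t(3) by simp
  moreover have "of_int s * (\<tau> powi s / \<tau>) * df g \<tau> \<in> U ((0 + (s * m - m)) + (m + R))"
    by (intro U_mult of_int_U U_divide U_power_int t s)
  ultimately show ?thesis using U_cong by (simp add: algebra_simps)
qed

lemma raises_df:
  assumes g: "aut g" and t: "\<pi> \<in> U 1" "df g \<pi> \<in> P (1 + R)" "R \<ge> 1"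
  shows "raises R (df g)"
  unfolding raises_def
proof (intro conjI allI ballI)
  show "additive (df g)" using tlinear_df[OF tlinear_aut[OF g]] by (rule tlinearD)
  fix n x assume xn: "x \<in> P n"
  show "df g x \<in> P (n + R)"
  proof (rule approximation[where L = UNIV and F = "df g"])
    fix x :: 'a
    have "\<pi> powi v x \<in> U (v x)" using U_power_int[OF t(1), of "v x"] by simp
    moreover have "df g (\<pi> powi v x) \<in> P (v x + R)" using df_power_int_P[OF g t, of "v x"] by simp
    ultimately show "\<exists>y\<in>UNIV. y \<in> U (v x) \<and> df g y \<in> P (v x + R)" by blast
  qed (use xn in \<open>simp_all add: tlinear_df tlinear_aut df_P g\<close>)
qed

text \<open>On \<pi>^n the leading term is n \<pi>^(n-1) (g - 1) \<pi>, and n is a unit when p does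
  not divide it.\<close>

lemma df_exact:
  assumes g: "aut g" and t: "\<pi> \<in> U 1" "df g \<pi> \<in> U (1 + R)" "R \<ge> 1" and x: "x \<in> U n" "\<not> int p dvd n"
  shows "df g x \<in> U (n + R)"
proof (rule approximation_exact[where L = UNIV and F = "df g" and y = "\<pi> powi n"])
  show "df g (\<pi> powi n) \<in> U (n + R)" using df_power_int_U[OF g t x(2)] by simp
  show "\<pi> powi n \<in> U n" using U_power_int[OF t(1), of n] by simp
  show "tlinear (df g)" by (intro tlinear_df tlinear_aut g)
  show "df g x \<in> P (n + R)" if "x \<in> P n" for x n
    using raises_df[OF g t(1) U_P[OF t(2)] t(3)] that by (rule raisesD)
qed (use x in simp_all)

end

text \<open>\<open>break1\<close> and \<open>break2\<close> express G_b = G and G_(b+1) = 1 through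
  exponents of the two generators. The last condition reflects that N/K is totally ramified of
  degree p^2, with e the absolute ramification index of K.\<close>

locale ram = resval v p T for v :: "'a::field_char_0 \<Rightarrow> int" and p T +
  fixes \<gamma> \<sigma> :: "'a \<Rightarrow> 'a" and b e :: int
  assumes aut_\<gamma>: "aut \<gamma>" and aut_\<sigma>: "aut \<sigma>"
    and comm: "\<gamma> (\<sigma> x) = \<sigma> (\<gamma> x)"
    and \<gamma>_p: "(\<gamma> ^^ p) x = x" and \<sigma>_p: "(\<sigma> ^^ p) x = x"
    and b_pos: "b \<ge> 1"
    and break1: "x \<in> P 1 \<Longrightarrow> (\<gamma> ^^ i) ((\<sigma> ^^ j) x) - x \<in> P (b + 1)"
    and break2: "i < p \<Longrightarrow> j < p \<Longrightarrow> (i, j) \<noteq> (0, 0) \<Longrightarrow> \<exists>x\<in>P 1. (\<gamma> ^^ i) ((\<sigma> ^^ j) x) - x \<notin> P (b + 2)"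
    and vp: "v (of_nat p) = int p ^ 2 * e"
begin

abbreviation "S \<equiv> df \<sigma>"
abbreviation "G \<equiv> df \<gamma>"

lemma aut_\<gamma>\<sigma>: "aut (\<lambda>x. (\<gamma> ^^ i) ((\<sigma> ^^ j) x))"
  by (rule aut_comp[OF aut_funpow[OF aut_\<gamma>] aut_funpow[OF aut_\<sigma>]])

text \<open>A larger displacement of one uniformizer would, by \<open>raises_df\<close>, put the
  element into the next ramification group.\<close>

lemma break_uniformizer:
  assumes "i < p" "j < p" "(i, j) \<noteq> (0, 0)" "\<pi> \<in> U 1"
  shows "(\<gamma> ^^ i) ((\<sigma> ^^ j) \<pi>) - \<pi> \<in> U (1 + b)"
proof (rule ccontr)
  let ?g = "\<lambda>x. (\<gamma> ^^ i) ((\<sigma> ^^ j) x)"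
  assume "\<not> ?thesis"
  then have 1: "df ?g \<pi> \<in> P (1 + (b + 1))"
    using P_cases[OF break1[OF U_P[OF assms(4)], of i j]] by (auto simp: add_ac df_def)
  have "raises (b + 1) (df ?g)" using raises_df[OF aut_\<gamma>\<sigma> assms(4) 1] b_pos by simp
  then have "(\<gamma> ^^ i) ((\<sigma> ^^ j) x) - x \<in> P (b + 2)" if "x \<in> P 1" for x
    using raisesD[of "b + 1" "df ?g" x 1] that by (simp add: add_ac df_def)
  with break2[OF assms(1-3)] show False by blast
qed

lemma S_uniformizer: "\<pi> \<in> U 1 \<Longrightarrow> S \<pi> \<in> U (1 + b)"
  using break_uniformizer[of 0 1 \<pi>] p_gt1 by (simp add: df_def)
lemma G_uniformizer: "\<pi> \<in> U 1 \<Longrightarrow> G \<pi> \<in> U (1 + b)"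
  using break_uniformizer[of 1 0 \<pi>] p_gt1 by (simp add: df_def)

lemma raises_S: "raises b S" and raises_G: "raises b G"
proof -
  obtain \<pi> where "\<pi> \<in> U 1" using ex_U by blast
  then show "raises b S" "raises b G"
    using raises_df[OF aut_\<sigma>, of \<pi> b] raises_df[OF aut_\<gamma>, of \<pi> b] S_uniformizer G_uniformizer b_pos by auto
qed
lemma S_exact: "x \<in> U n \<Longrightarrow> \<not> int p dvd n \<Longrightarrow> S x \<in> U (n + b)"
  using ex_U[of 1] df_exact[OF aut_\<sigma>] S_uniformizer b_pos by blast
lemma tlinear_S: "tlinear S" and tlinear_G: "tlinear G"
  by (intro tlinear_df tlinear_aut aut_\<sigma> aut_\<gamma>)+
lemma SG_comm: "S (G x) = G (S x)"
  by (simp add: df_def autD[OF aut_\<sigma>] autD[OF aut_\<gamma>] comm)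

text \<open>Expands g^p = 1 with g = 1 + (g - 1).\<close>

lemma power_relation:
  assumes g: "\<And>x. (g ^^ p) x = x" and r: "raises m (df g)" "m \<ge> 1"
  obtains E where "raises m E" "\<And>x. (df g ^^ p) x = - (of_nat p * (df g x + E (df g x)))"
proof -
  obtain E where E: "raises m E"
    "\<And>x. ((\<lambda>x. x + df g x) ^^ p) x = x + (df g ^^ p) x + of_nat p * (df g x + E (df g x))"
    using frobenius_operator[OF r] by blast
  have "(\<lambda>x. x + df g x) = g" by (auto simp: df_def)
  then have "(df g ^^ p) x = - (of_nat p * (df g x + E (df g x)))" for x
    using E(2)[of x] g[of x] by (simp add: eq_neg_iff_add_eq_0)
  with E(1) show ?thesis by (rule that)
qed

lemma \<sigma>_power_approx: "x \<in> P n \<Longrightarrow> (\<sigma> ^^ a) x - x - of_nat a * S x \<in> P (n + 2 * b)"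
proof (induction a)
  case (Suc a)
  have "(\<sigma> ^^ a) x - x = ((\<sigma> ^^ a) x - x - of_nat a * S x) + of_nat a * S x" by simp
  also have "\<dots> \<in> P (n + b)"
    using P_mono[OF Suc.IH[OF Suc.prems]] b_pos P_mult_of_nat[OF raisesD[OF raises_S Suc.prems]]
    by (intro P_add) auto
  finally have "S ((\<sigma> ^^ a) x - x) \<in> P ((n + b) + b)" by (rule raisesD[OF raises_S])
  moreover have "(\<sigma> ^^ Suc a) x - x - of_nat (Suc a) * S x
      = S ((\<sigma> ^^ a) x - x) + ((\<sigma> ^^ a) x - x - of_nat a * S x)"
    by (simp add: df_def autD[OF aut_\<sigma>] algebra_simps)
  moreover have "(\<sigma> ^^ a) x - x - of_nat a * S x \<in> P ((n + b) + b)"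
    using Suc.IH[OF Suc.prems] by (simp add: algebra_simps)
  ultimately have "(\<sigma> ^^ Suc a) x - x - of_nat (Suc a) * S x \<in> P ((n + b) + b)" by (simp only: P_add)
  then show ?case by (simp add: algebra_simps)
qed simp

text \<open>First-order part of \<gamma> \<sigma>^[c] - 1; for the right c the leading terms of
  \<open>G\<close> and \<open>c S\<close> cancel.\<close>

definition lam :: "'a \<Rightarrow> 'a \<Rightarrow> 'a" where "lam c x = G x + c * S x"

text \<open>On \<pi>^n both \<open>G\<close> and \<open>S\<close> equal n \<pi>^(n-1) times their
  value at \<pi>, up to 2 b >= b + 1; so cancellation at one uniformizer spreads to all
  valuations.\<close>

lemma lam_raises:
  assumes c: "c \<in> T" "c \<in> P 0" and \<pi>: "\<pi> \<in> U 1" "lam c \<pi> \<in> P (b + 2)"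
  shows "raises (b + 1) (lam c)"
proof -
  have lin: "tlinear (lam c)"
    using tlinear_S tlinear_G unfolding tlinear_def additive_def lam_def by (simp add: algebra_simps)
  have weak: "lam c x \<in> P n" if "x \<in> P n" for x n
    unfolding lam_def using that by (intro P_add P_mult0 c df_P aut_\<gamma> aut_\<sigma>)
  have test: "lam c (\<pi> powi n) \<in> P (n + (b + 1))" for n
  proof -
    let ?q = "of_int n * (\<pi> powi n / \<pi>)"
    have "G (\<pi> powi n) - ?q * G \<pi> \<in> P (n + 2 * b)" "S (\<pi> powi n) - ?q * S \<pi> \<in> P (n + 2 * b)"
      using df_power_int[OF aut_\<gamma> \<pi>(1) _ b_pos, of n] df_power_int[OF aut_\<sigma> \<pi>(1) _ b_pos, of n]
        S_uniformizer[OF \<pi>(1)] G_uniformizer[OF \<pi>(1)] by auto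
    then have "(G (\<pi> powi n) - ?q * G \<pi>) + c * (S (\<pi> powi n) - ?q * S \<pi>) \<in> P (n + 2 * b)"
      using c by (intro P_add P_mult0)
    then have "lam c (\<pi> powi n) - ?q * lam c \<pi> \<in> P (n + (b + 1))"
      using b_pos by (simp add: lam_def P_mono[of _ "n + 2 * b"] algebra_simps)
    moreover have "?q * lam c \<pi> \<in> P ((0 + (n * 1 - 1)) + (b + 2))"
      by (intro P_mult of_int_P U_P[OF U_divide] U_power_int \<pi>)
    ultimately show ?thesis using P_cong by (simp add: algebra_simps)
  qed
  show ?thesis unfolding raises_def
  proof (intro conjI allI ballI)
    show "additive (lam c)" by (rule tlinearD[OF lin])
    fix n x assume x: "x \<in> P n"
    show "lam c x \<in> P (n + (b + 1))"
    proof (rule approximation[where L = UNIV, OF lin])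
      fix x :: 'a
      have "\<pi> powi v x \<in> U (v x)" using U_power_int[OF \<pi>(1), of "v x"] by simp
      with test[of "v x"] show "\<exists>y\<in>UNIV. y \<in> U (v x) \<and> lam c y \<in> P (v x + (b + 1))" by blast
    qed (use x weak in auto)
  qed
qed

text \<open>If the residue of c were fixed by Frobenius, c would be congruent to an integer a < p.
  Then \<gamma> \<sigma>^a, which is not the identity, would move a uniformizer by more than the
  single break permits.\<close>

lemma lam_coeff_unit:
  assumes c: "c \<in> T" "c \<in> P 0" and r: "raises (b + 1) (lam c)"
  shows "c ^ p - c \<in> U 0"
proof (rule ccontr)
  assume "c ^ p - c \<notin> U 0"
  then have "c ^ p - c \<in> P 1" using P_cases[of "c ^ p - c" 0] c by (auto intro: P_diff P_power0)
  then obtain a where a: "a < p" "c - of_nat a \<in> P 1" using frobenius_fixed_residue c by blast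
  obtain \<pi> where \<pi>: "\<pi> \<in> U 1" using ex_U by blast
  have 1: "(\<sigma> ^^ a) \<pi> - \<pi> - of_nat a * S \<pi> \<in> P (b + 2)"
    using P_mono[OF \<sigma>_power_approx[OF U_P[OF \<pi>], of a]] b_pos by auto
  have "(\<sigma> ^^ a) \<pi> - \<pi> \<in> P (b + 1)" using break1[of \<pi> 0 a] U_P[OF \<pi>] by simp
  then have 2: "G ((\<sigma> ^^ a) \<pi> - \<pi>) \<in> P (b + 2)" using P_mono[OF raisesD[OF raises_G]] b_pos by auto
  have "(c - of_nat a) * S \<pi> \<in> P (1 + (1 + b))" by (intro P_mult a(2) U_P S_uniformizer \<pi>)
  then have 3: "(c - of_nat a) * S \<pi> \<in> P (b + 2)" by (simp add: algebra_simps)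
  have 4: "lam c \<pi> \<in> P (b + 2)" using raisesD[OF r U_P[OF \<pi>]] by (simp add: algebra_simps)
  have "\<gamma> ((\<sigma> ^^ a) \<pi>) - \<pi> = G ((\<sigma> ^^ a) \<pi> - \<pi>) + ((\<sigma> ^^ a) \<pi> - \<pi> - of_nat a * S \<pi>)
       + lam c \<pi> - (c - of_nat a) * S \<pi>"
    by (simp add: lam_def df_def autD[OF aut_\<gamma>] algebra_simps)
  also have "\<dots> \<in> P (b + 2)" by (intro P_add P_diff 1 2 3 4)
  finally show False
    using break_uniformizer[of 1 a \<pi>] p_gt1 a(1) \<pi> U_not_P[of _ "1 + b"] by (simp add: add_ac)
qed

lemma ex_lam: "\<exists>c\<in>T. c \<in> U 0 \<and> raises (b + 1) (lam c)"
proof -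
  obtain \<pi> where \<pi>: "\<pi> \<in> U 1" using ex_U by blast
  obtain c where c: "c \<in> T" "c \<in> U 0" "G \<pi> - c * (- S \<pi>) \<in> P (1 + b + 1)"
    using residue_step[OF G_uniformizer[OF \<pi>], of "- S \<pi>"] S_uniformizer[OF \<pi>] by auto
  then have "lam c \<pi> \<in> P (b + 2)" by (simp add: lam_def algebra_simps)
  with lam_raises[OF c(1) U_P[OF c(2)] \<pi>] c show ?thesis by blast
qed

text \<open>If p divides b, then \<open>S\<close> is exact on all iterates of a uniformizer, and S^p
  = -p S to leading order gives p b = v(p) + b. Expand (G + c S)^p: the outer terms combine to -p
  (c^p - c) S plus deeper terms, of exact valuation v(p) + 1 + b since c^p - c is a unit, and the
  mixed terms are deeper by a factor p. But \<open>lam c\<close> raises by b + 1 each time, which is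
  too much.\<close>

lemma b_not_dvd: "\<not> int p dvd b"
proof
  assume pb: "int p dvd b"
  obtain c where c: "c \<in> T" "c \<in> U 0" "raises (b + 1) (lam c)" using ex_lam by blast
  obtain \<pi> where \<pi>: "\<pi> \<in> U 1" using ex_U by blast
  obtain E where E: "raises b E" "\<And>x. (S ^^ p) x = - (of_nat p * (S x + E (S x)))"
    using power_relation[of \<sigma> b] \<sigma>_p raises_S b_pos by blast
  obtain E' where E': "raises b E'" "\<And>x. (G ^^ p) x = - (of_nat p * (G x + E' (G x)))"
    using power_relation[of \<gamma> b] \<gamma>_p raises_G b_pos by blast
  have n1: "\<not> int p dvd 1 + int k * b" for k
  proof
    assume "int p dvd 1 + int k * b"
    moreover have "int p dvd int k * b" using pb by (rule dvd_mult)
    ultimately have "int p dvd (1 + int k * b) - int k * b" by (rule dvd_diff)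
    then have "int p dvd 1" by simp
    then show False using p_gt1 zdvd_imp_le[of "int p" 1] by linarith
  qed
  have Sp: "(S ^^ p) \<pi> \<in> U (1 + int p * b)" using \<pi> by (rule iterate_U) (rule S_exact[OF _ n1])
  have S1: "S \<pi> \<in> U (1 + b)" by (rule S_uniformizer[OF \<pi>])
  have "S \<pi> + E (S \<pi>) \<in> U (1 + b)" using raises_U[OF E(1) b_pos S1] .
  then have "(S ^^ p) \<pi> \<in> U (vp + (1 + b))" unfolding E(2) U_uminus_iff by (intro U_mult p_U)
  from U_unique[OF Sp this] have eq: "int p * b = vp + b" by simp
  have cS: "((\<lambda>x. c * S x) ^^ k) x = c ^ k * (S ^^ k) x" for k x
    by (rule scaled_funpow[OF tlinear_S c(1)])
  have aS: "additive (\<lambda>x. c * S x)"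
    unfolding additive_def by (simp only: additive.add[OF raises_add[OF raises_S]] distrib_left simp_thms)
  have com: "G (c * S x) = c * S (G x)" for x
    by (simp only: tlinearD(2)[OF tlinear_G c(1)] SG_comm)
  define t where "t i = of_nat (p choose i) * (G ^^ i) (c ^ (p - i) * (S ^^ (p - i)) \<pi>)" for i
  have tm: "t i \<in> P (vp + b + 2)" if "i \<in> {1..<p}" for i
  proof -
    have "p dvd p choose i" using dvd_choose_prime[of i p] p_prime that by auto
    then obtain q where q: "p choose i = p * q" ..
    have 1: "(S ^^ (p - i)) \<pi> \<in> P (1 + int (p - i) * b)" by (rule raisesD[OF raises_funpow[OF raises_S] U_P[OF \<pi>]])
    have "(G ^^ i) (c ^ (p - i) * (S ^^ (p - i)) \<pi>) \<in> P (1 + int (p - i) * b + int i * b)"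
      by (rule raisesD[OF raises_funpow[OF raises_G] P_mult0[OF P_power0 1]]) (use c in auto)
    also have "1 + int (p - i) * b + int i * b = 1 + int p * b"
      using that by (simp add: of_nat_diff algebra_simps)
    finally have "of_nat p * (of_nat q * (G ^^ i) (c ^ (p - i) * (S ^^ (p - i)) \<pi>)) \<in> P (vp + (1 + int p * b))"
      by (intro P_mult U_P[OF p_U] P_mult_of_nat)
    moreover have "vp + b + 2 \<le> vp + (1 + int p * b)" using vp_pos eq by simp
    ultimately show ?thesis unfolding t_def q by (simp add: P_mono mult.assoc)
  qed
  have "lam c = (\<lambda>x. G x + c * S x)" by (auto simp: lam_def)
  then have "(lam c ^^ p) \<pi> = (\<Sum>i\<le>p. t i)"
    unfolding t_def cS[symmetric] using binomial_operators[OF raises_add[OF raises_G] aS com] by simp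
  also have "{..p} = insert 0 (insert p {1..<p})" using p_gt1 by auto
  also have "sum t \<dots> = t 0 + (t p + sum t {1..<p})" using p_gt1 by simp
  finally have lp: "(lam c ^^ p) \<pi> = t 0 + (t p + sum t {1..<p})" .
  have "t 0 = - (of_nat p * (c ^ p * S \<pi> + c ^ p * E (S \<pi>)))" "t p = - (of_nat p * (G \<pi> + E' (G \<pi>)))"
    unfolding t_def by (simp_all add: E(2) E'(2) algebra_simps)
  with lp have "- (lam c ^^ p) \<pi> = of_nat p * (((c ^ p - c) * S \<pi>) + (lam c \<pi> + c ^ p * E (S \<pi>) + E' (G \<pi>))) + - sum t {1..<p}"
    by (simp add: lam_def algebra_simps)
  moreover have "of_nat p * (((c ^ p - c) * S \<pi>) + (lam c \<pi> + c ^ p * E (S \<pi>) + E' (G \<pi>))) \<in> U (vp + (0 + (1 + b)))"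
  proof (intro U_mult p_U, rule U_add)
    show "(c ^ p - c) * S \<pi> \<in> U (0 + (1 + b))"
      using lam_coeff_unit[OF c(1) U_P[OF c(2)] c(3)] S1 by (rule U_mult)
    have "lam c \<pi> \<in> P (1 + (b + 1))" using raisesD[OF c(3) U_P[OF \<pi>]] .
    moreover have "E (S \<pi>) \<in> P (1 + b + b)" "E' (G \<pi>) \<in> P (1 + b + b)"
      using raisesD[OF E(1) U_P[OF S1]] raisesD[OF E'(1) U_P[OF G_uniformizer[OF \<pi>]]] by auto
    then have "E (S \<pi>) \<in> P (0 + (1 + b) + 1)" "E' (G \<pi>) \<in> P (0 + (1 + b) + 1)"
      using b_pos P_mono[of _ "1 + b + b" "0 + (1 + b) + 1"] by simp_all
    moreover from this(1) have "c ^ p * E (S \<pi>) \<in> P (0 + (1 + b) + 1)"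
      by (rule P_mult0[OF P_power0[OF U_P[OF c(2)]]])
    ultimately show "lam c \<pi> + c ^ p * E (S \<pi>) + E' (G \<pi>) \<in> P (0 + (1 + b) + 1)"
      by (intro P_add) (auto simp: algebra_simps)
  qed
  moreover have "- sum t {1..<p} \<in> P (vp + (0 + (1 + b)) + 1)"
    using P_sum[of "{1..<p}" t, OF tm] by (simp add: algebra_simps)
  ultimately have "- (lam c ^^ p) \<pi> \<in> U (vp + (0 + (1 + b)))" by (metis U_add)
  moreover have "(lam c ^^ p) \<pi> \<in> P (1 + int p * (b + 1))"
    by (rule raisesD[OF raises_funpow[OF c(3)] U_P[OF \<pi>]])
  ultimately have "1 + int p * (b + 1) \<le> vp + (0 + (1 + b))" using U_P_iff U_uminus_iff by blast
  then show False using eq p_gt1 by (simp add: algebra_simps)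
qed

end

section \<open>Truncated exponentiation and the operator \<open>\<Theta> - 1\<close>\<close>

context nval begin

text \<open>Coefficient j is, up to sign, an elementary symmetric function of degree card I - j in
  the \<open>u i\<close>.\<close>

lemma coeff_prod_linear_P:
  assumes "finite I" "\<And>i. i \<in> I \<Longrightarrow> u i \<in> P 1"
  shows "coeff (\<Prod>i\<in>I. [:- u i, 1:]) j \<in> P (int (card I) - int j)"
  using assms
proof (induction I arbitrary: j rule: finite_induct)
  case empty
  show ?case by (cases j) (simp_all add: coeff_1 P_mono[OF one_P])
next
  case (insert i I)
  let ?f = "\<Prod>i\<in>I. [:- u i, 1:]"
  have f: "coeff ?f k \<in> P (int (card I) - int k)" for k using insert by simp
  have a: "- u i * coeff ?f j \<in> P (1 + (int (card I) - int j))"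
    using insert.prems by (intro P_mult f) simp
  have "coeff ([:- u i, 1:] * ?f) j \<in> P (1 + (int (card I) - int j))"
  proof (cases j)
    case (Suc k)
    have "coeff ?f k \<in> P (1 + (int (card I) - int j))" using f[of k] Suc by simp
    with a show ?thesis by (simp add: Suc P_diff)
  qed (use a in simp)
  then show ?case using insert.hyps by (simp add: algebra_simps)
qed

end

context ram begin

text \<open>Fixed field of \<open>\<sigma>\<close>. Its nonzero elements have valuation divisible by
  p, since \<open>S\<close> would not kill them otherwise.\<close>

definition K1 :: "'a set" where "K1 = {k. \<sigma> k = k}"

lemma K1_iff: "k \<in> K1 \<longleftrightarrow> \<sigma> k = k" by (simp add: K1_def)
lemma K1_S: "k \<in> K1 \<longleftrightarrow> S k = 0" by (simp add: K1_def df_def)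
lemma T_K1: "c \<in> T \<Longrightarrow> c \<in> K1" by (simp add: K1_def autD[OF aut_\<sigma>])
lemma K1_closed:
  "x \<in> K1 \<Longrightarrow> y \<in> K1 \<Longrightarrow> x - y \<in> K1" "x \<in> K1 \<Longrightarrow> y \<in> K1 \<Longrightarrow> x + y \<in> K1"
  "x \<in> K1 \<Longrightarrow> y \<in> K1 \<Longrightarrow> x * y \<in> K1" "x \<in> K1 \<Longrightarrow> y \<in> K1 \<Longrightarrow> x / y \<in> K1"
  "x \<in> K1 \<Longrightarrow> x powi s \<in> K1" "x \<in> K1 \<Longrightarrow> \<gamma> x \<in> K1" "x \<in> K1 \<Longrightarrow> G x \<in> K1" "0 \<in> K1" "1 \<in> K1"
  by (simp_all add: K1_def df_def autD[OF aut_\<sigma>] aut_divide[OF aut_\<sigma>] aut_powi[OF aut_\<sigma>] comm[symmetric])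
lemma K1_combination: "x \<in> K1 \<Longrightarrow> y \<in> K1 \<Longrightarrow> c \<in> T \<Longrightarrow> x - c * y \<in> K1"
  by (rule K1_closed(1)[OF _ K1_closed(3)[OF T_K1]])

lemma K1_dvd: "k \<in> K1 \<Longrightarrow> k \<in> U n \<Longrightarrow> int p dvd n"
  using S_exact[of k n] by (auto simp: K1_S U_iff)
lemma K1_P: "k \<in> K1 \<Longrightarrow> k \<in> P (int p * m + 1) \<Longrightarrow> k \<in> P (int p * m + int p)"
proof (cases "k = 0")
  case False
  assume k: "k \<in> K1" "k \<in> P (int p * m + 1)"
  from K1_dvd[OF k(1) U_v[OF False]] obtain q where q: "v k = int p * q" ..
  have "int p * m + 1 \<le> int p * q" using k(2) False q by (simp add: P_iff)
  then have "int p * m < int p * q" by linarith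
  then have "m + 1 \<le> q" by (simp add: mult_less_cancel_left)
  then have "int p * (m + 1) \<le> int p * q" by (intro mult_left_mono) auto
  with q show ?thesis by (simp add: P_iff algebra_simps)
qed simp

text \<open>The break of \<open>\<gamma>\<close> on the field fixed by \<open>\<sigma>\<close>: with \<open>f\<close> the minimal polynomial of a
  uniformizer \<open>\<pi>\<close> over that field, \<open>(\<gamma> f) (\<pi>)\<close> is the product of the \<open>\<pi> - \<gamma> \<sigma>\<^sup>i \<pi>\<close>,
  while \<open>\<gamma> f - f\<close> has its coefficients in the fixed field.\<close>

lemma ex_\<tau>: "\<exists>\<tau>\<in>K1. \<tau> \<in> U (int p) \<and> G \<tau> \<in> U (int p + int p * b)"
proof -
  obtain \<pi> where \<pi>: "\<pi> \<in> U 1" using ex_U by blast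
  define u where "u i = (\<sigma> ^^ i) \<pi>" for i
  have u: "u i \<in> U 1" for i unfolding u_def by (rule autD(4)[OF aut_funpow[OF aut_\<sigma>] \<pi>])
  define f where "f = (\<Prod>i<p. [:- u i, 1:])"
  have deg: "degree f = p" and lead: "lead_coeff f = 1"
    unfolding f_def using monic_prod_linear[of u "{..<p}"] by simp_all
  have h\<sigma>: "additive \<sigma>" "\<And>x y. \<sigma> (x * y) = \<sigma> x * \<sigma> y" "\<sigma> 1 = 1"
    and h\<gamma>: "additive \<gamma>" "\<And>x y. \<gamma> (x * y) = \<gamma> x * \<gamma> y" "\<gamma> 1 = 1"
    using autD(1-3)[OF aut_\<sigma>] autD(1-3)[OF aut_\<gamma>] by blast+
  \<comment> \<open>\<open>\<sigma>\<close> shifts the factors cyclically; cancelling a linear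
    factor avoids reindexing modulo p.\<close>
  have "map_poly \<sigma> f = (\<Prod>i<p. [:- u (Suc i), 1:])"
    unfolding f_def map_poly_prod_hom[OF h\<sigma>] map_poly_linear_hom[OF h\<sigma>(1,3)] by (simp add: u_def)
  moreover have "[:- u 0, 1:] * (\<Prod>i<p. [:- u (Suc i), 1:]) = (\<Prod>i<p. [:- u i, 1:]) * [:- u p, 1:]"
    by (subst prod.lessThan_Suc_shift[symmetric]) simp
  moreover have "u p = u 0" by (simp add: u_def \<sigma>_p)
  ultimately have "[:- u 0, 1:] * map_poly \<sigma> f = [:- u 0, 1:] * f" by (simp add: f_def mult.commute)
  moreover have "[:- u 0, 1:] \<noteq> 0" by simp
  ultimately have "map_poly \<sigma> f = f" using mult_left_cancel by blast
  then have cK: "coeff f j \<in> K1" for j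
    using coeff_map_poly[of \<sigma> f j] additive.zero[OF h\<sigma>(1)] by (simp add: K1_def)
  have cP: "coeff f j \<in> P (int p - int j)" for j
    using coeff_prod_linear_P[of "{..<p}" u j] u unfolding f_def by auto
  have "map_poly \<gamma> f = (\<Prod>i<p. [:- \<gamma> (u i), 1:])"
    unfolding f_def map_poly_prod_hom[OF h\<gamma>] map_poly_linear_hom[OF h\<gamma>(1,3)] ..
  then have "poly (map_poly \<gamma> f) \<pi> = (\<Prod>i<p. \<pi> - \<gamma> (u i))" by (simp add: poly_prod)
  moreover have "poly f \<pi> = 0"
    unfolding f_def poly_prod using p_pos by (intro prod_zero) (auto simp: u_def intro: bexI[of _ 0])
  ultimately have sum: "(\<Sum>j<p. G (coeff f j) * \<pi> ^ j) = (\<Prod>i<p. \<pi> - \<gamma> (u i))"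
    using poly_map_poly_diff[OF h\<gamma>(1,3) lead, of \<pi>] by (simp add: deg df_def)
  have "\<pi> - \<gamma> (u i) \<in> U (1 + b)" if "i < p" for i
  proof -
    have "(\<gamma> ^^ 1) ((\<sigma> ^^ i) \<pi>) - \<pi> \<in> U (1 + b)" using break_uniformizer[of 1 i \<pi>] that p_gt1 \<pi> by simp
    then have "- (\<pi> - \<gamma> (u i)) \<in> U (1 + b)" by (simp add: u_def)
    then show ?thesis by (simp only: U_uminus_iff)
  qed
  then have sumU: "(\<Sum>j<p. G (coeff f j) * \<pi> ^ j) \<in> U (int p * (1 + b))"
    unfolding sum using U_prod[of "{..<p}" "\<lambda>i. \<pi> - \<gamma> (u i)" "1 + b"] by simp
  \<comment> \<open>The nonzero summands have valuations in distinct classes j modulo p, so none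
    cancel and each satisfies the bound known for the product.\<close>
  have vt: "G (coeff f j) * \<pi> ^ j \<in> U (v (G (coeff f j)) + int j) \<and> int p dvd v (G (coeff f j))"
    if "G (coeff f j) * \<pi> ^ j \<noteq> 0" for j
  proof -
    have nz: "G (coeff f j) \<noteq> 0" using that by auto
    show ?thesis using U_mult[OF U_v[OF nz] U_power[OF \<pi>, of j]] K1_dvd[OF K1_closed(7)[OF cK] U_v[OF nz]] by simp
  qed
  have terms: "G (coeff f j) * \<pi> ^ j \<in> P (int p * (1 + b))" if "j < p" for j
  proof (rule sum_distinct_val_P[where I = "{..<p}" and f = "\<lambda>j. G (coeff f j) * \<pi> ^ j"])
    fix i k assume a: "i \<in> {..<p}" "k \<in> {..<p}" "i \<noteq> k"
      "G (coeff f i) * \<pi> ^ i \<noteq> 0" "G (coeff f k) * \<pi> ^ k \<noteq> 0"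
    show "v (G (coeff f i) * \<pi> ^ i) \<noteq> v (G (coeff f k) * \<pi> ^ k)"
    proof
      assume "v (G (coeff f i) * \<pi> ^ i) = v (G (coeff f k) * \<pi> ^ k)"
      then have "v (G (coeff f i)) + int i = v (G (coeff f k)) + int k"
        using vt[OF a(4)] vt[OF a(5)] by (auto simp: U_iff)
      moreover obtain c d where "v (G (coeff f i)) = int p * c" "v (G (coeff f k)) = int p * d"
        using vt[OF a(4)] vt[OF a(5)] by (auto elim!: dvdE)
      ultimately have "int i mod int p = int k mod int p"
        by (metis add.commute mod_mult_self2)
      then show False using a by simp
    qed
  qed (use sumU that in auto)
  define \<tau> where "\<tau> = coeff f 0"
  have "\<tau> = (\<Prod>i<p. - u i)" unfolding \<tau>_def poly_0_coeff_0[symmetric] f_def by (simp add: poly_prod)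
  then have \<tau>: "\<tau> \<in> U (int p)" using U_prod[of "{..<p}" "\<lambda>i. - u i" 1] u by simp
  have \<tau>K: "\<tau> \<in> K1" unfolding \<tau>_def by (rule cK)
  have G\<tau>: "G \<tau> \<in> P (int p + int p * b)" using terms[of 0] p_pos by (simp add: \<tau>_def algebra_simps)
  \<comment> \<open>If \<open>G \<tau>\<close> were deeper, testing on powers of
    \<open>\<tau>\<close> would show that \<open>G\<close> raises all of \<open>K1\<close> by more
    than p b; every summand, hence the product, would be too deep.\<close>
  have "G \<tau> \<in> U (int p + int p * b)"
  proof (rule ccontr)
    assume "G \<tau> \<notin> U (int p + int p * b)"
    then have t: "G \<tau> \<in> P (int p + (int p * b + 1))" using P_cases[OF G\<tau>] by (simp add: add_ac)
    have R: "int p * b + 1 \<ge> 1" using b_pos by simp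
    have raise: "G x \<in> P (n + (int p * b + 1))" if x: "x \<in> K1" "x \<in> P n" for x n
    proof (rule approximation[where L = K1 and F = G])
      fix x assume x: "x \<in> K1" "x \<noteq> 0"
      obtain s where s: "v x = int p * s" using K1_dvd[OF x(1) U_v[OF x(2)]] ..
      show "\<exists>y\<in>K1. y \<in> U (v x) \<and> G y \<in> P (v x + (int p * b + 1))"
      proof (intro bexI conjI)
        show "\<tau> powi s \<in> U (v x)" using U_power_int[OF \<tau>, of s] s by (simp add: mult.commute)
        show "G (\<tau> powi s) \<in> P (v x + (int p * b + 1))"
          using df_power_int_P[OF aut_\<gamma> \<tau> t R, of s] s by (simp add: mult.commute)
      qed (rule K1_closed(5)[OF \<tau>K])
    qed (use x in \<open>simp_all add: tlinear_G df_P[OF aut_\<gamma>] K1_combination\<close>)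
    have "G (coeff f j) * \<pi> ^ j \<in> P (int p * (1 + b) + 1)" if "j < p" for j
    proof -
      \<comment> \<open>Coefficients of index below p have positive valuation, which for elements of
        \<open>K1\<close> rounds up to p.\<close>
      have "coeff f j \<in> P (int p * 0 + 1)" using P_mono[OF cP[of j]] that by simp
      then have "coeff f j \<in> P (int p)" using K1_P[OF cK, of j 0] by simp
      from raise[OF cK this] have "G (coeff f j) \<in> P (int p * (1 + b) + 1)" by (simp add: algebra_simps)
      moreover have "\<pi> ^ j \<in> P 0" using U_P_le[OF U_power[OF \<pi>, of j]] by simp
      ultimately show ?thesis using P_mult[of _ "int p * (1 + b) + 1" "\<pi> ^ j" 0] by simp
    qed
    then have "(\<Sum>j<p. G (coeff f j) * \<pi> ^ j) \<in> P (int p * (1 + b) + 1)" by (intro P_sum) simp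
    with U_not_P[OF sumU] show False by simp
  qed
  with \<tau> \<tau>K show ?thesis by blast
qed

definition \<tau> :: 'a where "\<tau> = (SOME t. t \<in> K1 \<and> t \<in> U (int p) \<and> G t \<in> U (int p + int p * b))"
lemma \<tau>: "\<tau> \<in> K1" "\<tau> \<in> U (int p)" "G \<tau> \<in> U (int p + int p * b)"
proof -
  have "\<exists>t. t \<in> K1 \<and> t \<in> U (int p) \<and> G t \<in> U (int p + int p * b)" using ex_\<tau> by blast
  from someI_ex[OF this] show "\<tau> \<in> K1" "\<tau> \<in> U (int p)" "G \<tau> \<in> U (int p + int p * b)"
    unfolding \<tau>_def by blast+
qed
lemma \<tau>_powi: "\<tau> powi s \<in> K1" "\<tau> powi s \<in> U (int p * s)"
  using K1_closed(5)[OF \<tau>(1)] U_power_int[OF \<tau>(2), of s] by (simp_all add: mult.commute)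

lemma pb_pos: "int p * b \<ge> 1" using p_pos b_pos by (simp add: Ints_mult int_one_le_iff_zero_less)

text \<open>The extension K1/K again has break b; measured with \<open>v\<close>, which is p times
  the normalized valuation of the fixed field, this reads p b.\<close>

lemma K1_raise: "x \<in> K1 \<Longrightarrow> x \<in> P n \<Longrightarrow> G x \<in> P (n + int p * b)"
proof -
  assume x: "x \<in> K1" "x \<in> P n"
  show "G x \<in> P (n + int p * b)"
  proof (rule approximation[where L = K1 and F = G])
    fix x assume x: "x \<in> K1" "x \<noteq> 0"
    obtain s where s: "v x = int p * s" using K1_dvd[OF x(1) U_v[OF x(2)]] ..
    show "\<exists>y\<in>K1. y \<in> U (v x) \<and> G y \<in> P (v x + int p * b)"
    proof (intro bexI conjI)
      show "\<tau> powi s \<in> U (v x)" using \<tau>_powi(2) s by simp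
      show "G (\<tau> powi s) \<in> P (v x + int p * b)"
        using df_power_int_P[OF aut_\<gamma> \<tau>(2) U_P[OF \<tau>(3)] pb_pos, of s] s by (simp add: mult.commute)
    qed (rule \<tau>_powi)
  qed (use x in \<open>simp_all add: tlinear_G df_P[OF aut_\<gamma>] K1_combination\<close>)
qed

lemma K1_exact:
  assumes "x \<in> K1" "x \<in> U (int p * s)" "\<not> int p dvd s"
  shows "G x \<in> U (int p * s + int p * b)"
proof (rule approximation_exact[where L = K1 and F = G and y = "\<tau> powi s"])
  show "G (\<tau> powi s) \<in> U (int p * s + int p * b)"
    using df_power_int_U[OF aut_\<gamma> \<tau>(2,3) pb_pos assms(3)] by (simp add: mult.commute)
qed (use assms K1_raise in \<open>simp_all add: tlinear_G \<tau>_powi K1_combination\<close>)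

lemma p_coprime_b: "int p dvd k * b \<longleftrightarrow> int p dvd k"
  using b_not_dvd prime_dvd_mult_iff[of "int p" k b] p_prime by simp

text \<open>Start from \<tau>^b: the k-th iterate under \<open>G\<close> has valuation p (k + 1) b
  with (k + 1) b prime to p until k = p - 1, so G^p gains at least p b at each of its p steps.
  Comparison with G^p = -p G to leading order gives p (p - 1) b <= v(p); equality is impossible
  because v(p) = p^2 e and p does not divide b.\<close>

lemma vp_gt: "int p * (int p - 1) * b < v (of_nat p)"
proof -
  obtain E where E: "raises b E" "\<And>x. (G ^^ p) x = - (of_nat p * (G x + E (G x)))"
    using power_relation[of \<gamma> b] \<gamma>_p raises_G b_pos by blast
  define x where "x = \<tau> powi b"
  have x: "x \<in> K1" "x \<in> U (int p * b)" unfolding x_def by (rule \<tau>_powi)+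
  have K: "(G ^^ k) x \<in> K1" for k
  proof (induction k)
    case (Suc k) then show ?case using K1_closed(7) by simp
  qed (use x in simp)
  have it: "(G ^^ k) x \<in> U (int p * ((1 + int k) * b))" if "k < p" for k
    using that
  proof (induction k)
    case (Suc k)
    have "\<not> int p dvd 1 + int k"
      using zdvd_imp_le[of "int p" "1 + int k"] Suc.prems by auto
    then have "\<not> int p dvd (1 + int k) * b" by (simp add: p_coprime_b)
    then have "G ((G ^^ k) x) \<in> U (int p * ((1 + int k) * b) + int p * b)"
      using K1_exact[OF K[of k]] Suc by simp
    then show ?case by (simp add: algebra_simps)
  qed (use x in simp)
  have "(G ^^ Suc (p - 1)) x \<in> P (int p * ((1 + int (p - 1)) * b) + int p * b)"
    unfolding funpow.simps comp_apply by (intro K1_raise[OF K] U_P[OF it]) simp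
  moreover have "Suc (p - 1) = p" "1 + int (p - 1) = int p" using p_gt1 by linarith+
  ultimately have Gp: "(G ^^ p) x \<in> P (int p * (int p * b) + int p * b)" by simp
  have "G x \<in> U (int p * b + int p * b)" using K1_exact[OF x b_not_dvd] .
  then have "G x + E (G x) \<in> U (int p * b + int p * b)" by (rule raises_U[OF E(1) b_pos])
  then have "of_nat p * (G x + E (G x)) \<in> U (v (of_nat p) + (int p * b + int p * b))" by (intro U_mult p_U)
  moreover have "of_nat p * (G x + E (G x)) \<in> P (int p * (int p * b) + int p * b)"
    using Gp unfolding E(2) by simp
  ultimately have "int p * (int p * b) + int p * b \<le> v (of_nat p) + (int p * b + int p * b)"
    using U_P_iff by blast
  then have le: "int p * ((int p - 1) * b) \<le> int p * (int p * e)"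
    unfolding vp by (simp add: algebra_simps power2_eq_square)
  have "(int p - 1) * b \<noteq> int p * e"
  proof
    assume "(int p - 1) * b = int p * e"
    then have "int p dvd (int p - 1) * b" by simp
    then have "int p dvd int p - 1" by (simp only: p_coprime_b)
    then show False using zdvd_imp_le[of "int p" "int p - 1"] p_gt1 by simp
  qed
  moreover have "(int p - 1) * b \<le> int p * e" using le p_pos by simp
  ultimately have "int p * ((int p - 1) * b) < int p * (int p * e)" using p_pos by simp
  then show ?thesis unfolding vp by (simp add: power2_eq_square mult.assoc)
qed

end

text \<open>Only the effect of the congruence defining \<omega> is kept: \<omega> is integral and
  makes the first-order part of \<delta> raise by b + 1.\<close>

locale refined = ram v p T \<gamma> \<sigma> b e
  for v :: "'a::field_char_0 \<Rightarrow> int" and p T \<gamma> \<sigma> b e +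
  fixes \<omega> :: 'a
  assumes \<omega>_T: "\<omega> \<in> T" and \<omega>_P: "\<omega> \<in> P 0" and lam_\<omega>: "raises (b + 1) (lam \<omega>)"
begin

lemma gb_T: "\<omega> gchoose k \<in> T"
proof -
  have "(\<Prod>i = 0..<k. \<omega> - of_nat i) \<in> T"
    by (induction k) (auto intro: subrngD[OF T_sub] \<omega>_T subrng_of_nat T_sub)
  moreover have "inverse (fact k) \<in> T"
    using T_inverse[OF subrng_of_nat[OF T_sub, of "fact k"]] by simp
  ultimately show ?thesis
    unfolding gbinomial_prod_rev divide_inverse by (rule subrngD(4)[OF T_sub])
qed
lemma gb_P: "k < p \<Longrightarrow> \<omega> gchoose k \<in> P 0" by (rule gbinomial_P0[OF \<omega>_P])

text \<open>\<open>\<sigma>\<^sup>[\<^sup>\<omega>\<^sup>] = 1 + B (\<sigma> - 1)\<close> with \<open>B = \<omega> + C\<close>.\<close>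

definition B :: "'a \<Rightarrow> 'a" where "B y = (\<Sum>i\<in>{1..<p}. (\<omega> gchoose i) * (S ^^ (i - 1)) y)"
definition C :: "'a \<Rightarrow> 'a" where "C y = (\<Sum>i\<in>{2..<p}. (\<omega> gchoose i) * (S ^^ (i - 1)) y)"
definition sexp :: "'a \<Rightarrow> 'a" where "sexp x = (\<Sum>i<p. (\<omega> gchoose i) * (S ^^ i) x)"
definition Th :: "'a \<Rightarrow> 'a" where "Th x = \<gamma> (sexp x)"
abbreviation \<delta> :: "'a \<Rightarrow> 'a" where "\<delta> \<equiv> df Th"

lemma B_C: "B y = \<omega> * y + C y"
proof -
  have "{1..<p} = insert 1 {2..<p}" using p_gt1 by auto
  then show ?thesis unfolding B_def C_def by simp
qed
lemma sexp_B: "sexp x = x + B (S x)"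
proof -
  have "{..<p} = insert 0 {1..<p}" using p_gt1 by auto
  moreover have "(\<Sum>i\<in>{1..<p}. (\<omega> gchoose i) * (S ^^ i) x) = B (S x)"
    unfolding B_def
  proof (rule sum.cong)
    fix i assume "i \<in> {1..<p}"
    then obtain k where "i = Suc k" by (cases i) auto
    then show "(\<omega> gchoose i) * (S ^^ i) x = (\<omega> gchoose i) * (S ^^ (i - 1)) (S x)" by (simp add: funpow_swap1)
  qed simp
  ultimately show ?thesis unfolding sexp_def by simp
qed

lemma tlinear_sum_S: "tlinear (\<lambda>y. \<Sum>i\<in>I. (\<omega> gchoose i) * (S ^^ h i) y)"
  using tlinearD(2)[OF tlinear_funpow[OF tlinear_S]]
  unfolding tlinear_def additive_def
  by (simp add: additive.add[OF tlinearD(1)[OF tlinear_funpow[OF tlinear_S]]] sum.distrib sum_distrib_left algebra_simps)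
lemma tlinear_B: "tlinear B" and tlinear_C: "tlinear C" and tlinear_sexp: "tlinear sexp"
  using tlinear_sum_S[of "\<lambda>i. i - 1" "{1..<p}"] tlinear_sum_S[of "\<lambda>i. i - 1" "{2..<p}"] tlinear_sum_S[of "\<lambda>i. i" "{..<p}"]
  unfolding B_def[abs_def] C_def[abs_def] sexp_def[abs_def] .
lemma tlinear_Th: "tlinear Th"
  using tlinear_sexp tlinear_aut[OF aut_\<gamma>] unfolding tlinear_def additive_def Th_def by simp
lemma tlinear_\<delta>: "tlinear \<delta>" by (rule tlinear_df[OF tlinear_Th])

lemma raises_C: "raises b C"
  unfolding raises_def
proof (intro conjI allI ballI)
  show "additive C" by (rule tlinearD[OF tlinear_C])
  fix n x assume x: "x \<in> P n"
  have "(S ^^ (i - 1)) x \<in> P (n + b)" if "i \<in> {2..<p}" for i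
  proof -
    have "1 \<le> i - 1" using that by auto
    from raises_funpow1[OF raises_S _ this] b_pos x show ?thesis by (auto dest: raisesD)
  qed
  then show "C x \<in> P (n + b)" unfolding C_def by (intro P_sum P_mult0 gb_P) auto
qed
lemma B_P: "x \<in> P n \<Longrightarrow> B x \<in> P n"
  unfolding B_C using P_mono[OF raisesD[OF raises_C]] b_pos by (intro P_add P_mult0 \<omega>_P) auto
lemma B_funpow: "x \<in> P n \<Longrightarrow> (B ^^ k) x \<in> P n \<and> (B ^^ k) x - \<omega> ^ k * x \<in> P (n + b)"
proof (induction k)
  case (Suc k)
  then have IH: "(B ^^ k) x \<in> P n" "(B ^^ k) x - \<omega> ^ k * x \<in> P (n + b)" by auto
  have "B ((B ^^ k) x) - \<omega> ^ Suc k * x = \<omega> * ((B ^^ k) x - \<omega> ^ k * x) + C ((B ^^ k) x)"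
    by (simp add: B_C algebra_simps)
  also have "\<dots> \<in> P (n + b)" by (intro P_add P_mult0 \<omega>_P IH raisesD[OF raises_C])
  finally show ?case using B_P[OF IH(1)] by simp
qed simp

lemma tlinear_commute_S: "tlinear F \<Longrightarrow> (\<And>x. F (S x) = S (F x)) \<Longrightarrow> F (sexp x) = sexp (F x)"
  unfolding sexp_def additive.sum[OF tlinearD(1)]
  by (simp add: tlinearD(2) gb_T funpow_commute[of S F])
lemma sexp_S: "sexp (S x) = S (sexp x)"
  using tlinear_commute_S[OF tlinear_S] by simp
lemma sexp_\<gamma>: "sexp (\<gamma> x) = \<gamma> (sexp x)"
  by (rule tlinear_commute_S[OF tlinear_aut[OF aut_\<gamma>], symmetric])
    (simp add: df_def autD[OF aut_\<gamma>] comm)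
lemma \<gamma>_S: "\<gamma> (S x) = S (\<gamma> x)"
  by (simp add: df_def autD[OF aut_\<gamma>] comm)
lemma Th_S: "Th (S x) = S (Th x)"
  by (simp add: Th_def sexp_S \<gamma>_S)
lemma \<delta>_S: "\<delta> (S x) = S (\<delta> x)"
  unfolding df_def[of Th] Th_S by (rule additive.diff[OF tlinearD(1)[OF tlinear_S], symmetric])
lemma B_S: "B (S x) = S (B x)"
proof -
  have "S (B x) = (\<Sum>i\<in>{1..<p}. (\<omega> gchoose i) * S ((S ^^ (i - 1)) x))"
    unfolding B_def additive.sum[OF tlinearD(1)[OF tlinear_S]] by (simp add: tlinearD(2)[OF tlinear_S gb_T])
  then show ?thesis unfolding B_def by (simp add: funpow_swap1)
qed

lemma raises_BS: "raises b (\<lambda>x. B (S x))"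
  unfolding raises_def using tlinearD(1)[OF tlinear_B] tlinearD(1)[OF tlinear_S] raisesD[OF raises_S] B_P
  by (simp add: additive_def)

lemma \<delta>_lam: "\<delta> x = lam \<omega> x + (C (S x) + G (B (S x)))"
  by (simp add: df_def Th_def sexp_B B_C lam_def autD[OF aut_\<gamma>])

text \<open>Everything beyond the first-order part \<open>lam \<omega>\<close> involves two
  differences and raises by 2 b.\<close>

lemma raises_\<delta>: "raises (b + 1) \<delta>"
  unfolding raises_def
proof (intro conjI allI ballI)
  show "additive \<delta>" by (rule tlinearD[OF tlinear_\<delta>])
  fix n x assume x: "x \<in> P n"
  note Sx = raisesD[OF raises_S x]
  have 1: "C (S x) \<in> P (n + (b + 1))" using P_mono[OF raisesD[OF raises_C Sx]] b_pos by simp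
  have 2: "G (B (S x)) \<in> P (n + (b + 1))" using P_mono[OF raisesD[OF raises_G B_P[OF Sx]]] b_pos by simp
  show "\<delta> x \<in> P (n + (b + 1))" unfolding \<delta>_lam by (intro P_add 1 2 raisesD[OF lam_\<omega> x])
qed

lemma Th_funpow_p: "(Th ^^ p) x = (sexp ^^ p) x"
proof -
  have "Th = (\<lambda>x. \<gamma> (sexp x))" by (auto simp: Th_def)
  then have "(Th ^^ p) x = (\<gamma> ^^ p) ((sexp ^^ p) x)"
    using funpow_comp_commute[of \<gamma> sexp p x] sexp_\<gamma> by simp
  then show ?thesis by (simp add: \<gamma>_p)
qed

text \<open>\<open>W\<close> preserves valuations because its leading coefficient \<open>\<omega> - \<omega>\<^sup>p\<close> is a unit.\<close>

lemma \<delta>_power_relation: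
  obtains W V where "\<And>n y. y \<in> U n \<Longrightarrow> W y \<in> U n" "\<And>n y. y \<in> P n \<Longrightarrow> W y \<in> P n"
    "\<And>n y. y \<in> U n \<Longrightarrow> V y \<in> U n" "\<And>n y. y \<in> P n \<Longrightarrow> V y \<in> P n"
    "\<And>x. (\<delta> ^^ p) x = of_nat p * (W (S x) - V (\<delta> x))"
proof -
  have b1: "b + 1 \<ge> 1" using b_pos by simp
  obtain E1 where E1: "raises b E1" "\<And>x. (S ^^ p) x = - (of_nat p * (S x + E1 (S x)))"
    using power_relation[of \<sigma> b] \<sigma>_p raises_S b_pos by blast
  obtain E2 where E2: "raises b E2"
    "\<And>x. ((\<lambda>x. x + B (S x)) ^^ p) x = x + ((\<lambda>x. B (S x)) ^^ p) x + of_nat p * (B (S x) + E2 (B (S x)))"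
    using frobenius_operator[OF raises_BS b_pos] by blast
  obtain E3 where E3: "raises (b + 1) E3"
    "\<And>x. ((\<lambda>x. x + \<delta> x) ^^ p) x = x + (\<delta> ^^ p) x + of_nat p * (\<delta> x + E3 (\<delta> x))"
    using frobenius_operator[OF raises_\<delta> b1] by blast
  \<comment> \<open>\<open>W\<close> and \<open>V\<close> come from expanding Th^p twice: as (1 +
    \<delta>)^p, and, since \<gamma>^p = 1, as sexp^p = (1 + B S)^p, where S^p is rewritten by
    \<sigma>^p = 1.\<close>
  define W where "W y = B y + E2 (B y) - (B ^^ p) (y + E1 y)" for y
  define V where "V y = y + E3 y" for y
  have lin: "additive (B ^^ p)" by (rule tlinearD(1)[OF tlinear_funpow[OF tlinear_B]])
  have wcong: "W y - (\<omega> - \<omega> ^ p) * y \<in> P (n + b)" if y: "y \<in> P n" for y n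
  proof -
    have "W y - (\<omega> - \<omega> ^ p) * y = C y + E2 (B y) - ((B ^^ p) y - \<omega> ^ p * y) - (B ^^ p) (E1 y)"
      unfolding W_def additive.add[OF lin] by (simp add: B_C algebra_simps)
    moreover have "(B ^^ p) (E1 y) \<in> P (n + b)" using B_funpow[OF raisesD[OF E1(1) y]] by blast
    ultimately show ?thesis
      using raisesD[OF raises_C y] raisesD[OF E2(1) B_P[OF y]] B_funpow[OF y, of p]
      by (simp only: P_add P_diff)
  qed
  have unit: "\<omega> - \<omega> ^ p \<in> U 0"
    using lam_coeff_unit[OF \<omega>_T \<omega>_P lam_\<omega>] U_uminus_iff[of "\<omega> ^ p - \<omega>" 0] by simp
  show ?thesis
  proof (rule that[of W V])
    show "W y \<in> U n" if "y \<in> U n" for n y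
      using U_cong[OF P_mono[OF wcong[OF U_P[OF that]]] U_mult0[OF unit that]] b_pos by simp
    show "W y \<in> P n" if "y \<in> P n" for n y
      using P_cong[OF P_mono[OF wcong[OF that]] P_mult0[OF U_P[OF unit] that]] b_pos by simp
    show "V y \<in> U n" if "y \<in> U n" for n y unfolding V_def using raises_U[OF E3(1) b1 that] .
    show "V y \<in> P n" if "y \<in> P n" for n y
      unfolding V_def using P_add[OF that P_mono[OF raisesD[OF E3(1) that]]] b_pos by simp
    fix x
    have "(\<lambda>x. x + \<delta> x) = Th" by (auto simp: df_def)
    then have "(Th ^^ p) x = x + (\<delta> ^^ p) x + of_nat p * V (\<delta> x)" using E3(2)[of x] by (simp add: V_def)
    moreover have "(\<lambda>x. x + B (S x)) = sexp" by (auto simp: sexp_B)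
    then have "(Th ^^ p) x = x + ((\<lambda>x. B (S x)) ^^ p) x + of_nat p * (B (S x) + E2 (B (S x)))"
      unfolding Th_funpow_p using E2(2)[of x] by simp
    moreover have "((\<lambda>x. B (S x)) ^^ p) x = (B ^^ p) ((S ^^ p) x)"
      using funpow_comp_commute[of B S p x] B_S by simp
    moreover have "(B ^^ p) ((S ^^ p) x) = - (of_nat p * (B ^^ p) (S x + E1 (S x)))"
      unfolding E1(2) additive.minus[OF lin]
      by (simp add: tlinearD(2)[OF tlinear_funpow[OF tlinear_B] subrng_of_nat[OF T_sub]])
    ultimately show "(\<delta> ^^ p) x = of_nat p * (W (S x) - V (\<delta> x))"
      unfolding W_def by (simp add: algebra_simps)
  qed
qed

text \<open>When \<delta> x is deeper than S x, the term \<open>W (S x)\<close> dominates the power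
  relation.\<close>

lemma \<delta>_power_exact:
  assumes "S x \<in> U n" "\<delta> x \<in> P (n + 1)"
  shows "(\<delta> ^^ p) x \<in> U (v (of_nat p) + n)"
proof -
  obtain W V where WV: "\<And>n y. y \<in> U n \<Longrightarrow> W y \<in> U n" "\<And>n y. y \<in> P n \<Longrightarrow> V y \<in> P n"
    "\<And>x. (\<delta> ^^ p) x = of_nat p * (W (S x) - V (\<delta> x))" using \<delta>_power_relation by metis
  have "W (S x) + - V (\<delta> x) \<in> U n" by (intro U_add WV assms P_uminus)
  then show ?thesis unfolding WV(3) by (intro U_mult p_U) simp
qed

lemma \<delta>_power_P:
  assumes "S x \<in> P n" "\<delta> x \<in> P n"
  shows "(\<delta> ^^ p) x \<in> P (v (of_nat p) + n)"
proof -
  obtain W V where WV: "\<And>n y. y \<in> P n \<Longrightarrow> W y \<in> P n" "\<And>n y. y \<in> P n \<Longrightarrow> V y \<in> P n"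
    "\<And>x. (\<delta> ^^ p) x = of_nat p * (W (S x) - V (\<delta> x))" using \<delta>_power_relation by metis
  show ?thesis unfolding WV(3) using assms by (intro P_mult P_diff WV U_P[OF p_U])
qed

text \<open>Read backwards, the power relation recovers the valuation of S x, because
  \<open>W\<close> preserves exact valuations.\<close>

lemma \<delta>_power_cancel:
  assumes "(\<delta> ^^ p) x \<in> U (v (of_nat p) + n)" "\<delta> x \<in> P (n + 1)"
  shows "S x \<in> U n"
proof -
  obtain W V where WV: "\<And>n y. y \<in> U n \<Longrightarrow> W y \<in> U n" "\<And>n y. y \<in> P n \<Longrightarrow> W y \<in> P n"
    "\<And>n y. y \<in> P n \<Longrightarrow> V y \<in> P n"
    "\<And>x. (\<delta> ^^ p) x = of_nat p * (W (S x) - V (\<delta> x))" using \<delta>_power_relation by metis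
  have "of_nat p * (W (S x) - V (\<delta> x)) / of_nat p \<in> U (v (of_nat p) + n - v (of_nat p))"
    using assms(1) unfolding WV(4) by (rule U_divide[OF _ p_U])
  then have "W (S x) - V (\<delta> x) \<in> U n" by simp
  from U_add[OF this WV(3)[OF assms(2)]] have W: "W (S x) \<in> U n" by simp
  have "S x \<noteq> 0"
  proof
    assume "S x = 0"
    then have "W (S x) = 0" using WV(2)[of "S x"] P_all_zero by simp
    with W show False by (simp add: U_iff)
  qed
  with U_unique[OF WV(1)[OF U_v[OF this]] W] show ?thesis by (auto simp: U_iff)
qed

end

section \<open>Binomials as test elements\<close>

lemma gbinomial_add:
  "(x + y :: 'b::field_char_0) gchoose n = (\<Sum>k\<le>n. (y gchoose k) * (x gchoose (n - k)))"
  using gbinomial_Vandermonde[of y x n] by (simp add: atLeast0AtMost add.commute)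

context ram begin

text \<open>A start congruent to b modulo p survives longest: the iterates have valuation (i + 1) b
  modulo p, which vanishes only at i = p - 1.\<close>

lemma S_iterate:
  assumes "x \<in> U n" "int p dvd n - b" "k < p"
  shows "(S ^^ k) x \<in> U (n + int k * b)"
  using assms(1)
proof (rule iterate_U)
  fix i x assume i: "i < k" "x \<in> U (n + int i * b)"
  have "\<not> int p dvd int i + 1" using zdvd_imp_le[of "int p" "int i + 1"] i assms(3) by auto
  then have "\<not> int p dvd (int i + 1) * b" by (simp add: p_coprime_b)
  moreover have "(n + int i * b) - (n - b) = (int i + 1) * b" by (simp add: algebra_simps)
  ultimately have "\<not> int p dvd n + int i * b" using dvd_diff[OF _ assms(2), of "n + int i * b"] by auto
  with i show "S x \<in> U (n + int i * b + b)" by (intro S_exact)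
qed

text \<open>Trace to the fixed field of \<open>\<sigma>\<close>.\<close>

definition Tr :: "'a \<Rightarrow> 'a" where "Tr x = (\<Sum>i<p. (\<sigma> ^^ i) x)"

lemma Tr_K1: "Tr x \<in> K1"
proof -
  have "\<sigma> (Tr x) = (\<Sum>i<p. (\<sigma> ^^ Suc i) x)"
    unfolding Tr_def additive.sum[OF autD(1)[OF aut_\<sigma>]] by simp
  moreover have "(\<sigma> ^^ 0) x + (\<Sum>i<p. (\<sigma> ^^ Suc i) x) = Tr x + (\<sigma> ^^ p) x"
    unfolding Tr_def by (subst sum.lessThan_Suc_shift[symmetric]) simp
  ultimately show ?thesis by (simp add: K1_iff \<sigma>_p)
qed

text \<open>Each g^i is expanded in powers of g - 1; summing the coefficients over i < p is the
  hockey-stick identity.\<close>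

lemma sum_funpow_eq:
  assumes g: "aut g"
  shows "(\<Sum>i<p. (g ^^ i) x) = (\<Sum>j<p. of_nat (p choose Suc j) * (df g ^^ j) x)"
proof -
  have "(g ^^ i) x = (\<Sum>j<p. of_nat (i choose j) * (df g ^^ j) x)" if "i < p" for i
  proof -
    have "(\<lambda>x. x + df g x) = g" by (auto simp: df_def)
    then have "(g ^^ i) x = (\<Sum>j\<le>i. of_nat (i choose j) * (df g ^^ j) x)"
      using binomial_one_plus[OF tlinearD(1)[OF tlinear_df[OF tlinear_aut[OF g]]], of i x] by simp
    also have "\<dots> = (\<Sum>j<p. of_nat (i choose j) * (df g ^^ j) x)"
      using that by (intro sum.mono_neutral_left) (auto simp: binomial_eq_0)
    finally show ?thesis .
  qed
  then have "(\<Sum>i<p. (g ^^ i) x) = (\<Sum>i<p. \<Sum>j<p. of_nat (i choose j) * (df g ^^ j) x)" by simp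
  also have "\<dots> = (\<Sum>j<p. \<Sum>i<p. of_nat (i choose j) * (df g ^^ j) x)" by (rule sum.swap)
  also have "\<dots> = (\<Sum>j<p. of_nat (p choose Suc j) * (df g ^^ j) x)"
  proof (rule sum.cong)
    fix j
    obtain q where q: "p = Suc q" using p_pos by (cases p) auto
    have "(\<Sum>i<p. i choose j) = p choose Suc j"
      using sum_choose_upper[of j q] unfolding q lessThan_Suc_atMost by simp
    then have "(\<Sum>i<p. of_nat (i choose j)) = (of_nat (p choose Suc j) :: 'a)"
      by (simp only: of_nat_sum[symmetric])
    then show "(\<Sum>i<p. of_nat (i choose j) * (df g ^^ j) x) = of_nat (p choose Suc j) * (df g ^^ j) x"
      by (simp add: sum_distrib_right[symmetric])
  qed simp
  finally show ?thesis .
qed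

text \<open>All coefficients but the last are divisible by p, so the trace is (g - 1)^(p-1) modulo
  p.\<close>

lemma sum_funpow_approx:
  assumes g: "aut g" and r: "raises m (df g)" "m \<ge> 0" and x: "x \<in> P n"
  shows "(\<Sum>i<p. (g ^^ i) x) - (df g ^^ (p - 1)) x \<in> P (vp + n)"
proof -
  obtain q where q: "p = Suc q" using p_pos by (cases p) auto
  have "(\<Sum>i<p. (g ^^ i) x) - (df g ^^ (p - 1)) x = (\<Sum>j<q. of_nat (p choose Suc j) * (df g ^^ j) x)"
    unfolding sum_funpow_eq[OF g] by (simp add: q)
  also have "\<dots> \<in> P (vp + n)"
  proof (rule P_sum)
    fix j assume j: "j \<in> {..<q}"
    have "p dvd p choose Suc j" using dvd_choose_prime[of "Suc j" p] p_prime j q by auto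
    then obtain k where k: "p choose Suc j = p * k" ..
    have "(df g ^^ j) x \<in> P n"
      using P_mono[OF raisesD[OF raises_funpow[OF r(1), of j] x]] r(2) by simp
    then have "of_nat p * (of_nat k * (df g ^^ j) x) \<in> P (vp + n)"
      by (intro P_mult U_P[OF p_U] P_mult_of_nat)
    then show "of_nat (p choose Suc j) * (df g ^^ j) x \<in> P (vp + n)" by (simp add: k mult.assoc)
  qed
  finally show ?thesis .
qed

lemma Tr_approx: "x \<in> P n \<Longrightarrow> Tr x - (S ^^ (p - 1)) x \<in> P (vp + n)"
  unfolding Tr_def using b_pos by (intro sum_funpow_approx[OF aut_\<sigma> raises_S]) auto

text \<open>The precision to which S \<xi> = 1 is achieved below: an element of valuation b has
  trace of valuation p b, approximated by (\<sigma> - 1)^(p-1) up to v(p) + b, and the quotient has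
  error v(p) + b - p b.\<close>

definition D0 :: int where "D0 = vp - (int p - 1) * b"

lemma D0_gt: "(int p - 1) * b < D0" and vp_gt_pb: "int p * b < vp + b"
proof -
  have "2 * ((int p - 1) * b) \<le> int p * ((int p - 1) * b)"
    using p_gt1 b_pos by (intro mult_right_mono) auto
  moreover have "int p * ((int p - 1) * b) < vp" using vp_gt by (simp only: mult.assoc)
  ultimately have 1: "2 * ((int p - 1) * b) < vp" by linarith
  then show "(int p - 1) * b < D0" unfolding D0_def by linarith
  have "(int p - 1) * b \<ge> 0" using p_gt1 b_pos by simp
  with 1 have "(int p - 1) * b < vp" by linarith
  then show "int p * b < vp + b" by (simp add: algebra_simps)
qed
lemma D0_pos: "D0 \<ge> 1"
proof -
  have "(int p - 1) * b \<ge> 0" using p_gt1 b_pos by simp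
  with D0_gt show ?thesis by linarith
qed

lemma ex_X: "\<exists>\<xi>\<in>U (- b). S \<xi> - 1 \<in> P D0"
proof -
  obtain \<rho> where \<rho>: "\<rho> \<in> U b" using ex_U by blast
  obtain q where q: "p = Suc (Suc q)" using p_gt1 by (cases p; cases "p - 1") auto
  have S1: "(S ^^ (p - 1)) \<rho> \<in> U (int p * b)"
    using S_iterate[OF \<rho>, of "p - 1"] p_gt1 by (simp add: of_nat_diff algebra_simps)
  have S2: "(S ^^ q) \<rho> \<in> U (int p * b - b)"
    using S_iterate[OF \<rho>, of q] by (simp add: q algebra_simps)
  have "Tr \<rho> - (S ^^ (p - 1)) \<rho> \<in> P (int p * b + 1)"
    using P_mono[OF Tr_approx[OF U_P[OF \<rho>]]] vp_gt_pb by simp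
  then have t: "Tr \<rho> \<in> U (int p * b)" using U_cong[OF _ S1] by simp
  \<comment> \<open>With q = p - 2, one more \<open>S\<close> turns the numerator into S^(p-1)
    \<rho>, which approximates the trace, while the denominator is fixed by \<open>\<sigma>\<close>.
    The choice v(\<rho>) = b makes all these iterates exact.\<close>
  define \<xi> where "\<xi> = (S ^^ q) \<rho> / Tr \<rho>"
  have tn: "Tr \<rho> \<noteq> 0" "\<sigma> (Tr \<rho>) = Tr \<rho>" using t Tr_K1 by (auto simp: U_iff K1_iff)
  have "S \<xi> = S ((S ^^ q) \<rho>) / Tr \<rho>"
    by (simp add: \<xi>_def df_def aut_divide[OF aut_\<sigma>] tn(2) diff_divide_distrib)
  then have "S \<xi> - 1 = - ((Tr \<rho> - (S ^^ (p - 1)) \<rho>) / Tr \<rho>)"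
    using tn(1) by (simp add: q field_simps)
  moreover have "(Tr \<rho> - (S ^^ (p - 1)) \<rho>) / Tr \<rho> \<in> P ((vp + b) - int p * b)"
    by (rule P_divide[OF Tr_approx[OF U_P[OF \<rho>]] t])
  ultimately have "S \<xi> - 1 \<in> P ((vp + b) - int p * b)" by (simp only: P_uminus_iff)
  moreover have "(vp + b) - int p * b = D0" by (simp add: D0_def algebra_simps)
  ultimately have "S \<xi> - 1 \<in> P D0" by simp
  moreover have "\<xi> \<in> U (- b)" using U_divide[OF S2 t] by (simp add: \<xi>_def)
  ultimately show ?thesis by blast
qed

text \<open>As \<open>\<sigma> \<xi>\<close> is nearly \<open>\<xi> + 1\<close>, the operator \<open>S\<close> acts on the binomials of \<open>\<xi>\<close> almost as
  a forward difference.\<close>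

definition \<xi> :: 'a where "\<xi> = (SOME \<xi>. \<xi> \<in> U (- b) \<and> S \<xi> - 1 \<in> P D0)"
lemma \<xi>: "\<xi> \<in> U (- b)" "S \<xi> - 1 \<in> P D0"
proof -
  have "\<exists>\<xi>. \<xi> \<in> U (- b) \<and> S \<xi> - 1 \<in> P D0" using ex_X by blast
  from someI_ex[OF this] show "\<xi> \<in> U (- b)" "S \<xi> - 1 \<in> P D0" unfolding \<xi>_def by blast+
qed

lemma aut_gbinomial: "aut g \<Longrightarrow> g (x gchoose k) = g x gchoose k"
proof -
  assume g: "aut g"
  have "g (\<Prod>i = 0..<k. x - of_nat i) = (\<Prod>i = 0..<k. g x - of_nat i)"
    by (induction k) (simp_all add: autD[OF g] aut_of_nat[OF g])
  moreover have "g (fact k) = fact k" using aut_of_nat[OF g, of "fact k"] by simp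
  ultimately show ?thesis by (simp add: gbinomial_prod_rev aut_divide[OF g])
qed

lemma gbinomial_P:
  assumes "Y \<in> P (- b)" "j < p" shows "Y gchoose j \<in> P (- (int j * b))"
proof -
  have "(\<Prod>i = 0..<k. Y - of_nat i) \<in> P (- (int k * b))" for k
  proof (induction k)
    case (Suc k)
    have "Y - of_nat k \<in> P (- b)" using b_pos by (intro P_diff assms P_mono[OF of_nat_P]) auto
    from P_mult[OF Suc this] show ?case by (simp add: algebra_simps)
  qed simp
  from P_divide[OF this fact_U[OF assms(2)]] show ?thesis by (simp add: gbinomial_prod_rev)
qed

lemma gbinomial_small_P:
  assumes "\<epsilon> \<in> P m" "m \<ge> 0" "j < p" "j \<ge> 1" shows "\<epsilon> gchoose j \<in> P m"
proof -
  have "(\<Prod>i = 0..<Suc k. \<epsilon> - of_nat i) \<in> P m" for k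
  proof (induction k)
    case (Suc k)
    have "\<epsilon> - of_nat (Suc k) \<in> P 0" by (intro P_diff of_nat_P P_mono[OF assms(1,2)])
    from P_mult[OF Suc this] show ?case by simp
  qed (use assms in simp)
  from P_divide[OF this fact_U[OF assms(3)], of "j - 1"] assms(4) show ?thesis by (simp add: gbinomial_prod_rev)
qed

text \<open>Vandermonde expands the left side into terms (\<epsilon> choose k) (Y choose j - k); for
  k >= 2 the first factor still has depth m, while the second loses at most (j - 2) b.\<close>

lemma gbinomial_shift2:
  assumes Y: "Y \<in> P (- b)" and \<epsilon>: "\<epsilon> \<in> P m" "m \<ge> 0" and j: "1 \<le> j" "j < p"
  shows "(Y + \<epsilon> gchoose j) - (Y gchoose j) - \<epsilon> * (Y gchoose (j - 1)) \<in> P (m - (int j - 2) * b)"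
proof -
  have set: "{..j} = insert 0 (insert 1 {2..j})" using j by auto
  have "(Y + \<epsilon> gchoose j) = (\<Sum>k\<le>j. (\<epsilon> gchoose k) * (Y gchoose (j - k)))"
    by (rule gbinomial_add)
  also have "\<dots> = (Y gchoose j) + (\<epsilon> * (Y gchoose (j - 1)) + (\<Sum>k\<in>{2..j}. (\<epsilon> gchoose k) * (Y gchoose (j - k))))"
    unfolding set by simp
  finally have "(Y + \<epsilon> gchoose j) - (Y gchoose j) - \<epsilon> * (Y gchoose (j - 1))
      = (\<Sum>k\<in>{2..j}. (\<epsilon> gchoose k) * (Y gchoose (j - k)))" by simp
  also have "\<dots> \<in> P (m - (int j - 2) * b)"
  proof (rule P_sum)
    fix k assume k: "k \<in> {2..j}"
    have "(\<epsilon> gchoose k) * (Y gchoose (j - k)) \<in> P (m + - (int (j - k) * b))"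
      using k j by (intro P_mult gbinomial_small_P gbinomial_P Y \<epsilon>) auto
    moreover have "int (j - k) * b \<le> (int j - 2) * b" using k b_pos by (intro mult_right_mono) auto
    ultimately show "(\<epsilon> gchoose k) * (Y gchoose (j - k)) \<in> P (m - (int j - 2) * b)"
      using P_mono by force
  qed
  finally show ?thesis .
qed

lemma gbinomial_shift:
  assumes Y: "Y \<in> P (- b)" and \<epsilon>: "\<epsilon> \<in> P m" "m \<ge> 0" and j: "1 \<le> j" "j < p"
  shows "(Y + \<epsilon> gchoose j) - (Y gchoose j) \<in> P (m - (int j - 1) * b)"
proof -
  have "(Y + \<epsilon> gchoose j) - (Y gchoose j) - \<epsilon> * (Y gchoose (j - 1)) \<in> P (m - (int j - 1) * b)"
    using P_mono[OF gbinomial_shift2[OF assms]] b_pos by (simp add: algebra_simps)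
  moreover have "\<epsilon> * (Y gchoose (j - 1)) \<in> P (m + - (int (j - 1) * b))"
    using j by (intro P_mult gbinomial_P Y \<epsilon>) auto
  then have "\<epsilon> * (Y gchoose (j - 1)) \<in> P (m - (int j - 1) * b)" using j by (simp add: of_nat_diff)
  ultimately show ?thesis by (rule P_cong)
qed

lemma gbinomial_X: "j < p \<Longrightarrow> \<xi> gchoose j \<in> U (- (int j * b))"
proof -
  assume j: "j < p"
  have "\<xi> - of_nat i \<in> U (- b)" for i
    using U_add[OF \<xi>(1), of "- of_nat i"] P_mono[OF of_nat_P[of i], of "- b + 1"] b_pos by simp
  then have "(\<Prod>i = 0..<j. \<xi> - of_nat i) \<in> U (int j * - b)" using U_prod[of "{0..<j}" "\<lambda>i. \<xi> - of_nat i" "- b"] by simp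
  from U_divide[OF this fact_U[OF j]] show ?thesis by (simp add: gbinomial_prod_rev)
qed

lemma S_gbinomial_X:
  assumes j: "1 \<le> j" "j < p"
  shows "S (\<xi> gchoose j) - (\<xi> gchoose (j - 1)) \<in> P (D0 - (int j - 1) * b)"
proof -
  have "\<sigma> \<xi> = (\<xi> + 1) + (S \<xi> - 1)" by (simp add: df_def)
  moreover have "\<xi> + 1 \<in> P (- b)" using \<xi>(1) P_mono[OF one_P, of "- b"] b_pos by (intro P_add) auto
  ultimately have "(\<sigma> \<xi> gchoose j) - (\<xi> + 1 gchoose j) \<in> P (D0 - (int j - 1) * b)"
    using gbinomial_shift[OF _ \<xi>(2) _ j, of "\<xi> + 1"] D0_pos by simp
  moreover have "(\<xi> + 1 gchoose j) = (\<xi> gchoose (j - 1)) + (\<xi> gchoose j)"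
    using gbinomial_Suc_Suc[of \<xi> "j - 1"] j by simp
  ultimately show ?thesis unfolding df_def aut_gbinomial[OF aut_\<sigma>] by (simp add: algebra_simps)
qed

lemma S_funpow_gbinomial_X:
  assumes j: "j < p"
  shows "(S ^^ i) (\<xi> gchoose j) - (if i \<le> j then \<xi> gchoose (j - i) else 0) \<in> P (D0 - (int j - int i) * b)"
proof (induction i)
  case (Suc i)
  let ?t = "\<lambda>i. if i \<le> j then \<xi> gchoose (j - i) else 0"
  have S0: "S 0 = 0" "S 1 = 0" by (simp_all add: df_def autD[OF aut_\<sigma>])
  have "S ((S ^^ i) (\<xi> gchoose j) - ?t i) \<in> P (D0 - (int j - int i) * b + b)"
    by (rule raisesD[OF raises_S Suc])
  moreover have "S (?t i) - ?t (Suc i) \<in> P (D0 - (int j - int i) * b + b)"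
  proof (cases "i < j")
    case True
    have "S (\<xi> gchoose (j - i)) - (\<xi> gchoose (j - i - 1)) \<in> P (D0 - (int (j - i) - 1) * b)"
      using True j by (intro S_gbinomial_X) auto
    with True show ?thesis by (simp add: of_nat_diff algebra_simps)
  next
    case False
    then show ?thesis using S0 by (cases "i = j") auto
  qed
  moreover have "(S ^^ Suc i) (\<xi> gchoose j) - ?t (Suc i)
      = S ((S ^^ i) (\<xi> gchoose j) - ?t i) + (S (?t i) - ?t (Suc i))"
    by (simp add: additive.diff[OF tlinearD(1)[OF tlinear_S]])
  ultimately have "(S ^^ Suc i) (\<xi> gchoose j) - ?t (Suc i) \<in> P (D0 - (int j - int i) * b + b)"
    by (simp only: P_add)
  then show ?case by (simp add: algebra_simps)
qed simp

text \<open>As b is invertible modulo p, the multiples -j b with j < p represent every class modulo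
  p.\<close>

lemma ex_digits: "\<exists>s j. j < p \<and> n = int p * s - int j * b"
proof -
  have "coprime (int p) b" using b_not_dvd p_prime by (simp add: prime_imp_coprime)
  then have "gcd b (int p) = 1" by (simp add: coprime_commute)
  then obtain x y where xy: "x * b + y * int p = 1" using bezout_int[of b "int p"] by auto
  define j where "j = nat ((- n * x) mod int p)"
  have j: "int j = (- n * x) mod int p" "j < p" unfolding j_def using p_pos
    by (simp_all add: nat_less_iff)
  have "n + int j * b = n + ((- n * x) - int p * ((- n * x) div int p)) * b"
    unfolding j(1) by (simp add: minus_mult_div_eq_mod)
  also have "\<dots> = n * (1 - x * b) - int p * ((- n * x) div int p) * b" by (simp add: algebra_simps)
  also have "1 - x * b = int p * y" using xy by (simp add: algebra_simps)
  finally have "n = int p * (n * y - ((- n * x) div int p) * b) - int j * b" by (simp add: algebra_simps)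
  with j(2) show ?thesis by blast
qed

end

section \<open>The operator \<Theta> - 1 on binomials\<close>

context refined begin

lemma \<delta>_const: "\<delta> 1 = 0" "\<delta> 0 = 0"
proof -
  have "S 1 = 0" "B 0 = 0" by (simp_all add: df_def autD[OF aut_\<sigma>] additive.zero[OF tlinearD(1)[OF tlinear_B]])
  then show "\<delta> 1 = 0" by (simp add: df_def[of Th] Th_def sexp_B autD[OF aut_\<gamma>])
  show "\<delta> 0 = 0" by (rule additive.zero[OF tlinearD(1)[OF tlinear_\<delta>]])
qed

lemma S_K1_mult: "k \<in> K1 \<Longrightarrow> (S ^^ i) (k * x) = k * (S ^^ i) x"
proof (induction i)
  case (Suc i)
  then show ?case by (simp add: df_def autD[OF aut_\<sigma>] K1_iff right_diff_distrib)
qed simp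
text \<open>\<open>sexp\<close> is linear over the fixed field of \<open>\<sigma>\<close>, so
  \<open>Th\<close> is semilinear over it. This substitute for multiplicativity yields the twisted
  Leibniz rule for products \<tau>^s (\<xi> choose j).\<close>

lemma Th_K1_mult: "k \<in> K1 \<Longrightarrow> Th (k * x) = \<gamma> k * Th x"
proof -
  assume k: "k \<in> K1"
  have "sexp (k * x) = k * sexp x"
    unfolding sexp_def by (simp add: S_K1_mult[OF k] sum_distrib_left algebra_simps)
  then show ?thesis by (simp add: Th_def autD[OF aut_\<gamma>])
qed
lemma \<delta>_K1_mult: "k \<in> K1 \<Longrightarrow> \<delta> (k * x) = \<gamma> k * \<delta> x + G k * x"
  by (simp add: df_def Th_K1_mult algebra_simps)
lemma \<delta>_K1: "k \<in> K1 \<Longrightarrow> \<delta> k = G k"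
  using \<delta>_K1_mult[of k 1] \<delta>_const by simp

text \<open>Since S^i diminishes the lower index by i, \<open>sexp\<close> becomes the sum of
  (\<omega> choose i) (\<xi> choose j - i), which is (\<xi> + \<omega> choose j) by Vandermonde.
  Truncation loses nothing because j < p.\<close>

lemma sexp_gbinomial_X:
  assumes j: "j < p"
  shows "sexp (\<xi> gchoose j) - (\<xi> + \<omega> gchoose j) \<in> P (D0 - (int j - 1) * b)"
proof -
  let ?t = "\<lambda>i. if i \<le> j then \<xi> gchoose (j - i) else 0"
  have "(\<xi> + \<omega> gchoose j) = (\<Sum>k\<le>j. (\<omega> gchoose k) * (\<xi> gchoose (j - k)))"
    by (rule gbinomial_add)
  also have "\<dots> = (\<Sum>k\<le>j. (\<omega> gchoose k) * ?t k)" by simp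
  also have "\<dots> = (\<Sum>i<p. (\<omega> gchoose i) * ?t i)"
    using j by (intro sum.mono_neutral_left) auto
  finally have "sexp (\<xi> gchoose j) - (\<xi> + \<omega> gchoose j) = (\<Sum>i<p. (\<omega> gchoose i) * ((S ^^ i) (\<xi> gchoose j) - ?t i))"
    unfolding sexp_def by (simp add: sum_subtractf right_diff_distrib)
  also have "\<dots> \<in> P (D0 - (int j - 1) * b)"
  proof (rule P_sum)
    fix i assume i: "i \<in> {..<p}"
    have "(S ^^ i) (\<xi> gchoose j) - ?t i \<in> P (D0 - (int j - 1) * b)"
    proof (cases "i = 0")
      case False
      then have "(int j - int i) * b \<le> (int j - 1) * b" using b_pos by (intro mult_right_mono) auto
      then show ?thesis using P_mono[OF S_funpow_gbinomial_X[OF j, of i]] by simp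
    qed simp
    then show "(\<omega> gchoose i) * ((S ^^ i) (\<xi> gchoose j) - ?t i) \<in> P (D0 - (int j - 1) * b)"
      using i by (intro P_mult0 gb_P) auto
  qed
  finally show ?thesis .
qed

lemma Th_gbinomial_X:
  assumes j: "j < p"
  shows "Th (\<xi> gchoose j) - (\<gamma> \<xi> + \<omega> gchoose j) \<in> P (D0 - (int j - 1) * b)"
proof -
  have "\<gamma> (sexp (\<xi> gchoose j) - (\<xi> + \<omega> gchoose j)) \<in> P (D0 - (int j - 1) * b)"
    by (rule aut_P[OF aut_\<gamma> sexp_gbinomial_X[OF j]])
  then show ?thesis
    by (simp add: Th_def autD[OF aut_\<gamma>] aut_gbinomial[OF aut_\<gamma>] \<omega>_T)
qed

text \<open>The case j = 1 of the preceding approximation identifies \<gamma> \<xi> + \<omega> -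
  \<xi> with \<delta> \<xi> up to \<open>D0\<close>; a first-order shift of the binomial does the
  rest.\<close>

lemma \<delta>_gbinomial_X:
  assumes d: "\<delta> \<xi> \<in> P d" "1 \<le> d" "d \<le> D0" and j: "1 \<le> j" "j < p"
  shows "\<delta> (\<xi> gchoose j) - \<delta> \<xi> * (\<xi> gchoose (j - 1)) \<in> P (min (d - (int j - 2) * b) (D0 - (int j - 1) * b))"
    (is "_ \<in> P ?m")
proof -
  define \<eta> where "\<eta> = \<gamma> \<xi> + \<omega> - \<xi>"
  have e: "\<eta> - \<delta> \<xi> \<in> P D0"
    using Th_gbinomial_X[of 1] p_gt1 P_uminus_iff[of "Th \<xi> - (\<gamma> \<xi> + \<omega>)" D0]
    by (simp add: \<eta>_def df_def algebra_simps del: P_uminus_iff)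
  have \<eta>: "\<eta> \<in> P d" by (rule P_cong[OF P_mono[OF e d(3)] d(1)])
  have 1: "Th (\<xi> gchoose j) - (\<xi> + \<eta> gchoose j) \<in> P ?m"
    using P_mono[OF Th_gbinomial_X[OF j(2)]] by (simp add: \<eta>_def)
  have 2: "(\<xi> + \<eta> gchoose j) - (\<xi> gchoose j) - \<eta> * (\<xi> gchoose (j - 1)) \<in> P ?m"
    using P_mono[OF gbinomial_shift2[OF U_P[OF \<xi>(1)] \<eta> _ j]] d(2) by simp
  have "(\<eta> - \<delta> \<xi>) * (\<xi> gchoose (j - 1)) \<in> P (D0 + - (int (j - 1) * b))"
    using j by (intro P_mult e gbinomial_P U_P[OF \<xi>(1)]) auto
  then have 3: "(\<eta> - \<delta> \<xi>) * (\<xi> gchoose (j - 1)) \<in> P ?m" using j by (auto simp: of_nat_diff intro: P_mono)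
  have "\<delta> (\<xi> gchoose j) - \<delta> \<xi> * (\<xi> gchoose (j - 1)) = (Th (\<xi> gchoose j) - (\<xi> + \<eta> gchoose j))
     + ((\<xi> + \<eta> gchoose j) - (\<xi> gchoose j) - \<eta> * (\<xi> gchoose (j - 1))) + (\<eta> - \<delta> \<xi>) * (\<xi> gchoose (j - 1))"
    by (simp add: df_def[of Th "\<xi> gchoose j"] algebra_simps)
  with 1 2 3 show ?thesis by (simp only: P_add)
qed

text \<open>S (\<delta> \<xi>) = \<delta> (S \<xi> - 1) lies beyond D0 + b, so \<open>S\<close>
  nearly kills \<delta> \<xi>; a valuation prime to p and at most (p - 1) b < D0 would contradict
  the exactness of \<open>S\<close>. The value (p - 1) b is itself prime to p, hence
  excluded.\<close>

lemma \<delta>_X_dichotomy: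
  "(\<exists>t. \<delta> \<xi> \<in> U (int p * t) \<and> 1 \<le> t \<and> int p * t < (int p - 1) * b) \<or> \<delta> \<xi> \<in> P ((int p - 1) * b + 1)"
proof (cases "\<delta> \<xi> \<in> P ((int p - 1) * b + 1)")
  case False
  then have nz: "\<delta> \<xi> \<noteq> 0" and le: "v (\<delta> \<xi>) \<le> (int p - 1) * b" by (auto simp: P_iff)
  have pos: "v (\<delta> \<xi>) \<ge> 1" using raisesD[OF raises_\<delta> U_P[OF \<xi>(1)]] nz by (simp add: P_iff)
  have "S (\<delta> \<xi>) = \<delta> (S \<xi> - 1)"
    unfolding \<delta>_S[symmetric] additive.diff[OF tlinearD(1)[OF tlinear_\<delta>]] \<delta>_const by simp
  then have SP: "S (\<delta> \<xi>) \<in> P (D0 + (b + 1))" using raisesD[OF raises_\<delta> \<xi>(2)] by simp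
  have dvd: "int p dvd v (\<delta> \<xi>)"
  proof (rule ccontr)
    assume "\<not> int p dvd v (\<delta> \<xi>)"
    from S_exact[OF U_v[OF nz] this] SP have "D0 + (b + 1) \<le> v (\<delta> \<xi>) + b" using U_P_iff by blast
    with le D0_gt show False by simp
  qed
  then obtain t where t: "v (\<delta> \<xi>) = int p * t" ..
  have "\<not> int p dvd (int p - 1) * b" using zdvd_imp_le[of "int p" "int p - 1"] p_gt1 by (auto simp: p_coprime_b)
  then have "int p * t < (int p - 1) * b" using le t by (metis dvd_triv_left order_le_less)
  moreover have "t \<ge> 1"
  proof (rule ccontr)
    assume "\<not> t \<ge> 1"
    then have "int p * t \<le> int p * 0" by (intro mult_left_mono) auto
    with pos t show False by simp
  qed
  ultimately show ?thesis using nz t by (auto simp: U_iff)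
qed simp

lemma \<delta>_weak: "x \<in> P n \<Longrightarrow> \<delta> x \<in> P n"
  using P_mono[OF raisesD[OF raises_\<delta>]] b_pos by simp

lemma test_element: "j < p \<Longrightarrow> \<tau> powi s * (\<xi> gchoose j) \<in> U (int p * s - int j * b)"
  using U_mult[OF \<tau>_powi(2) gbinomial_X] by simp

lemma \<delta>_test_element:
  assumes "\<delta> (\<xi> gchoose j) \<in> P m" "j < p"
  shows "\<delta> (\<tau> powi s * (\<xi> gchoose j)) - G (\<tau> powi s) * (\<xi> gchoose j) \<in> P (int p * s + m)"
  unfolding \<delta>_K1_mult[OF \<tau>_powi(1)]
  using P_mult[OF aut_P[OF aut_\<gamma> U_P[OF \<tau>_powi(2)]] assms(1), of s] by simp

text \<open>In \<delta>(k x) = \<gamma>(k) \<delta>(x) + G(k) x with k = \<tau>^s and x = (\<xi>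
  choose j), the first term gains b + p t and the second at least p b, which is more. So the first
  dominates for j >= 1, that is for valuations prime to p; for j = 0 only the bound remains.\<close>

lemma raise_I:
  assumes t: "\<delta> \<xi> \<in> U (int p * t)" "1 \<le> t" "int p * t < (int p - 1) * b"
  shows "raises (b + int p * t) \<delta>"
    and "x \<in> U n \<Longrightarrow> \<not> int p dvd n \<Longrightarrow> \<delta> x \<in> U (n + (b + int p * t))"
proof -
  have d1: "1 \<le> int p * t" using t(2) p_gt1 by (simp add: int_one_le_iff_zero_less)
  have lt: "b + int p * t + 1 \<le> int p * b" using t(3) by (simp add: algebra_simps)
  have \<delta>j: "\<delta> (\<xi> gchoose j) \<in> U (int p * t - (int j - 1) * b)" if j: "1 \<le> j" "j < p" for j
  proof -
    have "\<delta> (\<xi> gchoose j) - \<delta> \<xi> * (\<xi> gchoose (j - 1)) \<in> P (int p * t - (int j - 1) * b + 1)"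
      using P_mono[OF \<delta>_gbinomial_X[OF U_P[OF t(1)] d1 _ j]] D0_gt t(3) b_pos by (simp add: algebra_simps)
    moreover have "\<delta> \<xi> * (\<xi> gchoose (j - 1)) \<in> U (int p * t + - (int (j - 1) * b))"
      using j by (intro U_mult t gbinomial_X) auto
    then have "\<delta> \<xi> * (\<xi> gchoose (j - 1)) \<in> U (int p * t - (int j - 1) * b)" using j by (simp add: of_nat_diff)
    ultimately show ?thesis by (rule U_cong)
  qed
  have Gj: "G (\<tau> powi s) * (\<xi> gchoose j) \<in> P (int p * s - int j * b + (b + int p * t + 1))" if "j < p" for s j
  proof -
    have "G (\<tau> powi s) * (\<xi> gchoose j) \<in> P (int p * s + int p * b + - (int j * b))"
      by (intro P_mult K1_raise \<tau>_powi U_P[OF \<tau>_powi(2)] U_P[OF gbinomial_X[OF that]])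
    then show ?thesis by (rule P_mono) (use lt in simp)
  qed
  have testU: "\<delta> (\<tau> powi s * (\<xi> gchoose j)) \<in> U (int p * s - int j * b + (b + int p * t))"
    if j: "1 \<le> j" "j < p" for s j
  proof -
    have "\<gamma> (\<tau> powi s) * \<delta> (\<xi> gchoose j) \<in> U (int p * s + (int p * t - (int j - 1) * b))"
      by (intro U_mult autD(4)[OF aut_\<gamma>] \<tau>_powi \<delta>j j)
    then have "\<gamma> (\<tau> powi s) * \<delta> (\<xi> gchoose j) \<in> U (int p * s - int j * b + (b + int p * t))"
      by (simp add: algebra_simps)
    moreover have "G (\<tau> powi s) * (\<xi> gchoose j) \<in> P (int p * s - int j * b + (b + int p * t) + 1)"
      using Gj[OF j(2), of s] by (simp add: add.assoc)
    ultimately show ?thesis unfolding \<delta>_K1_mult[OF \<tau>_powi(1)] by (rule U_add)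
  qed
  have testP: "\<delta> (\<tau> powi s * (\<xi> gchoose j)) \<in> P (int p * s - int j * b + (b + int p * t))" if j: "j < p" for s j
  proof (cases "j = 0")
    case True
    have "G (\<tau> powi s) \<in> P (int p * s + int p * b)" by (intro K1_raise \<tau>_powi U_P[OF \<tau>_powi(2)])
    then show ?thesis using True lt by (auto simp: \<delta>_K1[OF \<tau>_powi(1)] intro: P_mono)
  qed (use U_P[OF testU] j in simp)
  have r: "\<delta> x \<in> P (n + (b + int p * t))" if "x \<in> P n" for x n
  proof (rule approximation[where L = UNIV and F = \<delta>])
    fix x :: 'a
    obtain s j where "j < p" "v x = int p * s - int j * b" using ex_digits by blast
    then show "\<exists>y\<in>UNIV. y \<in> U (v x) \<and> \<delta> y \<in> P (v x + (b + int p * t))"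
      using test_element testP by (intro bexI[of _ "\<tau> powi s * (\<xi> gchoose j)"]) auto
  qed (use that in \<open>simp_all add: tlinear_\<delta> \<delta>_weak\<close>)
  then show "raises (b + int p * t) \<delta>" using tlinearD(1)[OF tlinear_\<delta>] by (auto simp: raises_def)
  assume x: "x \<in> U n" "\<not> int p dvd n"
  obtain s j where sj: "j < p" "n = int p * s - int j * b" using ex_digits by blast
  with x(2) have j: "1 \<le> j" by (cases j) auto
  show "\<delta> x \<in> U (n + (b + int p * t))"
  proof (rule approximation_exact[where L = UNIV and F = \<delta> and y = "\<tau> powi s * (\<xi> gchoose j)"])
    show "\<delta> (\<tau> powi s * (\<xi> gchoose j)) \<in> U (n + (b + int p * t))" using testU[OF j sj(1)] sj(2) by simp
  qed (use r x sj test_element in \<open>simp_all add: tlinear_\<delta>\<close>)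
qed

text \<open>The roles are reversed: the binomial factor now gains more than p b, so \<open>G\<close>
  acting on \<tau>^s decides, and it is exact when p does not divide s.\<close>

lemma raise_II:
  assumes II: "\<delta> \<xi> \<in> P ((int p - 1) * b + 1)"
  shows "raises (int p * b) \<delta>"
    and "x \<in> U (int p * s - int j * b) \<Longrightarrow> \<not> int p dvd s \<Longrightarrow> j < p \<Longrightarrow> \<delta> x \<in> U (int p * s - int j * b + int p * b)"
proof -
  have \<delta>j: "\<delta> (\<xi> gchoose j) \<in> P (int p * b - int j * b + 1)" if j: "1 \<le> j" "j < p" for j
  proof -
    let ?d = "(int p - 1) * b + 1"
    have d: "1 \<le> ?d" "?d \<le> D0" using p_gt1 b_pos D0_gt by auto
    have "\<delta> (\<xi> gchoose j) - \<delta> \<xi> * (\<xi> gchoose (j - 1)) \<in> P (int p * b - int j * b + 1)"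
      using P_mono[OF \<delta>_gbinomial_X[OF II d j]] d b_pos by (simp add: algebra_simps)
    moreover have "\<delta> \<xi> * (\<xi> gchoose (j - 1)) \<in> P (?d + - (int (j - 1) * b))"
      using j by (intro P_mult II U_P[OF gbinomial_X]) auto
    then have "\<delta> \<xi> * (\<xi> gchoose (j - 1)) \<in> P (int p * b - int j * b + 1)" using j by (simp add: of_nat_diff algebra_simps)
    ultimately show ?thesis by (rule P_cong)
  qed
  have main: "\<delta> (\<tau> powi s * (\<xi> gchoose j)) - G (\<tau> powi s) * (\<xi> gchoose j) \<in> P (int p * s - int j * b + int p * b + 1)"
    if j: "j < p" for s j
  proof (cases "j = 0")
    case True then show ?thesis by (simp add: \<delta>_K1[OF \<tau>_powi(1)])
  next
    case False
    then have "1 \<le> j" by simp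
    from \<delta>_test_element[OF \<delta>j[OF this j] j, of s] show ?thesis by (simp add: algebra_simps)
  qed
  have testP: "\<delta> (\<tau> powi s * (\<xi> gchoose j)) \<in> P (int p * s - int j * b + int p * b)" if j: "j < p" for s j
  proof -
    have "G (\<tau> powi s) * (\<xi> gchoose j) \<in> P (int p * s + int p * b + - (int j * b))"
      by (intro P_mult K1_raise \<tau>_powi U_P[OF \<tau>_powi(2)] U_P[OF gbinomial_X[OF j]])
    then have "G (\<tau> powi s) * (\<xi> gchoose j) \<in> P (int p * s - int j * b + int p * b)" by (simp add: algebra_simps)
    from P_cong[OF P_mono[OF main[OF j]] this] show ?thesis by simp
  qed
  have r: "\<delta> x \<in> P (n + int p * b)" if "x \<in> P n" for x n
  proof (rule approximation[where L = UNIV and F = \<delta>])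
    fix x :: 'a
    obtain s j where "j < p" "v x = int p * s - int j * b" using ex_digits by blast
    then show "\<exists>y\<in>UNIV. y \<in> U (v x) \<and> \<delta> y \<in> P (v x + int p * b)"
      using test_element testP by (intro bexI[of _ "\<tau> powi s * (\<xi> gchoose j)"]) auto
  qed (use that in \<open>simp_all add: tlinear_\<delta> \<delta>_weak\<close>)
  then show "raises (int p * b) \<delta>" using tlinearD(1)[OF tlinear_\<delta>] by (auto simp: raises_def)
  assume x: "x \<in> U (int p * s - int j * b)" and s: "\<not> int p dvd s" and j: "j < p"
  show "\<delta> x \<in> U (int p * s - int j * b + int p * b)"
  proof (rule approximation_exact[where L = UNIV and F = \<delta> and y = "\<tau> powi s * (\<xi> gchoose j)"])
    have "G (\<tau> powi s) * (\<xi> gchoose j) \<in> U (int p * s + int p * b + - (int j * b))"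
      by (intro U_mult K1_exact \<tau>_powi gbinomial_X j s)
    then have "G (\<tau> powi s) * (\<xi> gchoose j) \<in> U (int p * s - int j * b + int p * b)" by (simp add: algebra_simps)
    from U_cong[OF main[OF j] this]
    show "\<delta> (\<tau> powi s * (\<xi> gchoose j)) \<in> U (int p * s - int j * b + int p * b)" .
  qed (use r x j test_element in \<open>simp_all add: tlinear_\<delta>\<close>)
qed

end

section \<open>Valuations attained by \<open>(\<Theta> - 1)\<^sup>p\<^sup>-\<^sup>1\<close>\<close>

context refined begin

definition D :: "'a \<Rightarrow> 'a" where "D = \<delta> ^^ (p - 1)"

lemma tlinear_D: "tlinear D" unfolding D_def by (rule tlinear_funpow[OF tlinear_\<delta>])
lemma D_add: "D (x + y) = D x + D y" and D_diff: "D (x - y) = D x - D y"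
  using additive.add[OF tlinearD(1)[OF tlinear_D]] additive.diff[OF tlinearD(1)[OF tlinear_D]] by blast+
lemma D_scale: "c \<in> T \<Longrightarrow> D (c * x) = c * D x" by (rule tlinearD(2)[OF tlinear_D])
lemma \<delta>_D: "\<delta> (D x) = (\<delta> ^^ p) x" and D_\<delta>: "D (\<delta> x) = (\<delta> ^^ p) x"
proof -
  have "Suc (p - 1) = p" using p_gt1 by simp
  then show 1: "\<delta> (D x) = (\<delta> ^^ p) x" unfolding D_def by (metis comp_apply funpow.simps(2))
  show "D (\<delta> x) = (\<delta> ^^ p) x" unfolding 1[symmetric] D_def by (rule funpow_swap1[symmetric])
qed
lemma inverse_p_T: "inverse (of_nat p) \<in> T"
  by (rule T_inverse[OF subrng_of_nat[OF T_sub]])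

text \<open>For y = \<delta> w / p the value D y is \<delta>^p w / p, with leading part
  \<open>W (S w)\<close> because \<delta> w is deeper than S w. Division by p thus reaches elements
  that iteration of \<delta> alone does not.\<close>

lemma D_\<delta>_div_p:
  assumes "w \<in> U m" "\<not> int p dvd m" "\<delta> w \<in> U k" "m + b < k"
  shows "\<exists>y\<in>U (k - vp). D y \<in> U (m + b)"
proof (intro bexI)
  have "(\<delta> ^^ p) w \<in> U (vp + (m + b))"
    using P_mono[OF U_P[OF assms(3)], of "m + b + 1"] assms(4) by (intro \<delta>_power_exact S_exact assms) auto
  then have "inverse (of_nat p) * (\<delta> ^^ p) w \<in> U (- vp + (vp + (m + b)))"
    by (intro U_mult U_inverse p_U)
  then show "D (inverse (of_nat p) * \<delta> w) \<in> U (m + b)"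
    by (simp add: D_scale[OF inverse_p_T] D_\<delta>)
  have "inverse (of_nat p) * \<delta> w \<in> U (- vp + k)" by (intro U_mult U_inverse p_U assms)
  then show "inverse (of_nat p) * \<delta> w \<in> U (k - vp)" by (simp add: algebra_simps)
qed

text \<open>Leading terms of valuation divisible by p are removed by \<open>T\<close>-multiples of
  powers of \<open>\<tau>\<close>, which lie in \<open>K1\<close>. The process stops unless x is in
  \<open>K1\<close>: S x is unchanged, and its valuation bounds how deep the remainder can
  get.\<close>

lemma K1_decomposition:
  assumes "x \<in> P n"
  obtains k x' where "x = k + x'" "k \<in> K1" "k \<in> P n" "x' \<in> P n" "x' = 0 \<or> (\<exists>m. x' \<in> U m \<and> \<not> int p dvd m)"
proof -
  have "\<exists>k x'. x = k + x' \<and> k \<in> K1 \<and> k \<in> P n \<and> x' \<in> P n \<and> (x' = 0 \<or> (\<exists>m. x' \<in> U m \<and> \<not> int p dvd m))"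
  proof (cases "S x = 0")
    case True
    then show ?thesis using assms by (intro exI[of _ x] exI[of _ 0]) (simp add: K1_S)
  next
    case False
    define M where "M = v (S x) + 1"
    have "S x \<notin> P M" using False by (simp add: M_def P_iff)
    then show ?thesis using assms
    proof (induction "nat (M - b - n)" arbitrary: n x rule: less_induct)
      case less
      have M: "n + b < M"
      proof (rule ccontr)
        assume "\<not> n + b < M"
        then have "S x \<in> P M" using P_mono[OF raisesD[OF raises_S less.prems(2)], of M] by simp
        with less.prems(1) show False by blast
      qed
      have step: "\<exists>k x'. x = k + x' \<and> k \<in> K1 \<and> k \<in> P n \<and> x' \<in> P n \<and> (x' = 0 \<or> (\<exists>m. x' \<in> U m \<and> \<not> int p dvd m))"
        if k0: "k0 \<in> K1" "k0 \<in> P n" "x - k0 \<in> P (n + 1)" for k0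
      proof -
        have "S (x - k0) = S x" using k0(1) by (simp add: df_def autD[OF aut_\<sigma>] K1_iff)
        then have "S (x - k0) \<notin> P M" using less.prems(1) by simp
        moreover have "nat (M - b - (n + 1)) < nat (M - b - n)" using M by simp
        ultimately obtain k x' where kx: "x - k0 = k + x'" "k \<in> K1" "k \<in> P (n + 1)" "x' \<in> P (n + 1)"
            "x' = 0 \<or> (\<exists>m. x' \<in> U m \<and> \<not> int p dvd m)"
          using less.hyps[of "n + 1" "x - k0"] k0(3) by blast
        have "x = (k0 + k) + x'" using kx(1) by (simp add: algebra_simps)
        moreover have "k0 + k \<in> P n" using k0(2) P_mono[OF kx(3), of n] by (simp add: P_add)
        moreover have "x' \<in> P n" using P_mono[OF kx(4), of n] by simp
        ultimately show ?thesis using kx K1_closed(2)[OF k0(1) kx(2)] by blast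
      qed
      consider "x \<in> P (n + 1)" | "x \<in> U n" "\<not> int p dvd n" | "x \<in> U n" "int p dvd n"
        using P_cases[OF less.prems(2)] by blast
      then show ?case
      proof cases
        case 1 then show ?thesis using step[of 0] K1_closed(8) by simp
      next
        case 2 then show ?thesis using less.prems(2) K1_closed(8) by (intro exI[of _ 0] exI[of _ x]) auto
      next
        case 3
        then obtain s where s: "n = int p * s" by blast
        then have t: "\<tau> powi s \<in> U n" using \<tau>_powi(2) by simp
        obtain c where c: "c \<in> T" "c \<in> U 0" "x - c * (\<tau> powi s) \<in> P (n + 1)" using residue_step[OF 3(1) t] by blast
        show ?thesis
          using step[OF K1_closed(3)[OF T_K1[OF c(1)] \<tau>_powi(1)] U_P[OF U_mult0[OF c(2) t]] c(3)] .
      qed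
    qed
  qed
  then show ?thesis using that by blast
qed

lemma \<delta>_funpow_K1: "k \<in> K1 \<Longrightarrow> (\<delta> ^^ i) k = (G ^^ i) k \<and> (\<delta> ^^ i) k \<in> K1"
proof (induction i)
  case (Suc i)
  then have eq: "(\<delta> ^^ i) k = (G ^^ i) k" and K: "(\<delta> ^^ i) k \<in> K1" by auto
  show ?case using \<delta>_K1[OF K] K1_closed(7)[OF K] eq by simp
qed simp

lemma \<delta>_funpow_K1_P: "k \<in> K1 \<Longrightarrow> k \<in> P n \<Longrightarrow> (\<delta> ^^ i) k \<in> P (n + int i * (int p * b))"
proof (induction i)
  case (Suc i)
  have K: "(\<delta> ^^ i) k \<in> K1" using \<delta>_funpow_K1[OF Suc.prems(1)] by blast
  have "\<delta> ((\<delta> ^^ i) k) \<in> P (n + int i * (int p * b) + int p * b)"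
    unfolding \<delta>_K1[OF K] using Suc by (intro K1_raise K) simp
  then show ?case by (simp add: algebra_simps)
qed simp

lemma D_K1_P: "k \<in> K1 \<Longrightarrow> k \<in> P n \<Longrightarrow> D k \<in> P (n + int p * (int p - 1) * b)"
  using \<delta>_funpow_K1_P[of k n "p - 1"] p_gt1 by (simp add: D_def of_nat_diff algebra_simps)

text \<open>The exponents s + i b are (i + 1) b modulo p, nonzero for all p - 1
  applications.\<close>

lemma D_K1_exact:
  assumes "k \<in> K1" "k \<in> U (int p * s)" "int p dvd s - b"
  shows "D k \<in> U (int p * s + int p * (int p - 1) * b)"
proof -
  have "(\<delta> ^^ i) k \<in> U (int p * (s + int i * b))" if "i < p" for i
    using that
  proof (induction i)
    case (Suc i)
    have K: "(\<delta> ^^ i) k \<in> K1" using \<delta>_funpow_K1[OF assms(1)] by blast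
    have "\<not> int p dvd int i + 1" using zdvd_imp_le[of "int p" "int i + 1"] Suc.prems by auto
    then have "\<not> int p dvd (int i + 1) * b" by (simp add: p_coprime_b)
    moreover have "(s + int i * b) - (s - b) = (int i + 1) * b" by (simp add: algebra_simps)
    ultimately have "\<not> int p dvd s + int i * b" using dvd_diff[OF _ assms(3), of "s + int i * b"] by auto
    then have "\<delta> ((\<delta> ^^ i) k) \<in> U (int p * (s + int i * b) + int p * b)"
      unfolding \<delta>_K1[OF K] using Suc by (intro K1_exact K) auto
    then show ?case by (simp add: algebra_simps)
  qed (use assms in simp)
  from this[of "p - 1"] show ?thesis using p_gt1 by (simp add: D_def of_nat_diff algebra_simps)
qed

text \<open>On the fixed field of \<open>\<sigma>\<close>, \<open>D\<close> is modulo \<open>p\<close> the trace to \<open>K\<close>, whose values have valuation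
  divisible by \<open>p\<^sup>2\<close>.\<close>

lemma D_K1_val:
  assumes k: "k \<in> K1" "k \<in> P n" and q: "D k \<in> U q" "q < n + vp"
  shows "int p ^ 2 dvd q"
proof -
  define t where "t = (\<Sum>i<p. (\<gamma> ^^ i) k)"
  have "t - D k \<in> P (vp + n)"
    unfolding t_def D_def conjunct1[OF \<delta>_funpow_K1[OF k(1)]] using b_pos k(2)
    by (intro sum_funpow_approx[OF aut_\<gamma> raises_G]) auto
  then have t: "t \<in> U q" using U_cong[OF P_mono q(1)] q(2) by (simp add: add.commute)
  have gK: "(\<gamma> ^^ i) k \<in> K1" for i
  proof (induction i)
    case (Suc i) then show ?case using K1_closed(6) by simp
  qed (use k in simp)
  have tK: "t \<in> K1"
    unfolding t_def K1_iff additive.sum[OF autD(1)[OF aut_\<sigma>]] using gK by (simp add: K1_iff)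
  have "\<gamma> t = (\<Sum>i<p. (\<gamma> ^^ Suc i) k)"
    unfolding t_def additive.sum[OF autD(1)[OF aut_\<gamma>]] by simp
  moreover have "(\<gamma> ^^ 0) k + (\<Sum>i<p. (\<gamma> ^^ Suc i) k) = t + (\<gamma> ^^ p) k"
    unfolding t_def by (subst sum.lessThan_Suc_shift[symmetric]) simp
  ultimately have "G t = 0" by (simp add: \<gamma>_p df_def)
  obtain s where s: "q = int p * s" using K1_dvd[OF tK t] ..
  have "int p dvd s"
  proof (rule ccontr)
    assume "\<not> int p dvd s"
    then have "G t \<in> U (int p * s + int p * b)" using K1_exact[OF tK] t s by simp
    with \<open>G t = 0\<close> show False by (simp add: U_iff)
  qed
  then show ?thesis using s by (auto simp: power2_eq_square)
qed

text \<open>The cut at r + v(p) reflects the quotient by p P^r.\<close>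

definition vals :: "int \<Rightarrow> int set" where
  "vals r = {n. n < r + vp \<and> (\<exists>y\<in>P r. D y \<in> U n)}"

lemma p_dvd_vp: "int p ^ 2 dvd vp" "int p dvd vp"
  by (simp_all add: vp power2_eq_square)
lemma not_dvd_multiple_b: "1 \<le> i \<Longrightarrow> i < int p \<Longrightarrow> \<not> int p dvd i * b"
  using zdvd_imp_le[of "int p" i] by (auto simp: p_coprime_b)

end

section \<open>The case v(\<delta> \<xi>) < (p - 1) b\<close>

locale refined_I = refined +
  fixes t :: int
  assumes t: "\<delta> \<xi> \<in> U (int p * t)" "1 \<le> t" "int p * t < (int p - 1) * b"
begin

abbreviation "bs \<equiv> b + int p * t"

lemma bs: "raises bs \<delta>" "x \<in> U n \<Longrightarrow> \<not> int p dvd n \<Longrightarrow> \<delta> x \<in> U (n + bs)"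
  by (rule raise_I[OF t])+
lemma bs_less: "bs < int p * b" using t(3) by (simp add: algebra_simps)
lemma pt_pos: "int p * t \<ge> 1" using t(2) p_gt1 by (simp add: int_one_le_iff_zero_less)

lemma D_P: "x \<in> P n \<Longrightarrow> D x \<in> P (n + (int p - 1) * bs)"
  using raisesD[OF raises_funpow[OF bs(1), of "p - 1"]] p_gt1 by (simp add: D_def of_nat_diff)

text \<open>The multiple p t in \<open>bs\<close> is invisible modulo p, so starting from b the
  iterates sit at (k + 1) b modulo p and all p - 1 applications are exact.\<close>

lemma D_exact: "x \<in> U n \<Longrightarrow> int p dvd n - b \<Longrightarrow> D x \<in> U (n + (int p - 1) * bs)"
proof -
  assume x: "x \<in> U n" and n: "int p dvd n - b"
  have "D x \<in> U (n + int (p - 1) * bs)" unfolding D_def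
  proof (rule iterate_U[OF x])
    fix k x assume k: "k < p - 1" "x \<in> U (n + int k * bs)"
    have "\<not> int p dvd (int k + 1) * b" using not_dvd_multiple_b[of "int k + 1"] k(1) by simp
    moreover have "(n + int k * bs) - ((n - b) + int p * (int k * t)) = (int k + 1) * b" by (simp add: algebra_simps)
    moreover have "int p dvd (n - b) + int p * (int k * t)" using n by simp
    ultimately have "\<not> int p dvd n + int k * bs" using dvd_diff by metis
    with k show "\<delta> x \<in> U (n + int k * bs + bs)" by (intro bs(2))
  qed
  then show ?thesis using p_gt1 by (simp add: of_nat_diff)
qed

text \<open>For v(x) = b the power relation gives \<delta>^p x the exact valuation v(p) + 2 b, while
  p applications of \<delta> give at least b + p bs; equality is impossible modulo p.\<close>

lemma I_bound: "int p ^ 2 * t + (int p - 1) * b < vp"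
proof -
  obtain x where x: "x \<in> U b" using ex_U by blast
  have "\<delta> x \<in> P (b + b + 1)" using P_mono[OF U_P[OF bs(2)[OF x b_not_dvd]]] pt_pos by simp
  then have 1: "\<delta> (D x) \<in> U (vp + (b + b))" unfolding \<delta>_D
    by (intro \<delta>_power_exact S_exact x b_not_dvd)
  have "\<delta> (D x) \<in> P (b + (int p - 1) * bs + bs)" by (intro raisesD[OF bs(1)] D_P U_P[OF x])
  with 1 have "b + (int p - 1) * bs + bs \<le> vp + (b + b)" using U_P_iff by blast
  then have "int p * bs \<le> vp + b" by (simp add: algebra_simps)
  moreover have "int p * bs \<noteq> vp + b"
  proof
    assume "int p * bs = vp + b"
    then have "int p dvd vp + b" by (metis dvd_triv_left)
    then show False using p_dvd_vp(2) b_not_dvd dvd_add_right_iff by blast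
  qed
  ultimately show ?thesis by (simp add: algebra_simps power2_eq_square)
qed

text \<open>If n is prime to p, one further \<delta> is exact, so v(\<delta>^p y) = n + bs is known
  and the power relation bounds n. If moreover n is congruent to b modulo p, the relation fixes the
  valuation of the part of \<open>y\<close> outside the fixed field, whose image under
  \<open>D\<close> is shallower than n and must be cancelled by the fixed part.\<close>

lemma vals_I_subset:
  assumes n: "n \<in> vals r"
  shows "int p dvd n \<and> r + (int p - 1) * bs \<le> n
    \<or> \<not> int p dvd n \<and> \<not> int p dvd n - b \<and> r + vp - int p * t \<le> n
    \<or> int p ^ 2 dvd n + (int p - 1) * b \<and> r + vp + (int p - 1) ^ 2 * b - int p ^ 2 * t \<le> n"
proof -
  obtain y where y: "y \<in> P r" "D y \<in> U n" and nR: "n < r + vp" using n by (auto simp: vals_def)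
  show ?thesis
  proof (cases "int p dvd n")
    case True
    then show ?thesis using U_P_iff[OF y(2)] D_P[OF y(1)] by blast
  next
    case False
    have \<delta>y: "\<delta> y \<in> P (r + bs)" by (rule raisesD[OF bs(1) y(1)])
    have e: "(\<delta> ^^ p) y \<in> U (n + bs)" unfolding \<delta>_D[symmetric] by (rule bs(2)[OF y(2) False])
    have "(\<delta> ^^ p) y \<in> P (vp + (r + b))"
      by (rule \<delta>_power_P[OF raisesD[OF raises_S y(1)] P_mono[OF \<delta>y]]) (use pt_pos in simp)
    then have lower: "r + vp - int p * t \<le> n" using U_P_iff[OF e] by simp
    show ?thesis
    proof (cases "int p dvd n - b")
      case True
      \<comment> \<open>The valuation forced on the part of \<open>y\<close> outside the fixed field
        by reading the power relation backwards; it is congruent to b modulo p.\<close>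
      define \<nu> where "\<nu> = n + int p * t - vp"
      have "(\<delta> ^^ p) y \<in> U (vp + (\<nu> + b))" using e by (simp add: \<nu>_def algebra_simps)
      then have Sy: "S y \<in> U (\<nu> + b)"
        by (rule \<delta>_power_cancel[OF _ P_mono[OF \<delta>y]]) (use nR in \<open>simp add: \<nu>_def\<close>)
      obtain k y' where ky: "y = k + y'" "k \<in> K1" "k \<in> P r" "y' = 0 \<or> (\<exists>m. y' \<in> U m \<and> \<not> int p dvd m)"
        using K1_decomposition[OF y(1)] by metis
      have "S y = S y'" using ky(1,2) by (simp add: df_def autD[OF aut_\<sigma>] K1_iff)
      with Sy have Sy': "S y' \<in> U (\<nu> + b)" by simp
      have "y' \<noteq> 0" using Sy' by (auto simp: df_def autD[OF aut_\<sigma>] U_iff)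
      then obtain m where m: "y' \<in> U m" "\<not> int p dvd m" using ky by blast
      have "m = \<nu>" using U_unique[OF S_exact[OF m] Sy'] by simp
      have "\<nu> - b = (n - b) + (int p * t - vp)" by (simp add: \<nu>_def)
      moreover have "int p dvd (n - b) + (int p * t - vp)"
        by (rule dvd_add[OF True dvd_diff[OF dvd_triv_left p_dvd_vp(2)]])
      ultimately have \<nu>b: "int p dvd \<nu> - b" by (simp only:)
      define q where "q = \<nu> + (int p - 1) * bs"
      have Dy': "D y' \<in> U q" unfolding q_def using D_exact[OF _ \<nu>b] m \<open>m = \<nu>\<close> by simp
      have "q = n + (int p ^ 2 * t + (int p - 1) * b) - vp"
        by (simp add: q_def \<nu>_def algebra_simps power2_eq_square)
      then have qn: "q < n" using I_bound by simp
      \<comment> \<open>D y' is strictly shallower than D y, so its leading term has to be cancelled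
        by D k; hence q is a valuation that \<open>D\<close> attains on the fixed field.\<close>
      have "D k = - D y' + D y" using ky(1) by (simp add: D_add)
      moreover have "- D y' + D y \<in> U q" using Dy' P_mono[OF U_P[OF y(2)]] qn by (intro U_add) auto
      ultimately have Dk: "D k \<in> U q" by simp
      have "int p ^ 2 dvd q" by (rule D_K1_val[OF ky(2,3) Dk]) (use qn nR in simp)
      moreover have "n + (int p - 1) * b = q + vp - int p ^ 2 * t"
        by (simp add: q_def \<nu>_def algebra_simps power2_eq_square)
      ultimately have "int p ^ 2 dvd n + (int p - 1) * b" using p_dvd_vp(1) by (simp add: dvd_diff)
      moreover have "r + int p * (int p - 1) * b \<le> q" using U_P_iff[OF Dk] D_K1_P[OF ky(2,3)] by blast
      then have "r + vp + (int p - 1) ^ 2 * b - int p ^ 2 * t \<le> n"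
        by (simp add: q_def \<nu>_def algebra_simps power2_eq_square)
      ultimately show ?thesis by blast
    qed (use lower False in blast)
  qed
qed

lemma vals_I_1:
  assumes "int p dvd n" "r + (int p - 1) * bs \<le> n" "n < r + vp"
  shows "n \<in> vals r"
proof -
  define m where "m = n - (int p - 1) * bs"
  obtain y where y: "y \<in> U m" using ex_U by blast
  have "m - b = n - int p * (bs - t)" by (simp add: m_def algebra_simps)
  then have "int p dvd m - b" using assms(1) by simp
  from D_exact[OF y this] have "D y \<in> U n" by (simp add: m_def)
  moreover have "y \<in> P r" using U_P_iff[OF y] assms(2) by (simp add: m_def)
  ultimately show ?thesis using assms(3) by (auto simp: vals_def)
qed

lemma vals_I_2:
  assumes "\<not> int p dvd n - b" "r + vp - int p * t \<le> n" "n < r + vp"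
  shows "n \<in> vals r"
proof -
  obtain w where w: "w \<in> U (n - b)" using ex_U by blast
  obtain y where y: "y \<in> U (n - b + bs - vp)" "D y \<in> U (n - b + b)"
    using D_\<delta>_div_p[OF w assms(1) bs(2)[OF w assms(1)]] pt_pos by auto
  have "y \<in> P r" using U_P_iff[OF y(1)] assms(2) by simp
  with y(2) assms(3) show ?thesis by (auto simp: vals_def)
qed

text \<open>The remaining valuations arise from \<open>y + k\<close> with \<open>k\<close> fixed by \<open>\<sigma>\<close> chosen such that the leading
  terms of \<open>D y\<close> and \<open>D k\<close> cancel. Modifying \<open>y\<close> removes all further terms of valuation
  divisible by \<open>p\<close>, and the first surviving term is determined by \<open>\<delta>\<^sup>p y\<close>.\<close>

lemma vals_I_3:
  assumes "int p ^ 2 dvd n + (int p - 1) * b"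
    and ge: "r + vp + (int p - 1) ^ 2 * b - int p ^ 2 * t \<le> n" and nR: "n < r + vp"
  shows "n \<in> vals r"
proof -
  \<comment> \<open>As in \<open>vals_I_subset\<close>: \<nu> is the valuation forced on
    \<open>y\<close>, and q that of D y, which a fixed element has to cancel.\<close>
  define \<nu> where "\<nu> = n + int p * t - vp"
  define q where "q = \<nu> + (int p - 1) * bs"
  have q: "q = (n + (int p - 1) * b) + int p ^ 2 * t - vp"
    by (simp add: q_def \<nu>_def algebra_simps power2_eq_square)
  have q2: "int p ^ 2 dvd q" unfolding q using assms(1) p_dvd_vp(1) by (simp add: dvd_diff)
  have q_ge: "r + int p * (int p - 1) * b \<le> q" using ge unfolding q by (simp add: algebra_simps power2_eq_square)
  obtain q' where "q = int p ^ 2 * q'" using q2 by blast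
  then have q': "q = int p * (int p * q')" by (simp add: power2_eq_square)
  have "\<nu> - b = int p * (int p * q' - bs + t)" using q' by (simp add: q_def algebra_simps)
  then have \<nu>b: "int p dvd \<nu> - b" by (metis dvd_triv_left)
  have not\<nu>: "\<not> int p dvd \<nu>"
  proof
    assume "int p dvd \<nu>"
    from dvd_diff[OF this \<nu>b] show False using b_not_dvd by simp
  qed
  have "(int p - 1) * bs \<le> (int p - 1) * (int p * b)" using bs_less p_gt1 by (intro mult_left_mono) auto
  then have \<nu>r: "r \<le> \<nu>" using q_ge by (simp add: q_def algebra_simps)
  have \<nu>_less: "\<nu> < r + int p * t" using nR by (simp add: \<nu>_def)
  define good where "good y k \<longleftrightarrow> y \<in> U \<nu> \<and> k \<in> K1 \<and> k \<in> P r" for y k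
  \<comment> \<open>The contribution of k to \<delta>^p is too deep to matter, as S k = 0 and
    \<open>G\<close> raises \<open>K1\<close> by p b; so the valuation is the same for every
    admissible pair.\<close>
  have key: "\<delta> (D (y + k)) \<in> U (n + bs)" if "good y k" for y k
  proof -
    have yk: "y \<in> U \<nu>" "k \<in> K1" "k \<in> P r" using that by (auto simp: good_def)
    have "\<delta> y \<in> P (\<nu> + b + 1)" using P_mono[OF U_P[OF bs(2)[OF yk(1) not\<nu>]]] pt_pos by simp
    then have 1: "(\<delta> ^^ p) y \<in> U (vp + (\<nu> + b))" by (intro \<delta>_power_exact S_exact yk not\<nu>)
    have "\<delta> k \<in> P (r + int p * b)" unfolding \<delta>_K1[OF yk(2)] by (intro K1_raise yk)
    moreover have "S k = 0" using yk(2) by (simp add: K1_S)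
    ultimately have "(\<delta> ^^ p) k \<in> P (vp + (r + int p * b))" by (intro \<delta>_power_P) auto
    then have "(\<delta> ^^ p) k \<in> P (vp + (\<nu> + b) + 1)"
      by (rule P_mono) (use \<nu>_less bs_less in simp)
    with 1 have "(\<delta> ^^ p) y + (\<delta> ^^ p) k \<in> U (vp + (\<nu> + b))" by (rule U_add)
    then show ?thesis
      unfolding \<delta>_D additive.add[OF tlinearD(1)[OF tlinear_funpow[OF tlinear_\<delta>]]]
      by (simp add: \<nu>_def algebra_simps)
  qed
  have finish: "n \<in> vals r" if g: "good y k" and m: "D (y + k) \<in> U m" "\<not> int p dvd m" for y k m
  proof -
    have "m + bs = n + bs" using U_unique[OF key[OF g] bs(2)[OF m]] by simp
    moreover have "y + k \<in> P r" using g \<nu>r by (auto simp: good_def intro: P_add U_P_le)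
    ultimately show ?thesis using m nR by (auto simp: vals_def)
  qed
  \<comment> \<open>A leading term of D (y + k) at a multiple of p is removed by changing
    \<open>y\<close> by an element of larger valuation, which keeps the pair admissible; at any
    other place \<open>finish\<close> applies.\<close>
  have "n \<in> vals r \<or> (\<exists>y k. good y k \<and> D (y + k) \<in> P (q + 1 + int i))" for i
  proof (induction i)
    case 0
    obtain y where y: "y \<in> U \<nu>" using ex_U by blast
    have Dy: "D y \<in> U q" unfolding q_def by (rule D_exact[OF y \<nu>b])
    define s where "s = int p * q' - (int p - 1) * b"
    have s1: "int p * s + int p * (int p - 1) * b = q" by (simp add: q' s_def algebra_simps)
    have "s - b = int p * (q' - b)" by (simp add: s_def algebra_simps)
    then have "int p dvd s - b" by simp
    from D_K1_exact[OF \<tau>_powi this] have Dk: "D (\<tau> powi s) \<in> U q" unfolding s1 .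
    obtain c where c: "c \<in> T" "c \<in> U 0" "D y - c * D (\<tau> powi s) \<in> P (q + 1)"
      using residue_step[OF Dy Dk] by blast
    define k where "k = - (c * (\<tau> powi s))"
    have "k = 0 - c * (\<tau> powi s)" by (simp add: k_def)
    then have "k \<in> K1" using K1_combination[OF K1_closed(8) \<tau>_powi(1) c(1)] by simp
    moreover have "k \<in> P r"
    proof -
      have "\<tau> powi s \<in> P r" using U_P_iff[OF \<tau>_powi(2)[of s], of r] s1 q_ge by simp
      then show ?thesis unfolding k_def P_uminus_iff by (rule P_mult0[OF U_P[OF c(2)]])
    qed
    ultimately have "good y k" using y by (simp add: good_def)
    moreover have "D (y + k) \<in> P (q + 1 + int 0)"
      using c(3) by (simp add: k_def D_diff D_scale[OF c(1)])
    ultimately show ?case by blast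
  next
    case (Suc i)
    then consider "n \<in> vals r" | y k where "good y k" "D (y + k) \<in> P (q + 1 + int i)" by blast
    then show ?case
    proof cases
      case (2 y k)
      define m where "m = q + 1 + int i"
      consider "D (y + k) \<in> P (m + 1)" | "D (y + k) \<in> U m" "\<not> int p dvd m" | "D (y + k) \<in> U m" "int p dvd m"
        using P_cases[OF 2(2)] unfolding m_def by blast
      then show ?thesis
      proof cases
        case 1
        have "m + 1 = q + 1 + int (Suc i)" by (simp add: m_def)
        with 1 2(1) show ?thesis by metis
      next
        case 2
        then show ?thesis using finish[OF \<open>good y k\<close>] by blast
      next
        case 3
        define l where "l = m - (int p - 1) * bs"
        obtain z where z: "z \<in> U l" using ex_U by blast
        have "l - b = m - int p * (bs - t)" by (simp add: l_def algebra_simps)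
        then have "int p dvd l - b" using 3(2) by simp
        from D_exact[OF z this] have Dz: "D z \<in> U m" by (simp add: l_def)
        obtain c where c: "c \<in> T" "c \<in> U 0" "D (y + k) - c * D z \<in> P (m + 1)"
          using residue_step[OF 3(1) Dz] by blast
        have "c * z \<in> P (\<nu> + 1)"
          using U_P_le[OF U_mult0[OF c(2) z], of "\<nu> + 1"] by (simp add: l_def m_def q_def)
        then have "y + - (c * z) \<in> U \<nu>" using 2(1) by (intro U_add P_uminus) (auto simp: good_def)
        then have "good (y - c * z) k" using 2(1) by (simp add: good_def)
        moreover have "D (y - c * z + k) \<in> P (q + 1 + int (Suc i))"
          using c(3) by (simp add: D_add D_diff D_scale[OF c(1)] m_def algebra_simps)
        ultimately show ?thesis by blast
      qed
    qed simp
  qed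
  \<comment> \<open>The removal cannot pass beyond n, because one further \<delta> would then
    contradict \<open>key\<close>.\<close>
  moreover have "\<not> D (y + k) \<in> P (n + 1)" if "good y k" for y k
  proof
    assume "D (y + k) \<in> P (n + 1)"
    from raisesD[OF bs(1) this] show False using U_P_iff[OF key[OF that]] by simp
  qed
  ultimately have "n \<in> vals r \<or> (\<exists>y k. good y k \<and> D (y + k) \<in> P (q + 1 + int (nat (n - q))) \<and> D (y + k) \<notin> P (n + 1))"
    by blast
  moreover have "D x \<in> P (n + 1)" if "D x \<in> P (q + 1 + int (nat (n - q)))" for x using P_mono[OF that] by simp
  ultimately show ?thesis by blast
qed

theorem vals_I:
  "vals r = {n. int p dvd n \<and> r + (int p - 1) * bs \<le> n \<and> n < r + vp}
    \<union> {n. \<not> int p dvd n \<and> \<not> int p dvd n - b \<and> r + vp - int p * t \<le> n \<and> n < r + vp}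
    \<union> {n. int p ^ 2 dvd n + (int p - 1) * b \<and> r + vp + (int p - 1) ^ 2 * b - int p ^ 2 * t \<le> n \<and> n < r + vp}"
proof -
  have "n < r + vp" if "n \<in> vals r" for n using that by (simp add: vals_def)
  then show ?thesis using vals_I_subset[of _ r] vals_I_1[of _ r] vals_I_2[of _ r] vals_I_3[of _ r] by blast
qed

end

section \<open>The case v(\<delta> \<xi>) > (p - 1) b\<close>

locale refined_II = refined +
  assumes II: "\<delta> \<xi> \<in> P ((int p - 1) * b + 1)"
begin

lemma pb: "raises (int p * b) \<delta>"
  "x \<in> U (int p * s - int j * b) \<Longrightarrow> \<not> int p dvd s \<Longrightarrow> j < p \<Longrightarrow> \<delta> x \<in> U (int p * s - int j * b + int p * b)"
  by (rule raise_II[OF II], assumption?)+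

lemma D_P: "x \<in> P n \<Longrightarrow> D x \<in> P (n + int p * (int p - 1) * b)"
  using raisesD[OF raises_funpow[OF pb(1), of "p - 1"]] p_gt1 by (simp add: D_def of_nat_diff algebra_simps)

text \<open>With n = -(i p + j) b modulo p^2, the condition on s in \<open>pb\<close> says that the
  high digit i is nonzero, and \<delta> lowers i by one.\<close>

lemma \<delta>_digits:
  assumes "x \<in> U n" "int p ^ 2 dvd n + int (i * p + j) * b" "1 \<le> i" "i < p" "j < p"
  shows "\<delta> x \<in> U (n + int p * b)"
proof -
  obtain m where m: "n + int (i * p + j) * b = int p ^ 2 * m" using assms(2) by blast
  define s where "s = int p * m - int i * b"
  have n: "n = int p * s - int j * b" using m by (simp add: s_def algebra_simps power2_eq_square)
  have "\<not> int p dvd int i * b" using assms by (intro not_dvd_multiple_b) auto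
  then have "\<not> int p dvd s" unfolding s_def by (metis add_diff_cancel_left' diff_add_cancel dvd_diff dvd_triv_left)
  with pb(2)[of x s j] assms(1,5) n show ?thesis by simp
qed

lemma ex_p2_digits: "\<exists>i j. i < p \<and> j < p \<and> int p ^ 2 dvd n + int (i * p + j) * b"
proof -
  obtain s j where sj: "j < p" "n = int p * s - int j * b" using ex_digits by blast
  obtain s' i where si: "i < p" "s = int p * s' - int i * b" using ex_digits by blast
  have "n + int (i * p + j) * b = int p ^ 2 * s'" unfolding sj(2) si(2) by (simp add: algebra_simps power2_eq_square)
  with sj(1) si(1) show ?thesis by (metis dvd_triv_left)
qed

text \<open>High digit 0 is where p - 1 exact applications of \<delta> arrive from high digit p - 1.
  If n has high digit i >= 1, one further \<delta> is exact and the power relation bounds n below.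
  Low digit p - 1 is then impossible: it would make v(S y) - b divisible by p, whereas S y = S y'
  for some y' of valuation prime to p.\<close>

theorem vals_II:
  "vals r = {n. (\<exists>j<p. int p ^ 2 dvd n + int j * b) \<and> r + int p * (int p - 1) * b \<le> n \<and> n < r + vp}
    \<union> {n. (\<exists>i j. 1 \<le> i \<and> i < p \<and> j < p - 1 \<and> int p ^ 2 dvd n + int (i * p + j) * b)
        \<and> r + vp - (int p - 1) * b \<le> n \<and> n < r + vp}" (is "_ = ?A \<union> ?B")
proof (intro equalityI subsetI)
  fix n assume "n \<in> vals r"
  then obtain y where y: "y \<in> P r" "D y \<in> U n" and nR: "n < r + vp" by (auto simp: vals_def)
  obtain i j where ij: "i < p" "j < p" "int p ^ 2 dvd n + int (i * p + j) * b" using ex_p2_digits by blast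
  show "n \<in> ?A \<union> ?B"
  proof (cases "i = 0")
    case True
    have "r + int p * (int p - 1) * b \<le> n" using U_P_iff[OF y(2)] D_P[OF y(1)] by blast
    then show ?thesis using True ij nR by auto
  next
    case False
    have \<delta>y: "\<delta> y \<in> P (r + int p * b)" by (rule raisesD[OF pb(1) y(1)])
    have e: "(\<delta> ^^ p) y \<in> U (n + int p * b)"
      unfolding \<delta>_D[symmetric] using False ij by (intro \<delta>_digits[OF y(2) ij(3)]) auto
    have "1 * b \<le> int p * b" using p_gt1 b_pos by (intro mult_right_mono) auto
    then have "(\<delta> ^^ p) y \<in> P (vp + (r + b))"
      by (intro \<delta>_power_P raisesD[OF raises_S y(1)] P_mono[OF \<delta>y]) simp
    then have lower: "r + vp - (int p - 1) * b \<le> n" using U_P_iff[OF e] by (simp add: algebra_simps)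
    have "j \<noteq> p - 1"
    proof
      assume j: "j = p - 1"
      define \<nu> where "\<nu> = n + int p * b - vp - b"
      have "(\<delta> ^^ p) y \<in> U (vp + (\<nu> + b))" using e by (simp add: \<nu>_def)
      then have Sy: "S y \<in> U (\<nu> + b)"
        by (rule \<delta>_power_cancel[OF _ P_mono[OF \<delta>y]]) (use nR in \<open>simp add: \<nu>_def\<close>)
      obtain k y' where ky: "y = k + y'" "k \<in> K1" "y' = 0 \<or> (\<exists>m. y' \<in> U m \<and> \<not> int p dvd m)"
        using K1_decomposition[OF y(1)] by metis
      have "S y = S y'" using ky(1,2) by (simp add: df_def autD[OF aut_\<sigma>] K1_iff)
      with Sy have Sy': "S y' \<in> U (\<nu> + b)" by simp
      have "y' \<noteq> 0" using Sy' by (auto simp: df_def autD[OF aut_\<sigma>] U_iff)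
      then obtain m where m: "y' \<in> U m" "\<not> int p dvd m" using ky by blast
      have "\<not> int p dvd \<nu>" using U_unique[OF S_exact[OF m] Sy'] m(2) by simp
      moreover obtain c where "n + int (i * p + j) * b = int p ^ 2 * c" using ij(3) by blast
      then have "\<nu> = int p * (int p * c - int i * b) - vp"
        using p_gt1 by (simp add: \<nu>_def j of_nat_diff algebra_simps power2_eq_square)
      ultimately show False using p_dvd_vp(2) by simp
    qed
    with ij False lower nR show ?thesis
      by (intro UnI2 CollectI conjI exI[of _ i] exI[of _ j]) auto
  qed
next
  fix n assume "n \<in> ?A \<union> ?B"
  then consider "n \<in> ?A" | "n \<in> ?B" by blast
  then show "n \<in> vals r"
  proof cases
    case 1
    then obtain j where j: "j < p" "int p ^ 2 dvd n + int j * b"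
      and n: "r + int p * (int p - 1) * b \<le> n" "n < r + vp" by blast
    define m where "m = n - int p * (int p - 1) * b"
    obtain y where y: "y \<in> U m" using ex_U by blast
    \<comment> \<open>After k steps the high digit is p - 1 - k, still nonzero for k < p -
      1.\<close>
    have "D y \<in> U (m + int (p - 1) * (int p * b))" unfolding D_def
    proof (rule iterate_U[OF y])
      fix k x assume k: "k < p - 1" "x \<in> U (m + int k * (int p * b))"
      have "int (p - 1 - k) = int p - 1 - int k" using k(1) by linarith
      then have "m + int k * (int p * b) + int ((p - 1 - k) * p + j) * b = n + int j * b"
        unfolding of_nat_add of_nat_mult m_def by (simp only:) (simp add: algebra_simps)
      then show "\<delta> x \<in> U (m + int k * (int p * b) + int p * b)"
        using k j by (intro \<delta>_digits[where i = "p - 1 - k" and j = j]) auto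
    qed
    moreover have "m + int (p - 1) * (int p * b) = n" using p_gt1 by (simp add: m_def of_nat_diff algebra_simps)
    moreover have "y \<in> P r" using U_P_iff[OF y] n(1) by (simp add: m_def)
    ultimately show ?thesis using n(2) by (auto simp: vals_def)
  next
    case 2
    then obtain i j where ij: "1 \<le> i" "i < p" "j < p - 1" "int p ^ 2 dvd n + int (i * p + j) * b"
      and n: "r + vp - (int p - 1) * b \<le> n" "n < r + vp" by blast
    \<comment> \<open>n - b has digits (i, j + 1), and j < p - 1 keeps the low digit below
      p.\<close>
    obtain w where w: "w \<in> U (n - b)" using ex_U by blast
    have e: "n - b + int (i * p + Suc j) * b = n + int (i * p + j) * b" by (simp add: algebra_simps)
    have "int p ^ 2 dvd n - b + int (i * p + Suc j) * b" unfolding e by (rule ij(4))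
    then have \<delta>w: "\<delta> w \<in> U (n - b + int p * b)"
      by (rule \<delta>_digits[OF w _ ij(1,2)]) (use ij(3) in simp)
    have "\<not> int p dvd n - b"
    proof
      assume d: "int p dvd n - b"
      obtain c where c: "n + int (i * p + j) * b = int p ^ 2 * c" using ij(4) by blast
      have "(int j + 1) * b = int p * (int p * c - int i * b) - (n - b)" using c by (simp add: algebra_simps power2_eq_square)
      then have "int p dvd (int j + 1) * b" using d by simp
      then show False using not_dvd_multiple_b[of "int j + 1"] ij(3) by auto
    qed
    moreover have "1 * b < int p * b" using p_gt1 b_pos by (intro mult_strict_right_mono) auto
    ultimately obtain y where y: "y \<in> U (n - b + int p * b - vp)" "D y \<in> U (n - b + b)"
      using D_\<delta>_div_p[OF w _ \<delta>w] by auto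
    have "y \<in> P r" using U_P_iff[OF y(1)] n(1) by (simp add: algebra_simps)
    then show ?thesis using y(2) n(2) by (auto simp: vals_def)
  qed
qed

end

section \<open>Counting residue classes\<close>

definition cl :: "int \<Rightarrow> int \<Rightarrow> int" where "cl x q = \<lceil>real_of_int x / real_of_int q\<rceil>"

lemma cl_le_iff: "q > 0 \<Longrightarrow> cl x q \<le> m \<longleftrightarrow> x \<le> q * m"
proof -
  assume q: "q > 0"
  have "cl x q \<le> m \<longleftrightarrow> real_of_int x / real_of_int q \<le> real_of_int m"
    unfolding cl_def by (rule ceiling_le_iff)
  also have "\<dots> \<longleftrightarrow> real_of_int x \<le> real_of_int m * real_of_int q"
    using q by (intro pos_divide_le_eq) simp
  also have "real_of_int m * real_of_int q = real_of_int (q * m)" by simp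
  also have "real_of_int x \<le> real_of_int (q * m) \<longleftrightarrow> x \<le> q * m" by (rule of_int_le_iff)
  finally show ?thesis .
qed

lemma cl_shift: "q > 0 \<Longrightarrow> cl (x + q * m) q = cl x q + m"
proof -
  assume q: "q > 0"
  have "real_of_int (x + q * m) / real_of_int q = real_of_int x / real_of_int q + real_of_int m"
    using q by (simp only: of_int_add of_int_mult add_divide_distrib) simp
  then show ?thesis unfolding cl_def by (simp only: ceiling_add_of_int)
qed

lemma cl_mono: "q > 0 \<Longrightarrow> x \<le> y \<Longrightarrow> cl x q \<le> cl y q"
  unfolding cl_def by (intro ceiling_mono divide_right_mono) auto

definition residue_class :: "int \<Rightarrow> int \<Rightarrow> int \<Rightarrow> int \<Rightarrow> int set" where
  "residue_class q c A B = {n. q dvd n + c \<and> A \<le> n \<and> n < B}"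

lemma residue_class_image:
  assumes "q > 0"
  shows "residue_class q c A B = (\<lambda>m. q * m - c) ` {cl (A + c) q..<cl (B + c) q}"
proof -
  have "n \<in> residue_class q c A B \<longleftrightarrow> (\<exists>m. n = q * m - c \<and> A + c \<le> q * m \<and> \<not> B + c \<le> q * m)" for n
    unfolding residue_class_def dvd_def by (auto simp: algebra_simps)
  then have iff: "n \<in> residue_class q c A B \<longleftrightarrow> (\<exists>m. n = q * m - c \<and> cl (A + c) q \<le> m \<and> m < cl (B + c) q)" for n
    unfolding cl_le_iff[OF assms, symmetric] not_le .
  show ?thesis unfolding set_eq_iff iff image_iff Bex_def atLeastLessThan_iff by blast
qed

lemma finite_residue_class: "q > 0 \<Longrightarrow> finite (residue_class q c A B)"
  by (simp add: residue_class_image)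

lemma card_residue_class:
  assumes "q > 0"
  shows "card (residue_class q c A B) = nat (cl (B + c) q - cl (A + c) q)"
  unfolding residue_class_image[OF assms] using assms by (subst card_image) (auto simp: inj_on_def)

lemma card_residue_class_int:
  assumes "q > 0" "A \<le> B"
  shows "int (card (residue_class q c A B)) = cl (B + c) q - cl (A + c) q"
  using card_residue_class[OF assms(1)] cl_mono[OF assms(1), of "A + c" "B + c"] assms(2) by simp

context refined begin

lemma p2_coprime_b: "int p ^ 2 dvd k * b \<Longrightarrow> int p ^ 2 dvd k"
proof -
  have "coprime (int p ^ 2) b" using b_not_dvd p_prime by (simp add: prime_imp_coprime)
  then show "int p ^ 2 dvd k * b \<Longrightarrow> int p ^ 2 dvd k" by (simp add: coprime_dvd_mult_left_iff)
qed

lemma class_unique: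
  assumes "int p ^ 2 dvd n + int s * b" "int p ^ 2 dvd n + int s' * b" "s < p ^ 2" "s' < p ^ 2"
  shows "s = s'"
proof -
  have "int p ^ 2 dvd (n + int s * b) - (n + int s' * b)" using assms(1,2) by (rule dvd_diff)
  then have "int p ^ 2 dvd (int s - int s') * b" by (simp add: algebra_simps)
  from p2_coprime_b[OF this] have "int (p ^ 2) dvd int s - int s'" by simp
  then have "int s mod int (p ^ 2) = int s' mod int (p ^ 2)" by (simp only: mod_eq_dvd_iff)
  then show ?thesis using assms(3,4) by (simp del: of_nat_power)
qed

lemma digits_less: "i < p \<Longrightarrow> j < p \<Longrightarrow> i * p + j < p ^ 2"
proof -
  assume "i < p" "j < p"
  then have "i * p + j < Suc i * p" "Suc i * p \<le> p * p" by (simp_all del: mult_Suc add: mult_le_mono1) simp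
  then show ?thesis by (simp add: power2_eq_square)
qed

lemma digits_unique: "i * p + j = i' * p + j' \<Longrightarrow> j < p \<Longrightarrow> j' < p \<Longrightarrow> i = i' \<and> j = j'"
proof -
  assume a: "i * p + j = i' * p + j'" "j < p" "j' < p"
  have "(i * p + j) div p = i" "(i' * p + j') div p = i'" using a(2,3) by simp_all
  with a(1) show ?thesis by simp
qed

text \<open>Both sides count the multiples of p in an interval; they split into the classes of -i p
  b modulo p^2, i < p, because b is invertible modulo p.\<close>

lemma sum_cl_classes:
  assumes "x \<le> x'"
  shows "(\<Sum>i<p. cl (x' + int (i * p) * b) (int p ^ 2)) - (\<Sum>i<p. cl (x + int (i * p) * b) (int p ^ 2))
    = cl x' (int p) - cl x (int p)"
proof -
  have pp: "int p > 0" "int p ^ 2 > 0" by simp_all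
  have "residue_class (int p) 0 x x' = (\<Union>i<p. residue_class (int p ^ 2) (int (i * p) * b) x x')"
  proof (intro equalityI subsetI)
    fix n assume n: "n \<in> residue_class (int p) 0 x x'"
    then obtain s where s: "n = int p * s" by (auto simp: residue_class_def)
    obtain i m where i: "i < p" "s = int p * m - int i * b" using ex_digits by blast
    have "n + int (i * p) * b = int p ^ 2 * m" unfolding s i(2) by (simp add: algebra_simps power2_eq_square)
    then have "int p ^ 2 dvd n + int (i * p) * b" by simp
    with n i(1) show "n \<in> (\<Union>i<p. residue_class (int p ^ 2) (int (i * p) * b) x x')"
      by (auto simp: residue_class_def)
  next
    fix n assume "n \<in> (\<Union>i<p. residue_class (int p ^ 2) (int (i * p) * b) x x')"
    then obtain i where i: "int p ^ 2 dvd n + int (i * p) * b" "x \<le> n" "n < x'" by (auto simp: residue_class_def)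
    obtain m where "n + int (i * p) * b = int p ^ 2 * m" using i(1) by blast
    then have "n = int p * (int p * m - int i * b)" by (simp add: algebra_simps power2_eq_square)
    with i show "n \<in> residue_class (int p) 0 x x'" by (simp add: residue_class_def)
  qed
  moreover have "card (\<Union>i<p. residue_class (int p ^ 2) (int (i * p) * b) x x')
      = (\<Sum>i<p. card (residue_class (int p ^ 2) (int (i * p) * b) x x'))"
  proof (rule card_UN_disjoint)
    show "\<forall>i\<in>{..<p}. \<forall>j\<in>{..<p}. i \<noteq> j \<longrightarrow>
      residue_class (int p ^ 2) (int (i * p) * b) x x' \<inter> residue_class (int p ^ 2) (int (j * p) * b) x x' = {}"
    proof (intro ballI impI equals0I)
      fix i j n assume ij: "i \<in> {..<p}" "j \<in> {..<p}" "i \<noteq> j"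
        and "n \<in> residue_class (int p ^ 2) (int (i * p) * b) x x' \<inter> residue_class (int p ^ 2) (int (j * p) * b) x x'"
      then have "i * p = j * p"
        using digits_less[of i 0] digits_less[of j 0]
        by (intro class_unique[of n]) (auto simp: residue_class_def)
      with ij show False by simp
    qed
  qed (simp_all add: finite_residue_class)
  ultimately have "int (card (residue_class (int p) 0 x x'))
      = (\<Sum>i<p. int (card (residue_class (int p ^ 2) (int (i * p) * b) x x')))" by simp
  then show ?thesis
    unfolding card_residue_class_int[OF pp(1) assms] card_residue_class_int[OF pp(2) assms] by (simp add: sum_subtractf)
qed

text \<open>\<open>saturated\<close> is the second value of \<epsilon>, and \<open>generic\<close>
  the formula for a_p without \<epsilon>.\<close>

definition saturated :: "int \<Rightarrow> int" where
  "saturated r = b + cl (r - int p * b) (int p ^ 2) - cl (r + (int p - 1) * b) (int p ^ 2)"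
definition generic :: "int \<Rightarrow> int" where
  "generic r = int p * e + cl r (int p) - cl (r - b) (int p) - b"

lemma cl_p2_shift: "cl (x + vp) (int p ^ 2) = cl x (int p ^ 2) + e" "cl (x + vp) (int p) = cl x (int p) + int p * e"
proof -
  show "cl (x + vp) (int p ^ 2) = cl x (int p ^ 2) + e" unfolding vp by (rule cl_shift) simp
  have "x + vp = x + int p * (int p * e)" by (simp add: vp power2_eq_square)
  then show "cl (x + vp) (int p) = cl x (int p) + int p * e" using cl_shift[of "int p" x "int p * e"] by simp
qed

lemma cl_saturated: "cl (r + int p * (int p - 1) * b) (int p ^ 2) = cl (r - int p * b) (int p ^ 2) + b"
proof -
  have "r + int p * (int p - 1) * b = (r - int p * b) + int p ^ 2 * b" by (simp add: algebra_simps power2_eq_square)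
  then show ?thesis using cl_shift[of "int p ^ 2" "r - int p * b" b] by (simp only: of_nat_0_less_iff zero_less_power p_pos)
qed

end

context refined_I begin

text \<open>Multiples of p contribute generic - (p - 1) t. Each of the p - 2 classes modulo p other
  than those of 0 and b contributes t, from a window of length p t. The class modulo p^2 contributes
  t - saturated once its lower end is at most r + v(p), and nothing before.\<close>

lemma card_vals_I:
  "int (card (vals r)) = generic r - (if int p ^ 2 * t < (int p - 1) ^ 2 * b then t else saturated r)"
proof -
  have pp: "int p > 0" "int p ^ 2 > 0" by simp_all
  let ?R = "r + vp"
  define A1 where "A1 = residue_class (int p) 0 (r + (int p - 1) * bs) ?R"
  define A2 where "A2 = {?R - int p * t..<?R} - (residue_class (int p) 0 (?R - int p * t) ?R \<union> residue_class (int p) (- b) (?R - int p * t) ?R)"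
  define A3 where "A3 = residue_class (int p ^ 2) ((int p - 1) * b) (?R + (int p - 1) ^ 2 * b - int p ^ 2 * t) ?R"
  have vals: "vals r = A1 \<union> A2 \<union> A3"
    unfolding vals_I A1_def A2_def A3_def residue_class_def by auto
  have n3: "\<not> int p dvd n \<and> int p dvd n - b" if n: "n \<in> A3" for n
  proof -
    obtain c where "n + (int p - 1) * b = int p ^ 2 * c" using n by (auto simp: A3_def residue_class_def)
    then have "n - b = int p * (int p * c - b)" by (simp add: algebra_simps power2_eq_square)
    then have d: "int p dvd n - b" by simp
    moreover have "\<not> int p dvd n"
    proof
      assume "int p dvd n"
      from dvd_diff[OF this d] show False using b_not_dvd by simp
    qed
    ultimately show ?thesis by blast
  qed
  have disj: "A1 \<inter> A2 = {}" "(A1 \<union> A2) \<inter> A3 = {}"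
    using n3 by (auto simp: A1_def A2_def residue_class_def)
  have fin: "finite A1" "finite A2" "finite A3" by (simp_all add: A1_def A2_def A3_def finite_residue_class)
  have card: "int (card (vals r)) = int (card A1) + int (card A2) + int (card A3)"
    unfolding vals using fin disj by (simp add: card_Un_disjoint)
  have pt0: "int p * t \<ge> 0" using t(2) by simp
  have "(int p - 1) * bs = int p ^ 2 * t + (int p - 1) * b - int p * t" by (simp add: algebra_simps power2_eq_square)
  then have "r + (int p - 1) * bs \<le> ?R" using I_bound pt0 by simp
  then have "int (card A1) = cl (r + vp + 0) (int p) - cl (r + (int p - 1) * bs + 0) (int p)"
    unfolding A1_def by (rule card_residue_class_int[OF pp(1)])
  moreover have "r + (int p - 1) * bs = (r - b) + int p * (b + (int p - 1) * t)" by (simp add: algebra_simps)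
  ultimately have c1: "int (card A1) = generic r - (int p - 1) * t"
    using cl_shift[OF pp(1), of "r - b" "b + (int p - 1) * t"] by (simp add: generic_def cl_p2_shift)
  have cc: "int (card (residue_class (int p) c (?R - int p * t) ?R)) = t" for c
  proof -
    have "int (card (residue_class (int p) c (?R - int p * t) ?R)) = cl (?R + c) (int p) - cl (?R - int p * t + c) (int p)"
      by (rule card_residue_class_int[OF pp(1)]) (use pt0 in simp)
    moreover have "?R + c = (?R - int p * t + c) + int p * t" by simp
    ultimately show ?thesis using cl_shift[OF pp(1), of "?R - int p * t + c" t] by simp
  qed
  have c2: "int (card A2) = int p * t - 2 * t"
  proof -
    have d: "residue_class (int p) 0 (?R - int p * t) ?R \<inter> residue_class (int p) (- b) (?R - int p * t) ?R = {}"
    proof (intro equals0I)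
      fix n assume "n \<in> residue_class (int p) 0 (?R - int p * t) ?R \<inter> residue_class (int p) (- b) (?R - int p * t) ?R"
      then have "int p dvd n" "int p dvd n - b" by (auto simp: residue_class_def)
      from dvd_diff[OF this] show False using b_not_dvd by simp
    qed
    let ?Z = "residue_class (int p) 0 (?R - int p * t) ?R \<union> residue_class (int p) (- b) (?R - int p * t) ?R"
    have Z: "int (card ?Z) = 2 * t" using d cc[of 0] cc[of "- b"] by (simp add: card_Un_disjoint finite_residue_class)
    have sub: "?Z \<subseteq> {?R - int p * t..<?R}" by (auto simp: residue_class_def)
    have "card A2 = card {?R - int p * t..<?R} - card ?Z"
      unfolding A2_def by (rule card_Diff_subset) (use sub in \<open>simp_all add: finite_residue_class\<close>)
    moreover have "card ?Z \<le> card {?R - int p * t..<?R}" by (rule card_mono[OF _ sub]) simp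
    moreover have "int (card {?R - int p * t..<?R}) = int p * t" using pt0 by simp
    ultimately show ?thesis using Z by linarith
  qed
  have c3: "int (card A3) = (if int p ^ 2 * t < (int p - 1) ^ 2 * b then 0 else t - saturated r)"
  proof (cases "int p ^ 2 * t < (int p - 1) ^ 2 * b")
    case True
    then have "A3 = {}" unfolding A3_def residue_class_def by auto
    with True show ?thesis by simp
  next
    case False
    then have "int (card A3) = cl (?R + (int p - 1) * b) (int p ^ 2)
        - cl (?R + (int p - 1) ^ 2 * b - int p ^ 2 * t + (int p - 1) * b) (int p ^ 2)"
      unfolding A3_def by (intro card_residue_class_int[OF pp(2)]) simp
    also have "?R + (int p - 1) ^ 2 * b - int p ^ 2 * t + (int p - 1) * b
        = (r + int p * (int p - 1) * b + vp) + int p ^ 2 * (- t)" by (simp add: algebra_simps power2_eq_square)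
    also have "?R + (int p - 1) * b = (r + (int p - 1) * b) + vp" by simp
    finally have "int (card A3) = t - saturated r"
      unfolding cl_shift[OF pp(2)] cl_p2_shift cl_saturated saturated_def by simp
    with False show ?thesis by simp
  qed
  show ?thesis unfolding card c1 c2 c3 by (simp add: algebra_simps)
qed

end

context refined_II begin

text \<open>Each class is counted by a difference of values of \<open>h\<close> at digit codes. The
  row sums telescope up to their end columns, and those columns are evaluated by
  \<open>sum_cl_classes\<close>.\<close>

lemma card_vals_II: "int (card (vals r)) = generic r - saturated r"
proof -
  have pp: "int p > 0" "int p ^ 2 > 0" by simp_all
  let ?R = "r + vp" and ?q = "int p ^ 2"
  define h where "h s = cl (r + int s * b) ?q" for s :: nat
  define F where "F s = residue_class ?q (int s * b) (r + int p * (int p - 1) * b) ?R" for s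
  define H where "H s = residue_class ?q (int s * b) (?R - (int p - 1) * b) ?R" for s
  define I where "I = {1..<p} \<times> {..<p - 1}"
  define code where "code ij = fst ij * p + snd ij" for ij :: "nat \<times> nat"
  have vals: "vals r = (\<Union>j<p. F j) \<union> (\<Union>ij\<in>I. H (code ij))"
    unfolding vals_II F_def H_def I_def code_def residue_class_def by fastforce
  have F_dvd: "?q dvd n + int s * b" if "n \<in> F s" for n s using that by (simp add: F_def residue_class_def)
  have H_dvd: "?q dvd n + int s * b" if "n \<in> H s" for n s using that by (simp add: H_def residue_class_def)
  have code_less: "code ij < p ^ 2" if "ij \<in> I" for ij using that digits_less by (auto simp: I_def code_def)
  have code_ge: "p \<le> code ij" if "ij \<in> I" for ij using that by (auto simp: I_def code_def trans_le_add1)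
  have j_less: "j < p ^ 2" if "j < p" for j using digits_less[of 0 j] that by simp
  have "(\<Union>j<p. F j) \<inter> (\<Union>ij\<in>I. H (code ij)) = {}"
  proof (intro equals0I)
    fix n assume "n \<in> (\<Union>j<p. F j) \<inter> (\<Union>ij\<in>I. H (code ij))"
    then obtain j ij where "j < p" "n \<in> F j" "ij \<in> I" "n \<in> H (code ij)" by auto
    with class_unique[OF F_dvd H_dvd j_less code_less] code_ge show False by fastforce
  qed
  then have "card (vals r) = card (\<Union>j<p. F j) + card (\<Union>ij\<in>I. H (code ij))"
    unfolding vals by (intro card_Un_disjoint) (auto simp: F_def H_def I_def finite_residue_class)
  moreover have "card (\<Union>j<p. F j) = (\<Sum>j<p. card (F j))"
  proof (rule card_UN_disjoint)
    show "\<forall>i\<in>{..<p}. \<forall>j\<in>{..<p}. i \<noteq> j \<longrightarrow> F i \<inter> F j = {}"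
    proof (intro ballI impI equals0I)
      fix i j n assume "i \<in> {..<p}" "j \<in> {..<p}" "i \<noteq> j" "n \<in> F i \<inter> F j"
      then show False using class_unique[OF F_dvd F_dvd j_less j_less] by blast
    qed
  qed (simp_all add: F_def finite_residue_class)
  moreover have "card (\<Union>ij\<in>I. H (code ij)) = (\<Sum>ij\<in>I. card (H (code ij)))"
  proof (rule card_UN_disjoint)
    show "\<forall>i\<in>I. \<forall>j\<in>I. i \<noteq> j \<longrightarrow> H (code i) \<inter> H (code j) = {}"
    proof (intro ballI impI equals0I)
      fix i j n assume ij: "i \<in> I" "j \<in> I" "i \<noteq> j" "n \<in> H (code i) \<inter> H (code j)"
      then have "code i = code j" using class_unique[OF H_dvd H_dvd code_less code_less] by blast
      then have "fst i = fst j \<and> snd i = snd j"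
        unfolding code_def by (rule digits_unique) (use ij in \<open>auto simp: I_def\<close>)
      with ij(3) show False by (simp add: prod_eq_iff)
    qed
  qed (simp_all add: I_def H_def finite_residue_class)
  moreover have "int (card (F j)) = e + h j - h ((p - 1) * p + j)" for j
  proof -
    have "int (card (F j)) = cl (?R + int j * b) ?q - cl (r + int p * (int p - 1) * b + int j * b) ?q"
      unfolding F_def by (rule card_residue_class_int[OF pp(2)]) (use vp_gt in simp)
    also have "?R + int j * b = (r + int j * b) + vp" by simp
    also have "int (p - 1) = int p - 1" using p_gt1 by linarith
    then have "int ((p - 1) * p + j) = int p * (int p - 1) + int j"
      unfolding of_nat_add of_nat_mult by (simp only: mult.commute)
    then have "r + int p * (int p - 1) * b + int j * b = r + int ((p - 1) * p + j) * b" by (simp only:) (simp add: algebra_simps)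
    finally show ?thesis unfolding cl_p2_shift h_def by simp
  qed
  moreover have "int (card (H (Suc i * p + j))) = h (Suc i * p + j) - h (i * p + Suc j)" for i j
  proof -
    have "int (card (H (Suc i * p + j))) = cl (?R + int (Suc i * p + j) * b) ?q - cl (?R - (int p - 1) * b + int (Suc i * p + j) * b) ?q"
      unfolding H_def by (rule card_residue_class_int[OF pp(2)]) (use p_gt1 b_pos in simp)
    also have "?R + int (Suc i * p + j) * b = (r + int (Suc i * p + j) * b) + vp" by simp
    \<comment> \<open>Shifting by (p - 1) b takes the digits (i + 1, j) to (i, j + 1).\<close>
    also have "?R - (int p - 1) * b + int (Suc i * p + j) * b = (r + int (i * p + Suc j) * b) + vp"
      by (simp add: algebra_simps)
    finally show ?thesis unfolding cl_p2_shift h_def by simp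
  qed
  moreover have "(\<Sum>ij\<in>I. int (card (H (code ij)))) = (\<Sum>i<p - 1. \<Sum>j<p - 1. int (card (H (Suc i * p + j))))"
  proof -
    have "(\<Sum>ij\<in>I. int (card (H (code ij)))) = (\<Sum>i\<in>{1..<p}. \<Sum>j<p - 1. int (card (H (i * p + j))))"
      unfolding I_def code_def by (simp add: sum.cartesian_product case_prod_unfold)
    also have "\<dots> = (\<Sum>i\<in>Suc ` {..<p - 1}. \<Sum>j<p - 1. int (card (H (i * p + j))))"
      using p_gt1 by (simp only: lessThan_atLeast0 image_Suc_atLeastLessThan) simp
    finally show ?thesis by (simp add: sum.reindex)
  qed
  ultimately have total: "int (card (vals r)) = (\<Sum>j<p. e + h j - h ((p - 1) * p + j))
      + (\<Sum>i<p - 1. \<Sum>j<p - 1. h (Suc i * p + j) - h (i * p + Suc j))" by simp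
  obtain q where q: "p = Suc q" using p_pos by (cases p) auto
  define Hs where "Hs i = (\<Sum>j<p. h (i * p + j))" for i
  \<comment> \<open>A difference of full row sums, corrected by column q = p - 1 of row i + 1 and
    column 0 of row i.\<close>
  have row: "(\<Sum>j<p - 1. h (Suc i * p + j) - h (i * p + Suc j)) = (Hs (Suc i) - Hs i) - (h (Suc i * p + q) - h (i * p))" for i
  proof -
    have "Hs (Suc i) = (\<Sum>j<q. h (Suc i * p + j)) + h (Suc i * p + q)" unfolding Hs_def q by simp
    moreover have "Hs i = h (i * p) + (\<Sum>j<q. h (i * p + Suc j))"
      unfolding Hs_def q by (subst sum.lessThan_Suc_shift) simp
    ultimately show ?thesis by (simp add: q sum_subtractf)
  qed
  have "(\<Sum>i<q. Hs (Suc i) - Hs i) = Hs q - Hs 0" by (rule sum_lessThan_telescope)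
  then have second: "(\<Sum>i<p - 1. \<Sum>j<p - 1. h (Suc i * p + j) - h (i * p + Suc j))
      = (Hs q - Hs 0) - ((\<Sum>i<q. h (Suc i * p + q)) - (\<Sum>i<q. h (i * p)))"
    unfolding row by (simp add: q sum_subtractf)
  have first: "(\<Sum>j<p. e + h j - h ((p - 1) * p + j)) = int p * e + Hs 0 - Hs q"
    unfolding Hs_def by (simp add: sum_subtractf sum.distrib q)
  have Q0: "(\<Sum>i<p. h (i * p)) = (\<Sum>i<q. h (i * p)) + h (q * p)" by (simp add: q)
  have Qq: "(\<Sum>i<p. h (i * p + q)) = h q + (\<Sum>i<q. h (Suc i * p + q))"
    unfolding q by (subst sum.lessThan_Suc_shift) simp
  have "(\<Sum>i<p. h (i * p + q)) - (\<Sum>i<p. h (i * p)) = cl (r + int q * b) (int p) - cl r (int p)"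
  proof -
    have "r \<le> r + int q * b" using b_pos by simp
    from sum_cl_classes[OF this] show ?thesis unfolding h_def by (simp add: algebra_simps)
  qed
  moreover have "int q = int p - 1" using q by simp
  then have "r + int q * b = (r - b) + int p * b" by (simp only:) (simp add: algebra_simps)
  then have "cl (r + int q * b) (int p) = cl (r - b) (int p) + b" using cl_shift[OF pp(1), of "r - b" b] by (simp only:)
  moreover have "h (q * p) = cl (r - int p * b) ?q + b"
  proof -
    have "r + int (q * p) * b = r + int p * (int p - 1) * b"
      unfolding of_nat_mult \<open>int q = int p - 1\<close> by (simp only: mult.commute)
    then show ?thesis unfolding h_def cl_saturated[symmetric] by (simp only:)
  qed
  moreover have "h q = cl (r + (int p - 1) * b) ?q" unfolding h_def using \<open>int q = int p - 1\<close> by simp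
  ultimately show ?thesis
    unfolding total first second generic_def saturated_def using Q0 Qq by simp
qed

end

context refined begin

text \<open>The second break is b + p t or p b. Clearing denominators turns the cutoff into p^2 t <
  (p - 1)^2 b in the first case, and p b always lies beyond it.\<close>

theorem card_vals:
  assumes \<rho>: "\<rho> \<in> U b" and bs_eq: "bs = v (\<delta> \<rho>) - b"
  shows "real (card (vals r)) = real_of_int (int p * e + \<lceil>real_of_int r / real p\<rceil> - \<lceil>real_of_int (r - b) / real p\<rceil> - b)
    - (if real_of_int bs < (real p - 1 + 1 / real p) * real_of_int b
       then real_of_int (bs - b) / real p
       else real_of_int (b + \<lceil>real_of_int (r - int p * b) / real p ^ 2\<rceil>
                           - \<lceil>real_of_int (r + (int p - 1) * b) / real p ^ 2\<rceil>))"
proof -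
  have g: "generic r = int p * e + \<lceil>real_of_int r / real p\<rceil> - \<lceil>real_of_int (r - b) / real p\<rceil> - b"
    by (simp add: generic_def cl_def)
  have s: "saturated r = b + \<lceil>real_of_int (r - int p * b) / real p ^ 2\<rceil> - \<lceil>real_of_int (r + (int p - 1) * b) / real p ^ 2\<rceil>"
    by (simp add: saturated_def cl_def)
  have pr: "real p > 0" by simp
  have iff: "real_of_int bs < (real p - 1 + 1 / real p) * real_of_int b \<longleftrightarrow> int p * bs < (int p ^ 2 - int p + 1) * b"
  proof -
    have "real_of_int bs < (real p - 1 + 1 / real p) * real_of_int b
        \<longleftrightarrow> real p * real_of_int bs < real p * ((real p - 1 + 1 / real p) * real_of_int b)" using pr by simp
    also have "real p * ((real p - 1 + 1 / real p) * real_of_int b) = real_of_int ((int p ^ 2 - int p + 1) * b)"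
    proof -
      have "real p * (real p - 1 + 1 / real p) = real p ^ 2 - real p + 1"
        using pr by (simp add: distrib_left right_diff_distrib power2_eq_square)
      then show ?thesis by (simp add: mult.assoc[symmetric])
    qed
    also have "real p * real_of_int bs = real_of_int (int p * bs)" by simp
    finally show ?thesis by (simp only: of_int_less_iff)
  qed
  from \<delta>_X_dichotomy consider t where "\<delta> \<xi> \<in> U (int p * t)" "1 \<le> t" "int p * t < (int p - 1) * b"
    | "\<delta> \<xi> \<in> P ((int p - 1) * b + 1)" by blast
  then show ?thesis
  proof cases
    case (1 t)
    interpret refined_I v p T \<gamma> \<sigma> b e \<omega> t by unfold_locales (use 1 in auto)
    have bst: "bs = b + int p * t" using raise_I(2)[OF 1 \<rho> b_not_dvd] unfolding bs_eq U_iff by linarith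
    have "int p * bs < (int p ^ 2 - int p + 1) * b \<longleftrightarrow> int p ^ 2 * t < (int p - 1) ^ 2 * b"
      unfolding bst by (auto simp: algebra_simps power2_eq_square)
    moreover have "real_of_int (bs - b) / real p = real_of_int t" by (simp add: bst)
    moreover have "real (card (vals r))
        = real_of_int (generic r - (if int p ^ 2 * t < (int p - 1) ^ 2 * b then t else saturated r))"
      using arg_cong[OF card_vals_I[of r], of real_of_int] by (simp only: of_int_of_nat_eq)
    ultimately show ?thesis unfolding iff g[symmetric] s[symmetric] by (simp split: if_split)
  next
    case 2
    interpret refined_II v p T \<gamma> \<sigma> b e \<omega> by unfold_locales (rule 2)
    \<comment> \<open>The digits of v(\<rho>) = b are s = b and j = p - 1.\<close>
    have eq: "int p * b - int (p - 1) * b = b" using p_gt1 by (simp add: of_nat_diff algebra_simps)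
    have "\<delta> \<rho> \<in> U (b + int p * b)"
      using raise_II(2)[OF 2, of \<rho> b "p - 1"] \<rho> b_not_dvd p_gt1 unfolding eq by simp
    then have bsb: "bs = int p * b" unfolding bs_eq U_iff by linarith
    have "(int p - 1) * b \<ge> 0" using p_gt1 b_pos by simp
    then have "\<not> int p * bs < (int p ^ 2 - int p + 1) * b" unfolding bsb by (simp add: algebra_simps power2_eq_square)
    moreover have "real (card (vals r)) = real_of_int (generic r - saturated r)"
      using arg_cong[OF card_vals_II[of r], of real_of_int] by (simp only: of_int_of_nat_eq)
    ultimately show ?thesis unfolding iff g[symmetric] s[symmetric] by simp
  qed
qed

end

section \<open>Finite-dimensional spaces over a \<open>p\<close>-adic field\<close>

definition sfield :: "'a::field set \<Rightarrow> bool" where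
  "sfield F \<longleftrightarrow> subrng F \<and> (\<forall>x\<in>F. inverse x \<in> F)"

lemma sfieldD:
  assumes "sfield F"
  shows "subrng F" "x \<in> F \<Longrightarrow> inverse x \<in> F" "x \<in> F \<Longrightarrow> y \<in> F \<Longrightarrow> x / y \<in> F"
    "x \<in> F \<Longrightarrow> x powi k \<in> F"
proof -
  show F: "subrng F" and i: "x \<in> F \<Longrightarrow> inverse x \<in> F" for x using assms by (auto simp: sfield_def)
  show "x \<in> F \<Longrightarrow> y \<in> F \<Longrightarrow> x / y \<in> F" unfolding divide_inverse by (intro subrngD(4)[OF F] i)
  show "x \<in> F \<Longrightarrow> x powi k \<in> F" unfolding power_int_def using subrng_power[OF F] i by auto
qed

text \<open>\<open>F\<close> may be a mere subring, which covers both vector spaces over Q_p and the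
  lattice Z_p[\<zeta>]; independence is not part of the notion.\<close>

definition lspan :: "'a::comm_ring_1 set \<Rightarrow> (nat \<Rightarrow> 'a) \<Rightarrow> nat \<Rightarrow> 'a set" where
  "lspan F f n = {\<Sum>i<n. a i * f i | a. \<forall>i. a i \<in> F}"

lemma lspanI: "(\<And>i. a i \<in> F) \<Longrightarrow> x = (\<Sum>i<n. a i * f i) \<Longrightarrow> x \<in> lspan F f n"
  unfolding lspan_def by auto

lemma lspanE: assumes "x \<in> lspan F f n" obtains a where "\<forall>i. a i \<in> F" "x = (\<Sum>i<n. a i * f i)"
  using assms unfolding lspan_def by auto

lemma lspan_0: "0 \<in> F \<Longrightarrow> lspan F f 0 = {0}"
  unfolding lspan_def by auto

lemma lspan_Suc: "0 \<in> F \<Longrightarrow> lspan F f (Suc n) = {u + c * f n | u c. u \<in> lspan F f n \<and> c \<in> F}"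
proof (intro equalityI subsetI)
  fix x assume "x \<in> lspan F f (Suc n)"
  then obtain a where "\<forall>i. a i \<in> F" "x = (\<Sum>i<n. a i * f i) + a n * f n" unfolding lspan_def by auto
  then show "x \<in> {u + c * f n | u c. u \<in> lspan F f n \<and> c \<in> F}" unfolding lspan_def by blast
next
  fix x assume "x \<in> {u + c * f n | u c. u \<in> lspan F f n \<and> c \<in> F}"
  then obtain a c where a: "\<forall>i. a i \<in> F" "c \<in> F" "x = (\<Sum>i<n. a i * f i) + c * f n" unfolding lspan_def by auto
  define a' where "a' i = (if i < n then a i else c)" for i
  have "x = (\<Sum>i<Suc n. a' i * f i)" unfolding a(3) a'_def by simp
  moreover have "\<forall>i. a' i \<in> F" using a by (simp add: a'_def)
  ultimately show "x \<in> lspan F f (Suc n)" unfolding lspan_def by blast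
qed

lemma lspan_closed:
  assumes F: "subrng F"
  shows "x \<in> lspan F f n \<Longrightarrow> y \<in> lspan F f n \<Longrightarrow> x + y \<in> lspan F f n"
    and "x \<in> lspan F f n \<Longrightarrow> c \<in> F \<Longrightarrow> c * x \<in> lspan F f n"
    and "0 \<in> lspan F f n" and "i < n \<Longrightarrow> c \<in> F \<Longrightarrow> c * f i \<in> lspan F f n"
proof -
  show "x + y \<in> lspan F f n" if "x \<in> lspan F f n" "y \<in> lspan F f n"
  proof -
    from that obtain a a' where "\<forall>i. a i \<in> F" "\<forall>i. a' i \<in> F" "x = (\<Sum>i<n. a i * f i)" "y = (\<Sum>i<n. a' i * f i)"
      unfolding lspan_def by auto
    then have "x + y = (\<Sum>i<n. (a i + a' i) * f i)" "\<forall>i. a i + a' i \<in> F"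
      using subrngD(6)[OF F] by (simp_all add: sum.distrib distrib_right)
    then show ?thesis by (intro lspanI[of "\<lambda>i. a i + a' i"]) auto
  qed
  show "c * x \<in> lspan F f n" if "x \<in> lspan F f n" "c \<in> F"
  proof -
    from that obtain a where "\<forall>i. a i \<in> F" "x = (\<Sum>i<n. a i * f i)" unfolding lspan_def by auto
    then have "c * x = (\<Sum>i<n. (c * a i) * f i)" "\<forall>i. c * a i \<in> F"
      using subrngD(4)[OF F that(2)] by (simp_all add: sum_distrib_left mult.assoc)
    then show ?thesis by (intro lspanI[of "\<lambda>i. c * a i"]) auto
  qed
  have "(\<Sum>i<n. 0 * f i) \<in> lspan F f n" using subrngD(2)[OF F] by (intro lspanI[of "\<lambda>_. 0"]) auto
  then show "0 \<in> lspan F f n" by simp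
  show "c * f i \<in> lspan F f n" if "i < n" "c \<in> F"
  proof -
    have "(\<Sum>j<n. (if j = i then c else 0) * f j) = (\<Sum>j<n. if j = i then c * f i else 0)" by (intro sum.cong) auto
    then have "c * f i = (\<Sum>j<n. (if j = i then c else 0) * f j)" using that(1) by simp
    moreover have "\<forall>j. (if j = i then c else 0) \<in> F" using that(2) subrngD(2)[OF F] by auto
    ultimately show ?thesis unfolding lspan_def by (intro CollectI exI[of _ "\<lambda>j. if j = i then c else 0"]) auto
  qed
qed

lemma lspan_sum: "subrng F \<Longrightarrow> (\<And>i. i \<in> I \<Longrightarrow> h i \<in> lspan F f n) \<Longrightarrow> sum h I \<in> lspan F f n"
  by (induction I rule: infinite_finite_induct) (simp_all add: lspan_closed)

lemma freshman_dream_power: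
  fixes a b :: "'a::comm_ring_1"
  assumes M: "subrng M" "a \<in> M" "b \<in> M" and p: "Factorial_Ring.prime p"
  shows "\<exists>c\<in>M. (a + b) ^ (p ^ d) - (a ^ (p ^ d) + b ^ (p ^ d)) = of_nat p * c"
proof (induction d)
  case 0
  show ?case using subrngD(2)[OF M(1)] by (intro bexI[of _ 0]) auto
next
  case (Suc d)
  then obtain c where c: "c \<in> M" "(a + b) ^ (p ^ d) - (a ^ (p ^ d) + b ^ (p ^ d)) = of_nat p * c" by blast
  define A B where "A = a ^ (p ^ d)" and "B = b ^ (p ^ d)"
  have AB: "A \<in> M" "B \<in> M" "of_nat p * c \<in> M" unfolding A_def B_def
    using M c by (auto intro: subrng_power subrngD subrng_of_nat)
  obtain c1 where c1: "c1 \<in> M" "((A + B) + of_nat p * c) ^ p - ((A + B) ^ p + (of_nat p * c) ^ p) = of_nat p * c1"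
    using freshman_dream[OF M(1) _ AB(3) p, of "A + B"] AB subrngD(6)[OF M(1)] by blast
  obtain c2 where c2: "c2 \<in> M" "(A + B) ^ p - (A ^ p + B ^ p) = of_nat p * c2"
    using freshman_dream[OF M(1) AB(1,2) p] by blast
  have pw: "x ^ (p ^ Suc d) = (x ^ (p ^ d)) ^ p" for x :: 'a unfolding power_mult[symmetric] by (simp add: mult.commute)
  have "(a + b) ^ (p ^ d) = (A + B) + of_nat p * c" using c(2) by (simp add: A_def B_def algebra_simps)
  then have "(a + b) ^ (p ^ Suc d) = ((A + B) + of_nat p * c) ^ p" unfolding pw by simp
  moreover have "((A + B) + of_nat p * c) ^ p = A ^ p + B ^ p + (of_nat p * c) ^ p + of_nat p * (c1 + c2)"
    using c1(2) c2(2) by (simp add: algebra_simps)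
  moreover have "(of_nat p * c) ^ p = of_nat p * (c * (of_nat p * c) ^ (p - 1))"
    using prime_gt_0_nat[OF p] by (simp add: power_eq_if mult.assoc)
  moreover have "A ^ p = a ^ (p ^ Suc d)" "B ^ p = b ^ (p ^ Suc d)" unfolding pw A_def B_def by simp_all
  ultimately have "(a + b) ^ (p ^ Suc d) - (a ^ (p ^ Suc d) + b ^ (p ^ Suc d))
      = of_nat p * (c * (of_nat p * c) ^ (p - 1) + (c1 + c2))"
    by (simp only: distrib_left add.assoc) simp
  moreover have "c * (of_nat p * c) ^ (p - 1) + (c1 + c2) \<in> M"
    using M(1) c(1) c1(1) c2(1) AB(3) by (auto intro: subrngD subrng_power)
  ultimately show ?case by blast
qed

text \<open>Fixed points of the q-power map on M / p M. Divisibility is asked inside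
  \<open>M\<close>, since elements of positive valuation in a lattice are not known in advance to be
  p times a lattice element.\<close>

definition frob_fixed :: "'a::comm_ring_1 set \<Rightarrow> nat \<Rightarrow> nat \<Rightarrow> 'a set" where
  "frob_fixed M p q = {y \<in> M. \<exists>c\<in>M. y ^ q - y = of_nat p * c}"

lemma frob_fixed_add:
  assumes M: "subrng M" and p: "Factorial_Ring.prime p" and x: "x \<in> frob_fixed M p (p ^ d)" "y \<in> frob_fixed M p (p ^ d)"
  shows "x + y \<in> frob_fixed M p (p ^ d)"
proof -
  obtain c1 c2 where c: "x \<in> M" "y \<in> M" "c1 \<in> M" "c2 \<in> M" "x ^ (p ^ d) - x = of_nat p * c1" "y ^ (p ^ d) - y = of_nat p * c2"
    using x by (auto simp: frob_fixed_def)
  obtain c3 where c3: "c3 \<in> M" "(x + y) ^ (p ^ d) - (x ^ (p ^ d) + y ^ (p ^ d)) = of_nat p * c3"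
    using freshman_dream_power[OF M c(1,2) p] by blast
  have "(x + y) ^ (p ^ d) - (x + y) = of_nat p * (c1 + c2 + c3)" using c c3(2) by (simp add: algebra_simps)
  moreover have "c1 + c2 + c3 \<in> M" "x + y \<in> M" using M c c3 by (auto intro: subrngD)
  ultimately show ?thesis by (auto simp: frob_fixed_def)
qed

lemma frob_fixed_of_nat:
  assumes M: "subrng M" and p: "Factorial_Ring.prime p"
  shows "of_nat n \<in> frob_fixed M p (p ^ d)"
proof (induction n)
  case 0
  show ?case using subrngD(2)[OF M] prime_gt_0_nat[OF p]
    by (auto simp: frob_fixed_def power_0_left intro!: bexI[of _ 0])
next
  case (Suc n)
  have "1 \<in> frob_fixed M p (p ^ d)" using subrngD(1,2)[OF M] by (auto simp: frob_fixed_def intro!: bexI[of _ 0])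
  from frob_fixed_add[OF M p this Suc] show ?case by simp
qed

lemma frob_fixed_sum:
  assumes M: "subrng M" and p: "Factorial_Ring.prime p" and h: "\<And>i. i \<in> I \<Longrightarrow> h i \<in> frob_fixed M p (p ^ d)"
  shows "sum h I \<in> frob_fixed M p (p ^ d)"
  using h frob_fixed_of_nat[OF M p, of 0 d]
  by (induction I rule: infinite_finite_induct) (simp_all add: frob_fixed_add[OF M p])

section \<open>Complete subspaces and bounded coefficients\<close>

context nval begin

definition cauchy :: "(nat \<Rightarrow> 'a) \<Rightarrow> bool" where
  "cauchy s \<longleftrightarrow> (\<forall>n. \<exists>M. \<forall>i\<ge>M. \<forall>j\<ge>M. s i - s j \<in> P n)"
definition limit :: "(nat \<Rightarrow> 'a) \<Rightarrow> 'a \<Rightarrow> bool" where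
  "limit s x \<longleftrightarrow> (\<forall>n. \<exists>M. \<forall>i\<ge>M. s i - x \<in> P n)"
definition compl :: "'a set \<Rightarrow> bool" where
  "compl A \<longleftrightarrow> (\<forall>s. (\<forall>i. s i \<in> A) \<longrightarrow> cauchy s \<longrightarrow> (\<exists>x\<in>A. limit s x))"

lemma complD: "compl A \<Longrightarrow> (\<And>i. s i \<in> A) \<Longrightarrow> cauchy s \<Longrightarrow> \<exists>x\<in>A. limit s x"
  unfolding compl_def by blast
lemma cauchyD: "cauchy s \<Longrightarrow> \<exists>M. \<forall>i\<ge>M. \<forall>j\<ge>M. s i - s j \<in> P n" by (simp add: cauchy_def)
lemma limitD: "limit s x \<Longrightarrow> \<exists>M. \<forall>i\<ge>M. s i - x \<in> P n" by (simp add: limit_def)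

text \<open>Otherwise approximations from \<open>A\<close> would form a Cauchy sequence with limit
  x.\<close>

lemma far_from_complete:
  assumes A: "compl A" and x: "x \<notin> A"
  shows "\<exists>c. \<forall>u\<in>A. x - u \<notin> P c"
proof (rule ccontr)
  assume "\<not> ?thesis"
  then have "\<forall>n. \<exists>u\<in>A. x - u \<in> P n" by blast
  then obtain u where u: "\<And>n. u n \<in> A" "\<And>n. x - u n \<in> P n" by metis
  have close: "x - u (int i) \<in> P n" if "i \<ge> nat n" for i n
    using P_mono[OF u(2)[of "int i"]] that by simp
  have "cauchy (\<lambda>i. u (int i))" unfolding cauchy_def
  proof (intro allI exI impI)
    fix n i j assume "i \<ge> nat n" "j \<ge> nat n"
    then have "(x - u (int j)) - (x - u (int i)) \<in> P n" by (intro P_diff close)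
    then show "u (int i) - u (int j) \<in> P n" by simp
  qed
  then obtain y where y: "y \<in> A" "limit (\<lambda>i. u (int i)) y" using complD[OF A, of "\<lambda>i. u (int i)"] u(1) by blast
  have "x - y \<in> P n" for n
  proof -
    obtain M where M: "\<forall>i\<ge>M. u (int i) - y \<in> P n" using limitD[OF y(2)] by blast
    define i where "i = max M (nat n)"
    have "(x - u (int i)) + (u (int i) - y) \<in> P n" using M by (intro P_add close) (auto simp: i_def)
    then show ?thesis by simp
  qed
  then have "x - y = 0" by (rule P_all_zero)
  with y x show False by simp
qed

text \<open>Equivalence of norms, by adding one vector at a time: a vector outside a complete subspace
  keeps a bounded valuation distance from it, which bounds its coefficient.\<close>

lemma lspan_complete_bounded:
  assumes F: "sfield F" and Fc: "compl F"
  shows "compl (lspan F f n) \<and>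
    (\<exists>C\<ge>0. \<forall>m. \<forall>x\<in>lspan F f n. x \<in> P m \<longrightarrow> (\<exists>a. (\<forall>i. a i \<in> F \<and> a i \<in> P (m - C)) \<and> x = (\<Sum>i<n. a i * f i)))"
proof (induction n)
  case 0
  have F0: "0 \<in> F" by (rule subrngD(2)[OF sfieldD(1)[OF F]])
  have "compl (lspan F f 0)" unfolding lspan_0[OF F0] compl_def limit_def by auto
  moreover have "\<forall>m. \<forall>x\<in>lspan F f 0. x \<in> P m \<longrightarrow> (\<exists>a. (\<forall>i. a i \<in> F \<and> a i \<in> P (m - 0)) \<and> x = (\<Sum>i<0. a i * f i))"
    unfolding lspan_0[OF F0] using F0 by (auto intro!: exI[of _ "\<lambda>_. 0"])
  ultimately show ?case by blast
next
  case (Suc n)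
  have Fr: "subrng F" and F0: "0 \<in> F" using sfieldD(1)[OF F] subrngD(2)[OF sfieldD(1)[OF F]] by auto
  let ?V = "lspan F f n"
  obtain C where C: "C \<ge> 0" "\<And>m x. x \<in> ?V \<Longrightarrow> x \<in> P m \<Longrightarrow> \<exists>a. (\<forall>i. a i \<in> F \<and> a i \<in> P (m - C)) \<and> x = (\<Sum>i<n. a i * f i)"
    using Suc by blast
  have Vc: "compl ?V" using Suc by blast
  show ?case
  proof (cases "f n \<in> ?V")
    case True
    have eq: "lspan F f (Suc n) = ?V"
    proof (intro equalityI subsetI)
      fix x assume "x \<in> lspan F f (Suc n)"
      then show "x \<in> ?V" unfolding lspan_Suc[OF F0] using lspan_closed(1,2)[OF Fr] True by auto
    next
      fix x assume "x \<in> ?V"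
      then have "x = x + 0 * f n" "x \<in> ?V" by auto
      then show "x \<in> lspan F f (Suc n)" unfolding lspan_Suc[OF F0] using F0 by blast
    qed
    have "\<exists>a. (\<forall>i. a i \<in> F \<and> a i \<in> P (m - C)) \<and> x = (\<Sum>i<Suc n. a i * f i)" if x: "x \<in> ?V" "x \<in> P m" for x m
    proof -
      obtain a where a: "\<forall>i. a i \<in> F \<and> a i \<in> P (m - C)" "x = (\<Sum>i<n. a i * f i)" using C(2)[OF x] by blast
      then show ?thesis using F0 by (intro exI[of _ "\<lambda>i. if i < n then a i else 0"]) auto
    qed
    then show ?thesis unfolding eq using Vc C(1) by blast
  next
    case False
    obtain c where c: "\<And>u. u \<in> ?V \<Longrightarrow> f n - u \<notin> P c" using far_from_complete[OF Vc False] by blast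
    \<comment> \<open>A coefficient k of too small valuation would bring f n within the forbidden
      distance of -u / k.\<close>
    have coeff: "k \<in> P (m - c)" if u: "u \<in> ?V" "k \<in> F" "u + k * f n \<in> P m" for u k m
    proof (rule ccontr)
      assume "k \<notin> P (m - c)"
      then have k: "k \<noteq> 0" "v k < m - c" by (auto simp: P_iff)
      have "(u + k * f n) / k \<in> P (m - v k)" using u(3) U_v[OF k(1)] by (rule P_divide)
      moreover have "(u + k * f n) / k = f n - (- inverse k) * u" using k(1) by (simp add: field_simps)
      moreover have "(- inverse k) * u \<in> ?V" using u F k Fr
        by (intro lspan_closed(2)[OF Fr] subrngD(5)[OF Fr] sfieldD(2)[OF F])
      ultimately show False using c[of "(- inverse k) * u"] P_mono[of _ "m - v k" c] k(2) by simp
    qed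
    define w where "w = v (f n)"
    \<comment> \<open>c measures the loss in the new coefficient, \<open>\<bar>c - w\<bar>\<close>
      the loss in x - k f n, and \<open>C\<close> the loss on the old span; absolute values avoid
      distinguishing signs.\<close>
    define C' where "C' = C + \<bar>c\<bar> + \<bar>c - w\<bar>"
    have C': "C' \<ge> 0" using C(1) by (simp add: C'_def)
    have "\<exists>a. (\<forall>i. a i \<in> F \<and> a i \<in> P (m - C')) \<and> x = (\<Sum>i<Suc n. a i * f i)"
      if x: "x \<in> lspan F f (Suc n)" "x \<in> P m" for x m
    proof -
      obtain u k where uk: "u \<in> ?V" "k \<in> F" "x = u + k * f n" using x(1) unfolding lspan_Suc[OF F0] by auto
      have k: "k \<in> P (m - c)" using coeff[OF uk(1,2)] x(2) uk(3) by simp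
      have "k * f n \<in> P (m - c + w)" unfolding w_def by (intro P_mult k) auto
      then have "x - k * f n \<in> P (m - \<bar>c - w\<bar>)" using P_mono[OF x(2)] by (intro P_diff) (auto intro: P_mono)
      then have "u \<in> P (m - \<bar>c - w\<bar>)" using uk(3) by simp
      from C(2)[OF uk(1) this] obtain a where a: "\<forall>i. a i \<in> F \<and> a i \<in> P (m - \<bar>c - w\<bar> - C)" "u = (\<Sum>i<n. a i * f i)" by blast
      define a' where "a' i = (if i < n then a i else k)" for i
      have "a' i \<in> F \<and> a' i \<in> P (m - C')" for i
        using a(1) uk(2) P_mono[of "a i" "m - \<bar>c - w\<bar> - C" "m - C'"] P_mono[OF k, of "m - C'"] C(1)
        by (auto simp: a'_def C'_def)
      moreover have "x = (\<Sum>i<Suc n. a' i * f i)" using uk(3) a(2) by (simp add: a'_def)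
      ultimately show ?thesis by blast
    qed
    moreover have "compl (lspan F f (Suc n))" unfolding compl_def
    proof (intro allI impI)
      fix s assume s: "\<forall>i. s i \<in> lspan F f (Suc n)" "cauchy s"
      then have "\<forall>i. \<exists>u k. u \<in> ?V \<and> k \<in> F \<and> s i = u + k * f n" unfolding lspan_Suc[OF F0] by blast
      then obtain u k where uk: "\<And>i. u i \<in> ?V" "\<And>i. k i \<in> F" "\<And>i. s i = u i + k i * f n" by metis
      have dV: "u i - u j \<in> ?V" for i j
        using lspan_closed(1)[OF Fr uk(1)[of i] lspan_closed(2)[OF Fr uk(1)[of j], of "-1"]]
          subrngD(5)[OF Fr subrngD(1)[OF Fr]] by simp
      have ck: "cauchy k" unfolding cauchy_def
      proof
        fix m
        obtain M where M: "\<forall>i\<ge>M. \<forall>j\<ge>M. s i - s j \<in> P (m + c)" using cauchyD[OF s(2)] by blast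
        have "k i - k j \<in> P m" if "i \<ge> M" "j \<ge> M" for i j
        proof -
          have "s i - s j = (u i - u j) + (k i - k j) * f n" unfolding uk(3) by (simp add: algebra_simps)
          then have "(u i - u j) + (k i - k j) * f n \<in> P (m + c)" using M that by metis
          from coeff[OF dV subrngD(3)[OF Fr uk(2) uk(2)] this] show ?thesis by simp
        qed
        then show "\<exists>M. \<forall>i\<ge>M. \<forall>j\<ge>M. k i - k j \<in> P m" by blast
      qed
      obtain k0 where k0: "k0 \<in> F" "limit k k0" using complD[OF Fc uk(2) ck] by blast
      have cu: "cauchy u" unfolding cauchy_def
      proof
        fix m
        obtain M1 where M1: "\<forall>i\<ge>M1. \<forall>j\<ge>M1. s i - s j \<in> P m" using cauchyD[OF s(2)] by blast
        obtain M2 where M2: "\<forall>i\<ge>M2. \<forall>j\<ge>M2. k i - k j \<in> P (m - w)" using cauchyD[OF ck] by blast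
        have "u i - u j \<in> P m" if ij: "i \<ge> max M1 M2" "j \<ge> max M1 M2" for i j
        proof -
          have 1: "(k i - k j) * f n \<in> P ((m - w) + w)" using M2 ij unfolding w_def by (intro P_mult) auto
          have 2: "s i - s j \<in> P m" using M1 ij by simp
          have "u i - u j = (s i - s j) - (k i - k j) * f n" unfolding uk(3) by (simp add: algebra_simps)
          then show ?thesis using P_diff[OF 2, of "(k i - k j) * f n"] 1 by simp
        qed
        then show "\<exists>M. \<forall>i\<ge>M. \<forall>j\<ge>M. u i - u j \<in> P m" by blast
      qed
      obtain u0 where u0: "u0 \<in> ?V" "limit u u0" using complD[OF Vc uk(1) cu] by blast
      have "limit s (u0 + k0 * f n)" unfolding limit_def
      proof
        fix m
        obtain M1 where M1: "\<forall>i\<ge>M1. u i - u0 \<in> P m" using limitD[OF u0(2)] by blast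
        obtain M2 where M2: "\<forall>i\<ge>M2. k i - k0 \<in> P (m - w)" using limitD[OF k0(2)] by blast
        have "s i - (u0 + k0 * f n) \<in> P m" if i: "i \<ge> max M1 M2" for i
        proof -
          have 1: "(k i - k0) * f n \<in> P ((m - w) + w)" using M2 i unfolding w_def by (intro P_mult) auto
          have "s i - (u0 + k0 * f n) = (u i - u0) + (k i - k0) * f n" unfolding uk(3) by (simp add: algebra_simps)
          moreover have "u i - u0 \<in> P m" using M1 i by simp
          ultimately show ?thesis using P_add[of "u i - u0" m "(k i - k0) * f n"] 1 by (simp only: diff_add_cancel)
        qed
        then show "\<exists>M. \<forall>i\<ge>M. s i - (u0 + k0 * f n) \<in> P m" by blast
      qed
      moreover have "u0 + k0 * f n \<in> lspan F f (Suc n)" unfolding lspan_Suc[OF F0] using u0 k0 by blast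
      ultimately show "\<exists>x\<in>lspan F f (Suc n). limit s x" by blast
    qed
    ultimately show ?thesis using C' by blast
  qed
qed

end

context pval begin

lemma frob_diff_power:
  assumes xy: "x \<in> P 0" "y \<in> P 0"
  shows "(x - y) ^ (p ^ k) - (x ^ (p ^ k) - y ^ (p ^ k)) \<in> P 1"
proof (induction k)
  case (Suc k)
  define A B where "A = (x - y) ^ (p ^ k)" and "B = x ^ (p ^ k) - y ^ (p ^ k)"
  have AB: "A \<in> P 0" "B \<in> P 0" unfolding A_def B_def using xy by (auto intro: P_power0 P_diff)
  have "A - B \<in> P 1" using Suc by (simp add: A_def B_def)
  from frob_pow_cong[OF AB this] have "A ^ p - B ^ p \<in> P 1" by (auto intro: P_mono)
  moreover have "B ^ p - ((x ^ (p ^ k)) ^ p - (y ^ (p ^ k)) ^ p) \<in> P 1"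
    unfolding B_def using xy by (intro frob_diff P_power0)
  ultimately have "A ^ p - ((x ^ (p ^ k)) ^ p - (y ^ (p ^ k)) ^ p) \<in> P 1" by (rule P_trans)
  moreover have "A ^ p = (x - y) ^ (p ^ Suc k)" "(x ^ (p ^ k)) ^ p = x ^ (p ^ Suc k)" "(y ^ (p ^ k)) ^ p = y ^ (p ^ Suc k)"
    by (simp_all add: A_def power_mult[symmetric] mult.commute)
  ultimately show ?case by simp
qed simp

lemma pow_q_cong:
  assumes "x \<in> P 0" "y \<in> P 0" "x - y \<in> P m" "m \<ge> 1" "d \<ge> 1"
  shows "x ^ (p ^ d) - y ^ (p ^ d) \<in> P (m + 1)"
proof -
  have "x ^ (p ^ k) - y ^ (p ^ k) \<in> P (m + int k)" for k
  proof (induction k)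
    case (Suc k)
    have "(x ^ (p ^ k)) ^ p - (y ^ (p ^ k)) ^ p \<in> P (m + int k + 1)"
      using assms Suc by (intro frob_pow_cong P_power0) auto
    moreover have "(x ^ (p ^ k)) ^ p = x ^ (p ^ Suc k)" "(y ^ (p ^ k)) ^ p = y ^ (p ^ Suc k)"
      by (simp_all add: power_mult[symmetric] mult.commute)
    ultimately show ?case by (simp add: algebra_simps)
  qed (use assms in simp)
  from P_mono[OF this[of d]] assms(5) show ?thesis by simp
qed

end

section \<open>Teichmueller representatives and unramified extensions\<close>

locale padic_base = pval v p for v :: "'a::field_char_0 \<Rightarrow> int" and p +
  fixes Q :: "'a set"
  assumes Q_field: "sfield Q" and Q_complete: "compl Q"
    and Q_dense: "x \<in> Q \<Longrightarrow> \<exists>c. x - of_rat c \<in> P n"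
begin

lemmas Q_ring = sfieldD(1)[OF Q_field]

text \<open>Density gives a rational approximation; integrality forces its denominator to be prime
  to p, and Bezout inverts the denominator modulo p^D.\<close>

lemma residue_Q:
  assumes "a \<in> Q" "a \<in> P 0"
  shows "\<exists>m<p ^ D. a - of_nat m \<in> P (int D * vp)"
proof (cases "D = 0")
  case False
  obtain c where c: "a - of_rat c \<in> P (int D * vp)" using Q_dense[OF assms(1)] by blast
  obtain num den where nd: "quotient_of c = (num, den)" by (cases "quotient_of c") auto
  have cd: "coprime num den" "den > 0" "c = of_int num / of_int den"
    using quotient_of_coprime[OF nd] quotient_of_denom_pos[OF nd] quotient_of_div[OF nd] by auto
  have rc: "of_rat c = (of_int num / of_int den :: 'a)" unfolding cd(3) by (simp add: of_rat_divide)
  have "int D * vp \<ge> 0" using vp_pos by simp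
  then have "of_rat c \<in> P 0" using P_diff[OF assms(2) P_mono[OF c]] by simp
  have "\<not> int p dvd den"
  proof
    assume d: "int p dvd den"
    have "\<not> int p dvd num"
    proof
      assume "int p dvd num"
      with d have "int p dvd 1" using cd(1) coprime_common_divisor[of num den "int p"] by simp
      then show False using p_gt1 by simp
    qed
    have dn: "(of_int den :: 'a) \<noteq> 0" using cd(2) by simp
    have "(of_int num / of_int den :: 'a) \<in> U (0 - v (of_int den))"
      by (rule U_divide[OF of_int_U[OF \<open>\<not> int p dvd num\<close>] U_v[OF dn]])
    with \<open>of_rat c \<in> P 0\<close> rc have "v (of_int den) \<le> 0" using U_P_iff by fastforce
    moreover have "v (of_int den) \<ge> 1" using of_int_P1[OF d] dn by (simp add: P_iff)
    ultimately show False by simp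
  qed
  then have denU: "of_int den \<in> U 0" by (rule of_int_U)
  have "coprime (int p) den" using \<open>\<not> int p dvd den\<close> p_prime by (simp add: prime_imp_coprime)
  then have "coprime den (int p ^ D)" by (simp add: coprime_commute)
  then have "gcd den (int p ^ D) = 1" by simp
  then obtain s t where st: "s * den + t * int p ^ D = 1" using bezout_int[of den "int p ^ D"] by auto
  define m where "m = nat ((num * s) mod int p ^ D)"
  have m: "int m = (num * s) mod int p ^ D" unfolding m_def by simp
  have "int m < int p ^ D" unfolding m by simp
  then have "int m < int (p ^ D)" by simp
  then have mless: "m < p ^ D" by (simp only: of_nat_less_iff)
  have "num - den * int m = num - den * (num * s - int p ^ D * ((num * s) div int p ^ D))"
    unfolding m by (simp add: minus_mult_div_eq_mod)
  also have "\<dots> = num * (1 - s * den) + int p ^ D * (den * ((num * s) div int p ^ D))" by (simp add: algebra_simps)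
  also have "1 - s * den = int p ^ D * t" using st by (simp add: algebra_simps)
  finally have e: "num - den * int m = int p ^ D * (num * t + den * ((num * s) div int p ^ D))" by (simp add: algebra_simps)
  have "(of_int (num - den * int m) :: 'a) = of_nat p ^ D * of_int (num * t + den * ((num * s) div int p ^ D))"
    unfolding e of_int_mult by simp
  moreover have "of_nat p ^ D * of_int (num * t + den * ((num * s) div int p ^ D)) \<in> P (int D * vp + 0)"
    by (intro P_mult U_P[OF U_power] p_U of_int_P)
  ultimately have "of_int (num - den * int m) \<in> P (int D * vp)" by simp
  from P_divide[OF this denU] have "of_int (num - den * int m) / of_int den \<in> P (int D * vp)" by simp
  moreover have "of_int (num - den * int m) / of_int den = of_rat c - (of_nat m :: 'a)"
    unfolding rc using cd(2) by (simp add: field_simps)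
  ultimately have "of_rat c - of_nat m \<in> P (int D * vp)" by simp
  with c have "a - of_nat m \<in> P (int D * vp)" by (rule P_trans)
  with mless show ?thesis by blast
qed (use assms in \<open>auto intro!: exI[of _ 0]\<close>)

lemma Zp_ring: "subrng (Q \<inter> P 0)"
  using Q_ring subrng_P0 unfolding subrng_def by blast

text \<open>a is a natural number plus p z with z in Z_p, and both parts are fixed modulo p.\<close>

lemma Zp_frob_fixed: "a \<in> Q \<Longrightarrow> a \<in> P 0 \<Longrightarrow> a \<in> frob_fixed (Q \<inter> P 0) p (p ^ d)"
proof -
  assume a: "a \<in> Q" "a \<in> P 0"
  obtain m where m: "a - of_nat m \<in> P vp" using residue_Q[OF a, of 1] by auto
  define z where "z = (a - of_nat m) / of_nat p"
  have z: "z \<in> Q \<inter> P 0" unfolding z_def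
    using P_divide[OF m p_U] a(1) by (auto intro!: sfieldD(3)[OF Q_field] subrngD(3)[OF Q_ring] subrng_of_nat[OF Q_ring])
  have zp: "of_nat p * z \<in> Q \<inter> P 0" by (intro subrngD(4)[OF Zp_ring] z subrng_of_nat[OF Zp_ring])
  obtain q where q: "p ^ d = Suc q" by (metis p_pos gr0_implies_Suc zero_less_power)
  have "(of_nat p * z) ^ (p ^ d) - of_nat p * z = of_nat p * (z * (of_nat p * z) ^ q - z)"
    unfolding q by (simp add: algebra_simps)
  moreover have "z * (of_nat p * z) ^ q - z \<in> Q \<inter> P 0"
    by (intro subrngD(3,4)[OF Zp_ring] subrng_power[OF Zp_ring] z zp)
  ultimately have "of_nat p * z \<in> frob_fixed (Q \<inter> P 0) p (p ^ d)" using zp unfolding frob_fixed_def by blast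
  from frob_fixed_add[OF Zp_ring p_prime frob_fixed_of_nat[OF Zp_ring p_prime, of m] this]
  show ?thesis by (simp add: z_def)
qed

context
  fixes f :: "nat \<Rightarrow> 'a" and n :: nat
begin

text \<open>By equivalence of norms the coefficients of integral vectors have bounded denominators,
  so finitely many of their digits determine the residue.\<close>

lemma finite_residues: "\<exists>R. finite R \<and> (\<forall>x\<in>lspan Q f n. x \<in> P 0 \<longrightarrow> (\<exists>y\<in>R. x - y \<in> P 1))"
proof -
  obtain C where C: "C \<ge> 0" "\<And>x. x \<in> lspan Q f n \<Longrightarrow> x \<in> P 0 \<Longrightarrow> \<exists>a. (\<forall>i. a i \<in> Q \<and> a i \<in> P (0 - C)) \<and> x = (\<Sum>i<n. a i * f i)"
    using lspan_complete_bounded[OF Q_field Q_complete, of f n] by blast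
  define s where "s = nat C"
  define W where "W = (\<Sum>i<n. \<bar>v (f i)\<bar>) + 1"
  \<comment> \<open>s powers of p clear the denominators; \<open>nat W\<close> further digits push
    the error, even after multiplication by f i, into \<open>P 1\<close>.\<close>
  define D where "D = s + nat W"
  have vp1: "1 \<le> vp" using vp_pos by simp
  have W: "1 - v (f i) \<le> W" if "i < n" for i
    using member_le_sum[of i "{..<n}" "\<lambda>i. \<bar>v (f i)\<bar>"] that by (simp add: W_def)
  define g where "g m = (\<Sum>i<n. of_nat (m i) / of_nat p ^ s * f i)" for m
  define R where "R = g ` (PiE {..<n} (\<lambda>_. {..<p ^ D}))"
  have "finite R" unfolding R_def by (intro finite_imageI finite_PiE) auto
  moreover have "\<exists>y\<in>R. x - y \<in> P 1" if x: "x \<in> lspan Q f n" "x \<in> P 0" for x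
  proof -
    obtain a where a: "\<forall>i. a i \<in> Q \<and> a i \<in> P (0 - C)" "x = (\<Sum>i<n. a i * f i)" using C(2)[OF x] by blast
    have "\<exists>m<p ^ D. a i * of_nat p ^ s - of_nat m \<in> P (int D * vp)" for i
    proof (rule residue_Q)
      show "a i * of_nat p ^ s \<in> Q" using a(1) by (auto intro: subrngD(4)[OF Q_ring] subrng_power[OF Q_ring] subrng_of_nat[OF Q_ring])
      have "a i * of_nat p ^ s \<in> P ((0 - C) + int s * vp)" using a(1) by (intro P_mult U_P[OF U_power] p_U) auto
      moreover have "C \<le> int s * vp" using C(1) mult_left_mono[OF vp1, of "int s"] by (simp add: s_def)
      ultimately show "a i * of_nat p ^ s \<in> P 0" by (auto intro: P_mono)
    qed
    then obtain m where m: "\<And>i. m i < p ^ D" "\<And>i. a i * of_nat p ^ s - of_nat (m i) \<in> P (int D * vp)" by metis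
    have "x - g (restrict m {..<n}) = (\<Sum>i<n. (a i * of_nat p ^ s - of_nat (m i)) / of_nat p ^ s * f i)"
      unfolding a(2) g_def sum_subtractf[symmetric] by (intro sum.cong) (simp_all add: field_simps)
    also have "\<dots> \<in> P 1"
    proof (rule P_sum)
      fix i assume i: "i \<in> {..<n}"
      have "(a i * of_nat p ^ s - of_nat (m i)) / of_nat p ^ s * f i \<in> P ((int D * vp - int s * vp) + v (f i))"
        by (intro P_mult P_divide U_power p_U m) auto
      moreover have "int D * vp - int s * vp = int (nat W) * vp" by (simp add: D_def algebra_simps)
      moreover have "int (nat W) * 1 \<le> int (nat W) * vp" using vp1 by (intro mult_left_mono) auto
      moreover have "1 - v (f i) \<le> int (nat W)" using W[of i] i by simp
      ultimately show "(a i * of_nat p ^ s - of_nat (m i)) / of_nat p ^ s * f i \<in> P 1"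
        by (elim P_mono) linarith
    qed
    finally have "x - g (restrict m {..<n}) \<in> P 1" .
    moreover have "g (restrict m {..<n}) \<in> R" unfolding R_def using m(1) by (intro imageI iffD2[OF restrict_PiE_iff]) blast
    ultimately show ?thesis by blast
  qed
  ultimately show ?thesis by blast
qed

text \<open>By pigeonhole two Frobenius iterates of x have the same residue; Frobenius is injective
  on residues, so the iterations common to both can be removed.\<close>

lemma frobenius_period:
  assumes K: "subrng (lspan Q f n)" and x: "x \<in> lspan Q f n" "x \<in> P 0"
  shows "\<exists>d\<ge>1. x ^ (p ^ d) - x \<in> P 1"
proof -
  obtain R where R: "finite R" "\<And>x. x \<in> lspan Q f n \<Longrightarrow> x \<in> P 0 \<Longrightarrow> \<exists>y\<in>R. x - y \<in> P 1"
    using finite_residues by blast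
  have "\<exists>y\<in>R. x ^ (p ^ k) - y \<in> P 1" for k
    by (rule R(2)[OF subrng_power[OF K x(1)] P_power0[OF x(2)]])
  then obtain h where h: "\<And>k. h k \<in> R" "\<And>k. x ^ (p ^ k) - h k \<in> P 1" by metis
  have "\<not> inj h"
  proof
    assume "inj h"
    moreover have "finite (range h)" using h(1) R(1) by (auto intro: finite_subset[of _ R])
    ultimately show False using finite_imageD by auto
  qed
  then obtain i j where ij: "i < j" "h i = h j" unfolding inj_def by (metis linorder_neqE_nat)
  define d where "d = j - i"
  have e: "(x ^ (p ^ d)) ^ (p ^ i) = x ^ (p ^ j)"
    using ij(1) by (simp add: power_mult[symmetric] power_add[symmetric] d_def)
  have "x ^ (p ^ j) - x ^ (p ^ i) \<in> P 1"
    using P_diff[OF h(2)[of j] h(2)[of i]] ij(2) by simp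
  moreover have "(x ^ (p ^ d) - x) ^ (p ^ i) - ((x ^ (p ^ d)) ^ (p ^ i) - x ^ (p ^ i)) \<in> P 1"
    using x by (intro frob_diff_power P_power0)
  ultimately have "(x ^ (p ^ d) - x) ^ (p ^ i) \<in> P 1" unfolding e by (rule P_cong[rotated])
  then have "x ^ (p ^ d) - x \<in> P 1" by (rule root_P) simp
  moreover have "d \<ge> 1" using ij(1) by (simp add: d_def)
  ultimately show ?thesis by blast
qed

text \<open>x^(q^k) converges, because q-th powers contract congruences and x^q = x modulo
  \<open>P 1\<close> starts the contraction. The limit stays in the span, which is complete.\<close>

lemma teichmueller:
  assumes K: "subrng (lspan Q f n)" and x: "x \<in> lspan Q f n" "x \<in> P 0"
  shows "\<exists>d\<ge>1. \<exists>\<zeta>\<in>lspan Q f n. \<zeta> ^ (p ^ d) = \<zeta> \<and> x - \<zeta> \<in> P 1"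
proof -
  obtain d where d: "d \<ge> 1" "x ^ (p ^ d) - x \<in> P 1" using frobenius_period[OF K x] by blast
  let ?q = "p ^ d"
  define s where "s k = x ^ (?q ^ k)" for k
  have sK: "s k \<in> lspan Q f n" "s k \<in> P 0" for k unfolding s_def by (intro subrng_power K x P_power0)+
  have s_Suc: "s (Suc k) = s k ^ ?q" for k by (simp add: s_def power_mult[symmetric] mult.commute)
  have step: "s (Suc k) - s k \<in> P (int k + 1)" for k
  proof (induction k)
    case (Suc k)
    have "s (Suc k) ^ ?q - s k ^ ?q \<in> P (int k + 1 + 1)" by (rule pow_q_cong[OF sK(2) sK(2) Suc _ d(1)]) simp
    then show ?case unfolding s_Suc[symmetric] by (simp add: algebra_simps)
  qed (use d(2) in \<open>simp add: s_def\<close>)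
  have diff: "s (M + k) - s M \<in> P (int M + 1)" for M k
  proof (induction k)
    case (Suc k)
    have "s (Suc (M + k)) - s (M + k) \<in> P (int M + 1)" using P_mono[OF step] by simp
    from P_add[OF this Suc] show ?case by simp
  qed simp
  have "cauchy s" unfolding cauchy_def
  proof (intro allI exI impI)
    fix m i j assume ij: "i \<ge> nat m" "j \<ge> nat m"
    have "s i - s (nat m) \<in> P (int (nat m) + 1)" "s j - s (nat m) \<in> P (int (nat m) + 1)"
      using diff[of "nat m" "i - nat m"] diff[of "nat m" "j - nat m"] ij by simp_all
    from P_diff[OF this] have "s i - s j \<in> P (int (nat m) + 1)" by simp
    then show "s i - s j \<in> P m" by (rule P_mono) simp
  qed
  then obtain \<zeta> where \<zeta>: "\<zeta> \<in> lspan Q f n" "limit s \<zeta>"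
    using complD[OF conjunct1[OF lspan_complete_bounded[OF Q_field Q_complete]], of s f n] sK(1) by blast
  have close: "\<exists>k. s k - \<zeta> \<in> P m \<and> s (Suc k) - \<zeta> \<in> P m" for m
  proof -
    obtain M where "\<forall>i\<ge>M. s i - \<zeta> \<in> P m" using limitD[OF \<zeta>(2)] by blast
    then show ?thesis by (intro exI[of _ M]) auto
  qed
  have \<zeta>P: "\<zeta> \<in> P 0"
  proof -
    obtain k where "s k - \<zeta> \<in> P 0" using close by blast
    from P_diff[OF sK(2)[of k] this] show ?thesis by simp
  qed
  have "\<zeta> ^ ?q - \<zeta> \<in> P m" for m
  proof -
    \<comment> \<open>The contraction needs depth at least 1, hence the maximum.\<close>
    obtain k where k: "s k - \<zeta> \<in> P (max m 1)" "s (Suc k) - \<zeta> \<in> P (max m 1)" using close by blast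
    have "s k ^ ?q - \<zeta> ^ ?q \<in> P (max m 1 + 1)" by (rule pow_q_cong[OF sK(2) \<zeta>P k(1) _ d(1)]) simp
    then have "s k ^ ?q - \<zeta> ^ ?q \<in> P m" by (rule P_mono) simp
    from P_diff[OF P_mono[OF k(2)] this, of] show ?thesis unfolding s_Suc by simp
  qed
  then have "\<zeta> ^ ?q = \<zeta>" using P_all_zero[of "\<zeta> ^ ?q - \<zeta>"] by simp
  moreover have "x - \<zeta> \<in> P 1"
  proof -
    obtain k where k: "s k - \<zeta> \<in> P 1" using close by blast
    have "s k - s 0 \<in> P 1" using diff[of 0 k] by simp
    from P_diff[OF k this] show ?thesis by (simp add: s_def)
  qed
  ultimately show ?thesis using d(1) \<zeta>(1) by blast
qed

end

text \<open>The lattice Z_p[\<zeta>] is generated by elements fixed by the q-power map modulo p, so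
  y^q = y modulo p Z_p[\<zeta>] for all its elements. If v(y) > 0, a high power y^(q^k) lies in p
  Z_p[\<zeta>] by equivalence of norms, hence so does y. Thus the lattice elements of positive
  valuation are the multiples of p.\<close>

lemma unramified_root_of_unity:
  assumes d: "d \<ge> 1" and \<zeta>: "\<zeta> ^ (p ^ d) = \<zeta>" and x: "x \<in> lspan Q (\<lambda>i. \<zeta> ^ i) (p ^ d)" "x \<noteq> 0"
  shows "vp dvd v x"
proof -
  let ?q = "p ^ d" and ?Z = "Q \<inter> P 0"
  define M where "M = lspan ?Z (\<lambda>i. \<zeta> ^ i) ?q"
  have q1: "?q > 1" using p_gt1 d by (intro one_less_power) auto
  have \<zeta>P: "\<zeta> \<in> P 0"
  proof (cases "\<zeta> = 0")
    case False
    have "\<zeta> \<in> U (int ?q * v \<zeta>)" using U_power[OF U_v[OF False], of ?q] \<zeta> by simp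
    then have "v \<zeta> = int ?q * v \<zeta>" by (simp add: U_iff)
    then have "(int ?q - 1) * v \<zeta> = 0" by (simp add: left_diff_distrib)
    then have "v \<zeta> = 0" using q1 by (auto simp del: of_nat_power)
    then show ?thesis by (simp add: P_iff)
  qed simp
  have Mc: "y \<in> M \<Longrightarrow> z \<in> M \<Longrightarrow> y + z \<in> M" "y \<in> M \<Longrightarrow> c \<in> ?Z \<Longrightarrow> c * y \<in> M"
    "0 \<in> M" "i < ?q \<Longrightarrow> c \<in> ?Z \<Longrightarrow> c * \<zeta> ^ i \<in> M" for y z c i
    unfolding M_def by (fact lspan_closed[OF Zp_ring])+
  have Msum: "(\<And>i. i \<in> I \<Longrightarrow> h i \<in> M) \<Longrightarrow> sum h I \<in> M" for h :: "nat \<Rightarrow> 'a" and I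
    unfolding M_def by (rule lspan_sum[OF Zp_ring])
  have pow: "c * \<zeta> ^ i \<in> M" if "c \<in> ?Z" for c i
  proof (induction i rule: less_induct)
    case (less i)
    show ?case
    proof (cases "i < ?q")
      case True
      then show ?thesis using Mc(4)[OF True that] by simp
    next
      case False
      then have "\<zeta> ^ i = \<zeta> ^ ?q * \<zeta> ^ (i - ?q)" by (simp add: power_add[symmetric])
      also have "\<dots> = \<zeta> ^ (Suc (i - ?q))" unfolding \<zeta> by simp
      finally show ?thesis using less[of "Suc (i - ?q)"] False q1 by simp
    qed
  qed
  have Mrep: "\<exists>a. (\<forall>i. a i \<in> ?Z) \<and> y = (\<Sum>i<?q. a i * \<zeta> ^ i)" if "y \<in> M" for y
    using that unfolding M_def lspan_def by blast
  have Mring: "subrng M" unfolding subrng_def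
  proof (intro conjI ballI)
    show "1 \<in> M" using pow[OF subrngD(1)[OF Zp_ring], of 0] by simp
    fix y z assume y: "y \<in> M" and z: "z \<in> M"
    have "(- 1) * z \<in> M" by (intro Mc(2) z subrngD(5)[OF Zp_ring] subrngD(1)[OF Zp_ring])
    from Mc(1)[OF y this] show "y - z \<in> M" by simp
    obtain a where a: "\<forall>i. a i \<in> ?Z" "y = (\<Sum>i<?q. a i * \<zeta> ^ i)" using Mrep[OF y] by blast
    obtain a' where a': "\<forall>i. a' i \<in> ?Z" "z = (\<Sum>i<?q. a' i * \<zeta> ^ i)" using Mrep[OF z] by blast
    have "y * z = (\<Sum>i<?q. \<Sum>j<?q. (a i * a' j) * \<zeta> ^ (i + j))"
      unfolding a(2) a'(2) sum_product by (simp add: power_add mult_ac)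
    also have "\<dots> \<in> M" using a(1) a'(1) by (intro Msum pow subrngD(4)[OF Zp_ring]) auto
    finally show "y * z \<in> M" .
  qed
  have ZM: "?Z \<subseteq> M" using pow[of _ 0] by auto
  have MP: "M \<subseteq> P 0"
  proof
    fix y assume "y \<in> M"
    then obtain a where "\<forall>i. a i \<in> ?Z" "y = (\<Sum>i<?q. a i * \<zeta> ^ i)" using Mrep by blast
    then show "y \<in> P 0" using \<zeta>P by (auto intro!: P_sum P_mult0 P_power0)
  qed
  define pM where "pM = {of_nat p * m | m. m \<in> M}"
  have pM_add: "y + z \<in> pM" if "y \<in> pM" "z \<in> pM" for y z
  proof -
    from that obtain m m' where "m \<in> M" "m' \<in> M" "y = of_nat p * m" "z = of_nat p * m'" unfolding pM_def by auto
    then have "y + z = of_nat p * (m + m')" "m + m' \<in> M" using Mc(1) by (simp_all add: distrib_left)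
    then show ?thesis unfolding pM_def by blast
  qed
  have pM_neg: "- y \<in> pM" if "y \<in> pM" for y
  proof -
    from that obtain m where "m \<in> M" "y = of_nat p * m" unfolding pM_def by auto
    then have "- y = of_nat p * (- m)" "- m \<in> M" using subrngD(5)[OF Mring] by simp_all
    then show ?thesis unfolding pM_def by blast
  qed
  have frob: "y ^ ?q - y \<in> pM" if "y \<in> M" for y
  proof -
    from Mrep[OF that] obtain a where a: "\<forall>i. a i \<in> ?Z" "y = (\<Sum>i<?q. a i * \<zeta> ^ i)" by blast
    have "a i * \<zeta> ^ i \<in> frob_fixed M p ?q" for i
    proof -
      have "a i \<in> frob_fixed ?Z p ?q" using a(1) Zp_frob_fixed by blast
      then obtain c where c: "c \<in> ?Z" "a i ^ ?q - a i = of_nat p * c" by (auto simp: frob_fixed_def)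
      have "(\<zeta> ^ i) ^ ?q = \<zeta> ^ i" by (metis \<zeta> power_commutes power_mult mult.commute)
      then have "(a i * \<zeta> ^ i) ^ ?q - a i * \<zeta> ^ i = (a i ^ ?q - a i) * \<zeta> ^ i"
        by (simp add: power_mult_distrib left_diff_distrib)
      also have "\<dots> = of_nat p * (c * \<zeta> ^ i)" using c(2) by simp
      finally show ?thesis using pow[OF c(1), of i] pow[of "a i" i] a(1) by (auto simp: frob_fixed_def)
    qed
    then have "y \<in> frob_fixed M p ?q" unfolding a(2) by (intro frob_fixed_sum[OF Mring p_prime])
    then show ?thesis by (auto simp: frob_fixed_def pM_def)
  qed
  obtain C where C: "C \<ge> 0" "\<And>m x. x \<in> lspan Q (\<lambda>i. \<zeta> ^ i) ?q \<Longrightarrow> x \<in> P m \<Longrightarrow>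
      \<exists>a. (\<forall>i. a i \<in> Q \<and> a i \<in> P (m - C)) \<and> x = (\<Sum>i<?q. a i * \<zeta> ^ i)"
    using lspan_complete_bounded[OF Q_field Q_complete, of "\<lambda>i. \<zeta> ^ i" ?q] by blast
  have MQ: "M \<subseteq> lspan Q (\<lambda>i. \<zeta> ^ i) ?q" unfolding M_def lspan_def by blast
  have small: "y \<in> pM" if y: "y \<in> M" "y \<in> P 1" for y
  proof -
    have tel: "y ^ (?q ^ k) - y \<in> pM" for k
    proof (induction k)
      case 0 show ?case using Mc(3) unfolding pM_def by (auto intro!: exI[of _ 0])
    next
      case (Suc k)
      have "y ^ (?q ^ Suc k) = (y ^ (?q ^ k)) ^ ?q" by (simp add: power_mult[symmetric] mult.commute)
      then have "y ^ (?q ^ Suc k) - y ^ (?q ^ k) \<in> pM" using frob[OF subrng_power[OF Mring y(1)]] by simp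
      from pM_add[OF this Suc] show ?case by simp
    qed
    \<comment> \<open>The power reaches depth C + v(p), so that after the loss C every coefficient
      is still divisible by p.\<close>
    define k where "k = nat (C + vp)"
    define z where "z = y ^ (?q ^ k)"
    have "k < ?q ^ k" using q1 by (intro power_gt_expt) simp
    have "z \<in> P (int (?q ^ k) * 1)" unfolding z_def by (rule P_power[OF y(2)])
    then have "z \<in> P (C + vp)" using \<open>k < ?q ^ k\<close> by (rule_tac P_mono) (auto simp: k_def simp del: of_nat_power)
    moreover have "z \<in> lspan Q (\<lambda>i. \<zeta> ^ i) ?q" using MQ subrng_power[OF Mring y(1)] unfolding z_def by blast
    ultimately obtain a where a: "\<forall>i. a i \<in> Q \<and> a i \<in> P (C + vp - C)" "z = (\<Sum>i<?q. a i * \<zeta> ^ i)" using C(2) by blast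
    have "a i / of_nat p \<in> ?Z" for i
      using a(1) P_divide[OF _ p_U, of "a i" vp] by (auto intro: sfieldD(3)[OF Q_field] subrng_of_nat[OF Q_ring])
    then have "(\<Sum>i<?q. (a i / of_nat p) * \<zeta> ^ i) \<in> M" unfolding M_def by (intro lspanI[of "\<lambda>i. a i / of_nat p"]) auto
    moreover have "z = of_nat p * (\<Sum>i<?q. (a i / of_nat p) * \<zeta> ^ i)" unfolding a(2) sum_distrib_left by simp
    ultimately have "z \<in> pM" unfolding pM_def by blast
    moreover have "y = z + - (z - y)" by simp
    ultimately show ?thesis using pM_add pM_neg tel[of k] unfolding z_def by metis
  qed
  have Mval: "vp dvd v y" if "y \<in> M" "y \<noteq> 0" for y
    using that
  proof (induction "nat (v y)" arbitrary: y rule: less_induct)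
    case less
    have v0: "v y \<ge> 0" using MP less.prems by (auto simp: P_iff)
    show ?case
    proof (cases "v y = 0")
      case False
      then have "y \<in> P 1" using v0 by (simp add: P_iff)
      from small[OF less.prems(1) this] obtain m where m: "m \<in> M" "y = of_nat p * m" unfolding pM_def by auto
      have mn: "m \<noteq> 0" using m less.prems by auto
      have vy: "v y = vp + v m" unfolding m(2) by (rule v_mult) (use mn in auto)
      have "v m \<ge> 0" using MP m(1) mn by (auto simp: P_iff)
      then have "vp dvd v m" using less.hyps[of m] m(1) mn vy vp_pos by simp
      then show ?thesis unfolding vy by simp
    qed simp
  qed
  \<comment> \<open>A power of p moves x into the lattice without changing its valuation modulo
    v(p).\<close>
  define s where "s = nat (C - v x)"
  define y where "y = of_nat p ^ s * x"
  have yU: "y \<in> U (int s * vp + v x)" unfolding y_def by (intro U_mult U_power p_U U_v x)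
  have "int s * 1 \<le> int s * vp" using vp_pos by (intro mult_left_mono) auto
  moreover have "C - v x \<le> int s" by (simp add: s_def)
  ultimately have "y \<in> P C" unfolding U_P_iff[OF yU] by linarith
  moreover have "y \<in> lspan Q (\<lambda>i. \<zeta> ^ i) ?q" unfolding y_def
    by (intro lspan_closed(2)[OF Q_ring] x subrng_power[OF Q_ring] subrng_of_nat[OF Q_ring])
  ultimately obtain a where "\<forall>i. a i \<in> Q \<and> a i \<in> P (C - C)" "y = (\<Sum>i<?q. a i * \<zeta> ^ i)" using C(2) by blast
  then have "y \<in> M" unfolding M_def lspan_def by auto
  moreover have "y \<noteq> 0" using yU by (simp add: U_iff)
  ultimately have "vp dvd v y" by (rule Mval)
  moreover have "v y = int s * vp + v x" using yU by (simp add: U_iff)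
  ultimately have "vp dvd int s * vp + v x" by simp
  then show ?thesis using dvd_add_right_iff[of vp "int s * vp" "v x"] dvd_triv_right[of vp "int s"] by blast
qed

end

section \<open>The field tower\<close>

lemma amb_simps [simp]:
  "carrier amb = UNIV" "x \<otimes>\<^bsub>amb\<^esub> y = x * y" "\<one>\<^bsub>amb\<^esub> = 1" "\<zero>\<^bsub>amb\<^esub> = 0" "x \<oplus>\<^bsub>amb\<^esub> y = x + y"
  by (simp_all add: ring_of_type_algebra_def)

lemma field_amb: "field (amb :: 'a::field_char_0 ring)" by (rule field_from_type_algebra)
lemma ring_amb: "ring (amb :: 'a::field_char_0 ring)" by (rule ring_from_type_algebra)
lemma domain_amb: "domain (amb :: 'a::field_char_0 ring)" by (rule field.axioms(1)[OF field_amb])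

lemma a_inv_amb [simp]: "\<ominus>\<^bsub>amb\<^esub> (x :: 'a::field_char_0) = - x"
proof -
  interpret ring "amb :: 'a ring" by (rule ring_amb)
  show ?thesis by (rule minus_equality) auto
qed

lemma m_inv_amb: "(x :: 'a::field_char_0) \<noteq> 0 \<Longrightarrow> inv\<^bsub>amb\<^esub> x = inverse x"
proof -
  assume x: "x \<noteq> 0"
  interpret field "amb :: 'a ring" by (rule field_amb)
  show ?thesis by (rule comm_inv_char) (use x in auto)
qed

lemma sfield_subfield:
  assumes "subfield F amb" shows "sfield F"
proof -
  note sr = subringE[OF subfieldE(1)[OF assms]]
  have "x - y \<in> F" if "x \<in> F" "y \<in> F" for x y using sr(7)[OF that(1) sr(5)[OF that(2)]] by simp
  moreover have "inverse x \<in> F" if "x \<in> F" for x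
    using ring.subfield_m_inv(1)[OF ring_amb assms, of x] that sr(2) m_inv_amb[of x] by (cases "x = 0") auto
  ultimately show ?thesis using sr(3,6) unfolding sfield_def subrng_def by auto
qed

text \<open>The list is reversed because \<open>Span\<close> treats the head of a list as the vector
  added last.\<close>

lemma Span_lspan: "0 \<in> F \<Longrightarrow> ring.Span amb F (map f (rev [0..<k])) = lspan F f k"
proof (induction k)
  case (Suc k)
  have "ring.Span amb F (map f (rev [0..<Suc k])) = ring.line_extension amb F (f k) (lspan F f k)"
    using Suc by (simp add: ring.Span.simps[OF ring_amb])
  also have "\<dots> = lspan F f (Suc k)"
  proof (rule Set.set_eqI)
    fix x
    have "x \<in> ring.line_extension amb F (f k) (lspan F f k) \<longleftrightarrow> (\<exists>c\<in>F. \<exists>u\<in>lspan F f k. x = u + c * f k)"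
      unfolding ring.line_extension_mem_iff[OF ring_amb] amb_simps add.commute[of "_ * _"] ..
    also have "\<dots> \<longleftrightarrow> x \<in> lspan F f (Suc k)" unfolding lspan_Suc[OF Suc.prems] by blast
    finally show "x \<in> ring.line_extension amb F (f k) (lspan F f k) \<longleftrightarrow> x \<in> lspan F f (Suc k)" .
  qed
  finally show ?case .
qed (simp add: ring.Span.simps[OF ring_amb] lspan_0)

lemma finite_dim_lspan:
  assumes F: "subfield F amb" "ring.finite_dimension amb F E"
  shows "\<exists>f n. E = lspan F f n"
proof -
  obtain n where "ring.dimension amb n F E" using F(2) ring.finite_dimension_def[OF ring_amb] by blast
  then obtain Vs where "ring.Span amb F Vs = E" using ring.exists_base[OF ring_amb F(1)] by blast
  moreover have "Vs = map (\<lambda>i. rev Vs ! i) (rev [0..<length Vs])"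
    by (rule nth_equalityI) (simp_all add: rev_nth)
  ultimately show ?thesis using Span_lspan[OF subrngD(2)[OF sfieldD(1)[OF sfield_subfield[OF F(1)]]], of "\<lambda>i. rev Vs ! i" "length Vs"]
    by metis
qed

lemma independent_map:
  assumes "0 \<in> F" "\<And>k. k < n \<Longrightarrow> f k \<notin> lspan F f k"
  shows "ring.independent amb F (map f (rev [0..<n]))"
  using assms(2)
proof (induction n)
  case 0
  show ?case by (simp add: ring.li_Nil[OF ring_amb])
next
  case (Suc n)
  then show ?case by (auto intro!: ring.li_Cons[OF ring_amb] simp: Span_lspan[OF assms(1)] simp del: ring.Span.simps)
qed

text \<open>The relation \<zeta>^q = \<zeta> folds the exponent q back to 1, so multiplication by
  \<zeta> preserves the span.\<close>

lemma lspan_simple_extension: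
  assumes "subrng F" "\<zeta> ^ q = \<zeta>" "q > 1"
  shows "ring.simple_extension amb F \<zeta> \<subseteq> lspan F (\<lambda>i. \<zeta> ^ i) q"
proof
  fix x assume "x \<in> ring.simple_extension amb F \<zeta>"
  then show "x \<in> lspan F (\<lambda>i. \<zeta> ^ i) q"
  proof (induction rule: ring.simple_extension.induct[OF ring_amb, consumes 1, case_names zero lin])
    case zero
    then show ?case using lspan_closed(3)[OF assms(1)] by simp
  next
    case (lin k1 k2)
    then obtain a where a: "\<forall>i. a i \<in> F" "k1 = (\<Sum>i<q. a i * \<zeta> ^ i)" by (blast elim: lspanE)
    have "a i * \<zeta> ^ Suc i \<in> lspan F (\<lambda>i. \<zeta> ^ i) q" if "i < q" for i
    proof (cases "Suc i = q")
      case True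
      then have "\<zeta> ^ Suc i = \<zeta> ^ 1" using assms(2) by (simp only: power_one_right)
      then show ?thesis using lspan_closed(4)[OF assms(1,3), of "a i" "\<lambda>i. \<zeta> ^ i"] a(1) by (simp only:)
    next
      case False
      then show ?thesis using lspan_closed(4)[OF assms(1), of "Suc i" q "a i" "\<lambda>i. \<zeta> ^ i"] that a(1) by simp
    qed
    then have "(\<Sum>i<q. a i * \<zeta> ^ Suc i) \<in> lspan F (\<lambda>i. \<zeta> ^ i) q" by (intro lspan_sum assms) auto
    moreover have "k1 * \<zeta> = (\<Sum>i<q. a i * \<zeta> ^ Suc i)" unfolding a(2) sum_distrib_right by (simp add: mult_ac)
    moreover have "k2 \<in> lspan F (\<lambda>i. \<zeta> ^ i) q"
      using lspan_closed(4)[OF assms(1), of 0 q k2 "\<lambda>i. \<zeta> ^ i"] assms(3) lin by simp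
    ultimately show ?case using lspan_closed(1)[OF assms(1)] by simp
  qed
qed

context nval begin

text \<open>The values of \<open>v\<close> on nonzero elements of \<open>F\<close> form a subgroup
  of the integers, generated by its least positive element; the assumption on x makes it
  nontrivial.\<close>

lemma ram_index_props:
  assumes F: "sfield F" and x: "x \<in> F" "x \<noteq> 0" "v x \<noteq> 0"
  shows "ram_index v F > 0" "\<exists>t\<in>F. t \<in> U (int (ram_index v F))"
    "y \<in> F \<Longrightarrow> y \<noteq> 0 \<Longrightarrow> int (ram_index v F) dvd v y"
    "(\<And>y. y \<in> F \<Longrightarrow> y \<noteq> 0 \<Longrightarrow> int d dvd v y) \<Longrightarrow> v z = int d \<Longrightarrow> z \<in> F \<Longrightarrow> z \<noteq> 0 \<Longrightarrow> d > 0 \<Longrightarrow> ram_index v F = d"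
proof -
  let ?R = "\<lambda>e::nat. 0 < e \<and> (\<exists>x\<in>F - {0}. v x = int e)"
  have ix: "inverse x \<in> F" "v (inverse x) = - v x" "inverse x \<noteq> 0"
    using sfieldD(2)[OF F x(1)] U_inverse[OF U_v[OF x(2)]] by (auto simp: U_iff)
  have "\<exists>e. ?R e"
  proof (cases "v x > 0")
    case True
    then show ?thesis using x by (intro exI[of _ "nat (v x)"]) auto
  next
    case False
    then show ?thesis using x ix by (intro exI[of _ "nat (- v x)"]) auto
  qed
  then have L: "?R (ram_index v F)" unfolding ram_index_def by (rule LeastI_ex)
  then show pos: "ram_index v F > 0" by simp
  from L show ext: "\<exists>t\<in>F. t \<in> U (int (ram_index v F))" by (auto simp: U_iff)
  have least: "ram_index v F \<le> e" if "?R e" for e unfolding ram_index_def by (rule Least_le[of ?R, OF that])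
  show dvd: "int (ram_index v F) dvd v y" if y: "y \<in> F" "y \<noteq> 0" for y
  proof -
    obtain t where t: "t \<in> F" "t \<in> U (int (ram_index v F))" using ext by blast
    let ?q = "v y div int (ram_index v F)" and ?m = "v y mod int (ram_index v F)"
    have "y * t powi (- ?q) \<in> U (v y + - ?q * int (ram_index v F))" by (intro U_mult U_power_int t U_v y)
    moreover have "v y + - ?q * int (ram_index v F) = ?m" by (simp add: minus_div_mult_eq_mod)
    moreover have "y * t powi (- ?q) \<in> F" by (intro subrngD(4)[OF sfieldD(1)[OF F]] y sfieldD(4)[OF F] t)
    ultimately have "\<exists>x\<in>F - {0}. v x = ?m" by (auto simp: U_iff)
    moreover have m: "?m \<ge> 0" "?m < int (ram_index v F)" using pos by simp_all
    ultimately have "?R (nat ?m)" if "?m \<noteq> 0" using that by auto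
    then have "?m = 0" using least[of "nat ?m"] m by (cases "?m = 0") auto
    then show ?thesis by (rule mod_0_imp_dvd)
  qed
  show "ram_index v F = d" if d: "\<And>y. y \<in> F \<Longrightarrow> y \<noteq> 0 \<Longrightarrow> int d dvd v y" "v z = int d" "z \<in> F" "z \<noteq> 0" "d > 0"
  proof -
    have "ram_index v F \<le> d" using least[of d] d by auto
    moreover obtain t where t: "t \<in> F" "t \<in> U (int (ram_index v F))" using ext by blast
    then have "int d dvd int (ram_index v F)" using d(1)[of t] by (auto simp: U_iff)
    then have "d \<le> ram_index v F" using pos by (auto dest: dvd_imp_le)
    ultimately show ?thesis by simp
  qed
qed

lemma ram_index_UNIV: "ram_index v UNIV = 1"
proof -
  obtain x where x: "x \<in> U 1" using ex_U by blast
  show ?thesis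
    by (rule ram_index_props(4)[of UNIV x 1 x]) (use x in \<open>auto simp: U_iff sfield_def subrng_def\<close>)
qed

lemma prime_ideal_pow_UNIV [simp]: "prime_ideal_pow v UNIV n = P n"
  by (auto simp: prime_ideal_pow_def P_iff val_of_def ram_index_UNIV)

end

lemma padic_base_padic_subfield:
  assumes "pval v p" "padic_subfield p v Q"
  shows "padic_base v p Q"
proof -
  interpret pval v p by (rule assms(1))
  show ?thesis
  proof
    show "sfield Q" using assms(2) by (auto simp: padic_subfield_def intro: sfield_subfield)
    show "\<exists>c. x - of_rat c \<in> P n" if "x \<in> Q" for x n
      using assms(2) that unfolding padic_subfield_def P_iff by blast
    show "compl Q" unfolding compl_def cauchy_def limit_def P_iff
      using assms(2) unfolding padic_subfield_def by (auto simp: image_subset_iff)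
  qed
qed

section \<open>Residue fields and degrees in the tower\<close>

locale galois_tower = pval v p for v :: "'a::field_char_0 \<Rightarrow> int" and p +
  fixes Q K T :: "'a set" and \<gamma> \<sigma> :: "'a \<Rightarrow> 'a" and b :: int
  assumes Qp: "padic_subfield p v Q"
    and K: "subfield K amb" and QK: "Q \<subseteq> K" and KQ: "ring.finite_dimension amb Q K"
    and T: "max_unramified p v Q K T"
    and gal: "galois_over K" and tot: "totally_ramified_over v K"
    and \<gamma>G: "\<gamma> \<in> carrier (gal_group K)" and \<sigma>G: "\<sigma> \<in> carrier (gal_group K)"
    and gen: "generate (gal_group K) {\<gamma>, \<sigma>} = carrier (gal_group K)"
    and iso: "gal_group K \<cong> integer_mod_group p \<times>\<times> integer_mod_group p"
    and brk: "one_break v K b"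
begin

sublocale padic_base v p Q using padic_base_padic_subfield[OF _ Qp] pval_axioms by blast

lemma K_field: "sfield K" by (rule sfield_subfield[OF K])
lemmas K_ring = sfieldD(1)[OF K_field]
lemma K0: "0 \<in> K" by (rule subrngD(2)[OF K_ring])
lemma p_K: "of_nat p \<in> K" by (rule subrng_of_nat[OF K_ring])

lemma T_unr: "subfield T amb" "Q \<subseteq> T" "T \<subseteq> K" "abs_ram_index p v T = 1"
  and T_max: "subfield L amb \<Longrightarrow> Q \<subseteq> L \<Longrightarrow> L \<subseteq> K \<Longrightarrow> abs_ram_index p v L = 1 \<Longrightarrow> L \<subseteq> T"
  using T by (auto simp: max_unramified_def)

lemma T_field: "sfield T" by (rule sfield_subfield[OF T_unr(1)])

abbreviation "n \<equiv> ram_index v K"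

lemma ram_K: "n > 0" "\<exists>t\<in>K. t \<in> U (int n)" "y \<in> K \<Longrightarrow> y \<noteq> 0 \<Longrightarrow> int n dvd v y"
  using ram_index_props(1-3)[OF K_field p_K] vp_pos by auto

lemma T_ram: "ram_index v T = nat vp" "y \<in> T \<Longrightarrow> y \<noteq> 0 \<Longrightarrow> vp dvd v y"
proof -
  have p: "of_nat p \<in> T" by (rule subrng_of_nat[OF sfieldD(1)[OF T_field]])
  note r = ram_index_props(1-3)[OF T_field p]
  have "vp div int (ram_index v T) = 1" using T_unr(4) by (simp add: abs_ram_index_def val_of_def)
  moreover have "int (ram_index v T) dvd vp" using r(3)[OF _ _ p] vp_pos by simp
  ultimately have e: "int (ram_index v T) = vp" by (metis dvd_div_mult_self mult_1)
  then show "ram_index v T = nat vp" by simp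
  show "vp dvd v y" if "y \<in> T" "y \<noteq> 0" using r(3)[OF _ _ that] vp_pos e by simp
qed

lemma val_ring_T: "val_ring v T = T \<inter> P 0"
  unfolding prime_ideal_pow_def val_of_def T_ram(1) P_def using vp_pos
  by (auto simp: pos_imp_zdiv_nonneg_iff)

lemma T_P1: "x \<in> T \<Longrightarrow> x \<in> P 1 \<Longrightarrow> x \<in> P vp"
  using T_ram(2)[of x] zdvd_imp_le[of vp "v x"] by (cases "x = 0") (auto simp: P_iff)

text \<open>Q(\<zeta>) has absolute ramification index 1 by \<open>unramified_root_of_unity\<close>,
  so the maximality of \<open>T\<close> absorbs it.\<close>

lemma teich_in_T:
  assumes "\<zeta> \<in> K" "\<zeta> ^ (p ^ d) = \<zeta>" "d \<ge> 1"
  shows "\<zeta> \<in> T"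
proof -
  let ?L = "ring.simple_extension amb Q \<zeta>"
  have Q: "subfield Q amb" using Qp by (simp add: padic_subfield_def)
  have alg: "(ring.algebraic amb over Q) \<zeta>"
    by (rule ring.finite_dimension_imp_algebraic[OF ring_amb Q subfieldE(1)[OF K] KQ assms(1)])
  have L: "subfield ?L amb"
    using domain.simple_extension_is_subfield[OF domain_amb Q, of \<zeta>] alg by simp
  have QL: "Q \<subseteq> ?L" using ring.simple_extension_incl[OF ring_amb, of Q \<zeta>] by simp
  have LK: "?L \<subseteq> K" by (rule ring.simple_extension_subring_incl[OF ring_amb subfieldE(1)[OF K] QK assms(1)])
  have \<zeta>L: "\<zeta> \<in> ?L" using ring.simple_extension_mem[OF ring_amb subfieldE(1)[OF Q], of \<zeta>] by simp
  have q1: "p ^ d > 1" using p_gt1 assms(3) by (intro one_less_power) auto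
  have d: "vp dvd v y" if "y \<in> ?L" "y \<noteq> 0" for y
    using unramified_root_of_unity[OF assms(3,2) _ that(2)] lspan_simple_extension[OF Q_ring assms(2) q1] that(1) by blast
  have "of_nat p \<in> ?L" using QL subrng_of_nat[OF Q_ring] by blast
  moreover have "ram_index v ?L = nat vp"
  proof (rule ram_index_props(4)[OF sfield_subfield[OF L], of "of_nat p" _ "of_nat p"])
    show "of_nat p \<in> ?L" by fact
    then show "of_nat p \<in> ?L" .
  qed (use vp_pos d in auto)
  ultimately have "abs_ram_index p v ?L = 1" using vp_pos by (simp add: abs_ram_index_def val_of_def)
  from T_max[OF L QL LK this] \<zeta>L show ?thesis by blast
qed

lemma K_lspan: "\<exists>f k. K = lspan Q f k"
  using Qp by (intro finite_dim_lspan[OF _ KQ]) (simp add: padic_subfield_def)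

lemma K_compl: "compl K"
  using K_lspan lspan_complete_bounded[OF Q_field Q_complete] by metis

lemma residue_K:
  assumes "u \<in> K" "u \<in> U 0" shows "\<exists>c\<in>T. c \<in> U 0 \<and> u - c \<in> P 1"
proof -
  obtain f k where f: "K = lspan Q f k" using K_lspan by blast
  obtain d \<zeta> where d: "d \<ge> 1" "\<zeta> \<in> K" "\<zeta> ^ (p ^ d) = \<zeta>" "u - \<zeta> \<in> P 1"
    using teichmueller[OF K_ring[unfolded f] assms(1)[unfolded f] U_P[OF assms(2)]] unfolding f[symmetric] by blast
  have "\<zeta> \<in> U 0" using U_cong[of \<zeta> u 0] P_diff_swap[OF d(4)] assms(2) by simp
  with teich_in_T[OF d(2,3,1)] d(4) show ?thesis by blast
qed

lemma N_dim: "ring.dimension amb n K UNIV"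
  using ring.finite_dimensionE[OF ring_amb K, of UNIV] gal tot
  unfolding galois_over_def totally_ramified_over_def over_def by simp

text \<open>Valuations on \<open>K\<close> are multiples of n, so v(a i \<pi>^i) is congruent to i
  modulo n.\<close>

lemma K_powers_distinct:
  assumes \<pi>: "\<pi> \<in> U 1" and a: "\<And>i. a i \<in> K" and ij: "i < n" "j < n" "i \<noteq> j" "a i \<noteq> 0" "a j \<noteq> 0"
  shows "v (a i * \<pi> ^ i) \<noteq> v (a j * \<pi> ^ j)"
proof
  assume e: "v (a i * \<pi> ^ i) = v (a j * \<pi> ^ j)"
  have "v (a k * \<pi> ^ k) = v (a k) + int k" if "a k \<noteq> 0" for k
    using U_mult[OF U_v[OF that] U_power[OF \<pi>, of k]] by (simp add: U_iff)
  then have "v (a i) + int i = v (a j) + int j" using e ij by metis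
  then have "int i - int j = v (a j) - v (a i)" by simp
  then have "int n dvd int i - int j" using ram_K(3)[OF a] ij by simp
  then have "int n \<le> \<bar>int i - int j\<bar>" using ij(3) by (intro zdvd_imp_le) auto
  then show False using ij by linarith
qed

lemma K_powers_P:
  assumes \<pi>: "\<pi> \<in> U 1" and a: "\<And>i. a i \<in> K" and m: "m \<le> n" and s: "(\<Sum>i<m. a i * \<pi> ^ i) \<in> P k" and i: "i < m"
  shows "a i * \<pi> ^ i \<in> P k"
proof (rule sum_distinct_val_P[where I = "{..<m}" and f = "\<lambda>i. a i * \<pi> ^ i"])
  show "v (a i * \<pi> ^ i) \<noteq> v (a j * \<pi> ^ j)"
    if "i \<in> {..<m}" "j \<in> {..<m}" "i \<noteq> j" "a i * \<pi> ^ i \<noteq> 0" "a j * \<pi> ^ j \<noteq> 0" for i j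
    using K_powers_distinct[of \<pi> a i j, OF \<pi> a] that m by auto
qed (use s i in auto)

lemma K_powers_indep:
  assumes \<pi>: "\<pi> \<in> U 1" and k: "k < n" shows "\<pi> ^ k \<notin> lspan K (\<lambda>i. \<pi> ^ i) k"
proof
  assume "\<pi> ^ k \<in> lspan K (\<lambda>i. \<pi> ^ i) k"
  then obtain a where a: "\<forall>i. a i \<in> K" "\<pi> ^ k = (\<Sum>i<k. a i * \<pi> ^ i)" by (rule lspanE)
  define a' where "a' i = (if i < k then - a i else 1)" for i
  have "(\<Sum>i<Suc k. a' i * \<pi> ^ i) = 0" using a(2) by (simp add: a'_def sum_negf)
  then have "(\<Sum>i<Suc k. a' i * \<pi> ^ i) \<in> P (int k + 1)" by simp
  moreover have "a' i \<in> K" for i using a(1) K_ring by (auto simp: a'_def intro: subrngD)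
  ultimately have "a' k * \<pi> ^ k \<in> P (int k + 1)" using K_powers_P[OF \<pi>, of a' "Suc k" "int k + 1" k] k by simp
  then show False using U_not_P[OF U_power[OF \<pi>, of k]] by (simp add: a'_def)
qed

text \<open>n independent powers in a space of dimension n; total ramification is what makes n that
  dimension.\<close>

lemma N_lspan: assumes "\<pi> \<in> U 1" shows "UNIV = lspan K (\<lambda>i. \<pi> ^ i) n"
proof -
  let ?Us = "map (\<lambda>i. \<pi> ^ i) (rev [0..<n])"
  have "ring.independent amb K ?Us" by (rule independent_map[OF K0 K_powers_indep[OF assms]])
  from ring.independent_length_eq_dimension[OF ring_amb K N_dim this] have "ring.Span amb K ?Us = UNIV" by simp
  then show ?thesis using Span_lspan[OF K0, of "\<lambda>i. \<pi> ^ i" n] by simp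
qed

text \<open>In an integral expansion by powers of \<pi> only the constant term can be a unit, so
  \<open>N\<close> has no residues beyond those of \<open>K\<close>.\<close>

lemma residue_N:
  assumes "u \<in> U 0" shows "\<exists>c\<in>T. c \<in> U 0 \<and> u - c \<in> P 1"
proof -
  obtain \<pi> where \<pi>: "\<pi> \<in> U 1" using ex_U by blast
  have "u \<in> lspan K (\<lambda>i. \<pi> ^ i) n" using N_lspan[OF \<pi>] by blast
  then obtain a where a: "\<forall>i. a i \<in> K" "u = (\<Sum>i<n. a i * \<pi> ^ i)" by (rule lspanE)
  have P0: "a i * \<pi> ^ i \<in> P 0" if "i < n" for i
    using K_powers_P[OF \<pi>, of a n 0 i] a that U_P[OF assms] by simp
  have P1: "a i * \<pi> ^ i \<in> P 1" if i: "i < n" "i > 0" for i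
  proof (cases "a i = 0")
    case False
    have u: "a i * \<pi> ^ i \<in> U (v (a i) + int i * 1)" by (intro U_mult U_power \<pi> U_v False)
    have "v (a i) + int i \<noteq> 0"
    proof
      assume "v (a i) + int i = 0"
      then have "int n dvd int i" using ram_K(3)[of "a i"] a(1) False by (metis add.commute dvd_minus_iff eq_neg_iff_add_eq_0)
      then show False using i by (auto dest: dvd_imp_le)
    qed
    then show ?thesis using P0[OF i(1)] unfolding U_P_iff[OF u] by simp
  qed simp
  obtain m where m: "n = Suc m" using ram_K(1) gr0_implies_Suc by blast
  have "u - a 0 = (\<Sum>i<m. a (Suc i) * \<pi> ^ Suc i)" unfolding a(2) m sum.lessThan_Suc_shift by simp
  also have "\<dots> \<in> P 1" by (intro P_sum P1) (auto simp: m)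
  finally have ua: "u - a 0 \<in> P 1" .
  then have "a 0 \<in> U 0" using U_cong[of "a 0" u 0] P_diff_swap[OF ua] assms by simp
  from residue_K[OF _ this] a(1) obtain c where "c \<in> T" "c \<in> U 0" "a 0 - c \<in> P 1" by blast
  with P_trans[OF ua] show ?thesis by blast
qed

sublocale resval v p T
  by unfold_locales (use T_field residue_N in \<open>auto intro: sfieldD\<close>)

abbreviation "\<Gamma> \<equiv> carrier (gal_group K)"

section \<open>The Galois group acts by isometries\<close>

lemma GD:
  assumes "g \<in> \<Gamma>"
  shows "g (x + y) = g x + g y" "g (x * y) = g x * g y" "g 1 = 1" "x \<in> K \<Longrightarrow> g x = x" "bij g" "additive g"
    "g 0 = 0" "g x = 0 \<longleftrightarrow> x = 0" "g (x ^ k) = g x ^ k"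
proof -
  have h: "g \<in> ring_iso amb amb" using assms by (simp add: gal_group_def)
  show 1: "g (x + y) = g x + g y" for x y using ring_iso_memE(3)[OF h, of x y] by simp
  show 2: "g (x * y) = g x * g y" for x y using ring_iso_memE(2)[OF h, of x y] by simp
  show 3: "g 1 = 1" using ring_iso_memE(4)[OF h] by simp
  show "x \<in> K \<Longrightarrow> g x = x" using assms by (simp add: gal_group_def)
  show b: "bij g" using ring_iso_memE(5)[OF h] by simp
  show ad: "additive g" using 1 by (simp add: additive_def)
  show z: "g 0 = 0" using ad by (rule additive.zero)
  show "g x = 0 \<longleftrightarrow> x = 0" using b z by (metis bij_pointE)
  show "g (x ^ k) = g x ^ k" by (induction k) (simp_all add: 2 3)
qed

text \<open>Automorphisms are not assumed continuous; being linear on a finite-dimensional space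
  over a complete field, they are bounded.\<close>

lemma G_bounded:
  assumes "g \<in> \<Gamma>" shows "\<exists>C\<ge>0. \<forall>m. \<forall>x\<in>P m. g x \<in> P (m - C)"
proof -
  obtain \<pi> where \<pi>: "\<pi> \<in> U 1" using ex_U by blast
  let ?f = "\<lambda>i. \<pi> ^ i"
  obtain C where C: "C \<ge> 0" "\<And>m x. x \<in> lspan K ?f n \<Longrightarrow> x \<in> P m \<Longrightarrow> \<exists>a. (\<forall>i. a i \<in> K \<and> a i \<in> P (m - C)) \<and> x = (\<Sum>i<n. a i * ?f i)"
    using lspan_complete_bounded[OF K_field K_compl, of ?f n] by blast
  define W where "W = (\<Sum>i<n. \<bar>v (g (?f i))\<bar>)"
  have W: "- W \<le> v (g (?f i))" if "i < n" for i
    using member_le_sum[of i "{..<n}" "\<lambda>i. \<bar>v (g (?f i))\<bar>"] that by (simp add: W_def)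
  have W0: "W \<ge> 0" unfolding W_def by (rule sum_nonneg) simp
  have "g x \<in> P (m - (C + W))" if "x \<in> P m" for x m
  proof -
    obtain a where a: "\<forall>i. a i \<in> K \<and> a i \<in> P (m - C)" "x = (\<Sum>i<n. a i * ?f i)"
      using C(2)[of x m] N_lspan[OF \<pi>] \<open>x \<in> P m\<close> by blast
    have "g x = (\<Sum>i<n. g (a i * ?f i))" unfolding a(2) by (rule additive.sum[OF GD(6)[OF assms]])
    also have "\<dots> = (\<Sum>i<n. a i * g (?f i))" using GD(2,4)[OF assms] a(1) by simp
    also have "\<dots> \<in> P (m - (C + W))"
    proof (rule P_sum)
      fix i assume i: "i \<in> {..<n}"
      have "a i * g (?f i) \<in> P ((m - C) + v (g (?f i)))" using a(1) by (intro P_mult) auto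
      then show "a i * g (?f i) \<in> P (m - (C + W))" by (rule P_mono) (use W[of i] i in simp)
    qed
    finally show ?thesis .
  qed
  then show ?thesis using C(1) W0 by (intro exI[of _ "C + W"]) auto
qed

text \<open>A bounded loss C, applied to the powers y^k, amounts to a loss of at most C / k for y,
  hence to none. The inverse gives the other inequality.\<close>

lemma G_val:
  assumes g: "g \<in> \<Gamma>" and x: "x \<noteq> 0" shows "v (g x) = v x"
proof -
  obtain C where C: "C \<ge> 0" "\<And>m x. x \<in> P m \<Longrightarrow> g x \<in> P (m - C)" using G_bounded[OF g] by blast
  have ge: "v y \<le> v (g y)" if y: "y \<noteq> 0" for y
  proof (rule ccontr)
    assume "\<not> ?thesis"
    then have lt: "v (g y) + 1 \<le> v y" by simp
    define k where "k = nat (C + 1)"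
    have gy: "g y \<noteq> 0" using GD(8)[OF g] y by simp
    have "g (y ^ k) \<in> P (int k * v y - C)" by (intro C(2) P_power P_v)
    then have "g y ^ k \<in> P (int k * v y - C)" by (simp add: GD(9)[OF g])
    then have "int k * v y - C \<le> int k * v (g y)" using U_P_iff[OF U_power[OF U_v[OF gy], of k]] by simp
    moreover have "int k * (v (g y) + 1) \<le> int k * v y" using lt by (intro mult_left_mono) auto
    ultimately show False using C(1) by (simp add: k_def algebra_simps)
  qed
  have vi: "v (inverse y) = - v y" if "y \<noteq> 0" for y using U_inverse[OF U_v[OF that]] by (simp add: U_iff)
  have "g x * g (inverse x) = 1" using GD(2,3)[OF g] x by (metis right_inverse)
  then have "g (inverse x) = inverse (g x)" by (simp add: inverse_unique)
  then have "v (g (inverse x)) = - v (g x)" using vi[of "g x"] GD(8)[OF g] x by simp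
  then show ?thesis using ge[OF x] ge[of "inverse x"] vi[OF x] x by simp
qed

lemma G_aut: "g \<in> \<Gamma> \<Longrightarrow> aut g"
  unfolding aut_def using GD G_val T_unr(3) by (auto simp: U_iff)

lemma G_comp: "g \<in> \<Gamma> \<Longrightarrow> h \<in> \<Gamma> \<Longrightarrow> g \<circ> h \<in> \<Gamma>"
  using ring_iso_set_trans[of h amb amb g amb] by (auto simp: gal_group_def)
lemma G_id: "id \<in> \<Gamma>"
  using ring_iso_set_refl[of amb] by (auto simp: gal_group_def id_def)
lemma G_funpow: "g \<in> \<Gamma> \<Longrightarrow> g ^^ k \<in> \<Gamma>"
  by (induction k) (auto simp: G_comp G_id simp del: comp_def)

lemma G_structure:
  shows "card \<Gamma> = p ^ 2" "g \<in> \<Gamma> \<Longrightarrow> h \<in> \<Gamma> \<Longrightarrow> g \<circ> h = h \<circ> g" "g \<in> \<Gamma> \<Longrightarrow> g ^^ p = id"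
proof -
  let ?Z = "integer_mod_group p \<times>\<times> integer_mod_group p"
  obtain \<phi> where \<phi>: "\<phi> \<in> hom (gal_group K) ?Z" "bij_betw \<phi> \<Gamma> (carrier ?Z)"
    using iso unfolding is_iso_def iso_def by blast
  have cZ: "carrier ?Z = {0..<int p} \<times> {0..<int p}" by (simp add: carrier_integer_mod_group)
  show "card \<Gamma> = p ^ 2" using bij_betw_same_card[OF \<phi>(2)] unfolding cZ by (simp add: power2_eq_square)
  have hom: "\<phi> (g \<circ> h) = ((fst (\<phi> g) + fst (\<phi> h)) mod int p, (snd (\<phi> g) + snd (\<phi> h)) mod int p)"
    if "g \<in> \<Gamma>" "h \<in> \<Gamma>" for g h
  proof -
    have "\<phi> (g \<circ> h) = \<phi> g \<otimes>\<^bsub>?Z\<^esub> \<phi> h" using hom_mult[OF \<phi>(1) that] by (simp add: gal_group_def)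
    then show ?thesis by (simp add: DirProd_def split: prod.splits)
  qed
  have inj: "g = h" if "g \<in> \<Gamma>" "h \<in> \<Gamma>" "\<phi> g = \<phi> h" for g h
    using \<phi>(2) that by (auto simp: bij_betw_def inj_on_def)
  show "g \<circ> h = h \<circ> g" if "g \<in> \<Gamma>" "h \<in> \<Gamma>" for g h
    using that by (intro inj) (simp_all add: G_comp hom add.commute)
  have mem: "\<phi> g \<in> {0..<int p} \<times> {0..<int p}" if "g \<in> \<Gamma>" for g using bij_betwE[OF \<phi>(2)] that cZ by blast
  have pow: "\<phi> (g ^^ Suc k) = ((int (Suc k) * fst (\<phi> g)) mod int p, (int (Suc k) * snd (\<phi> g)) mod int p)"
    if g: "g \<in> \<Gamma>" for g k
  proof (induction k)
    case 0
    then show ?case using mem[OF g] by (auto simp: mod_pos_pos_trivial)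
  next
    case (Suc k)
    have "\<phi> (g ^^ Suc (Suc k)) = \<phi> (g \<circ> g ^^ Suc k)" by (simp only: funpow.simps(2))
    also have "\<dots> = ((fst (\<phi> g) + fst (\<phi> (g ^^ Suc k))) mod int p, (snd (\<phi> g) + snd (\<phi> (g ^^ Suc k))) mod int p)"
      by (rule hom[OF g G_funpow[OF g]])
    finally show ?case unfolding Suc.IH
      by (simp add: mod_add_right_eq distrib_right add.assoc del: funpow.simps)
  qed
  obtain q where q: "p = Suc q" using p_pos gr0_implies_Suc by blast
  have "\<phi> (g ^^ p) = (0, 0)" if "g \<in> \<Gamma>" for g unfolding q pow[OF that] by (simp add: q[symmetric])
  moreover have "id ^^ p = id" by simp
  ultimately have "\<phi> (g ^^ p) = \<phi> id" if "g \<in> \<Gamma>" for g using that G_id by metis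
  then show "g ^^ p = id" if "g \<in> \<Gamma>" for g using that by (intro inj G_funpow G_id)
qed

lemma G_group: "group (gal_group K)"
proof (rule groupI)
  fix g assume g: "g \<in> \<Gamma>"
  obtain q where q: "p = Suc q" using p_pos gr0_implies_Suc by blast
  have "g ^^ q \<circ> g = id" using G_structure(3)[OF g] unfolding q by (simp add: funpow_swap1 fun_eq_iff)
  then show "\<exists>h\<in>\<Gamma>. h \<otimes>\<^bsub>gal_group K\<^esub> g = \<one>\<^bsub>gal_group K\<^esub>"
    using G_funpow[OF g, of q] by (auto simp: gal_group_def)
qed (use G_comp G_id in \<open>auto simp: gal_group_def\<close>)

definition gs :: "nat \<times> nat \<Rightarrow> 'a \<Rightarrow> 'a" where "gs ij x = (\<gamma> ^^ fst ij) ((\<sigma> ^^ snd ij) x)"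

lemma gs_mem: "gs ij \<in> \<Gamma>"
  using G_comp[OF G_funpow[OF \<gamma>G, of "fst ij"] G_funpow[OF \<sigma>G, of "snd ij"]] by (simp add: gs_def[abs_def] comp_def)

lemma funpow_comm: "f \<circ> g = g \<circ> f \<Longrightarrow> (f ^^ i) ((g ^^ j) x) = (g ^^ j) ((f ^^ i) x)"
proof -
  assume fg: "f \<circ> g = g \<circ> f"
  have 1: "f ((g ^^ j) x) = (g ^^ j) (f x)" for j x
    by (induction j arbitrary: x) (use fg in \<open>auto simp: fun_eq_iff\<close>)
  show ?thesis by (induction i) (simp_all add: 1)
qed

text \<open>The generators commute and have order dividing p, so every word reduces to \<gamma>^i
  \<sigma>^j with exponents below p.\<close>

lemma gs_surj: "\<Gamma> = gs ` ({..<p} \<times> {..<p})"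
proof (intro equalityI subsetI)
  fix g assume "g \<in> \<Gamma>"
  then have "g \<in> generate (gal_group K) {\<gamma>, \<sigma>}" using gen by simp
  then have "\<exists>ij. g = gs ij"
  proof (induction rule: generate.induct)
    case one
    then show ?case by (intro exI[of _ "(0, 0)"]) (simp add: gal_group_def gs_def[abs_def] id_def)
  next
    case (incl h)
    then have "h = gs (1, 0) \<or> h = gs (0, 1)" by (auto simp: gs_def[abs_def])
    then show ?case by blast
  next
    case (inv h)
    obtain q where q: "p = Suc q" using p_pos gr0_implies_Suc by blast
    have h: "h \<in> \<Gamma>" using inv \<gamma>G \<sigma>G by auto
    have "h ^^ q \<circ> h = id" using G_structure(3)[OF h] unfolding q by (simp add: funpow_swap1 fun_eq_iff)
    then have "h ^^ q \<otimes>\<^bsub>gal_group K\<^esub> h = \<one>\<^bsub>gal_group K\<^esub>" by (simp add: gal_group_def)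
    then have "inv\<^bsub>gal_group K\<^esub> h = h ^^ q" by (rule group.inv_equality[OF G_group _ h G_funpow[OF h]])
    then have "inv\<^bsub>gal_group K\<^esub> h = gs (q, 0) \<or> inv\<^bsub>gal_group K\<^esub> h = gs (0, q)" using inv by (auto simp: gs_def[abs_def])
    then show ?case by blast
  next
    case (eng h1 h2)
    then obtain i j k l where h: "h1 = gs (i, j)" "h2 = gs (k, l)" by (metis surj_pair)
    have "h1 \<otimes>\<^bsub>gal_group K\<^esub> h2 = gs (i + k, j + l)"
      unfolding h using funpow_comm[OF G_structure(2)[OF \<sigma>G \<gamma>G]]
      by (auto simp: gal_group_def gs_def fun_eq_iff funpow_add)
    then show ?case by blast
  qed
  then obtain i j where g: "g = gs (i, j)" by (metis surj_pair)
  have "(\<gamma> ^^ p) x = x" "(\<sigma> ^^ p) x = x" for x using G_structure(3) \<gamma>G \<sigma>G by auto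
  then have "gs (i, j) = gs (i mod p, j mod p)" unfolding gs_def[abs_def] by (simp add: funpow_mod_eq)
  then show "g \<in> gs ` ({..<p} \<times> {..<p})" using g by auto
qed (use gs_mem in auto)

lemma gs_inj: "inj_on gs ({..<p} \<times> {..<p})"
  by (rule eq_card_imp_inj_on) (simp_all add: gs_surj[symmetric] G_structure(1) power2_eq_square)

lemma G_eq:
  assumes "\<pi> \<in> U 1" "g \<in> \<Gamma>" "h \<in> \<Gamma>" "g \<pi> = h \<pi>" shows "g = h"
proof
  fix x
  have "x \<in> lspan K (\<lambda>i. \<pi> ^ i) n" using N_lspan[OF assms(1)] by blast
  then obtain a where a: "\<forall>i. a i \<in> K" "x = (\<Sum>i<n. a i * \<pi> ^ i)" by (rule lspanE)
  have "k x = (\<Sum>i<n. a i * k \<pi> ^ i)" if "k \<in> \<Gamma>" for k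
    using a(1) GD(2,4,9)[OF that] unfolding a(2) additive.sum[OF GD(6)[OF that]] by simp
  from this[OF assms(2)] this[OF assms(3)] show "g x = h x" using assms(4) by simp
qed

text \<open>The conjugates of \<pi> are distinct roots of a polynomial of degree n over
  \<open>K\<close>, so p^2 <= n. Conversely the product of all X - g \<pi> has coefficients in
  \<open>K\<close> by the Galois property and annihilates \<pi>, whose powers below n are
  independent.\<close>

lemma degree_eq: "n = p ^ 2"
proof -
  obtain \<pi> where \<pi>: "\<pi> \<in> U 1" using ex_U by blast
  have fin: "finite \<Gamma>" using gs_surj by simp
  have "p ^ 2 \<le> n"
  proof -
    have "\<pi> ^ n \<in> lspan K (\<lambda>i. \<pi> ^ i) n" using N_lspan[OF \<pi>] by blast
    then obtain a where a: "\<forall>i. a i \<in> K" "\<pi> ^ n = (\<Sum>i<n. a i * \<pi> ^ i)" by (rule lspanE)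
    define f where "f = monom 1 n - (\<Sum>i<n. monom (a i) i)"
    have "degree (\<Sum>i<n. monom (a i) i) < n" using ram_K(1)
      by (intro degree_sum_less) (auto intro: le_less_trans[OF degree_monom_le])
    then have deg: "degree f = n" unfolding f_def diff_conv_add_uminus
      by (subst degree_add_eq_left) (auto simp: degree_monom_eq)
    have root: "poly f (g \<pi>) = 0" if g: "g \<in> \<Gamma>" for g
    proof -
      have "g (\<pi> ^ n) = (\<Sum>i<n. g (a i * \<pi> ^ i))" unfolding a(2) by (rule additive.sum[OF GD(6)[OF g]])
      then have "g \<pi> ^ n = (\<Sum>i<n. a i * g \<pi> ^ i)" using GD(2,4,9)[OF g] a(1) by simp
      then show ?thesis by (simp add: f_def poly_sum poly_monom)
    qed
    have "f \<noteq> 0" using deg ram_K(1) by auto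
    have "card \<Gamma> = card ((\<lambda>g. g \<pi>) ` \<Gamma>)" using G_eq[OF \<pi>] by (intro card_image[symmetric] inj_onI) auto
    also have "\<dots> \<le> card {x. poly f x = 0}" using root \<open>f \<noteq> 0\<close> by (intro card_mono poly_roots_finite) auto
    also have "\<dots> \<le> n" using card_poly_roots_bound[OF \<open>f \<noteq> 0\<close>] deg by simp
    finally show ?thesis using G_structure(1) by simp
  qed
  moreover have "n \<le> p ^ 2"
  proof (rule ccontr)
    assume "\<not> ?thesis"
    then have lt: "p ^ 2 < n" by simp
    define f where "f = (\<Prod>g\<in>\<Gamma>. [:- g \<pi>, 1:])"
    have deg: "degree f = p ^ 2" "lead_coeff f = 1" unfolding f_def
      using monic_prod_linear[of "\<lambda>g. g \<pi>" \<Gamma>] G_structure(1) by simp_all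
    have coeffs: "coeff f i \<in> K" for i
    proof -
      have "h (coeff f i) = coeff f i" if h: "h \<in> \<Gamma>" for h
      proof -
        have "map_poly h f = (\<Prod>g\<in>\<Gamma>. [:- (h \<circ> g) \<pi>, 1:])" unfolding f_def
          map_poly_prod_hom[OF GD(6,2,3)[OF h]] map_poly_linear_hom[OF GD(6,3)[OF h]] by simp
        also have "\<dots> = f" unfolding f_def
        proof (rule prod.reindex_bij_betw)
          have inj: "inj_on (\<lambda>g. h \<circ> g) \<Gamma>" using GD(5)[OF h] by (auto simp: inj_on_def fun_eq_iff bij_def inj_def)
          then show "bij_betw (\<lambda>g. h \<circ> g) \<Gamma> \<Gamma>" unfolding bij_betw_def
            using G_comp[OF h] by (intro conjI endo_inj_surj fin) auto
        qed
        finally show ?thesis using coeff_map_poly[of h f i] GD(7)[OF h] by simp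
      qed
      then show ?thesis using gal unfolding galois_over_def by blast
    qed
    have "poly f \<pi> = 0" unfolding f_def poly_prod using G_id fin by (intro prod_zero bexI[of _ id]) auto
    then have "(\<Sum>i<Suc (p ^ 2). coeff f i * \<pi> ^ i) = 0"
      unfolding poly_altdef deg(1) lessThan_Suc_atMost .
    then have "(\<Sum>i<Suc (p ^ 2). coeff f i * \<pi> ^ i) \<in> P (int (p ^ 2) + 1)" by simp
    from K_powers_P[OF \<pi> coeffs _ this, of "p ^ 2"] lt have "coeff f (p ^ 2) * \<pi> ^ (p ^ 2) \<in> P (int (p ^ 2) + 1)" by simp
    then show False using U_not_P[OF U_power[OF \<pi>, of "p ^ 2"]] deg(2)[unfolded deg(1)] by simp
  qed
  ultimately show ?thesis by simp
qed

lemma vp_eq: "vp = int p ^ 2 * abs_ram_index p v K"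
  using ram_K(3)[OF p_K] degree_eq by (simp add: abs_ram_index_def val_of_def)

text \<open>g \<pi> is c \<pi> to leading order with c in \<open>T\<close>, and g^p = 1 forces c^p =
  1 in the residue field, where p-th roots are unique; so c is congruent to 1.\<close>

lemma G_wild:
  assumes g: "g \<in> \<Gamma>" and x: "x \<in> P 1" shows "g x - x \<in> P 2"
proof -
  note ga = G_aut[OF g]
  obtain \<pi> where \<pi>: "\<pi> \<in> U 1" using ex_U by blast
  have nz: "\<pi> \<noteq> 0" using \<pi> by (simp add: U_iff)
  have "g \<pi> / \<pi> \<in> U 0" using U_divide[OF autD(4)[OF ga \<pi>] \<pi>] by simp
  then obtain c where c: "c \<in> T" "c \<in> U 0" "g \<pi> / \<pi> - c \<in> P 1" using residue by blast
  have "(g \<pi> / \<pi> - c) * \<pi> \<in> P (1 + 1)" by (intro P_mult c U_P \<pi>)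
  then have c2: "g \<pi> - c * \<pi> \<in> P 2" using nz by (simp add: left_diff_distrib)
  have pw: "(g ^^ k) \<pi> - c ^ k * \<pi> \<in> P 2" for k
  proof (induction k)
    case (Suc k)
    have "g ((g ^^ k) \<pi> - c ^ k * \<pi>) \<in> P 2" by (rule aut_P[OF ga Suc])
    then have "(g ^^ Suc k) \<pi> - c ^ k * g \<pi> \<in> P 2"
      using autD(5)[OF ga subrng_power[OF T_sub c(1)]] by (simp add: autD[OF ga])
    moreover have "c ^ k * (g \<pi> - c * \<pi>) \<in> P 2" by (intro P_mult0 c2 P_power0 U_P c)
    ultimately show ?case using P_add by (fastforce simp: algebra_simps)
  qed simp
  have "\<pi> - c ^ p * \<pi> \<in> P 2" using pw[of p] G_structure(3)[OF g] by simp
  then have "(\<pi> - c ^ p * \<pi>) / \<pi> \<in> P (2 - 1)" using \<pi> by (rule P_divide)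
  moreover have "(\<pi> - c ^ p * \<pi>) / \<pi> = 1 - c ^ p" using nz by (simp add: diff_divide_distrib)
  ultimately have 1: "1 - c ^ p \<in> P 1" by simp
  have "(1 - c) ^ p - (1 ^ p - c ^ p) \<in> P 1" using c by (intro frob_diff) auto
  then have "(1 - c) ^ p \<in> P 1" using P_cong[of "(1 - c) ^ p"] 1 by simp
  then have "1 - c \<in> P 1" by (rule root_P) simp
  from P_mult[OF this U_P[OF \<pi>]] have "(1 - c) * \<pi> \<in> P (1 + 1)" .
  then have "(g \<pi> - c * \<pi>) - (1 - c) * \<pi> \<in> P 2" by (intro P_diff c2) simp
  then have "df g \<pi> \<in> P (1 + 1)" by (simp add: df_def algebra_simps)
  from raisesD[OF raises_df[OF ga \<pi> this] x] show ?thesis by (simp add: df_def)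
qed

lemma break_groups: "ram_group v K b = \<Gamma>" "ram_group v K (b + 1) = {id}"
  using brk by (auto simp: one_break_def)

lemma ram_group_iff: "g \<in> ram_group v K i \<longleftrightarrow> g \<in> \<Gamma> \<and> (\<forall>x\<in>P 1. g x - x \<in> P (i + 1))"
  by (simp add: ram_group_def)

text \<open>Otherwise \<open>G_wild\<close> would put the whole group into the trivial group
  G_(b+1).\<close>

lemma b_ge1: "b \<ge> 1"
proof (rule ccontr)
  assume "\<not> ?thesis"
  then have b: "b + 1 + 1 \<le> 2" by simp
  have "g \<in> ram_group v K (b + 1)" if "g \<in> \<Gamma>" for g
    unfolding ram_group_iff using that P_mono[OF G_wild[OF that] b] by blast
  then have "\<Gamma> \<subseteq> {id}" using break_groups by blast
  then have "card \<Gamma> \<le> 1" using card_mono[of "{id}" \<Gamma>] by simp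
  moreover have "p ^ 2 > 1" using p_gt1 by (intro one_less_power) auto
  ultimately show False using G_structure(1) by simp
qed

sublocale ram v p T \<gamma> \<sigma> b "abs_ram_index p v K"
proof
  show "aut \<gamma>" "aut \<sigma>" by (intro G_aut \<gamma>G \<sigma>G)+
  show "\<gamma> (\<sigma> x) = \<sigma> (\<gamma> x)" for x using G_structure(2)[OF \<gamma>G \<sigma>G] by (simp add: fun_eq_iff)
  show "(\<gamma> ^^ p) x = x" "(\<sigma> ^^ p) x = x" for x using G_structure(3) \<gamma>G \<sigma>G by auto
  show "b \<ge> 1" by (rule b_ge1)
  show "(\<gamma> ^^ i) ((\<sigma> ^^ j) x) - x \<in> P (b + 1)" if "x \<in> P 1" for x i j
  proof -
    have "gs (i, j) \<in> ram_group v K b" unfolding break_groups by (rule gs_mem)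
    then show ?thesis using that unfolding ram_group_iff by (auto simp: gs_def)
  qed
  show "\<exists>x\<in>P 1. (\<gamma> ^^ i) ((\<sigma> ^^ j) x) - x \<notin> P (b + 2)" if ij: "i < p" "j < p" "(i, j) \<noteq> (0, 0)" for i j
  proof -
    have "gs (i, j) \<noteq> gs (0, 0)" using inj_onD[OF gs_inj, of "(i, j)" "(0, 0)"] ij by auto
    moreover have "gs (0, 0) = id" by (auto simp: gs_def)
    ultimately have "gs (i, j) \<notin> ram_group v K (b + 1)" unfolding break_groups by simp
    then show ?thesis using gs_mem[of "(i, j)"] unfolding ram_group_iff by (auto simp: gs_def add.assoc)
  qed
  show "vp = int p ^ 2 * abs_ram_index p v K" by (rule vp_eq)
qed

text \<open>The two first-order parts differ at \<rho>0 by (\<omega> - c) S \<rho>0, and S \<rho>0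
  has valuation exactly 2 b since p does not divide b; so \<omega> agrees modulo \<open>P 1\<close>
  with the constant c of \<open>ex_lam\<close>.\<close>

lemma refined_axioms_from_rho:
  assumes \<omega>: "\<omega> \<in> T" and \<rho>: "\<rho>0 \<in> U b" "\<gamma> \<rho>0 - \<rho>0 + \<omega> * (\<sigma> \<rho>0 - \<rho>0) \<in> P (2 * b + 1)"
  shows "refined v p T \<gamma> \<sigma> b (abs_ram_index p v K) \<omega>"
proof -
  obtain c where c: "c \<in> T" "c \<in> U 0" "raises (b + 1) (lam c)" using ex_lam by blast
  have "lam c \<rho>0 \<in> P (b + (b + 1))" by (rule raisesD[OF c(3) U_P[OF \<rho>(1)]])
  then have "lam \<omega> \<rho>0 - lam c \<rho>0 \<in> P (2 * b + 1)" using \<rho>(2) by (intro P_diff) (simp_all add: lam_def df_def)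
  then have d: "(\<omega> - c) * S \<rho>0 \<in> P (2 * b + 1)" by (simp add: lam_def algebra_simps)
  have s: "S \<rho>0 \<in> U (b + b)" by (rule S_exact[OF \<rho>(1) b_not_dvd])
  then have nz: "S \<rho>0 \<noteq> 0" by (rule U_nz)
  have "(\<omega> - c) * S \<rho>0 / S \<rho>0 \<in> P (2 * b + 1 - (b + b))" using d s by (rule P_divide)
  then have wc: "\<omega> - c \<in> P 1" using nz by simp
  show ?thesis
  proof
    show "\<omega> \<in> T" by fact
    show wP: "\<omega> \<in> P 0" using P_cong[of \<omega> c 0] P_mono[OF wc, of 0] U_P[OF c(2)] by simp
    obtain \<pi> where \<pi>: "\<pi> \<in> U 1" using ex_U by blast
    have "lam c \<pi> \<in> P (1 + (b + 1))" by (rule raisesD[OF c(3) U_P[OF \<pi>]])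
    moreover have "(\<omega> - c) * S \<pi> \<in> P (1 + (1 + b))" by (intro P_mult wc U_P S_uniformizer \<pi>)
    moreover have "lam \<omega> \<pi> = lam c \<pi> + (\<omega> - c) * S \<pi>" by (simp add: lam_def algebra_simps)
    ultimately have "lam \<omega> \<pi> \<in> P (b + 2)" by (auto intro: P_add simp: add.commute)
    then show "raises (b + 1) (lam \<omega>)" by (rule lam_raises[OF \<omega> wP \<pi>])
  qed
qed

end

section \<open>Dimensions along chains of subspaces\<close>

text \<open>Each step of the filtration is trivial or adds one line, so a basis grows along it. Used
  both for the valuation filtration and for the coordinates of a direct sum.\<close>

lemma (in vectorspace) dim_chain:
  fixes S :: "nat \<Rightarrow> 'c set"
  assumes S0: "S 0 = {\<zero>\<^bsub>V\<^esub>}" and stay: "\<And>k. k < m \<Longrightarrow> k \<notin> E \<Longrightarrow> S (Suc k) = S k"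
    and grow: "\<And>k. k < m \<Longrightarrow> k \<in> E \<Longrightarrow>
      \<exists>x\<in>carrier V. x \<notin> S k \<and> S (Suc k) = {s \<oplus>\<^bsub>V\<^esub> c \<odot>\<^bsub>V\<^esub> x | s c. s \<in> S k \<and> c \<in> carrier K}"
    and Sm: "S m = carrier V"
  shows "dim = card {k \<in> E. k < m}"
proof -
  have "k \<le> m \<Longrightarrow> \<exists>B. finite B \<and> B \<subseteq> carrier V \<and> card B = card {i \<in> E. i < k} \<and> lin_indpt B \<and> span B = S k" for k
  proof (induction k)
    case 0
    have "lin_indpt {}" unfolding lin_dep_def by auto
    then show ?case using S0 span_empty by (intro exI[of _ "{}"]) auto
  next
    case (Suc k)
    then obtain B where B: "finite B" "B \<subseteq> carrier V" "card B = card {i \<in> E. i < k}" "lin_indpt B" "span B = S k" by auto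
    show ?case
    proof (cases "k \<in> E")
      case False
      then have "{i \<in> E. i < Suc k} = {i \<in> E. i < k}" by (auto simp: less_Suc_eq)
      then show ?thesis using B stay[of k] False Suc.prems by auto
    next
      case True
      then obtain x where x: "x \<in> carrier V" "x \<notin> S k"
        "S (Suc k) = {s \<oplus>\<^bsub>V\<^esub> c \<odot>\<^bsub>V\<^esub> x | s c. s \<in> S k \<and> c \<in> carrier K}" using grow[of k] Suc.prems by auto
      have xB: "x \<notin> B" using in_own_span[OF B(2)] B(5) x(2) by blast
      have li: "lin_indpt (B \<union> {x})" using lin_dep_iff_in_span[OF B(2,4) x(1) xB] B(5) x(2) by blast
      have Bx: "B \<union> {x} \<subseteq> carrier V" using B(2) x(1) by auto
      interpret sp: submodule K "span (B \<union> {x})" V by (rule span_is_submodule[OF Bx])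
      have "span (B \<union> {x}) = S (Suc k)"
      proof (intro equalityI subsetI)
        fix y assume "y \<in> span (B \<union> {x})"
        then obtain a where a: "a \<in> B \<union> {x} \<rightarrow> carrier K" "lincomb a (B \<union> {x}) = y"
          using finite_in_span[OF _ Bx, of y] B(1) by auto
        have "y = a x \<odot>\<^bsub>V\<^esub> x \<oplus>\<^bsub>V\<^esub> lincomb a B"
          using lincomb_insert[OF B(1,2) a(1) xB x(1)] a(2) by simp
        moreover have "lincomb a B \<in> span B" unfolding span_def using B(1) a(1) by auto
        moreover have "lincomb a B \<in> carrier V" using B(2) a(1) by (intro lincomb_closed) auto
        ultimately have "y = lincomb a B \<oplus>\<^bsub>V\<^esub> a x \<odot>\<^bsub>V\<^esub> x" "lincomb a B \<in> S k" "a x \<in> carrier K"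
          using a(1) x(1) B(5) by (auto intro: M.a_comm)
        then show "y \<in> S (Suc k)" unfolding x(3) by blast
      next
        fix y assume "y \<in> S (Suc k)"
        then obtain s c where y: "y = s \<oplus>\<^bsub>V\<^esub> c \<odot>\<^bsub>V\<^esub> x" "s \<in> span B" "c \<in> carrier K" unfolding x(3) B(5) by blast
        have "s \<in> span (B \<union> {x})" using y(2) span_is_monotone[of B "B \<union> {x}"] by blast
        moreover have "x \<in> span (B \<union> {x})" using in_own_span[OF Bx] by blast
        ultimately show "y \<in> span (B \<union> {x})" unfolding y(1) using y(3) by (intro sp.m_closed sp.smult_closed)
      qed
      moreover have "{i \<in> E. i < Suc k} = insert k {i \<in> E. i < k}" using True by (auto simp: less_Suc_eq)
      then have "card (B \<union> {x}) = card {i \<in> E. i < Suc k}" using B(1,3) xB by simp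
      ultimately show ?thesis using li Bx B(1) by (intro exI[of _ "B \<union> {x}"]) auto
    qed
  qed
  from this[of m] obtain B where B: "finite B" "B \<subseteq> carrier V" "card B = card {i \<in> E. i < m}" "lin_indpt B" "span B = carrier V"
    using Sm by auto
  then have "basis B" unfolding basis_def by simp
  from dim_basis[OF B(1) this] show ?thesis using B(3) by simp
qed

section \<open>The modules \<open>L(i)\<close>\<close>

locale coeff_field = field R for R :: "'a ring" (structure)
begin

abbreviation "PR \<equiv> poly_ring R"
definition "X1 = var R \<ominus>\<^bsub>PR\<^esub> \<one>\<^bsub>PR\<^esub>"

lemma PR_domain: "domain PR" by (rule univ_poly_is_domain[OF carrier_is_subring])

lemma var_PR: "var R \<in> carrier PR" by (rule var_closed(1)[OF carrier_is_subring])

lemma X1_closed: "X1 \<in> carrier PR"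
proof -
  interpret PR: domain PR by (rule PR_domain)
  show ?thesis unfolding X1_def using var_PR by simp
qed

lemma X1_eval: "eval X1 \<one> = \<zero>"
proof -
  interpret PR: domain PR by (rule PR_domain)
  interpret e: ring_hom_ring PR R "\<lambda>p. eval p \<one>" by (rule eval_ring_hom[OF carrier_is_subring one_closed])
  have "eval X1 \<one> = eval (var R) \<one> \<oplus> eval (\<ominus>\<^bsub>PR\<^esub> \<one>\<^bsub>PR\<^esub>) \<one>"
    unfolding X1_def PR.minus_eq using var_PR by (intro e.hom_add) auto
  also have "\<dots> = \<one> \<oplus> \<ominus> \<one>" using e.hom_a_inv[OF PR.one_closed] e.hom_one eval_var[OF one_closed] by simp
  finally show ?thesis by (simp add: r_neg)
qed

lemma X1_eq: "X1 = [\<one>, \<ominus> \<one>]"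
proof -
  interpret PR: domain PR by (rule PR_domain)
  have "\<one>\<^bsub>PR\<^esub> = [\<one>]" by (simp add: univ_poly_one)
  have c: "[\<one>, \<ominus> \<one>] \<in> carrier PR" by (auto simp: univ_poly_carrier[symmetric] polynomial_def)
  have "[\<one>, \<ominus> \<one>] \<oplus>\<^bsub>PR\<^esub> \<one>\<^bsub>PR\<^esub> = var R"
    by (simp add: univ_poly_add univ_poly_one var_def l_neg)
  then have "X1 = ([\<one>, \<ominus> \<one>] \<oplus>\<^bsub>PR\<^esub> \<one>\<^bsub>PR\<^esub>) \<ominus>\<^bsub>PR\<^esub> \<one>\<^bsub>PR\<^esub>" by (simp add: X1_def)
  also have "\<dots> = [\<one>, \<ominus> \<one>]" using c by (simp add: PR.minus_eq PR.a_assoc PR.r_neg)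
  finally show ?thesis .
qed

lemma PR_split:
  assumes "g \<in> carrier PR"
  shows "\<exists>h\<in>carrier PR. \<exists>c\<in>carrier R. g = X1 \<otimes>\<^bsub>PR\<^esub> h \<oplus>\<^bsub>PR\<^esub> poly_of_const c"
proof -
  obtain h r where hr: "h \<in> carrier PR" "r \<in> carrier PR" "long_divides g X1 (h, r)"
    using exists_long_division[OF carrier_is_subfield assms X1_closed] X1_eq by auto
  then have "g = X1 \<otimes>\<^bsub>PR\<^esub> h \<oplus>\<^bsub>PR\<^esub> r" "length r - 1 = 0" unfolding long_divides_def X1_eq by auto
  moreover have "r \<in> poly_of_const ` carrier R" unfolding poly_of_const_over_carrier
    using hr(2) \<open>length r - 1 = 0\<close> by blast
  ultimately show ?thesis using hr(1) by blast
qed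

lemma X1_pow_nz: "X1 [^]\<^bsub>PR\<^esub> (k :: nat) \<noteq> \<zero>\<^bsub>PR\<^esub>"
proof -
  interpret PR: domain PR by (rule PR_domain)
  have "X1 \<noteq> \<zero>\<^bsub>PR\<^esub>" by (simp add: X1_eq univ_poly_zero)
  then show ?thesis using X1_closed by (induction k) (auto simp: PR.integral_iff)
qed

text \<open>Cancelling (x - 1)^k would make x - 1 invertible, which evaluation at 1 refutes.\<close>

lemma X1_pow_not_mem: "X1 [^]\<^bsub>PR\<^esub> (k :: nat) \<notin> PIdl\<^bsub>PR\<^esub> (X1 [^]\<^bsub>PR\<^esub> Suc k)"
proof
  interpret PR: domain PR by (rule PR_domain)
  interpret e: ring_hom_ring PR R "\<lambda>p. eval p \<one>" by (rule eval_ring_hom[OF carrier_is_subring one_closed])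
  assume "X1 [^]\<^bsub>PR\<^esub> k \<in> PIdl\<^bsub>PR\<^esub> (X1 [^]\<^bsub>PR\<^esub> Suc k)"
  then obtain h where h: "h \<in> carrier PR" "X1 [^]\<^bsub>PR\<^esub> k = h \<otimes>\<^bsub>PR\<^esub> X1 [^]\<^bsub>PR\<^esub> Suc k"
    unfolding cgenideal_def by auto
  let ?x = "X1 [^]\<^bsub>PR\<^esub> k"
  have x: "?x \<in> carrier PR" using X1_closed by simp
  have "?x \<otimes>\<^bsub>PR\<^esub> \<one>\<^bsub>PR\<^esub> = ?x \<otimes>\<^bsub>PR\<^esub> (h \<otimes>\<^bsub>PR\<^esub> X1)"
    using h x X1_closed by (simp add: PR.m_ac)
  then have "\<one>\<^bsub>PR\<^esub> = h \<otimes>\<^bsub>PR\<^esub> X1"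
    using PR.m_lcancel[OF X1_pow_nz x, of "\<one>\<^bsub>PR\<^esub>" "h \<otimes>\<^bsub>PR\<^esub> X1"] h(1) X1_closed by simp
  then have "eval (\<one>\<^bsub>PR\<^esub>) \<one> = eval h \<one> \<otimes> eval X1 \<one>" using e.hom_mult[OF h(1) X1_closed] by simp
  then show False using e.hom_one e.hom_closed[OF h(1)] X1_eval by simp
qed

lemma L_poly_eq: "L_poly R i = X1 [^]\<^bsub>PR\<^esub> i" by (simp add: L_poly_def X1_def)

lemma L_closed: "L_poly R i \<in> carrier PR"
proof -
  interpret PR: domain PR by (rule PR_domain)
  show ?thesis unfolding L_poly_eq using X1_closed by simp
qed

lemma L_proj_hom: "ring_hom_ring PR (L_ring R i) (L_proj R i)"
  unfolding L_ring_def L_proj_def by (rule rupture_surj_hom(2)[OF carrier_is_subring L_closed])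

lemma L_cring: "cring (L_ring R i)"
proof -
  interpret PR: domain PR by (rule PR_domain)
  interpret I: ideal "PIdl\<^bsub>PR\<^esub> (L_poly R i)" PR by (rule PR.cgenideal_ideal[OF L_closed])
  show ?thesis unfolding L_ring_def rupture_def by (rule I.quotient_is_cring[OF PR.is_cring])
qed

lemma L_proj_surj: "u \<in> carrier (L_ring R i) \<Longrightarrow> \<exists>g\<in>carrier PR. u = L_proj R i g"
  unfolding L_ring_def rupture_def L_proj_def FactRing_def A_RCOSETS_def' by auto

lemma L_proj_zero_iff:
  assumes "g \<in> carrier PR"
  shows "L_proj R i g = \<zero>\<^bsub>L_ring R i\<^esub> \<longleftrightarrow> g \<in> PIdl\<^bsub>PR\<^esub> (L_poly R i)"
proof -
  interpret PR: domain PR by (rule PR_domain)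
  interpret I: ideal "PIdl\<^bsub>PR\<^esub> (L_poly R i)" PR by (rule PR.cgenideal_ideal[OF L_closed])
  have "L_proj R i g = \<zero>\<^bsub>L_ring R i\<^esub> \<longleftrightarrow> PIdl\<^bsub>PR\<^esub> (L_poly R i) +>\<^bsub>PR\<^esub> g = PIdl\<^bsub>PR\<^esub> (L_poly R i)"
    by (simp add: L_proj_def L_ring_def rupture_def FactRing_def)
  also have "\<dots> \<longleftrightarrow> g \<in> PIdl\<^bsub>PR\<^esub> (L_poly R i)"
    using I.a_rcos_const I.a_rcos_self[OF assms] by blast
  finally show ?thesis .
qed

definition Lt :: "nat \<Rightarrow> 'a list set" where "Lt i = L_proj R i X1"

lemma Lt_closed: "Lt i \<in> carrier (L_ring R i)"
proof -
  interpret h: ring_hom_ring PR "L_ring R i" "L_proj R i" by (rule L_proj_hom)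
  show ?thesis unfolding Lt_def using X1_closed by simp
qed

text \<open>The hypothesis is additive so that no subtraction in the module has to be matched with
  one in L(i).\<close>

lemma Lt_eq:
  assumes "u \<in> carrier (L_ring R i)" "w \<in> carrier (L_ring R i)" "w \<oplus>\<^bsub>L_ring R i\<^esub> u = L_map R i u"
  shows "w = Lt i \<otimes>\<^bsub>L_ring R i\<^esub> u"
proof -
  interpret PR: domain PR by (rule PR_domain)
  interpret L: cring "L_ring R i" by (rule L_cring)
  interpret h: ring_hom_ring PR "L_ring R i" "L_proj R i" by (rule L_proj_hom)
  have xc: "L_proj R i (var R) \<in> carrier (L_ring R i)" using var_PR by simp
  have "Lt i = L_proj R i (var R) \<oplus>\<^bsub>L_ring R i\<^esub> \<ominus>\<^bsub>L_ring R i\<^esub> \<one>\<^bsub>L_ring R i\<^esub>"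
    unfolding Lt_def X1_def PR.minus_eq using var_PR by simp
  then have "Lt i \<otimes>\<^bsub>L_ring R i\<^esub> u = L_map R i u \<oplus>\<^bsub>L_ring R i\<^esub> \<ominus>\<^bsub>L_ring R i\<^esub> u"
    unfolding L_map_def using xc assms(1) by (simp add: L.l_distr L.l_minus)
  also have "\<dots> = w" unfolding assms(3)[symmetric] using assms(1,2) by (simp add: L.a_assoc L.r_neg)
  finally show ?thesis by simp
qed

lemma Lt_pow: "Lt i [^]\<^bsub>L_ring R i\<^esub> (k :: nat) = L_proj R i (X1 [^]\<^bsub>PR\<^esub> k)"
proof -
  interpret h: ring_hom_ring PR "L_ring R i" "L_proj R i" by (rule L_proj_hom)
  show ?thesis unfolding Lt_def by (rule h.hom_nat_pow[OF X1_closed, symmetric])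
qed

lemma Lt_pow_zero:
  assumes "i \<le> k" shows "Lt i [^]\<^bsub>L_ring R i\<^esub> (k :: nat) = \<zero>\<^bsub>L_ring R i\<^esub>"
proof -
  interpret PR: domain PR by (rule PR_domain)
  have "X1 [^]\<^bsub>PR\<^esub> k = X1 [^]\<^bsub>PR\<^esub> (k - i) \<otimes>\<^bsub>PR\<^esub> X1 [^]\<^bsub>PR\<^esub> i"
    using X1_closed assms by (simp add: PR.nat_pow_mult)
  then have "X1 [^]\<^bsub>PR\<^esub> k \<in> PIdl\<^bsub>PR\<^esub> (L_poly R i)" unfolding L_poly_eq cgenideal_def
    using X1_closed by (intro CollectI exI[of _ "X1 [^]\<^bsub>PR\<^esub> (k - i)"]) auto
  then show ?thesis unfolding Lt_pow using L_proj_zero_iff[of "X1 [^]\<^bsub>PR\<^esub> k"] X1_closed by simp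
qed

lemma Lt_pow_nonzero: "Lt (Suc k) [^]\<^bsub>L_ring R (Suc k)\<^esub> k \<noteq> \<zero>\<^bsub>L_ring R (Suc k)\<^esub>"
proof -
  interpret PR: domain PR by (rule PR_domain)
  show ?thesis unfolding Lt_pow using X1_pow_not_mem L_proj_zero_iff[of "X1 [^]\<^bsub>PR\<^esub> k" "Suc k"] X1_closed
    by (simp add: L_poly_eq del: PR.nat_pow_Suc)
qed

lemma L_smult_closed: "c \<in> carrier R \<Longrightarrow> L_proj R i (poly_of_const c) \<in> carrier (L_ring R i)"
proof -
  interpret h: ring_hom_ring PR "L_ring R i" "L_proj R i" by (rule L_proj_hom)
  assume "c \<in> carrier R"
  then have "poly_of_const c \<in> carrier PR" using ring_hom_closed[OF canonical_embedding_is_hom[OF carrier_is_subring], of c] by simp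
  then show ?thesis by simp
qed

text \<open>Modulo x - 1 every element is a constant, and (x - 1)^(k+1) = 0 in L(k+1); hence the
  image of the k-th power is a line.\<close>

lemma Lt_pow_scalar:
  assumes "u \<in> carrier (L_ring R (Suc k))"
  shows "\<exists>c\<in>carrier R. Lt (Suc k) [^]\<^bsub>L_ring R (Suc k)\<^esub> k \<otimes>\<^bsub>L_ring R (Suc k)\<^esub> u
      = L_proj R (Suc k) (poly_of_const c) \<otimes>\<^bsub>L_ring R (Suc k)\<^esub> Lt (Suc k) [^]\<^bsub>L_ring R (Suc k)\<^esub> k"
proof -
  let ?L = "L_ring R (Suc k)" and ?T = "Lt (Suc k)"
  interpret L: cring ?L by (rule L_cring)
  interpret h: ring_hom_ring PR ?L "L_proj R (Suc k)" by (rule L_proj_hom)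
  obtain g where g: "g \<in> carrier PR" "u = L_proj R (Suc k) g" using L_proj_surj[OF assms] by blast
  obtain h c where hc: "h \<in> carrier PR" "c \<in> carrier R" "g = X1 \<otimes>\<^bsub>PR\<^esub> h \<oplus>\<^bsub>PR\<^esub> poly_of_const c" using PR_split[OF g(1)] by blast
  have pc: "poly_of_const c \<in> carrier PR" using ring_hom_closed[OF canonical_embedding_is_hom[OF carrier_is_subring], of c] hc(2) by simp
  have "u = ?T \<otimes>\<^bsub>?L\<^esub> L_proj R (Suc k) h \<oplus>\<^bsub>?L\<^esub> L_proj R (Suc k) (poly_of_const c)"
    unfolding g(2) hc(3) Lt_def using hc(1) pc X1_closed by simp
  then have "?T [^]\<^bsub>?L\<^esub> k \<otimes>\<^bsub>?L\<^esub> u = (?T [^]\<^bsub>?L\<^esub> Suc k) \<otimes>\<^bsub>?L\<^esub> L_proj R (Suc k) h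
      \<oplus>\<^bsub>?L\<^esub> L_proj R (Suc k) (poly_of_const c) \<otimes>\<^bsub>?L\<^esub> ?T [^]\<^bsub>?L\<^esub> k"
    using Lt_closed hc(1) pc by (simp add: L.r_distr L.m_ac)
  also have "?T [^]\<^bsub>?L\<^esub> Suc k = \<zero>\<^bsub>?L\<^esub>" by (rule Lt_pow_zero) simp
  finally show ?thesis using hc pc Lt_closed by (intro bexI[of _ c]) simp_all
qed

text \<open>The image sees only the copies of L(p); filtering it by how many of their coordinates
  may be nonzero gives one jump per copy.\<close>

lemma dim_decomposition:
  fixes V :: "('a, 'm) module"
  assumes V: "module R V" and \<theta>: "\<theta> \<in> carrier V \<rightarrow> carrier V" and dec: "decomposes_as R p V \<theta> a" and p: "p \<ge> 1"
    and D: "vectorspace R (diff_power_image V \<theta> (p - 1))"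
  shows "a p = vectorspace.dim R (diff_power_image V \<theta> (p - 1))"
proof -
  interpret V: module R V by (rule V)
  define m where "m = p - 1"
  define D where "D = diff_power_image V \<theta> m"
  interpret D: vectorspace R D unfolding D_def m_def by (rule D)
  define I where "I = (SIGMA i:{1..p}. {..<a i})"
  define N where "N u = \<theta> u \<ominus>\<^bsub>V\<^esub> u" for u
  define L where "L ij = L_ring R (fst ij)" for ij :: "nat \<times> nat"
  have opD: "\<zero>\<^bsub>D\<^esub> = \<zero>\<^bsub>V\<^esub>" "x \<oplus>\<^bsub>D\<^esub> y = x \<oplus>\<^bsub>V\<^esub> y" "c \<odot>\<^bsub>D\<^esub> x = c \<odot>\<^bsub>V\<^esub> x"
    "carrier D = (N ^^ m) ` carrier V" for x y c
    by (simp_all add: D_def diff_power_image_def N_def[abs_def])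
  obtain \<phi> where \<phi>: "\<phi> \<in> LinearCombinations.module_hom R V (fin_direct_sum I (\<lambda>ij. L_module R (fst ij)))"
    "bij_betw \<phi> (carrier V) (\<Pi>\<^sub>E ij\<in>I. carrier (L ij))"
    "\<And>u. u \<in> carrier V \<Longrightarrow> \<phi> (\<theta> u) = (\<lambda>ij\<in>I. L_map R (fst ij) (\<phi> u ij))"
    using dec unfolding decomposes_as_def module_op_iso_def I_def L_def
    by (auto simp: Let_def fin_direct_sum_def L_module_def)
  have mem: "\<phi> u ij \<in> carrier (L ij)" if "u \<in> carrier V" "ij \<in> I" for u ij
    using bij_betwE[OF \<phi>(2)] that by (blast dest: PiE_mem)
  have add: "\<phi> (u \<oplus>\<^bsub>V\<^esub> w) ij = \<phi> u ij \<oplus>\<^bsub>L ij\<^esub> \<phi> w ij" if "u \<in> carrier V" "w \<in> carrier V" "ij \<in> I" for u w ij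
    using module_hom_add[OF \<phi>(1) that(1,2)] that(3) by (simp add: fin_direct_sum_def L_module_def L_def)
  have smult: "\<phi> (c \<odot>\<^bsub>V\<^esub> u) ij = L_proj R (fst ij) (poly_of_const c) \<otimes>\<^bsub>L ij\<^esub> \<phi> u ij"
    if "c \<in> carrier R" "u \<in> carrier V" "ij \<in> I" for c u ij
    using module_hom_smult[OF \<phi>(1) that(1,2)] that(3) by (simp add: fin_direct_sum_def L_module_def L_def)
  have cr: "cring (L ij)" for ij unfolding L_def by (rule L_cring)
  have zero: "\<phi> \<zero>\<^bsub>V\<^esub> ij = \<zero>\<^bsub>L ij\<^esub>" if "ij \<in> I" for ij
  proof -
    interpret C: cring "L ij" by (rule cr)
    have "\<phi> \<zero>\<^bsub>V\<^esub> ij \<oplus>\<^bsub>L ij\<^esub> \<phi> \<zero>\<^bsub>V\<^esub> ij = \<phi> \<zero>\<^bsub>V\<^esub> ij" using add[of "\<zero>\<^bsub>V\<^esub>" "\<zero>\<^bsub>V\<^esub>" ij] that by simp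
    then show ?thesis using mem[of "\<zero>\<^bsub>V\<^esub>" ij] that C.add.r_cancel_one' by simp
  qed
  have eqI: "u = w" if "u \<in> carrier V" "w \<in> carrier V" "\<And>ij. ij \<in> I \<Longrightarrow> \<phi> u ij = \<phi> w ij" for u w
  proof -
    have "\<phi> u = \<phi> w" using that bij_betwE[OF \<phi>(2)] by (intro PiE_ext[of _ I "\<lambda>ij. carrier (L ij)"]) auto
    then show ?thesis using \<phi>(2) that(1,2) by (auto simp: bij_betw_def inj_on_def)
  qed
  have NV: "N u \<in> carrier V" if "u \<in> carrier V" for u using \<theta> that by (auto simp: N_def)
  have NkV: "(N ^^ k) u \<in> carrier V" if "u \<in> carrier V" for u k using that by (induction k) (auto intro: NV)
  have \<phi>N: "\<phi> (N u) ij = Lt (fst ij) \<otimes>\<^bsub>L ij\<^esub> \<phi> u ij" if "u \<in> carrier V" "ij \<in> I" for u ij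
  proof -
    have "\<theta> u \<in> carrier V" using \<theta> that(1) by blast
    then have "N u \<oplus>\<^bsub>V\<^esub> u = \<theta> u" using that(1) by (simp add: N_def V.M.minus_eq V.M.a_assoc V.M.l_neg)
    then have "\<phi> (N u) ij \<oplus>\<^bsub>L ij\<^esub> \<phi> u ij = L_map R (fst ij) (\<phi> u ij)"
      using add[OF NV[OF that(1)] that] \<phi>(3)[OF that(1)] that(2) by simp
    then show ?thesis using Lt_eq mem[OF that] mem[OF NV[OF that(1)] that(2)] unfolding L_def by simp
  qed
  have \<phi>Nk: "\<phi> ((N ^^ k) u) ij = Lt (fst ij) [^]\<^bsub>L ij\<^esub> k \<otimes>\<^bsub>L ij\<^esub> \<phi> u ij" if "u \<in> carrier V" "ij \<in> I" for u ij k
  proof (induction k)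
    case 0
    interpret C: cring "L ij" by (rule cr)
    show ?case using mem[OF that] by simp
  next
    case (Suc k)
    interpret C: cring "L ij" by (rule cr)
    have "Lt (fst ij) \<in> carrier (L ij)" unfolding L_def by (rule Lt_closed)
    then show ?case using \<phi>N[OF NkV[OF that(1), of k] that(2)] Suc mem[OF that] by (simp add: C.m_ac)
  qed
  have DV: "u \<in> carrier V" if "u \<in> carrier D" for u using that NkV unfolding opD(4) by auto
  have low: "\<phi> u ij = \<zero>\<^bsub>L ij\<^esub>" if u: "u \<in> carrier D" "ij \<in> I" "fst ij < p" for u ij
  proof -
    interpret C: cring "L ij" by (rule cr)
    obtain y where y: "y \<in> carrier V" "u = (N ^^ m) y" using u(1) unfolding opD(4) by blast
    have "Lt (fst ij) [^]\<^bsub>L ij\<^esub> m = \<zero>\<^bsub>L ij\<^esub>" unfolding L_def m_def using u(3) by (intro Lt_pow_zero) simp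
    then show ?thesis unfolding y(2) \<phi>Nk[OF y(1) u(2)] using mem[OF y(1) u(2)] by simp
  qed
  define S where "S k = {u \<in> carrier D. \<forall>j. k \<le> j \<longrightarrow> j < a p \<longrightarrow> \<phi> u (p, j) = \<zero>\<^bsub>L (p, j)\<^esub>}" for k
  have pI: "(p, j) \<in> I" if "j < a p" for j using that p by (auto simp: I_def)
  have "D.dim = card {k \<in> UNIV. k < a p}"
  proof (rule D.dim_chain[of S])
    show "S 0 = {\<zero>\<^bsub>D\<^esub>}"
    proof (intro equalityI subsetI)
      fix u assume "u \<in> S 0"
      then have u: "u \<in> carrier D" "\<And>j. j < a p \<Longrightarrow> \<phi> u (p, j) = \<zero>\<^bsub>L (p, j)\<^esub>" by (auto simp: S_def)
      have "u = \<zero>\<^bsub>V\<^esub>"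
      proof (rule eqI[OF DV[OF u(1)]])
        fix ij assume ij: "ij \<in> I"
        show "\<phi> u ij = \<phi> \<zero>\<^bsub>V\<^esub> ij"
        proof (cases "fst ij < p")
          case True
          then show ?thesis using low[OF u(1) ij] zero[OF ij] by simp
        next
          case False
          then obtain j where "ij = (p, j)" "j < a p" using ij by (auto simp: I_def)
          then show ?thesis using u(2) zero[OF ij] by simp
        qed
      qed simp
      then show "u \<in> {\<zero>\<^bsub>D\<^esub>}" by (simp add: opD)
    next
      fix u assume "u \<in> {\<zero>\<^bsub>D\<^esub>}"
      then show "u \<in> S 0" using zero[OF pI] D.zero_closed by (auto simp: S_def opD(1))
    qed
    show "S (a p) = carrier D" by (auto simp: S_def)
    fix k assume k: "k < a p"
    \<comment> \<open>The element 1 in the k-th copy of L(p) and 0 elsewhere; its image under the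
      power spans the line to be added.\<close>
    define w where "w = (\<lambda>ij\<in>I. if ij = (p, k) then \<one>\<^bsub>L ij\<^esub> else \<zero>\<^bsub>L ij\<^esub>)"
    have "w \<in> (\<Pi>\<^sub>E ij\<in>I. carrier (L ij))"
    proof (rule PiE_I)
      fix ij assume "ij \<in> I"
      interpret C: cring "L ij" by (rule cr)
      show "w ij \<in> carrier (L ij)" using \<open>ij \<in> I\<close> C.one_closed C.zero_closed by (cases "ij = (p, k)") (simp_all add: w_def)
    qed (simp add: w_def)
    then obtain u0 where u0: "u0 \<in> carrier V" "\<phi> u0 = w" using \<phi>(2) unfolding bij_betw_def by (metis imageE)
    define x where "x = (N ^^ m) u0"
    have xD: "x \<in> carrier D" unfolding opD(4) x_def using u0(1) by blast
    let ?T = "\<lambda>ij. Lt (fst ij) [^]\<^bsub>L ij\<^esub> m"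
    have Tc: "?T ij \<in> carrier (L ij)" for ij
    proof -
      interpret C: cring "L ij" by (rule cr)
      show ?thesis unfolding L_def using Lt_closed C.nat_pow_closed[unfolded L_def] by blast
    qed
    have x1: "\<phi> x (p, k) = ?T (p, k)"
    proof -
      interpret C: cring "L (p, k)" by (rule cr)
      show ?thesis unfolding x_def \<phi>Nk[OF u0(1) pI[OF k]] u0(2) w_def using pI[OF k] Tc[of "(p, k)"] by simp
    qed
    have x0: "\<phi> x (p, j) = \<zero>\<^bsub>L (p, j)\<^esub>" if "j < a p" "j \<noteq> k" for j
    proof -
      interpret C: cring "L (p, j)" by (rule cr)
      show ?thesis unfolding x_def \<phi>Nk[OF u0(1) pI[OF that(1)]] u0(2) w_def using pI[OF that(1)] that(2) Tc[of "(p, j)"] by simp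
    qed
    have "?T (p, k) \<noteq> \<zero>\<^bsub>L (p, k)\<^esub>" using Lt_pow_nonzero[of m] p by (simp add: L_def m_def)
    then have xS: "x \<notin> S k" using x1 k by (auto simp: S_def)
    have "S (Suc k) = {s \<oplus>\<^bsub>D\<^esub> c \<odot>\<^bsub>D\<^esub> x | s c. s \<in> S k \<and> c \<in> carrier R}"
    proof (intro equalityI subsetI)
      fix u assume "u \<in> S (Suc k)"
      then have u: "u \<in> carrier D" "\<And>j. Suc k \<le> j \<Longrightarrow> j < a p \<Longrightarrow> \<phi> u (p, j) = \<zero>\<^bsub>L (p, j)\<^esub>" by (auto simp: S_def)
      obtain y where y: "y \<in> carrier V" "u = (N ^^ m) y" using u(1) unfolding opD(4) by blast
      obtain c where c: "c \<in> carrier R"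
        "\<phi> u (p, k) = L_proj R p (poly_of_const c) \<otimes>\<^bsub>L (p, k)\<^esub> ?T (p, k)"
        using Lt_pow_scalar[of "\<phi> y (p, k)" m] mem[OF y(1) pI[OF k]] p
        unfolding y(2) \<phi>Nk[OF y(1) pI[OF k]] by (auto simp: L_def m_def)
      define s where "s = u \<ominus>\<^bsub>D\<^esub> c \<odot>\<^bsub>D\<^esub> x"
      have cx: "c \<odot>\<^bsub>D\<^esub> x \<in> carrier D" using c(1) xD by (rule D.smult_closed)
      have sD: "s \<in> carrier D" unfolding s_def using u(1) cx by (rule D.M.minus_closed)
      have us: "u = s \<oplus>\<^bsub>D\<^esub> c \<odot>\<^bsub>D\<^esub> x"
        unfolding s_def D.M.minus_eq using u(1) cx by (simp add: D.M.a_assoc D.M.l_neg)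
      have \<phi>u: "\<phi> u (p, j) = \<phi> s (p, j) \<oplus>\<^bsub>L (p, j)\<^esub> L_proj R p (poly_of_const c) \<otimes>\<^bsub>L (p, j)\<^esub> \<phi> x (p, j)" if "j < a p" for j
        using add[OF DV[OF sD] DV[OF cx] pI[OF that]] smult[OF c(1) DV[OF xD] pI[OF that]] us unfolding opD by simp
      have "\<phi> s (p, j) = \<zero>\<^bsub>L (p, j)\<^esub>" if j: "k \<le> j" "j < a p" for j
      proof -
        interpret C: cring "L (p, j)" by (rule cr)
        have sc: "\<phi> s (p, j) \<in> carrier (L (p, j))" by (rule mem[OF DV[OF sD] pI[OF j(2)]])
        have pc: "L_proj R p (poly_of_const c) \<in> carrier (L (p, j))" unfolding L_def using L_smult_closed[OF c(1), of p] by simp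
        show ?thesis
        proof (cases "j = k")
          case True
          define z where "z = L_proj R p (poly_of_const c) \<otimes>\<^bsub>L (p, j)\<^esub> ?T (p, j)"
          have zc: "z \<in> carrier (L (p, j))" unfolding z_def by (rule C.m_closed[OF pc Tc])
          have "\<phi> s (p, j) \<oplus>\<^bsub>L (p, j)\<^esub> z = z" using \<phi>u[OF j(2)] c(2) x1 True by (simp add: z_def)
          then show ?thesis using C.add.r_cancel[of z "\<phi> s (p, j)" "\<zero>\<^bsub>L (p, j)\<^esub>"] zc sc by simp
        next
          case False
          then have "\<phi> s (p, j) \<oplus>\<^bsub>L (p, j)\<^esub> \<zero>\<^bsub>L (p, j)\<^esub> = \<zero>\<^bsub>L (p, j)\<^esub>"
            using \<phi>u[OF j(2)] u(2)[of j] x0[OF j(2)] j pc by simp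
          then show ?thesis using sc by simp
        qed
      qed
      then have "s \<in> S k" using sD by (simp add: S_def)
      with us c(1) show "u \<in> {s \<oplus>\<^bsub>D\<^esub> c \<odot>\<^bsub>D\<^esub> x | s c. s \<in> S k \<and> c \<in> carrier R}" by blast
    next
      fix u assume "u \<in> {s \<oplus>\<^bsub>D\<^esub> c \<odot>\<^bsub>D\<^esub> x | s c. s \<in> S k \<and> c \<in> carrier R}"
      then obtain s c where u: "u = s \<oplus>\<^bsub>D\<^esub> c \<odot>\<^bsub>D\<^esub> x" "s \<in> S k" "c \<in> carrier R" by blast
      have sD: "s \<in> carrier D" using u(2) by (simp add: S_def)
      have cx: "c \<odot>\<^bsub>D\<^esub> x \<in> carrier D" using u(3) xD by (rule D.smult_closed)
      have "\<phi> u (p, j) = \<zero>\<^bsub>L (p, j)\<^esub>" if j: "Suc k \<le> j" "j < a p" for j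
      proof -
        interpret C: cring "L (p, j)" by (rule cr)
        have pc: "L_proj R p (poly_of_const c) \<in> carrier (L (p, j))" unfolding L_def using L_smult_closed[OF u(3), of p] by simp
        have "\<phi> u (p, j) = \<phi> s (p, j) \<oplus>\<^bsub>L (p, j)\<^esub> L_proj R p (poly_of_const c) \<otimes>\<^bsub>L (p, j)\<^esub> \<phi> x (p, j)"
          using add[OF DV[OF sD] DV[OF cx] pI[OF j(2)]] smult[OF u(3) DV[OF xD] pI[OF j(2)]] u(1) unfolding opD by simp
        then show ?thesis using u(2) x0[OF j(2)] j pc by (simp add: S_def)
      qed
      moreover have "u \<in> carrier D" unfolding u(1) using sD cx by (rule D.M.a_closed)
      ultimately show "u \<in> S (Suc k)" by (simp add: S_def)
    qed
    with xD xS show "\<exists>x\<in>carrier D. x \<notin> S k \<and> S (Suc k) = {s \<oplus>\<^bsub>D\<^esub> c \<odot>\<^bsub>D\<^esub> x | s c. s \<in> S k \<and> c \<in> carrier R}" by blast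
  qed simp
  then show ?thesis by (simp add: D_def m_def)
qed

end

section \<open>The module \<open>\<PP>\<^sup>r / p \<PP>\<^sup>r\<close>\<close>

lemma coset_amb: "H +>\<^bsub>amb\<^esub> x = {y. y - x \<in> H}"
  by (auto simp: a_r_coset_def r_coset_def ring_of_type_algebra_def intro!: bexI[of _ "_ - x"])

definition subgp :: "'a::ab_group_add set \<Rightarrow> bool" where
  "subgp H \<longleftrightarrow> 0 \<in> H \<and> (\<forall>x\<in>H. \<forall>y\<in>H. x - y \<in> H)"

lemma subgpD:
  assumes "subgp H" shows "0 \<in> H" "x \<in> H \<Longrightarrow> y \<in> H \<Longrightarrow> x - y \<in> H" "x \<in> H \<Longrightarrow> - x \<in> H" "x \<in> H \<Longrightarrow> y \<in> H \<Longrightarrow> x + y \<in> H"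
proof -
  have H: "0 \<in> H" "\<And>x y. x \<in> H \<Longrightarrow> y \<in> H \<Longrightarrow> x - y \<in> H" using assms by (auto simp: subgp_def)
  show "0 \<in> H" "x \<in> H \<Longrightarrow> y \<in> H \<Longrightarrow> x - y \<in> H" by (fact H)+
  show n: "x \<in> H \<Longrightarrow> - x \<in> H" for x using H(2)[OF H(1), of x] by simp
  show "x \<in> H \<Longrightarrow> y \<in> H \<Longrightarrow> x + y \<in> H" using H(2)[of x "- y"] n[of y] by simp
qed

lemma coset_eq_iff: "subgp H \<Longrightarrow> H +>\<^bsub>amb\<^esub> x = H +>\<^bsub>amb\<^esub> y \<longleftrightarrow> x - y \<in> H"
proof
  assume H: "subgp H"
  {
    assume "H +>\<^bsub>amb\<^esub> x = H +>\<^bsub>amb\<^esub> y"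
    moreover have "x \<in> H +>\<^bsub>amb\<^esub> x" using subgpD(1)[OF H] by (simp add: coset_amb)
    ultimately show "x - y \<in> H" by (simp add: coset_amb)
  next
    assume xy: "x - y \<in> H"
    have "z - x \<in> H \<longleftrightarrow> z - y \<in> H" for z
      using subgpD(4)[OF H _ xy, of "z - x"] subgpD(2)[OF H _ xy, of "z - y"] by auto
    then show "H +>\<^bsub>amb\<^esub> x = H +>\<^bsub>amb\<^esub> y" by (simp add: coset_amb)
  }
qed

lemma coset_self: "subgp H \<Longrightarrow> x \<in> H +>\<^bsub>amb\<^esub> x"
  using subgpD(1) by (simp add: coset_amb)

lemma coset_zero: "H +>\<^bsub>amb\<^esub> 0 = H" by (simp add: coset_amb)

lemma coset_add:
  assumes H: "subgp H" shows "(H +>\<^bsub>amb\<^esub> x) <+>\<^bsub>amb\<^esub> (H +>\<^bsub>amb\<^esub> y) = H +>\<^bsub>amb\<^esub> (x + y)"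
proof (intro equalityI subsetI)
  fix z assume "z \<in> (H +>\<^bsub>amb\<^esub> x) <+>\<^bsub>amb\<^esub> (H +>\<^bsub>amb\<^esub> y)"
  then obtain s t where "z = s + t" "s - x \<in> H" "t - y \<in> H" by (auto simp: set_add_def' coset_amb)
  then show "z \<in> H +>\<^bsub>amb\<^esub> (x + y)" using subgpD(4)[OF H, of "s - x" "t - y"] by (simp add: coset_amb algebra_simps)
next
  fix z assume "z \<in> H +>\<^bsub>amb\<^esub> (x + y)"
  then have "z = x + (z - x)" "x \<in> H +>\<^bsub>amb\<^esub> x" "z - x \<in> H +>\<^bsub>amb\<^esub> y"
    using coset_self[OF H] by (auto simp: coset_amb algebra_simps)
  then show "z \<in> (H +>\<^bsub>amb\<^esub> x) <+>\<^bsub>amb\<^esub> (H +>\<^bsub>amb\<^esub> y)" unfolding set_add_def' by fastforce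
qed

lemma coset_UN:
  assumes "subgp H" "\<And>y. y - x \<in> H \<Longrightarrow> h y = A" shows "(\<Union>y\<in>H +>\<^bsub>amb\<^esub> x. h y) = A"
proof -
  have "h y = A" if "y \<in> H +>\<^bsub>amb\<^esub> x" for y using assms(2) that by (simp add: coset_amb)
  then show ?thesis using coset_self[OF assms(1), of x] by blast
qed

lemma (in nval) subgp_P: "subgp (P n)" unfolding subgp_def by (auto intro: P_diff)

text \<open>Adds what identifies \<open>Fq\<close> with the residue field of \<open>T\<close>: p is
  a uniformizer of \<open>T\<close>.\<close>

locale refined_unramified = refined +
  assumes T_O: "val_ring v T = T \<inter> P 0" and T_p: "x \<in> T \<Longrightarrow> x \<in> P 1 \<Longrightarrow> x \<in> P vp"
begin

definition OT :: "'a set" where "OT = T \<inter> P 0"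
abbreviation "J \<equiv> T \<inter> P 1"

lemma OT_iff: "x \<in> OT \<longleftrightarrow> x \<in> T \<and> x \<in> P 0" by (simp add: OT_def)

lemma O_ring: "subrng OT" using T_sub subrng_P0 unfolding subrng_def OT_def by blast

lemma subgp_J: "subgp J" unfolding subgp_def using subrngD(2,3)[OF T_sub] by (auto intro: P_diff)

lemma J_mult: "a \<in> OT \<Longrightarrow> x \<in> J \<Longrightarrow> a * x \<in> J"
  using subrngD(4)[OF T_sub] by (auto simp: OT_iff intro: P_mult0)

lemma J_O: "x \<in> J \<Longrightarrow> x \<in> OT" by (auto simp: OT_iff intro: P_mono)

lemma p_O: "(\<lambda>x. of_nat p * x) ` OT = J"
proof (intro equalityI subsetI)
  fix y assume "y \<in> (\<lambda>x. of_nat p * x) ` OT"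
  then obtain x where x: "x \<in> OT" "y = of_nat p * x" by blast
  have "x * of_nat p \<in> P 1" using x(1) by (intro P_mult0 p_P1) (simp add: OT_iff)
  then show "y \<in> J" using x subrngD(4)[OF T_sub subrng_of_nat[OF T_sub]] by (simp add: mult.commute OT_iff)
next
  fix y assume y: "y \<in> J"
  have "y / of_nat p \<in> P (vp - vp)" using T_p[of y] y by (intro P_divide p_U) auto
  moreover have "y / of_nat p \<in> T" unfolding divide_inverse
    using y by (intro subrngD(4)[OF T_sub] T_inverse subrng_of_nat[OF T_sub]) auto
  ultimately show "y \<in> (\<lambda>x. of_nat p * x) ` OT" by (intro image_eqI[of _ _ "y / of_nat p"]) (auto simp: OT_iff)
qed

lemma p_P: "(\<lambda>x. of_nat p * x) ` P n = P (n + vp)"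
proof (intro equalityI subsetI)
  fix y assume "y \<in> P (n + vp)"
  then have "y / of_nat p \<in> P (n + vp - vp)" by (intro P_divide p_U) auto
  then show "y \<in> (\<lambda>x. of_nat p * x) ` P n" by (intro image_eqI[of _ _ "y / of_nat p"]) auto
qed (use P_mult[OF U_P[OF p_U]] in \<open>auto simp: add.commute\<close>)

definition ci :: "'a \<Rightarrow> 'a set" where "ci a = J +>\<^bsub>amb\<^esub> a"

lemma ci_eq: "a \<in> T \<Longrightarrow> b' \<in> T \<Longrightarrow> ci a = ci b' \<longleftrightarrow> a - b' \<in> P 1"
  unfolding ci_def coset_eq_iff[OF subgp_J] using subrngD(3)[OF T_sub] by auto

abbreviation "F \<equiv> Fq p v T"

lemma F_alt: "F = (amb\<lparr>carrier := OT\<rparr>) Quot J" unfolding Fq_def T_O OT_def[symmetric] p_O ..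

lemma coset_O: "H +>\<^bsub>amb\<lparr>carrier := M\<rparr>\<^esub> x = H +>\<^bsub>amb\<^esub> x" by (simp add: a_r_coset_def r_coset_def)

lemma F_carrier: "carrier F = ci ` OT"
  by (auto simp: F_alt FactRing_def A_RCOSETS_def' coset_O ci_def)
lemma F_zero: "\<zero>\<^bsub>F\<^esub> = ci 0" by (simp add: F_alt FactRing_def ci_def coset_zero)
lemma F_one: "\<one>\<^bsub>F\<^esub> = ci 1" by (simp add: F_alt FactRing_def ci_def coset_O)
lemma F_add: "ci a \<oplus>\<^bsub>F\<^esub> ci b' = ci (a + b')"
proof -
  have "set_add (amb\<lparr>carrier := OT\<rparr>) = set_add amb" by (intro ext) (simp add: set_add_def set_mult_def)
  then show ?thesis using coset_add[OF subgp_J] by (simp add: F_alt FactRing_def ci_def)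
qed
lemma F_mult: assumes "a \<in> OT" "b' \<in> OT" shows "ci a \<otimes>\<^bsub>F\<^esub> ci b' = ci (a * b')"
proof -
  have "ci a \<otimes>\<^bsub>F\<^esub> ci b' = (\<Union>x\<in>J +>\<^bsub>amb\<^esub> a. \<Union>y\<in>J +>\<^bsub>amb\<^esub> b'. J +>\<^bsub>amb\<^esub> (x * y))"
    by (simp add: F_alt FactRing_def rcoset_mult_def coset_O ci_def)
  also have "\<dots> = J +>\<^bsub>amb\<^esub> (a * b')"
  proof (intro coset_UN subgp_J)
    fix x y assume xy: "x - a \<in> J" "y - b' \<in> J"
    have "x \<in> OT" using subrngD(6)[OF O_ring J_O[OF xy(1)] assms(1)] by simp
    then have "x * (y - b') + b' * (x - a) \<in> J" by (intro subgpD(4)[OF subgp_J] J_mult xy assms(2))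
    then have "x * y - a * b' \<in> J" by (simp add: algebra_simps)
    then show "J +>\<^bsub>amb\<^esub> (x * y) = J +>\<^bsub>amb\<^esub> (a * b')" by (simp only: coset_eq_iff[OF subgp_J])
  qed
  finally show ?thesis by (simp add: ci_def)
qed

lemma FE: assumes "A \<in> carrier F" obtains a where "a \<in> OT" "A = ci a"
  using assms unfolding F_carrier by blast
lemma FI: "a \<in> OT \<Longrightarrow> ci a \<in> carrier F" unfolding F_carrier by blast
lemmas O_closed = subrngD[OF O_ring]

lemma field_F: "field F"
proof -
  have "cring F"
  proof (rule cringI)
    show "abelian_group F"
    proof (rule abelian_groupI)
      fix x assume "x \<in> carrier F"
      then obtain a where "a \<in> OT" "x = ci a" by (rule FE)
      then show "\<exists>y\<in>carrier F. y \<oplus>\<^bsub>F\<^esub> x = \<zero>\<^bsub>F\<^esub>"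
        using O_closed(5) by (intro bexI[of _ "ci (- a)"] FI) (auto simp: F_add F_zero)
    qed (auto elim!: FE simp: F_add F_zero add_ac intro!: FI O_closed)
    show "comm_monoid F"
      by (rule comm_monoidI) (auto elim!: FE simp: F_mult F_one O_closed mult_ac intro!: FI O_closed)
  qed (auto elim!: FE simp: F_add F_mult O_closed distrib_right)
  then show ?thesis
  proof (rule cring.cring_fieldI2)
    have "(0::'a) - 1 \<notin> P 1" using U_not_P[of 1 0] by simp
    then show "\<zero>\<^bsub>F\<^esub> \<noteq> \<one>\<^bsub>F\<^esub>" unfolding F_zero F_one using ci_eq[of 0 1] subrngD(1,2)[OF T_sub] by simp
    fix A assume A: "A \<in> carrier F" "A \<noteq> \<zero>\<^bsub>F\<^esub>"
    then obtain a where a: "a \<in> OT" "A = ci a" by (blast elim: FE)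
    then have "a \<notin> P 1" using A(2) ci_eq[of a 0] subrngD(2)[OF T_sub] by (auto simp: F_zero OT_iff)
    then have u: "a \<in> U 0" using P_cases[of a 0] a(1) by (auto simp: OT_iff)
    have i: "inverse a \<in> OT" using T_inverse[of a] U_inverse[OF u] a(1) by (auto simp: OT_iff)
    have "a * inverse a = 1" using u by (simp add: U_iff)
    then show "\<exists>B\<in>carrier F. A \<otimes>\<^bsub>F\<^esub> B = \<one>\<^bsub>F\<^esub>"
      using i a by (intro bexI[of _ "ci (inverse a)"] FI) (simp_all add: F_mult F_one)
  qed
qed

context
  fixes r :: int
begin

abbreviation "V \<equiv> ideal_module p v r"
abbreviation "R \<equiv> r + vp"
definition cs :: "'a \<Rightarrow> 'a set" where "cs x = P R +>\<^bsub>amb\<^esub> x"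

lemma cs_eq: "cs x = cs y \<longleftrightarrow> x - y \<in> P R" unfolding cs_def by (rule coset_eq_iff[OF subgp_P])

lemma V_carrier: "carrier V = cs ` P r"
  by (auto simp: ideal_module_def quot_module_def p_P A_RCOSETS_def' coset_O cs_def)
lemma V_zero: "\<zero>\<^bsub>V\<^esub> = cs 0" by (simp add: ideal_module_def quot_module_def p_P cs_def coset_zero)
lemma V_add: "cs x \<oplus>\<^bsub>V\<^esub> cs y = cs (x + y)"
  using coset_add[OF subgp_P] by (simp add: ideal_module_def quot_module_def cs_def)
text \<open>Independence of representatives rests on p being a uniformizer of \<open>T\<close>: a
  scalar of positive valuation has valuation at least v(p) and so kills the quotient.\<close>

lemma V_smult: assumes "a \<in> OT" "x \<in> P r" shows "ci a \<odot>\<^bsub>V\<^esub> cs x = cs (a * x)"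
proof -
  have "ci a \<odot>\<^bsub>V\<^esub> cs x = (\<Union>s\<in>J +>\<^bsub>amb\<^esub> a. \<Union>y\<in>P R +>\<^bsub>amb\<^esub> x. P R +>\<^bsub>amb\<^esub> (s * y))"
    by (simp add: ideal_module_def quot_module_def p_P cs_def ci_def)
  also have "\<dots> = P R +>\<^bsub>amb\<^esub> (a * x)"
  proof (intro coset_UN subgp_J subgp_P)
    fix s y assume sy: "s - a \<in> J" "y - x \<in> P R"
    have "s \<in> OT" using subrngD(6)[OF O_ring J_O[OF sy(1)] assms(1)] by simp
    then have "s * (y - x) \<in> P R" using sy(2) by (auto simp: OT_iff intro: P_mult0)
    moreover have "(s - a) * x \<in> P (vp + r)" using T_p[of "s - a"] sy(1) assms(2) by (intro P_mult) auto
    ultimately have "s * (y - x) + (s - a) * x \<in> P R" by (intro P_add) (simp_all add: add.commute)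
    then have "s * y - a * x \<in> P R" by (simp add: algebra_simps)
    then show "P R +>\<^bsub>amb\<^esub> (s * y) = P R +>\<^bsub>amb\<^esub> (a * x)" by (simp only: coset_eq_iff[OF subgp_P])
  qed
  finally show ?thesis by (simp add: cs_def)
qed

lemma VE: assumes "A \<in> carrier V" obtains x where "x \<in> P r" "A = cs x"
  using assms unfolding V_carrier by blast
lemma VI: "x \<in> P r \<Longrightarrow> cs x \<in> carrier V" unfolding V_carrier by blast

lemma OP: "a \<in> OT \<Longrightarrow> x \<in> P n \<Longrightarrow> a * x \<in> P n" by (auto simp: OT_iff intro: P_mult0)

lemma module_V: "module F V"
proof (rule moduleI)
  show "cring F" using field_F by (simp add: fieldE(1))
  show "abelian_group V"
  proof (rule abelian_groupI)
    fix x assume "x \<in> carrier V"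
    then obtain a where "a \<in> P r" "x = cs a" by (rule VE)
    then show "\<exists>y\<in>carrier V. y \<oplus>\<^bsub>V\<^esub> x = \<zero>\<^bsub>V\<^esub>"
      by (intro bexI[of _ "cs (- a)"] VI) (auto simp: V_add V_zero)
  qed (auto elim!: VE simp: V_add V_zero add_ac intro!: VI P_add)
qed (auto elim!: VE FE simp: V_add V_smult F_add F_mult F_one OP O_closed P_add algebra_simps intro!: VI OP)

lemma V_minus: "x \<in> P r \<Longrightarrow> y \<in> P r \<Longrightarrow> cs x \<ominus>\<^bsub>V\<^esub> cs y = cs (x - y)"
proof -
  assume xy: "x \<in> P r" "y \<in> P r"
  interpret module F V by (rule module_V)
  have "\<ominus>\<^bsub>V\<^esub> cs y = cs (- y)" by (rule M.minus_equality) (use xy in \<open>auto simp: V_add V_zero intro!: VI\<close>)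
  then show ?thesis by (simp add: M.minus_eq V_add)
qed

abbreviation "\<theta> \<equiv> ideal_map p v r Th"

lemma Th_P: "x \<in> P n \<Longrightarrow> Th x \<in> P n"
  using P_add[of "\<delta> x" n x] P_mono[OF raisesD[OF raises_\<delta>, of x n], of n] b_pos by (auto simp: df_def)

lemma \<theta>_cs: "\<theta> (cs x) = cs (Th x)"
proof -
  have "\<theta> (cs x) = (\<Union>y\<in>P R +>\<^bsub>amb\<^esub> x. P R +>\<^bsub>amb\<^esub> Th y)"
    by (simp add: ideal_map_def quot_map_def p_P cs_def)
  also have "\<dots> = P R +>\<^bsub>amb\<^esub> Th x"
  proof (intro coset_UN subgp_P)
    fix y assume "y - x \<in> P R"
    then have "Th (y - x) \<in> P R" by (rule Th_P)
    then have "Th y - Th x \<in> P R" using additive.diff[OF tlinearD(1)[OF tlinear_Th]] by simp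
    then show "P R +>\<^bsub>amb\<^esub> Th y = P R +>\<^bsub>amb\<^esub> Th x" by (simp only: coset_eq_iff[OF subgp_P])
  qed
  finally show ?thesis by (simp add: cs_def)
qed

lemma \<theta>_closed: "\<theta> \<in> carrier V \<rightarrow> carrier V" by (auto elim!: VE simp: \<theta>_cs intro!: VI Th_P)

lemma \<delta>_pow_P: "x \<in> P n \<Longrightarrow> (\<delta> ^^ k) x \<in> P n"
  by (induction k) (use P_mono[OF raisesD[OF raises_\<delta>]] b_pos in auto)

definition "W = diff_power_image V \<theta> (p - 1)"

lemma W_carrier: "carrier W = {cs (D y) | y. y \<in> P r}"
proof -
  have step: "((\<lambda>u. \<theta> u \<ominus>\<^bsub>V\<^esub> u) ^^ k) (cs x) = cs ((\<delta> ^^ k) x)" if "x \<in> P r" for x k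
  proof (induction k)
    case (Suc k)
    have k: "(\<delta> ^^ k) x \<in> P r" by (rule \<delta>_pow_P[OF that])
    show ?case using Suc V_minus[OF Th_P[OF k] k] by (simp add: \<theta>_cs df_def[of Th "(\<delta> ^^ k) x"])
  qed simp
  have "carrier W = (\<lambda>u. ((\<lambda>u. \<theta> u \<ominus>\<^bsub>V\<^esub> u) ^^ (p - 1)) u) ` carrier V" by (simp add: W_def diff_power_image_def)
  also have "\<dots> = {cs (D y) | y. y \<in> P r}" unfolding V_carrier image_image D_def using step by auto
  finally show ?thesis .
qed

lemma W_ops: "\<zero>\<^bsub>W\<^esub> = cs 0" "cs x \<oplus>\<^bsub>W\<^esub> cs y = cs (x + y)" "a \<in> OT \<Longrightarrow> x \<in> P r \<Longrightarrow> ci a \<odot>\<^bsub>W\<^esub> cs x = cs (a * x)"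
  by (simp_all add: W_def diff_power_image_def V_zero V_add V_smult)

lemma D_P: "y \<in> P n \<Longrightarrow> D y \<in> P n" unfolding D_def by (rule \<delta>_pow_P)

lemma vectorspace_W: "vectorspace F W"
proof -
  interpret module F V by (rule module_V)
  have "submodule F (carrier W) V"
  proof (rule submodule.intro[OF module_V])
    show "carrier W \<subseteq> carrier V" unfolding W_carrier by (auto intro!: VI D_P)
    show "\<zero>\<^bsub>V\<^esub> \<in> carrier W" unfolding W_carrier V_zero using additive.zero[OF tlinearD(1)[OF tlinear_D]]
      by (intro CollectI exI[of _ 0]) auto
    show "x \<oplus>\<^bsub>V\<^esub> y \<in> carrier W" if "x \<in> carrier W" "y \<in> carrier W" for x y
    proof -
      from that obtain s t where "s \<in> P r" "t \<in> P r" "x = cs (D s)" "y = cs (D t)" unfolding W_carrier by blast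
      then show ?thesis unfolding W_carrier using additive.add[OF tlinearD(1)[OF tlinear_D]]
        by (intro CollectI exI[of _ "s + t"]) (auto simp: V_add intro: P_add)
    qed
    show "c \<odot>\<^bsub>V\<^esub> x \<in> carrier W" if "c \<in> carrier F" "x \<in> carrier W" for c x
    proof -
      from that obtain a s where "a \<in> OT" "s \<in> P r" "c = ci a" "x = cs (D s)" unfolding W_carrier by (blast elim: FE)
      then show ?thesis unfolding W_carrier using D_scale[of a s]
        by (intro CollectI exI[of _ "a * s"]) (auto simp: V_smult D_P OT_iff intro: P_mult0)
    qed
  qed
  from submodule_is_module[OF this] have "module F W" by (simp add: W_def diff_power_image_def)
  then show ?thesis using field_F by (simp add: vectorspace_def)
qed

text \<open>The image is filtered by the depth of D y, descending from r + v(p), where it is zero. A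
  step is nontrivial exactly when the valuation reached occurs in \<open>vals r\<close>, and then it
  adds one line, as leading coefficients come from \<open>T\<close>.\<close>

lemma dim_W: "vectorspace.dim F W = card (vals r)"
proof -
  interpret W: vectorspace F W by (rule vectorspace_W)
  define S' where "S' k = {cs (D y) | y. y \<in> P r \<and> D y \<in> P (R - int k)}" for k :: nat
  \<comment> \<open>Index k stands for the valuation gained in passing from \<open>S' k\<close> to
    \<open>S' (Suc k)\<close>.\<close>
  define E where "E = {k :: nat. R - 1 - int k \<in> vals r}"
  have "W.dim = card {k \<in> E. k < nat vp}"
  proof (rule W.dim_chain[of S'])
    show "S' 0 = {\<zero>\<^bsub>W\<^esub>}"
    proof (intro equalityI subsetI)
      fix u assume "u \<in> {\<zero>\<^bsub>W\<^esub>}"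
      then show "u \<in> S' 0" unfolding S'_def W_ops(1) using additive.zero[OF tlinearD(1)[OF tlinear_D]]
        by (intro CollectI exI[of _ 0]) auto
    next
      fix u assume "u \<in> S' 0"
      then obtain y where "D y \<in> P R" "u = cs (D y)" unfolding S'_def by auto
      moreover from this have "cs (D y) = cs 0" unfolding cs_eq by simp
      ultimately show "u \<in> {\<zero>\<^bsub>W\<^esub>}" by (simp add: W_ops(1))
    qed
    show "S' (nat vp) = carrier W" unfolding W_carrier S'_def using vp_pos by (auto intro: D_P)
    fix k assume k: "k < nat vp"
    define n where "n = R - 1 - int k"
    have n: "R - int k = n + 1" "R - int (Suc k) = n" "n < R" by (simp_all add: n_def)
    {
      assume "k \<notin> E"
      then have "D y \<notin> U n" if "y \<in> P r" for y using that n(3) unfolding E_def vals_def n_def by blast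
      then have "D y \<in> P (n + 1)" if "y \<in> P r" "D y \<in> P n" for y using P_cases[OF that(2)] that(1) by blast
      then have "y \<in> P r \<and> D y \<in> P n \<longleftrightarrow> y \<in> P r \<and> D y \<in> P (n + 1)" for y
        using P_mono[of "D y" "n + 1" n] by auto
      then show "S' (Suc k) = S' k" unfolding S'_def n by simp
    }
    assume "k \<in> E"
    then have "n \<in> vals r" by (simp add: E_def n_def)
    then obtain z where z: "z \<in> P r" "D z \<in> U n" unfolding vals_def by blast
    have xW: "cs (D z) \<in> carrier W" unfolding W_carrier using z by blast
    have xS: "cs (D z) \<notin> S' k"
    proof
      assume "cs (D z) \<in> S' k"
      then obtain y where "D y \<in> P (n + 1)" "D z - D y \<in> P R" unfolding S'_def n by (auto simp: cs_eq)
      then have "D z \<in> P (n + 1)" using P_cong[OF P_mono[of "D z - D y" R "n + 1"]] n(3) by auto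
      then show False using U_not_P[OF z(2)] by blast
    qed
    have "S' (Suc k) = {s \<oplus>\<^bsub>W\<^esub> c \<odot>\<^bsub>W\<^esub> cs (D z) | s c. s \<in> S' k \<and> c \<in> carrier F}"
    proof (intro equalityI subsetI)
      fix u assume "u \<in> S' (Suc k)"
      then obtain y where y: "y \<in> P r" "D y \<in> P n" "u = cs (D y)" unfolding S'_def n by blast
      have "\<exists>c\<in>T. c \<in> P 0 \<and> D y - c * D z \<in> P (n + 1)"
      proof (cases "D y \<in> P (n + 1)")
        case True
        then show ?thesis using subrngD(2)[OF T_sub] by (intro bexI[of _ 0]) auto
      next
        case False
        then have "D y \<in> U n" using P_cases[OF y(2)] by blast
        from residue_step[OF this z(2)] show ?thesis by blast
      qed
      then obtain c where c: "c \<in> T" "c \<in> P 0" "D y - c * D z \<in> P (n + 1)" by blast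
      have cz: "c * z \<in> P r" using c(2) z(1) by (rule P_mult0)
      have Dy: "D (y - c * z) = D y - c * D z"
        using additive.diff[OF tlinearD(1)[OF tlinear_D]] D_scale[OF c(1)] by simp
      have "cs (D (y - c * z)) \<in> S' k" unfolding S'_def n using c(3) y(1) cz
        by (intro CollectI exI[of _ "y - c * z"]) (auto simp: Dy intro: P_diff)
      moreover have "u = cs (D (y - c * z)) \<oplus>\<^bsub>W\<^esub> ci c \<odot>\<^bsub>W\<^esub> cs (D z)"
        using c D_P[OF z(1)] by (simp add: W_ops OT_iff Dy y(3))
      moreover have "ci c \<in> carrier F" using c by (intro FI) (simp add: OT_iff)
      ultimately show "u \<in> {s \<oplus>\<^bsub>W\<^esub> c \<odot>\<^bsub>W\<^esub> cs (D z) | s c. s \<in> S' k \<and> c \<in> carrier F}" by blast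
    next
      fix u assume "u \<in> {s \<oplus>\<^bsub>W\<^esub> c \<odot>\<^bsub>W\<^esub> cs (D z) | s c. s \<in> S' k \<and> c \<in> carrier F}"
      then obtain y c where u: "u = cs (D y) \<oplus>\<^bsub>W\<^esub> ci c \<odot>\<^bsub>W\<^esub> cs (D z)" "y \<in> P r" "D y \<in> P (n + 1)" "c \<in> OT"
        unfolding S'_def n by (blast elim: FE)
      have D: "D (y + c * z) = D y + c * D z"
        using additive.add[OF tlinearD(1)[OF tlinear_D]] D_scale[of c] u(4) by (simp add: OT_iff)
      have "u = cs (D (y + c * z))" unfolding D u(1) using W_ops D_P[OF z(1)] u(4) by simp
      moreover have "y + c * z \<in> P r" using u z by (intro P_add OP)
      moreover have "D (y + c * z) \<in> P n" unfolding D using u(3,4) z(2) by (intro P_add OP) (auto intro: P_mono)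
      ultimately show "u \<in> S' (Suc k)" unfolding S'_def n by blast
    qed
    with xW xS show "\<exists>x\<in>carrier W. x \<notin> S' k \<and> S' (Suc k) = {s \<oplus>\<^bsub>W\<^esub> c \<odot>\<^bsub>W\<^esub> x | s c. s \<in> S' k \<and> c \<in> carrier F}" by blast
  qed
  also have "\<dots> = card (vals r)"
  proof (rule bij_betw_same_card[of "\<lambda>k. R - 1 - int k"])
    have rn: "r \<le> n \<and> n < R" if "n \<in> vals r" for n
    proof -
      from that obtain y where "y \<in> P r" "D y \<in> U n" "n < R" unfolding vals_def by blast
      then show ?thesis using U_P_iff D_P by blast
    qed
    have "n \<in> (\<lambda>k. R - 1 - int k) ` {k \<in> E. k < nat vp}" if n: "n \<in> vals r" for n
    proof (rule image_eqI)
      show n': "n = R - 1 - int (nat (R - 1 - n))" using rn[OF n] by simp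
      show "nat (R - 1 - n) \<in> {k \<in> E. k < nat vp}" using rn[OF n] n n' vp_pos unfolding E_def by auto
    qed
    then show "bij_betw (\<lambda>k. R - 1 - int k) {k \<in> E. k < nat vp} (vals r)"
      unfolding bij_betw_def by (auto simp: inj_on_def E_def)
  qed
  finally show ?thesis .
qed

lemma a_p_eq:
  assumes "decomposes_as F p V \<theta> a"
  shows "a p = vectorspace.dim F W" "a p = card (vals r)"
proof -
  interpret coeff_field F using field_F by (simp add: coeff_field_def)
  show "a p = vectorspace.dim F W" unfolding W_def
    by (rule dim_decomposition[OF module_V \<theta>_closed assms _ vectorspace_W[unfolded W_def]]) (use p_gt1 in simp)
  then show "a p = card (vals r)" by (simp add: dim_W)
qed

end

end

theorem theorem12:
  fixes p f :: nat
    and v :: "'a::field_char_0 \<Rightarrow> int"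
    and Q K T :: "'a set"
    and \<gamma> \<sigma> \<Theta> :: "'a \<Rightarrow> 'a"
    and \<rho>0 \<omega> :: 'a
    and b bs r :: int
    and a :: "nat \<Rightarrow> nat"
    and \<epsilon> :: real
  assumes "Factorial_Ring.prime p"
    and "normalized_valuation v"
    and "padic_subfield p v Q"
    and "subfield K amb" and "Q \<subseteq> K" and "ring.finite_dimension amb Q K"
    and "f = inertia_degree v Q K"
    and "max_unramified p v Q K T"
    and "galois_over K" and "totally_ramified_over v K"
    and "\<gamma> \<in> carrier (gal_group K)" and "\<sigma> \<in> carrier (gal_group K)"
    and "generate (gal_group K) {\<gamma>, \<sigma>} = carrier (gal_group K)"
    and "gal_group K \<cong> integer_mod_group p \<times>\<times> integer_mod_group p"
    and "one_break v K b"
    and "\<rho>0 \<noteq> 0" and "v \<rho>0 = b"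
    and "\<omega> \<in> T" and "\<omega> ^ (p ^ f - 1) = 1"
    and "\<gamma> \<rho>0 - \<rho>0 + \<omega> * (\<sigma> \<rho>0 - \<rho>0) = 0 \<or>
         2 * b < v (\<gamma> \<rho>0 - \<rho>0 + \<omega> * (\<sigma> \<rho>0 - \<rho>0))"
    and "\<Theta> = \<gamma> \<circ> trunc_exp p \<sigma> \<omega>"
    and "bs = v (\<Theta> \<rho>0 - \<rho>0) - v \<rho>0"
    and "decomposes_as (Fq p v T) p (ideal_module p v r) (ideal_map p v r \<Theta>) a"
    and "\<epsilon> = (if real_of_int bs < (real p - 1 + 1 / real p) * real_of_int b
              then real_of_int (bs - b) / real p
              else real_of_int (b + \<lceil>real_of_int (r - int p * b) / real p ^ 2\<rceil>
                                  - \<lceil>real_of_int (r + (int p - 1) * b) / real p ^ 2\<rceil>))"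
  shows "a p = vectorspace.dim (Fq p v T)
                 (diff_power_image (ideal_module p v r) (ideal_map p v r \<Theta>) (p - 1))
       \<and> real (a p) = real_of_int (int p * abs_ram_index p v K
                        + \<lceil>real_of_int r / real p\<rceil>
                        - \<lceil>real_of_int (r - b) / real p\<rceil> - b) - \<epsilon>"
proof -
  have "galois_tower v p Q K T \<gamma> \<sigma> b"
    by (intro galois_tower.intro pval.intro nval.intro pval_axioms.intro galois_tower_axioms.intro)
      (use assms in \<open>simp_all add: padic_subfield_def\<close>)
  then interpret tower: galois_tower v p Q K T \<gamma> \<sigma> b .
  have \<rho>: "\<rho>0 \<in> tower.U b" using assms by (simp add: tower.U_iff)
  have "\<gamma> \<rho>0 - \<rho>0 + \<omega> * (\<sigma> \<rho>0 - \<rho>0) \<in> tower.P (2 * b + 1)" using assms by (auto simp: tower.P_iff)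
  then have "refined v p T \<gamma> \<sigma> b (abs_ram_index p v K) \<omega>"
    using tower.refined_axioms_from_rho[OF _ \<rho>] assms by blast
  moreover have "val_ring v T = T \<inter> tower.P 0" by (rule tower.val_ring_T)
  moreover have "x \<in> tower.P (v (of_nat p))" if "x \<in> T" "x \<in> tower.P 1" for x using tower.T_P1 that by blast
  ultimately have "refined_unramified v p T \<gamma> \<sigma> b (abs_ram_index p v K) \<omega>"
    by (intro refined_unramified.intro refined_unramified_axioms.intro)
  then interpret ref: refined_unramified v p T \<gamma> \<sigma> b "abs_ram_index p v K" \<omega> .
  have \<Theta>: "\<Theta> = ref.Th"
    unfolding assms(21) by (simp add: fun_eq_iff ref.Th_def ref.sexp_def trunc_exp_def tower.df_def[abs_def])
  have bs: "bs = v (tower.df ref.Th \<rho>0) - b" using assms \<Theta> by (simp add: tower.df_def)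
  have dec: "decomposes_as (Fq p v T) p (ideal_module p v r) (ideal_map p v r ref.Th) a" using assms(23) \<Theta> by simp
  show ?thesis
    using ref.a_p_eq[OF dec] ref.card_vals[OF \<rho> bs, of r] unfolding \<Theta> ref.W_def assms(24) by simp
qed

end
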